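(* Let $n\ge2$, let $G,G^*$ be bounded domains in $\mathbb R^n$, $x_0\in G$, $p>n-1$, and let $Q:G\to[0,\infty]$ be Lebesgue measurable with $Q\in L^{\frac{n-1}{p-n+1}}_{\rm loc}(G)$. If $f:G\to G^*$ is a lower $Q$-homeomorphism with respect to $p$-modulus at $x_0$, then $f$ is a ring $\widetilde Q$-homeomorphism with respect to $\alpha$-modulus at $x_0$, where $\widetilde Q=Q^{\frac{n-1}{p-n+1}}$ and $\alpha=\frac{p}{p-n+1}$.
   Context: Surface modulus: for a family $\Gamma$ of $(n-1)$-dimensional surfaces $S$ (continuous maps from open subsets of $\overline{\mathbb R^{n-1}}$ to $\mathbb R^n$), $\int_S\rho\,d\mathcal A=\int\rho(y)N(S,y)\,dH^{n-1}y$ with $N(S,y)=\mathrm{card}\,S^{-1}(y)$; $M_p(\Gamma)=\inf\int_{\mathbb R^n}\rho^p\,dm$ over Borel $\rho\ge0$ with $\int_S\rho^{n-1}d\mathcal A\ge1$ for all $S\in\Gamma$; $p$-a.e. $S$ means outside a subfamily of $p$-modulus zero; $\rho\in\mathrm{ext}_p\mathrm{adm}\,\Gamma$ means $\rho\ge0$ Lebesgue measurable with $\int_S\rho^{n-1}d\mathcal A\ge1$ for $p$-a.e. $S\in\Gamma$. Lower $Q$-homeomorphism: $f:G\to G^*$ is a lower $Q$-homeomorphism with respect to $p$-modulus at $x_0$ if for all $0<\varepsilon<\varepsilon_0<\sup_{x\in G}|x-x_0|$: $M_p(f(\Sigma_\varepsilon))\ge\inf_{\rho\in\mathrm{ext}_p\mathrm{adm}\,\Sigma_\varepsilon}\int_{\{\varepsilon<|x-x_0|<\varepsilon_0\}}\rho^p(x)/Q(x)\,dm(x)$,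 where $\Sigma_\varepsilon$ is the family of intersections with $G$ of the spheres $\{|x-x_0|=r\}$, $\varepsilon<r<\varepsilon_0$. Curve modulus: for a family $\Delta$ of curves, $M_\alpha(\Delta)=\inf\int_{\mathbb R^n}\rho^\alpha\,dm$ over Borel $\rho\ge0$ with $\int_\gamma\rho\,ds\ge1$ for all (locally rectifiable) $\gamma\in\Delta$. $\Delta(E,F,G)$ denotes the family of curves $\gamma:[a,b]\to\mathbb R^n$ with $\gamma(a)\in E$, $\gamma(b)\in F$, $\gamma(t)\in G$ for $a<t<b$. Ring homeomorphism: with $d_0=\mathrm{dist}(x_0,\partial G)$, a homeomorphism $f:G\to\mathbb R^n$ is a ring $\widetilde Q$-homeomorphism with respect to $\alpha$-modulus at $x_0$ if for all $0<r_1<r_2<d_0$ and every measurable $\eta:(r_1,r_2)\to[0,\infty]$ with $\int_{r_1}^{r_2}\eta(r)\,dr\ge1$, $$M_\alpha\big(\Delta(f(S_1),f(S_2),f(G))\big)\le\int_{A(x_0,r_1,r_2)}\widetilde Q(x)\,\eta^\alpha(|x-x_0|)\,dx,$$ where $S_i=\{|x-x_0|=r_i\}$ and $A(x_0,r_1,r_2)=\{r_1<|x-x_0|<r_2\}$. *)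

theory Defs
  imports "HOL-Analysis.Analysis"
begin

(* real powers of extended nonnegative reals, for positive exponents: \<infinity>^a = \<infinity> *)
definition epowr :: "ennreal \<Rightarrow> real \<Rightarrow> ennreal" where
  "epowr x a = (if x = \<infinity> then \<infinity> else ennreal (enn2real x powr a))"

definition hausdorff_outer :: "real \<Rightarrow> 'a::metric_space set \<Rightarrow> ennreal" where
  "hausdorff_outer s A =
     (SUP \<delta>\<in>{0::real<..}. INF C \<in> {C :: nat \<Rightarrow> 'a set. A \<subseteq> (\<Union>i. C i) \<and>
                                 (\<forall>i. bounded (C i) \<and> diameter (C i) < \<delta>)}.
        (\<Sum>i. ennreal (unit_ball_vol s * (diameter (C i) / 2) powr s)))"

definition hausdorff_measure :: "real \<Rightarrow> 'a::metric_space measure" where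
  "hausdorff_measure s = measure_of UNIV (sets borel) (hausdorff_outer s)"

(* A surface S is represented through its multiplicity function N(S,y) = card S^{-1}(y). *)
definition surface_integral :: "('a::euclidean_space \<Rightarrow> ennreal) \<Rightarrow> ('a \<Rightarrow> ennreal) \<Rightarrow> ennreal" where
  "surface_integral \<rho> N = (\<integral>\<^sup>+ y. \<rho> y * N y \<partial>(hausdorff_measure (real (DIM('a) - 1))))"

definition surface_modulus :: "real \<Rightarrow> ('a::euclidean_space \<Rightarrow> ennreal) set \<Rightarrow> ennreal" where
  "surface_modulus p \<Gamma> =
     (INF \<rho> \<in> {\<rho> :: 'a \<Rightarrow> ennreal. \<rho> \<in> borel_measurable borel \<and>
                 (\<forall>N\<in>\<Gamma>. surface_integral (\<lambda>y. \<rho> y ^ (DIM('a) - 1)) N \<ge> 1)}.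
        \<integral>\<^sup>+ x. epowr (\<rho> x) p \<partial>lborel)"

definition ext_adm :: "real \<Rightarrow> ('a::euclidean_space \<Rightarrow> ennreal) set \<Rightarrow> ('a \<Rightarrow> ennreal) set" where
  "ext_adm p \<Gamma> = {\<rho>. \<rho> \<in> borel_measurable lebesgue \<and>
      (\<exists>\<Gamma>0 \<subseteq> \<Gamma>. surface_modulus p \<Gamma>0 = 0 \<and>
         (\<forall>N \<in> \<Gamma> - \<Gamma>0. surface_integral (\<lambda>y. \<rho> y ^ (DIM('a) - 1)) N \<ge> 1))}"

(* \<Sigma>_\<epsilon>: intersections with G of the spheres |x-x0| = r, \<epsilon> < r < \<epsilon>0 (as injectively
   parametrized surfaces, multiplicity = indicator) *)
definition sphere_family :: "'a::euclidean_space set \<Rightarrow> 'a \<Rightarrow> real \<Rightarrow> real \<Rightarrow> ('a \<Rightarrow> ennreal) set" where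
  "sphere_family G x0 \<epsilon> \<epsilon>0 = {indicator (sphere x0 r \<inter> G) | r. \<epsilon> < r \<and> r < \<epsilon>0}"

(* f(\<Sigma>_\<epsilon>) for a homeomorphism f (images f\<circ>S are again injective) *)
definition image_sphere_family ::
  "('a::euclidean_space \<Rightarrow> 'a) \<Rightarrow> 'a set \<Rightarrow> 'a \<Rightarrow> real \<Rightarrow> real \<Rightarrow> ('a \<Rightarrow> ennreal) set" where
  "image_sphere_family f G x0 \<epsilon> \<epsilon>0 = {indicator (f ` (sphere x0 r \<inter> G)) | r. \<epsilon> < r \<and> r < \<epsilon>0}"

definition lower_Q_homeo ::
  "real \<Rightarrow> ('a::euclidean_space \<Rightarrow> ennreal) \<Rightarrow> ('a \<Rightarrow> 'a) \<Rightarrow> 'a set \<Rightarrow> 'a set \<Rightarrow> 'a \<Rightarrow> bool" where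
  "lower_Q_homeo p Q f G G' x0 \<longleftrightarrow>
     (\<exists>g. homeomorphism G G' f g) \<and>
     (\<forall>\<epsilon> \<epsilon>0. 0 < \<epsilon> \<and> \<epsilon> < \<epsilon>0 \<and> \<epsilon>0 < (SUP x\<in>G. dist x x0) \<longrightarrow>
        surface_modulus p (image_sphere_family f G x0 \<epsilon> \<epsilon>0) \<ge>
        (INF \<rho> \<in> ext_adm p (sphere_family G x0 \<epsilon> \<epsilon>0).
           \<integral>\<^sup>+ x \<in> {x\<in>G. \<epsilon> < dist x x0 \<and> dist x x0 < \<epsilon>0}. epowr (\<rho> x) p / Q x \<partial>lebesgue))"

definition curve_length :: "(real \<Rightarrow> 'a::metric_space) \<Rightarrow> real \<Rightarrow> real \<Rightarrow> ennreal" where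
  "curve_length \<gamma> a b =
     (SUP ts \<in> {ts. sorted ts \<and> set ts \<subseteq> {a..b}}.
        ennreal (\<Sum>i < length ts - 1. dist (\<gamma> (ts ! i)) (\<gamma> (ts ! Suc i))))"

definition line_integral :: "('a::metric_space \<Rightarrow> ennreal) \<Rightarrow> (real \<Rightarrow> 'a) \<Rightarrow> real \<Rightarrow> real \<Rightarrow> ennreal" where
  "line_integral \<rho> \<gamma> a b =
     (\<integral>\<^sup>+ t. \<rho> (\<gamma> t) * indicator {a..b} t
        \<partial>(interval_measure (\<lambda>t. enn2real (curve_length \<gamma> a (max a (min t b))))))"

definition curve_family :: "'a::metric_space set \<Rightarrow> 'a set \<Rightarrow> 'a set \<Rightarrow> ((real \<Rightarrow> 'a) \<times> real \<times> real) set" where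
  "curve_family E F G = {(\<gamma>, a, b). a < b \<and> continuous_on {a..b} \<gamma> \<and> \<gamma> a \<in> E \<and> \<gamma> b \<in> F \<and>
                          (\<forall>t\<in>{a<..<b}. \<gamma> t \<in> G)}"

(* M_\<alpha>(\<Delta>); curves on compact intervals are locally rectifiable iff rectifiable *)
definition curve_modulus :: "real \<Rightarrow> ((real \<Rightarrow> 'a::euclidean_space) \<times> real \<times> real) set \<Rightarrow> ennreal" where
  "curve_modulus \<alpha> \<Delta> =
     (INF \<rho> \<in> {\<rho> :: 'a \<Rightarrow> ennreal. \<rho> \<in> borel_measurable borel \<and>
                 (\<forall>(\<gamma>, a, b) \<in> \<Delta>. curve_length \<gamma> a b < \<infinity> \<longrightarrow> line_integral \<rho> \<gamma> a b \<ge> 1)}.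
        \<integral>\<^sup>+ x. epowr (\<rho> x) \<alpha> \<partial>lborel)"

definition ring_Q_homeo ::
  "real \<Rightarrow> ('a::euclidean_space \<Rightarrow> ennreal) \<Rightarrow> ('a \<Rightarrow> 'a) \<Rightarrow> 'a set \<Rightarrow> 'a \<Rightarrow> bool" where
  "ring_Q_homeo \<alpha> Qt f G x0 \<longleftrightarrow>
     (\<exists>g. homeomorphism G (f ` G) f g) \<and>
     (\<forall>r1 r2 (\<eta> :: real \<Rightarrow> ennreal).
        0 < r1 \<and> r1 < r2 \<and> r2 < infdist x0 (frontier G) \<and>
        \<eta> \<in> borel_measurable (lebesgue_on {r1<..<r2}) \<and>
        (\<integral>\<^sup>+ r \<in> {r1<..<r2}. \<eta> r \<partial>lebesgue) \<ge> 1 \<longrightarrow>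
        curve_modulus \<alpha> (curve_family (f ` sphere x0 r1) (f ` sphere x0 r2) (f ` G)) \<le>
        (\<integral>\<^sup>+ x \<in> {x. r1 < dist x x0 \<and> dist x x0 < r2}. Qt x * epowr (\<eta> (dist x x0)) \<alpha> \<partial>lebesgue))"

end

theory Submission
  imports Defs
begin

text \<open>Put \<open>s = p/(n-1)\<close>, so that \<open>\<alpha>\<close> is the exponent conjugate to \<open>s\<close>, and write \<open>S \<rho>\<close> for the image of the sphere of
  radius \<open>\<rho>\<close> about \<open>x0\<close>. Testing the lower modulus inequality with densities that are constant multiples of a given
  \<open>\<phi>\<close> on each \<open>S \<rho>\<close>, and applying Young's inequality in the source, gives an inequality between measures on all
  subintervals of the radii; optimising it radius by radius shows that the measure
  \<open>\<mu> = \<integral> \<eta>(\<rho>) H(\<cdot> \<inter> S \<rho>) d\<rho>\<close> satisfies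
  \<open>\<integral> \<phi> d\<mu> \<le> (1/s) \<integral> \<phi>\<^sup>s dm + (1/\<alpha>) R\<close>, where \<open>R\<close> is the right-hand side of the ring inequality. By duality the
  mollifications of \<open>\<mu>\<close> have \<open>\<alpha>\<close>-energy at most \<open>R\<close>. Since moving a point across \<open>S \<rho>\<close> changes the potential
  \<open>y \<mapsto> \<integral> \<eta>(\<rho>) 1[y inside S \<rho>] d\<rho>\<close> by \<open>\<eta>(\<rho>) d\<rho>\<close>, the mollified \<open>\<mu>\<close> is an upper gradient of the mollified potential, and so
  its line integral along any rectifiable curve joining the two boundary images is at least \<open>\<integral> \<eta>\<close>.

  No coarea formula and no isodiametric inequality are needed: the constant \<open>isodiam\<close> relating Hausdorff measure to
  shadow volumes is the same in the source (comparison with the surface area of spheres) and in the target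
  (volume swept out by \<open>S \<rho>\<close> under translation), hence cancels.\<close>

section \<open>Hausdorff measures\<close>

text \<open>Young's inequality with a free factor \<open>t\<close> takes the place of Hoelder's
  because both sides of \<open>t * (b - a) \<le> t powr s / s * N1 + N2 / \<alpha>\<close> are
  additive in the interval: such a bound passes from intervals to Borel sets, and \<open>t\<close>
  may then vary with the radius. For a test density normalised by \<open>A \<rho>\<close> on
  \<open>S \<rho>\<close>, the weight \<open>\<eta> powr \<alpha>\<close> together with
  \<open>t = A * \<eta> powr (1 - \<alpha>)\<close> turns the left side into the integral of
  \<open>A * \<eta>\<close>, and since \<open>\<alpha> + (1 - \<alpha>) * s = 0\<close> the
  normalisation cancels on the right.

  The obstacle is that \<open>f\<close> is merely a homeomorphism. Image spheres may lack normals
  and have infinite area, so they are used only as compact sets containing the frontier of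
  \<open>D \<rho>\<close>, which a segment with one endpoint inside must meet. Radii of infinite
  area are discarded by testing the estimate with the indicator of a compact set: where
  \<open>\<eta>\<close> is positive they form a null set as soon as the right side is finite. The
  area of the remaining spheres has to depend measurably on the radius, which comes from upper
  semicontinuity of the \<open>\<delta>\<close>-contents.\<close>

definition hausdorff_cost :: "real \<Rightarrow> 'a::metric_space set \<Rightarrow> ennreal" where
  "hausdorff_cost s C = ennreal (unit_ball_vol s * (diameter C / 2) powr s)"

definition hausdorff_pre :: "real \<Rightarrow> real \<Rightarrow> 'a::metric_space set \<Rightarrow> ennreal" where
  "hausdorff_pre s \<delta> A = (INF C \<in> {C :: nat \<Rightarrow> 'a set. A \<subseteq> (\<Union>i. C i) \<and>
     (\<forall>i. bounded (C i) \<and> diameter (C i) < \<delta>)}. \<Sum>i. hausdorff_cost s (C i))"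

lemma hausdorff_outer_pre: "hausdorff_outer s A = (SUP \<delta>\<in>{0<..}. hausdorff_pre s \<delta> A)"
  unfolding hausdorff_outer_def hausdorff_pre_def hausdorff_cost_def ..

lemma hausdorff_cost_empty [simp]: "hausdorff_cost s {} = 0"
  by (simp add: hausdorff_cost_def)

lemma hausdorff_pre_le:
  assumes "A \<subseteq> (\<Union>i. C i)" "\<And>i. bounded (C i)" "\<And>i. diameter (C i) < \<delta>"
  shows "hausdorff_pre s \<delta> A \<le> (\<Sum>i::nat. hausdorff_cost s (C i))"
  unfolding hausdorff_pre_def by (rule INF_lower) (use assms in auto)

lemma hausdorff_pre_lessE:
  assumes "hausdorff_pre s \<delta> A < c"
  obtains C :: "nat \<Rightarrow> 'a::metric_space set" where "A \<subseteq> (\<Union>i. C i)" "\<And>i. bounded (C i)"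
    "\<And>i. diameter (C i) < \<delta>" "(\<Sum>i. hausdorff_cost s (C i)) < c"
  using assms unfolding hausdorff_pre_def INF_less_iff by auto

lemma hausdorff_pre_empty [simp]: "0 < \<delta> \<Longrightarrow> hausdorff_pre s \<delta> {} = 0"
  using hausdorff_pre_le[of "{}" "\<lambda>_. {}" \<delta> s] by simp

lemma hausdorff_pre_mono: "A \<subseteq> B \<Longrightarrow> hausdorff_pre s \<delta> A \<le> hausdorff_pre s \<delta> B"
  unfolding hausdorff_pre_def by (rule INF_superset_mono) auto

lemma hausdorff_pre_antimono: "\<delta> \<le> \<delta>' \<Longrightarrow> hausdorff_pre s \<delta>' A \<le> hausdorff_pre s \<delta> A"
  unfolding hausdorff_pre_def by (rule INF_superset_mono) (auto intro: less_le_trans)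

lemma hausdorff_pre_countable_subadditive:
  "hausdorff_pre s \<delta> (\<Union>i. A i) \<le> (\<Sum>i::nat. hausdorff_pre s \<delta> (A i))"
proof (rule ennreal_le_epsilon)
  fix e :: real
  assume fin: "(\<Sum>i. hausdorff_pre s \<delta> (A i)) < top" and e: "0 < e"
  have "hausdorff_pre s \<delta> (A i) < hausdorff_pre s \<delta> (A i) + ennreal (e * (1/2)^Suc i)" for i
    using ennreal_suminf_lessD[OF fin, of i] e
    by (simp add: ennreal_add_left_cancel_less[of _ 0, simplified])
  from this have "\<exists>C :: nat \<Rightarrow> 'a set. A i \<subseteq> (\<Union>j. C j) \<and> (\<forall>j. bounded (C j) \<and> diameter (C j) < \<delta>) \<and>
      (\<Sum>j. hausdorff_cost s (C j)) < hausdorff_pre s \<delta> (A i) + ennreal (e * (1/2)^Suc i)" for i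
    by (rule hausdorff_pre_lessE) blast
  then obtain C :: "nat \<Rightarrow> nat \<Rightarrow> 'a set" where C: "\<And>i. A i \<subseteq> (\<Union>j. C i j)"
      "\<And>i j. bounded (C i j)" "\<And>i j. diameter (C i j) < \<delta>"
      "\<And>i. (\<Sum>j. hausdorff_cost s (C i j)) < hausdorff_pre s \<delta> (A i) + ennreal (e * (1/2)^Suc i)"
    by metis
  define D where "D k = (case prod_decode k of (i, j) \<Rightarrow> C i j)" for k
  have "(\<Union>i. A i) \<subseteq> (\<Union>k. D k)"
  proof
    fix x assume "x \<in> (\<Union>i. A i)"
    then obtain i j where "x \<in> C i j" using C(1) by blast
    then have "x \<in> D (prod_encode (i, j))" by (simp add: D_def)
    then show "x \<in> (\<Union>k. D k)" by blast
  qed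
  then have "hausdorff_pre s \<delta> (\<Union>i. A i) \<le> (\<Sum>k. hausdorff_cost s (D k))"
    by (rule hausdorff_pre_le) (auto simp: D_def C split: prod.split)
  also have "\<dots> = (\<Sum>k. (\<lambda>(i,j). hausdorff_cost s (C i j)) (prod_decode k))"
    by (rule suminf_cong) (simp add: D_def split: prod.split)
  also have "\<dots> = (\<Sum>i. \<Sum>j. hausdorff_cost s (C i j))"
    by (rule suminf_ennreal_2dimen) simp
  also have "\<dots> \<le> (\<Sum>i. hausdorff_pre s \<delta> (A i) + ennreal (e * (1/2)^Suc i))"
    by (intro suminf_le summableI less_imp_le C)
  also have "\<dots> = (\<Sum>i. hausdorff_pre s \<delta> (A i)) + (\<Sum>i. ennreal (e * (1/2)^Suc i))"
    by (rule suminf_add[symmetric]) auto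
  also have "(\<Sum>i. ennreal (e * (1/2)^Suc i)) = ennreal e"
    using power_half_series e by (intro suminf_ennreal_eq) (auto dest: sums_mult[where c=e])
  finally show "hausdorff_pre s \<delta> (\<Union>i. A i) \<le> (\<Sum>i. hausdorff_pre s \<delta> (A i)) + ennreal e" .
qed

lemma hausdorff_pre_Un_le:
  assumes "0 < \<delta>"
  shows "hausdorff_pre s \<delta> (A \<union> B) \<le> hausdorff_pre s \<delta> A + hausdorff_pre s \<delta> B"
proof -
  let ?F = "\<lambda>i::nat. if i = 0 then A else if i = 1 then B else {}"
  have "(\<Union>i. ?F i) = A \<union> B" by (auto split: if_splits)
  then have "hausdorff_pre s \<delta> (A \<union> B) \<le> (\<Sum>i. hausdorff_pre s \<delta> (?F i))"
    using hausdorff_pre_countable_subadditive[of s \<delta> ?F] by simp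
  also have "\<dots> = (\<Sum>i\<in>{0,1}. hausdorff_pre s \<delta> (?F i))"
    by (rule suminf_finite) (use assms in auto)
  finally show ?thesis by simp
qed

text \<open>The contents grow as \<open>\<delta>\<close> decreases, so a sequence of scales
  suffices; monotone sequences allow the supremum to be exchanged with sums, products and
  measurability.\<close>

lemma hausdorff_outer_SUP_seq:
  "hausdorff_outer s A = (SUP n. hausdorff_pre s (1 / real (Suc n)) A)"
  unfolding hausdorff_outer_pre
proof (rule antisym)
  show "(SUP \<delta>\<in>{0<..}. hausdorff_pre s \<delta> A) \<le> (SUP n. hausdorff_pre s (1 / real (Suc n)) A)"
  proof (rule SUP_least)
    fix \<delta> :: real assume "\<delta> \<in> {0<..}"
    then obtain n where "inverse (real (Suc n)) < \<delta>" using reals_Archimedean by auto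
    then have "hausdorff_pre s \<delta> A \<le> hausdorff_pre s (1 / real (Suc n)) A"
      by (intro hausdorff_pre_antimono) (simp add: inverse_eq_divide)
    then show "hausdorff_pre s \<delta> A \<le> (SUP n. hausdorff_pre s (1 / real (Suc n)) A)"
      by (rule order_trans) (rule SUP_upper, simp)
  qed
qed (rule SUP_mono, auto intro!: bexI[of _ "1 / real (Suc _)"])

lemma incseq_hausdorff_pre: "incseq (\<lambda>n. hausdorff_pre s (1 / real (Suc n)) A)"
  by (auto simp: incseq_def intro!: hausdorff_pre_antimono divide_left_mono)

lemma hausdorff_pre_le_outer: "0 < \<delta> \<Longrightarrow> hausdorff_pre s \<delta> A \<le> hausdorff_outer s A"
  unfolding hausdorff_outer_pre by (rule SUP_upper) simp

lemma hausdorff_outer_empty [simp]: "hausdorff_outer s {} = 0"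
  by (simp add: hausdorff_outer_SUP_seq)

lemma hausdorff_outer_mono: "A \<subseteq> B \<Longrightarrow> hausdorff_outer s A \<le> hausdorff_outer s B"
  unfolding hausdorff_outer_pre by (intro SUP_mono) (auto intro: hausdorff_pre_mono)

lemma hausdorff_outer_countable_subadditive:
  "hausdorff_outer s (\<Union>i. A i) \<le> (\<Sum>i::nat. hausdorff_outer s (A i))"
  unfolding hausdorff_outer_pre[of s "\<Union>i. A i"]
proof (rule SUP_least)
  fix \<delta> :: real assume "\<delta> \<in> {0<..}"
  then have "(\<Sum>i. hausdorff_pre s \<delta> (A i)) \<le> (\<Sum>i. hausdorff_outer s (A i))"
    by (intro suminf_le) (auto intro: hausdorff_pre_le_outer)
  then show "hausdorff_pre s \<delta> (\<Union>i. A i) \<le> (\<Sum>i. hausdorff_outer s (A i))"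
    using hausdorff_pre_countable_subadditive order_trans by blast
qed

lemma hausdorff_outer_Un_le:
  "hausdorff_outer s (A \<union> B) \<le> hausdorff_outer s A + hausdorff_outer s B"
proof -
  let ?F = "\<lambda>i::nat. if i = 0 then A else if i = 1 then B else {}"
  have "(\<Union>i. ?F i) = A \<union> B" by (auto split: if_splits)
  then have "hausdorff_outer s (A \<union> B) \<le> (\<Sum>i. hausdorff_outer s (?F i))"
    using hausdorff_outer_countable_subadditive[of s ?F] by simp
  also have "\<dots> = (\<Sum>i\<in>{0,1}. hausdorff_outer s (?F i))"
    by (rule suminf_finite) auto
  finally show ?thesis by simp
qed

text \<open>A covering set of diameter below \<open>\<delta>\<close> cannot meet both
  \<open>A\<close> and \<open>B\<close>, so any cover of the union splits into two covers that share
  no nonempty set.\<close>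

lemma hausdorff_pre_add_separated:
  assumes sep: "\<And>x y. x \<in> A \<Longrightarrow> y \<in> B \<Longrightarrow> \<delta> \<le> dist x y"
  shows "hausdorff_pre s \<delta> A + hausdorff_pre s \<delta> B \<le> hausdorff_pre s \<delta> (A \<union> B)"
  unfolding hausdorff_pre_def[of s \<delta> "A \<union> B"]
proof (rule INF_greatest, clarsimp)
  fix C :: "nat \<Rightarrow> 'a set"
  assume C: "A \<subseteq> (\<Union>i. C i)" "B \<subseteq> (\<Union>i. C i)" "\<forall>i. bounded (C i) \<and> diameter (C i) < \<delta>"
  have pos: "0 < \<delta>" using C(3) diameter_ge_0[of "C 0"] by (auto intro: le_less_trans)
  define CA where "CA i = (if C i \<inter> A = {} then {} else C i)" for i
  define CB where "CB i = (if C i \<inter> B = {} then {} else C i)" for i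
  have disj: "C i \<inter> A = {} \<or> C i \<inter> B = {}" for i
  proof (rule ccontr)
    assume "\<not> ?thesis"
    then obtain x y where "x \<in> C i" "x \<in> A" "y \<in> C i" "y \<in> B" by blast
    then have "\<delta> \<le> diameter (C i)"
      using sep[of x y] diameter_bounded_bound[of "C i" x y] C(3) by force
    then show False using C(3) by (meson not_less)
  qed
  have "hausdorff_pre s \<delta> A \<le> (\<Sum>i. hausdorff_cost s (CA i))"
  proof (rule hausdorff_pre_le)
    show "A \<subseteq> (\<Union>i. CA i)"
    proof
      fix x assume x: "x \<in> A"
      then obtain i where "x \<in> C i" using C by blast
      then have "x \<in> CA i" using x by (auto simp: CA_def)
      then show "x \<in> (\<Union>i. CA i)" by blast
    qed
  qed (use C pos in \<open>auto simp: CA_def\<close>)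
  moreover have "hausdorff_pre s \<delta> B \<le> (\<Sum>i. hausdorff_cost s (CB i))"
  proof (rule hausdorff_pre_le)
    show "B \<subseteq> (\<Union>i. CB i)"
    proof
      fix x assume x: "x \<in> B"
      then obtain i where "x \<in> C i" using C by blast
      then have "x \<in> CB i" using x by (auto simp: CB_def)
      then show "x \<in> (\<Union>i. CB i)" by blast
    qed
  qed (use C pos in \<open>auto simp: CB_def\<close>)
  moreover have "(\<Sum>i. hausdorff_cost s (CA i)) + (\<Sum>i. hausdorff_cost s (CB i))
      = (\<Sum>i. hausdorff_cost s (CA i) + hausdorff_cost s (CB i))"
    by (rule suminf_add) auto
  moreover have "\<dots> \<le> (\<Sum>i. hausdorff_cost s (C i))"
    by (rule suminf_le) (use disj in \<open>auto simp: CA_def CB_def\<close>)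
  ultimately show "hausdorff_pre s \<delta> A + hausdorff_pre s \<delta> B \<le> (\<Sum>i. hausdorff_cost s (C i))"
    by (metis add_mono order_trans)
qed

lemma hausdorff_outer_add_separated:
  assumes sep: "\<And>x y. x \<in> A \<Longrightarrow> y \<in> B \<Longrightarrow> d \<le> dist x y" and d: "0 < d"
  shows "hausdorff_outer s A + hausdorff_outer s B \<le> hausdorff_outer s (A \<union> B)"
proof -
  have "hausdorff_outer s A + hausdorff_outer s B =
      (SUP n. hausdorff_pre s (1 / real (Suc n)) A + hausdorff_pre s (1 / real (Suc n)) B)"
    unfolding hausdorff_outer_SUP_seq
    by (rule ennreal_SUP_add[symmetric]) (rule incseq_hausdorff_pre)+
  also have "\<dots> \<le> hausdorff_outer s (A \<union> B)"
  proof (rule SUP_least)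
    fix n
    let ?e = "min d (1 / real (Suc n))"
    have "hausdorff_pre s (1 / real (Suc n)) A + hausdorff_pre s (1 / real (Suc n)) B
        \<le> hausdorff_pre s ?e A + hausdorff_pre s ?e B"
      by (intro add_mono hausdorff_pre_antimono) auto
    also have "\<dots> \<le> hausdorff_pre s ?e (A \<union> B)"
      by (rule hausdorff_pre_add_separated) (use sep in force)
    also have "\<dots> \<le> hausdorff_outer s (A \<union> B)"
      by (rule hausdorff_pre_le_outer) (use d in auto)
    finally show "hausdorff_pre s (1 / real (Suc n)) A + hausdorff_pre s (1 / real (Suc n)) B
        \<le> hausdorff_outer s (A \<union> B)" .
  qed
  finally show ?thesis .
qed

text \<open>The gap may shrink with the later index: the sets are added one at a time, and the
  \<open>n\<close>-th one needs a positive distance \<open>d n\<close> to all earlier ones.\<close>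

lemma hausdorff_outer_sum_separated:
  fixes A :: "nat \<Rightarrow> 'a::metric_space set"
  assumes "\<And>i j x y. i < j \<Longrightarrow> x \<in> A i \<Longrightarrow> y \<in> A j \<Longrightarrow> d j \<le> dist x y" and "\<And>j. 0 < d j"
  shows "(\<Sum>i<n. hausdorff_outer s (A i)) \<le> hausdorff_outer s (\<Union>i<n. A i)"
proof (induction n)
  case (Suc n)
  have "(\<Sum>i<Suc n. hausdorff_outer s (A i)) \<le> hausdorff_outer s (\<Union>i<n. A i) + hausdorff_outer s (A n)"
    using Suc by (simp add: add_right_mono)
  also have "\<dots> \<le> hausdorff_outer s ((\<Union>i<n. A i) \<union> A n)"
    by (rule hausdorff_outer_add_separated[of _ _ "d n"]) (use assms in auto)
  finally show ?case by (simp add: lessThan_Suc Un_commute)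
qed simp

text \<open>Caratheodory's criterion for metric outer measures. The points off \<open>C\<close> are
  cut into shells by their distance to \<open>C\<close>. Shells of equal parity are separated from
  each other, so the shell measures have a finite sum and the part of \<open>X - C\<close> close to
  \<open>C\<close> is negligible; the rest has positive distance to \<open>C\<close>.\<close>

lemma hausdorff_outer_split_closed:
  assumes "closed C"
  shows "hausdorff_outer s (X \<inter> C) + hausdorff_outer s (X - C) \<le> hausdorff_outer s X"
proof (cases "C = {} \<or> hausdorff_outer s X = \<infinity>")
  case True then show ?thesis by auto
next
  case False
  then have ne: "C \<noteq> {}" and fin: "hausdorff_outer s X < \<infinity>" by (auto simp: top.not_eq_extremum)
  let ?H = "hausdorff_outer s"
  let ?d = "\<lambda>x. infdist x C"
  define F where "F k = {x \<in> X. 1 / real (Suc k) \<le> ?d x}" for k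
  define R where "R j = {x \<in> X. 1 / real (j+2) \<le> ?d x \<and> ?d x < 1 / real (j+1)}" for j
  have gap: "\<bar>?d x - ?d y\<bar> \<le> dist x y" for x y
    using infdist_triangle[of x C y] infdist_triangle[of y C x] by (simp add: dist_commute)
  \<comment> \<open>\<open>c = 0\<close> and \<open>c = 1\<close> give the shells of even and odd
    index. In the gap below, the value for \<open>j = 0\<close> is a dummy that only has to be
    positive, since no earlier index is compared with it.\<close>
  have Reven: "(\<Sum>i<n. ?H (R (2*i + c))) \<le> ?H X" for n c
  proof -
    have "(\<Sum>i<n. ?H (R (2*i + c))) \<le> ?H (\<Union>i<n. R (2*i + c))"
    proof (rule hausdorff_outer_sum_separated[of _ "\<lambda>j. if j = 0 then 1 else 1 / real (2*j+c) - 1 / real (2*j+c+1)"])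
      fix i j x y assume ij: "i < (j::nat)" and x: "x \<in> R (2*i+c)" and y: "y \<in> R (2*j+c)"
      have "1 / real (2*j+c) \<le> 1 / real (2*i+c+2)"
        using ij by (intro divide_left_mono) auto
      also have "\<dots> \<le> ?d x" using x by (simp add: R_def)
      finally have "1 / real (2*j+c) - 1 / real (2*j+c+1) \<le> ?d x - ?d y"
        using y by (auto simp: R_def)
      also have "\<dots> \<le> dist x y" using gap[of x y] by auto
      finally show "(if j = 0 then 1 else 1 / real (2*j+c) - 1 / real (2*j+c+1)) \<le> dist x y"
        using ij by simp
    next
      fix j :: nat
      have "1 / real (2*j+c+1) < 1 / real (2*j+c)" if "j \<noteq> 0"
        using that by (intro divide_strict_left_mono) auto
      then show "0 < (if j = 0 then 1 else 1 / real (2*j+c) - 1 / real (2*j+c+1))" by simp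
    qed
    also have "\<dots> \<le> ?H X" by (rule hausdorff_outer_mono) (auto simp: R_def)
    finally show ?thesis .
  qed
  have "(\<Sum>i<n. ?H (R i)) \<le> 2 * ?H X" for n
  proof -
    have "(\<Sum>i<n. ?H (R i)) \<le> (\<Sum>i<2*n. ?H (R i))" by (rule sum_mono2) auto
    also have "\<dots> = (\<Sum>i<n. ?H (R (2*i))) + (\<Sum>i<n. ?H (R (2*i+1)))"
      by (induction n) (simp_all add: algebra_simps)
    also have "\<dots> \<le> ?H X + ?H X" using Reven[of 0 n] Reven[of 1 n] by (intro add_mono) auto
    finally show ?thesis by (simp add: mult_2)
  qed
  then have "(\<Sum>i. ?H (R i)) \<le> 2 * ?H X" by (intro suminf_le_const summableI)
  also have "2 * ?H X < \<infinity>" using fin by (simp add: ennreal_mult_less_top)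
  finally have sfin: "(\<Sum>i. ?H (R i)) < \<infinity>" .
  define h where "h i = enn2real (?H (R i))" for i
  have hH: "?H (R i) = ennreal (h i)" for i
    using ennreal_suminf_lessD[OF sfin, of i] by (simp add: h_def)
  have summ: "summable h"
  proof (rule summable_suminf_not_top)
    show "(\<Sum>i. ennreal (h i)) \<noteq> top" using sfin unfolding hH by simp
  qed (simp add: h_def)
  have cov: "X - C \<subseteq> F k \<union> (\<Union>j. R (j + k))" for k
  proof
    fix x assume x: "x \<in> X - C"
    then have d: "0 < ?d x" using assms ne
      by (metis DiffD2 in_closed_iff_infdist_zero infdist_nonneg less_eq_real_def)
    show "x \<in> F k \<union> (\<Union>j. R (j + k))"
    proof (cases "1 / real (Suc k) \<le> ?d x")
      case True then show ?thesis using x by (simp add: F_def)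
    next
      case small: False
      obtain n0 where "inverse (real (Suc n0)) < ?d x" using reals_Archimedean[OF d] by auto
      moreover have "1 / real (n0 + 2) \<le> inverse (real (Suc n0))"
        by (simp add: inverse_eq_divide frac_le)
      ultimately have ex: "1 / real (n0 + 2) \<le> ?d x" by linarith
      define j where "j = (LEAST n. 1 / real (n + 2) \<le> ?d x)"
      have j1: "1 / real (j + 2) \<le> ?d x" unfolding j_def by (rule LeastI[of _ n0]) (rule ex)
      have j2: "?d x < 1 / real (j + 1)"
      proof (cases j)
        case 0
        have "1 / real (Suc k) \<le> 1" by simp
        then have "?d x < 1" using small by linarith
        then show ?thesis using 0 by simp
      next
        case (Suc i)
        then have "\<not> 1 / real (i + 2) \<le> ?d x" unfolding j_def by (intro not_less_Least) simp
        then show ?thesis using Suc by simp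
      qed
      have "k \<le> j"
      proof (rule ccontr)
        assume "\<not> k \<le> j"
        then have "1 / real (Suc k) \<le> 1 / real (j + 2)" by (intro divide_left_mono) auto
        then show False using j1 small by linarith
      qed
      then have "x \<in> R ((j - k) + k)" using j1 j2 x by (simp add: R_def)
      then show ?thesis by blast
    qed
  qed
  show ?thesis
  proof (rule ennreal_le_epsilon)
    fix e :: real assume e: "0 < e"
    obtain k where k: "norm (\<Sum>i. h (i + k)) < e"
      using suminf_exist_split[OF e summ] by blast
    have "?H (X - C) \<le> ?H (F k \<union> (\<Union>j. R (j + k)))" by (rule hausdorff_outer_mono) (rule cov)
    also have "\<dots> \<le> ?H (F k) + ?H (\<Union>j. R (j + k))" by (rule hausdorff_outer_Un_le)
    also have "\<dots> \<le> ?H (F k) + (\<Sum>j. ?H (R (j + k)))"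
      by (intro add_left_mono hausdorff_outer_countable_subadditive)
    also have "(\<Sum>j. ?H (R (j + k))) = ennreal (\<Sum>j. h (j + k))"
      unfolding hH using summ summable_iff_shift[of h k]
      by (intro suminf_ennreal2) (simp_all add: h_def[abs_def])
    also have "\<dots> \<le> ennreal e" using k by (intro ennreal_leI) auto
    finally have "?H (X - C) \<le> ?H (F k) + ennreal e" by (simp add: add_left_mono)
    then have "?H (X \<inter> C) + ?H (X - C) \<le> (?H (X \<inter> C) + ?H (F k)) + ennreal e"
      by (simp add: add.assoc add_left_mono)
    also have "?H (X \<inter> C) + ?H (F k) \<le> ?H ((X \<inter> C) \<union> F k)"
    proof (rule hausdorff_outer_add_separated[of _ _ "1 / real (Suc k)"])
      fix x y assume "x \<in> X \<inter> C" "y \<in> F k"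
      then show "1 / real (Suc k) \<le> dist x y"
        using infdist_le[of x C y] by (auto simp: F_def dist_commute)
    qed simp
    also have "\<dots> \<le> ?H X" by (rule hausdorff_outer_mono) (auto simp: F_def)
    finally show "?H (X \<inter> C) + ?H (X - C) \<le> ?H X + ennreal e" by (simp add: add_right_mono)
  qed
qed

text \<open>\<open>measure_of\<close> in \<open>hausdorff_measure\<close> yields the intended values
  only if the set function is countably additive on the Borel sets, and zero otherwise.
  Caratheodory's construction over all subsets gives this once closed sets are known to be
  measurable.\<close>

lemma measure_space_hausdorff_outer: "measure_space UNIV (sets borel) (hausdorff_outer s)"
proof -
  let ?L = "lambda_system UNIV (UNIV :: 'a set set) (hausdorff_outer s)"
  interpret P: sigma_algebra "UNIV :: 'a set" "UNIV :: 'a set set"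
    using sigma_algebra_Pow[of UNIV] by simp
  have "outer_measure_space (UNIV :: 'a set set) (hausdorff_outer s)"
    by (simp add: outer_measure_space_def positive_def increasing_def countably_subadditive_def
        hausdorff_outer_mono hausdorff_outer_countable_subadditive)
  then have ms: "measure_space UNIV ?L (hausdorff_outer s)"
    by (rule P.caratheodory_lemma)
  have "C \<in> ?L" if "closed C" for C :: "'a set"
  proof -
    have "hausdorff_outer s (X \<inter> C) + hausdorff_outer s (X - C) = hausdorff_outer s X" for X
      using hausdorff_outer_split_closed[OF that, of s X]
        hausdorff_outer_Un_le[of s "X \<inter> C" "X - C"]
      unfolding Int_Diff_Un by (rule antisym)
    moreover have "C \<inter> X = X \<inter> C" "(UNIV - C) \<inter> X = X - C" for X by auto
    ultimately show ?thesis unfolding lambda_system_def by simp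
  qed
  then have "sigma_sets UNIV {C :: 'a set. closed C} \<subseteq> ?L"
    using ms by (intro sigma_algebra.sigma_sets_subset) (auto simp: measure_space_def)
  then have "sets (borel :: 'a measure) \<subseteq> ?L" by (simp add: borel_eq_closed)
  then show ?thesis
    by (rule measure_down[OF ms, rotated]) (use sets.sigma_algebra_axioms[of borel] in simp)
qed

lemma space_hausdorff_measure [simp]: "space (hausdorff_measure s) = UNIV"
  by (simp add: hausdorff_measure_def)

lemma sets_hausdorff_measure [simp, measurable_cong]: "sets (hausdorff_measure s) = sets borel"
  unfolding hausdorff_measure_def
  by (subst sets_measure_of) (use sets.sigma_sets_eq[of borel] in auto)

lemma emeasure_hausdorff_measure:
  "A \<in> sets borel \<Longrightarrow> emeasure (hausdorff_measure s) A = hausdorff_outer s A"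
  unfolding hausdorff_measure_def using measure_space_hausdorff_outer[of s]
  by (intro emeasure_measure_of_sigma) (auto simp: measure_space_def)

lemma hausdorff_cost_le:
  "0 \<le> s \<Longrightarrow> bounded C \<Longrightarrow> diameter C \<le> d \<Longrightarrow>
    hausdorff_cost s C \<le> ennreal (unit_ball_vol s * (d / 2) powr s)"
  unfolding hausdorff_cost_def using diameter_ge_0[of C]
  by (intro ennreal_leI mult_left_mono powr_mono2) auto

lemma le_ennreal_mult_INF:
  fixes f :: "'i \<Rightarrow> ennreal"
  assumes c: "0 < c" and le: "\<And>i. i \<in> I \<Longrightarrow> x \<le> ennreal c * f i"
  shows "x \<le> ennreal c * (INF i\<in>I. f i)"
proof -
  have cancel: "ennreal (1 / c) * (ennreal c * y) = y" "ennreal c * (ennreal (1 / c) * y) = y" for y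
    using c by (simp_all add: mult.assoc[symmetric] ennreal_mult'[symmetric])
  have "ennreal (1 / c) * x \<le> (INF i\<in>I. f i)"
    using mult_left_mono[OF le, of _ "ennreal (1 / c)"] by (intro INF_greatest) (simp add: cancel)
  then have "ennreal c * (ennreal (1 / c) * x) \<le> ennreal c * (INF i\<in>I. f i)"
    by (rule mult_left_mono) simp
  then show ?thesis by (simp add: cancel)
qed

lemma hausdorff_outer_lipschitz_image:
  fixes f :: "'a::metric_space \<Rightarrow> 'b::metric_space"
  assumes s: "0 \<le> s" and L: "0 < L"
    and lip: "\<And>x y. x \<in> A \<Longrightarrow> y \<in> A \<Longrightarrow> dist (f x) (f y) \<le> L * dist x y"
  shows "hausdorff_outer s (f ` A) \<le> ennreal (L powr s) * hausdorff_outer s A"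
  unfolding hausdorff_outer_pre[of s "f ` A"]
proof (rule SUP_least)
  fix \<delta> :: real assume "\<delta> \<in> {0<..}"
  then have \<delta>: "0 < \<delta>" by simp
  have "hausdorff_pre s \<delta> (f ` A) \<le> ennreal (L powr s) * hausdorff_pre s (\<delta> / L) A"
    unfolding hausdorff_pre_def[of s "\<delta> / L" A]
  proof (rule le_ennreal_mult_INF)
    show "0 < L powr s" using L by simp
  next
    fix C :: "nat \<Rightarrow> 'a set"
    assume "C \<in> {C. A \<subseteq> (\<Union>i. C i) \<and> (\<forall>i. bounded (C i) \<and> diameter (C i) < \<delta> / L)}"
    then have C: "A \<subseteq> (\<Union>i. C i)" "\<And>i. bounded (C i)" "\<And>i. diameter (C i) < \<delta> / L" by auto
    define D where "D i = f ` (A \<inter> C i)" for i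
    have D: "dist x y \<le> L * diameter (C i)" if xy: "x \<in> D i" "y \<in> D i" for i x y
    proof -
      obtain u v where uv: "u \<in> A \<inter> C i" "v \<in> A \<inter> C i" "x = f u" "y = f v"
        using xy by (auto simp: D_def)
      have "dist x y \<le> L * dist u v" using lip uv by auto
      also have "\<dots> \<le> L * diameter (C i)"
        using uv C(2)[of i] L by (intro mult_left_mono diameter_bounded_bound) auto
      finally show ?thesis .
    qed
    have bD: "bounded (D i)" for i
      unfolding bounded_two_points using D by blast
    have dD: "diameter (D i) \<le> L * diameter (C i)" for i
    proof (cases "D i = {}")
      case True then show ?thesis using diameter_ge_0[OF C(2)[of i]] L by simp
    next
      case False
      then have "(SUP (x,y)\<in>D i \<times> D i. dist x y) \<le> L * diameter (C i)"
        using D by (intro cSUP_least) auto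
      then show ?thesis using False by (simp add: diameter_def[of "D i"])
    qed
    have "hausdorff_pre s \<delta> (f ` A) \<le> (\<Sum>i. hausdorff_cost s (D i))"
    proof (rule hausdorff_pre_le)
      show "f ` A \<subseteq> (\<Union>i. D i)" using C(1) unfolding D_def by blast
      show "diameter (D i) < \<delta>" for i
        using dD[of i] C(3)[of i] L by (simp add: field_simps)
    qed (rule bD)
    also have "\<dots> \<le> (\<Sum>i. ennreal (L powr s) * hausdorff_cost s (C i))"
    proof (intro suminf_le summableI)
      fix i
      have "hausdorff_cost s (D i) \<le> ennreal (unit_ball_vol s * (L * diameter (C i) / 2) powr s)"
        by (rule hausdorff_cost_le[OF s bD dD])
      also have "(L * diameter (C i) / 2) powr s = L powr s * (diameter (C i) / 2) powr s"
        using L diameter_ge_0[OF C(2)[of i]] by (simp add: powr_mult[symmetric])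
      finally show "hausdorff_cost s (D i) \<le> ennreal (L powr s) * hausdorff_cost s (C i)"
        using s by (simp add: hausdorff_cost_def ennreal_mult'[symmetric] mult_ac)
    qed
    also have "\<dots> = ennreal (L powr s) * (\<Sum>i. hausdorff_cost s (C i))" by simp
    finally show "hausdorff_pre s \<delta> (f ` A) \<le> ennreal (L powr s) * (\<Sum>i. hausdorff_cost s (C i))" .
  qed
  also have "\<dots> \<le> ennreal (L powr s) * hausdorff_outer s A"
    using \<delta> L by (intro mult_left_mono hausdorff_pre_le_outer) auto
  finally show "hausdorff_pre s \<delta> (f ` A) \<le> ennreal (L powr s) * hausdorff_outer s A" .
qed

section \<open>Isometry invariance and slicing of Lebesgue measure\<close>

lemma nn_integral_lborel_translate:
  fixes c :: "'a::euclidean_space"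
  assumes [measurable]: "f \<in> borel_measurable borel"
  shows "(\<integral>\<^sup>+x. f (c + x) \<partial>lborel) = (\<integral>\<^sup>+x. f x \<partial>lborel)"
  using nn_integral_distr[of "(+) c" lborel borel f] by (simp add: lborel_distr_plus)

lemma nn_integral_lborel_scale:
  fixes f :: "'a::euclidean_space \<Rightarrow> ennreal"
  assumes [measurable]: "f \<in> borel_measurable borel" and c: "0 < c"
  shows "(\<integral>\<^sup>+x. f x \<partial>lborel) = ennreal (c ^ DIM('a)) * (\<integral>\<^sup>+x. f (c *\<^sub>R x) \<partial>lborel)"
  using c by (subst lborel_affine[of c 0])
    (simp_all add: nn_integral_density nn_integral_distr nn_integral_cmult)

lemma emeasure_lborel_scale_vimage:
  fixes A :: "'a::euclidean_space set"
  assumes "A \<in> sets borel" "0 < c"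
  shows "emeasure lborel A = ennreal (c ^ DIM('a)) * emeasure lborel {x. c *\<^sub>R x \<in> A}"
proof -
  have [measurable]: "{x. c *\<^sub>R x \<in> A} \<in> sets borel"
    using measurable_sets_borel[OF _ assms(1), of "\<lambda>x. c *\<^sub>R x"] by (simp add: vimage_def)
  have "emeasure lborel A = (\<integral>\<^sup>+x. indicator A x \<partial>lborel)" using assms by simp
  also have "\<dots> = ennreal (c ^ DIM('a)) * (\<integral>\<^sup>+x. indicator A (c *\<^sub>R x) \<partial>lborel)"
    by (rule nn_integral_lborel_scale) (use assms in auto)
  also have "(\<integral>\<^sup>+x. indicator A (c *\<^sub>R x) \<partial>lborel) = (\<integral>\<^sup>+x. indicator {x. c *\<^sub>R x \<in> A} x \<partial>lborel)"
    by (rule nn_integral_cong) (auto simp: indicator_def)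
  finally show ?thesis by simp
qed

text \<open>Uniqueness of Haar measure, by Tonelli: \<open>m(A) N(B) = m(B) N(-A)\<close> for translation
  invariant \<open>m\<close> and \<open>N\<close>; here \<open>A\<close> is the unit ball.\<close>

lemma distr_lborel_isometry:
  fixes T :: "'a::euclidean_space \<Rightarrow> 'a"
  assumes T: "linear T" "\<And>x. norm (T x) = norm x"
  shows "distr lborel borel T = lborel"
proof (rule measure_eqI)
  define N where "N = distr lborel borel T"
  have inj: "inj T" using T by (metis linear_injective_0 norm_eq_zero)
  have surj: "surj T" using linear_injective_imp_surjective[OF T(1) inj] by simp
  have [measurable]: "T \<in> borel_measurable borel"
    by (rule borel_measurable_continuous_onI) (rule linear_continuous_on_compose[OF continuous_on_id T(1)])
  interpret N: sigma_finite_measure N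
  proof
    show "\<exists>A. countable A \<and> A \<subseteq> sets N \<and> \<Union>A = space N \<and> (\<forall>a\<in>A. emeasure N a \<noteq> \<infinity>)"
    proof (intro exI conjI ballI)
      show "countable (range (\<lambda>n::nat. cball (0::'a) (real n)))" by simp
      show "range (\<lambda>n::nat. cball (0::'a) (real n)) \<subseteq> sets N" by (auto simp: N_def)
      show "\<Union> (range (\<lambda>n::nat. cball (0::'a) (real n))) = space N"
        by (auto simp: N_def intro: real_arch_simple)
    next
      fix a assume "a \<in> range (\<lambda>n::nat. cball (0::'a) (real n))"
      then obtain n where a: "a = cball 0 (real n)" by auto
      have "T -` a = a" unfolding a by (auto simp: T)
      then show "emeasure N a \<noteq> \<infinity>"
        using emeasure_lborel_cball_finite[of "0::'a" "real n"]
        by (simp add: N_def emeasure_distr a)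
    qed
  qed
  interpret P: pair_sigma_finite "lborel :: 'a measure" N ..
  have inv: "(\<integral>\<^sup>+y. f (x + y) \<partial>N) = (\<integral>\<^sup>+y. f y \<partial>N)" if [measurable]: "f \<in> borel_measurable borel" for f x
  proof -
    obtain z where z: "x = T z" using surj by (metis surjD)
    have "(\<integral>\<^sup>+y. f (x + y) \<partial>N) = (\<integral>\<^sup>+y. f (T (z + y)) \<partial>lborel)"
      by (simp add: N_def nn_integral_distr z linear_add[OF T(1)])
    also have "\<dots> = (\<integral>\<^sup>+y. f (T y) \<partial>lborel)"
      by (rule nn_integral_lborel_translate) simp
    also have "\<dots> = (\<integral>\<^sup>+y. f y \<partial>N)" by (simp add: N_def nn_integral_distr)
    finally show ?thesis .
  qed
  fix B assume "B \<in> sets (distr lborel borel T)"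
  then have [measurable]: "B \<in> sets borel" by simp
  define A where "A = ball (0::'a) 1"
  have [measurable]: "A \<in> sets borel" by (simp add: A_def)
  have NB: "sets N = sets borel" "space N = UNIV" by (auto simp: N_def)
  note [measurable_cong] = NB(1)
  have "emeasure lborel A * emeasure N B = (\<integral>\<^sup>+x. indicator A x * (\<integral>\<^sup>+y. indicator B y \<partial>N) \<partial>lborel)"
    by (simp add: nn_integral_multc NB)
  also have "\<dots> = (\<integral>\<^sup>+x. indicator A x * (\<integral>\<^sup>+y. indicator B (x + y) \<partial>N) \<partial>lborel)"
    by (intro nn_integral_cong arg_cong2[where f="(*)"] refl inv[symmetric]) simp
  also have "\<dots> = (\<integral>\<^sup>+x. (\<integral>\<^sup>+y. indicator A x * indicator B (x + y) \<partial>N) \<partial>lborel)"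
    by (intro nn_integral_cong nn_integral_cmult[symmetric]) (simp cong: measurable_cong_sets add: NB)
  also have "\<dots> = (\<integral>\<^sup>+y. (\<integral>\<^sup>+x. indicator A x * indicator B (x + y) \<partial>lborel) \<partial>N)"
    by (rule P.Fubini'[symmetric]) measurable
  also have "\<dots> = (\<integral>\<^sup>+y. (\<integral>\<^sup>+x. indicator A (- y + x) * indicator B x \<partial>lborel) \<partial>N)"
  proof (rule nn_integral_cong)
    fix y
    have "(\<integral>\<^sup>+x. indicator A (- y + x) * indicator B x \<partial>lborel)
       = (\<integral>\<^sup>+x. indicator A (- y + (y + x)) * indicator B (y + x) \<partial>lborel :: ennreal)"
      by (rule nn_integral_lborel_translate[symmetric]) measurable
    then show "(\<integral>\<^sup>+x. indicator A x * indicator B (x + y) \<partial>lborel)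
      = (\<integral>\<^sup>+x. indicator A (- y + x) * indicator B x \<partial>lborel :: ennreal)"
      by (simp add: add.commute)
  qed
  also have "\<dots> = (\<integral>\<^sup>+x. (\<integral>\<^sup>+y. indicator A (- y + x) * indicator B x \<partial>N) \<partial>lborel)"
    by (rule P.Fubini') measurable
  also have "\<dots> = (\<integral>\<^sup>+x. (\<integral>\<^sup>+y. indicator A (- x + y) \<partial>N) * indicator B x \<partial>lborel)"
  proof (rule nn_integral_cong)
    fix x
    have "indicator A (- y + x) = (indicator A (- x + y) :: ennreal)" for y
      by (auto simp: A_def indicator_def norm_minus_commute)
    then show "(\<integral>\<^sup>+y. indicator A (- y + x) * indicator B x \<partial>N)
      = (\<integral>\<^sup>+y. indicator A (- x + y) \<partial>N) * indicator B x"
      by (simp add: nn_integral_multc NB cong: measurable_cong_sets)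
  qed
  also have "\<dots> = (\<integral>\<^sup>+x. (\<integral>\<^sup>+y. indicator A y \<partial>N) * indicator B x \<partial>lborel)"
    by (intro nn_integral_cong arg_cong2[where f="(*)"] refl inv) simp
  also have "\<dots> = emeasure N A * emeasure lborel B"
    by (simp add: nn_integral_cmult NB)
  \<comment> \<open>A linear isometry preserves the unit ball, which fixes the constant of
    proportionality.\<close>
  also have "emeasure N A = emeasure lborel A"
  proof -
    have "T -` A = A" unfolding A_def by (auto simp: T)
    then show ?thesis by (simp add: N_def emeasure_distr)
  qed
  finally have eq: "emeasure lborel A * emeasure N B = emeasure lborel A * emeasure lborel B" .
  have "emeasure lborel A \<noteq> 0" "emeasure lborel A \<noteq> top"
    using emeasure_lborel_ball_finite[of "0::'a" 1]
    using less_imp_neq[OF unit_ball_vol_pos[of "real DIM('a)"]] by (auto simp: A_def emeasure_ball)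
  with eq show "emeasure (distr lborel borel T) B = emeasure lborel B"
    unfolding N_def by (simp add: ennreal_mult_cancel_left)
qed simp

definition proj_orth :: "'a::euclidean_space \<Rightarrow> 'a \<Rightarrow> 'a" where
  "proj_orth e x = x - (x \<bullet> e) *\<^sub>R e"

text \<open>The (n-1)-dimensional Lebesgue measure on the hyperplane orthogonal to \<open>e\<close>,
  encoded as the volume of the cylinder of height 1 over the set, so that no measure on a subspace
  has to be constructed.\<close>

definition cross_area :: "'a::euclidean_space \<Rightarrow> 'a set \<Rightarrow> ennreal" where
  "cross_area e Y = emeasure lborel {x. proj_orth e x \<in> Y \<and> 0 \<le> x \<bullet> e \<and> x \<bullet> e \<le> 1}"

lemma continuous_on_proj_orth [continuous_intros]: "continuous_on S (proj_orth e)"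
  unfolding proj_orth_def[abs_def] by (intro continuous_intros)

lemma borel_measurable_proj_orth [measurable]: "proj_orth e \<in> borel_measurable borel"
  by (intro borel_measurable_continuous_onI continuous_intros)

lemma linear_proj_orth: "linear (proj_orth e)"
  by (rule linearI) (auto simp: proj_orth_def algebra_simps inner_add_left)

lemma proj_orth_add_scaleR [simp]: "norm e = 1 \<Longrightarrow> proj_orth e (x + s *\<^sub>R e) = proj_orth e x"
  by (simp add: proj_orth_def algebra_simps dot_square_norm)

lemma proj_orth_inner [simp]: "norm e = 1 \<Longrightarrow> proj_orth e x \<bullet> e = 0"
  by (simp add: proj_orth_def inner_diff_left dot_square_norm)

lemma proj_orth_id: "x \<bullet> e = 0 \<Longrightarrow> proj_orth e x = x"
  by (simp add: proj_orth_def)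

lemma proj_orth_idem [simp]: "norm e = 1 \<Longrightarrow> proj_orth e (proj_orth e x) = proj_orth e x"
  by (simp add: proj_orth_id)

lemma norm_proj_orth_sq: "norm e = 1 \<Longrightarrow> (norm x)\<^sup>2 = (norm (proj_orth e x))\<^sup>2 + (x \<bullet> e)\<^sup>2"
  unfolding power2_norm_eq_inner
  by (simp add: proj_orth_def inner_diff_left inner_diff_right dot_square_norm[of e]
      inner_commute[of e x] power2_eq_square[of "x \<bullet> e"])

lemma norm_proj_orth_le: "norm e = 1 \<Longrightarrow> norm (proj_orth e x) \<le> norm x"
  using norm_proj_orth_sq[of e x] zero_le_power2[of "x \<bullet> e"]
  by (intro power2_le_imp_le[OF _ norm_ge_zero]) linarith

lemma dist_proj_orth_le: "norm e = 1 \<Longrightarrow> dist (proj_orth e x) (proj_orth e y) \<le> dist x y"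
  by (metis dist_norm linear_diff linear_proj_orth norm_proj_orth_le)

text \<open>Cavalieri's principle without coordinates. Each slice is written as an integral over the
  slab \<open>0 \<le> x \<bullet> e \<le> 1\<close>; two translations, one in \<open>s\<close> and
  one in \<open>x\<close>, turn the slab condition into a condition on \<open>s\<close>, where it
  describes an interval of length 1.\<close>

lemma emeasure_lborel_slices:
  fixes D :: "'a::euclidean_space set"
  assumes [measurable]: "D \<in> sets borel" and e: "norm e = 1"
  shows "emeasure lborel D = (\<integral>\<^sup>+s. cross_area e {y. y + s *\<^sub>R e \<in> D} \<partial>lborel)"
proof -
  let ?I = "\<lambda>x::'a. indicator {0..1} (x \<bullet> e) :: ennreal"
  have ee: "e \<bullet> e = 1" using e by (simp add: dot_square_norm)
  have "cross_area e {y. y + s *\<^sub>R e \<in> D}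
      = (\<integral>\<^sup>+x. ?I x * indicator D (x + (s - x \<bullet> e) *\<^sub>R e) \<partial>lborel)" for s
  proof -
    have "cross_area e {y. y + s *\<^sub>R e \<in> D}
      = (\<integral>\<^sup>+x. indicator {x. proj_orth e x \<in> {y. y + s *\<^sub>R e \<in> D} \<and> 0 \<le> x \<bullet> e \<and> x \<bullet> e \<le> 1} x \<partial>lborel)"
      unfolding cross_area_def by (subst nn_integral_indicator) measurable
    also have "\<dots> = (\<integral>\<^sup>+x. ?I x * indicator D (x + (s - x \<bullet> e) *\<^sub>R e) \<partial>lborel)"
      by (intro nn_integral_cong) (auto simp: indicator_def proj_orth_def algebra_simps)
    finally show ?thesis .
  qed
  then have "(\<integral>\<^sup>+s. cross_area e {y. y + s *\<^sub>R e \<in> D} \<partial>lborel)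
      = (\<integral>\<^sup>+s. (\<integral>\<^sup>+x. ?I x * indicator D (x + (s - x \<bullet> e) *\<^sub>R e) \<partial>lborel) \<partial>lborel)"
    by simp
  also have "\<dots> = (\<integral>\<^sup>+x. (\<integral>\<^sup>+s. ?I x * indicator D (x + (s - x \<bullet> e) *\<^sub>R e) \<partial>lborel) \<partial>lborel)"
    by (rule lborel_pair.Fubini') measurable
  also have "\<dots> = (\<integral>\<^sup>+x. (\<integral>\<^sup>+s. ?I x * indicator D (x + s *\<^sub>R e) \<partial>lborel) \<partial>lborel)"
  proof (rule nn_integral_cong)
    fix x :: 'a
    show "(\<integral>\<^sup>+s. ?I x * indicator D (x + (s - x \<bullet> e) *\<^sub>R e) \<partial>lborel)
       = (\<integral>\<^sup>+s. ?I x * indicator D (x + s *\<^sub>R e) \<partial>lborel)"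
      using nn_integral_lborel_translate[of "\<lambda>s. ?I x * indicator D (x + s *\<^sub>R e)" "- (x \<bullet> e)"]
      by (simp add: algebra_simps)
  qed
  also have "\<dots> = (\<integral>\<^sup>+s. (\<integral>\<^sup>+x. ?I x * indicator D (x + s *\<^sub>R e) \<partial>lborel) \<partial>lborel)"
    by (rule lborel_pair.Fubini'[symmetric]) measurable
  also have "\<dots> = (\<integral>\<^sup>+s. (\<integral>\<^sup>+x. ?I (x - s *\<^sub>R e) * indicator D x \<partial>lborel) \<partial>lborel)"
  proof (rule nn_integral_cong)
    fix s :: real
    show "(\<integral>\<^sup>+x. ?I x * indicator D (x + s *\<^sub>R e) \<partial>lborel)
       = (\<integral>\<^sup>+x. ?I (x - s *\<^sub>R e) * indicator D x \<partial>lborel)"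
      using nn_integral_lborel_translate[of "\<lambda>x. ?I (x - s *\<^sub>R e) * indicator D x" "s *\<^sub>R e"]
      by (simp add: add.commute)
  qed
  also have "\<dots> = (\<integral>\<^sup>+x. (\<integral>\<^sup>+s. ?I (x - s *\<^sub>R e) * indicator D x \<partial>lborel) \<partial>lborel)"
    by (rule lborel_pair.Fubini') measurable
  also have "\<dots> = (\<integral>\<^sup>+x. indicator D x \<partial>lborel)"
  proof (rule nn_integral_cong)
    fix x :: 'a
    have "(\<integral>\<^sup>+s. ?I (x - s *\<^sub>R e) * indicator D x \<partial>lborel)
        = (\<integral>\<^sup>+s. indicator {x \<bullet> e - 1 .. x \<bullet> e} s \<partial>lborel) * indicator D x"
      by (subst nn_integral_multc[symmetric])
         (auto intro!: nn_integral_cong simp: indicator_def inner_diff_left ee)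
    then show "(\<integral>\<^sup>+s. ?I (x - s *\<^sub>R e) * indicator D x \<partial>lborel) = indicator D x" by simp
  qed
  finally show ?thesis by simp
qed

lemma emeasure_cylinder:
  fixes Y :: "'a::euclidean_space set"
  assumes [measurable]: "Y \<in> sets borel" and e: "norm e = 1" and ab: "a \<le> b"
  shows "emeasure lborel {x. proj_orth e x \<in> Y \<and> a \<le> x \<bullet> e \<and> x \<bullet> e \<le> b}
    = ennreal (b - a) * cross_area e Y"
proof -
  let ?D = "{x. proj_orth e x \<in> Y \<and> a \<le> x \<bullet> e \<and> x \<bullet> e \<le> b}"
  have ee: "e \<bullet> e = 1" using e by (simp add: dot_square_norm)
  have sl: "cross_area e {y. y + s *\<^sub>R e \<in> ?D} = indicator {a..b} s * cross_area e Y" for s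
  proof (cases "s \<in> {a..b}")
    case True
    have "{x. proj_orth e x \<in> {y. y + s *\<^sub>R e \<in> ?D} \<and> 0 \<le> x \<bullet> e \<and> x \<bullet> e \<le> 1}
       = {x. proj_orth e x \<in> Y \<and> 0 \<le> x \<bullet> e \<and> x \<bullet> e \<le> 1}"
      using True e by (auto simp: inner_add_left ee)
    then have "cross_area e {y. y + s *\<^sub>R e \<in> ?D} = cross_area e Y"
      unfolding cross_area_def by (rule arg_cong)
    then show ?thesis using True by simp
  next
    case False
    have "{x. proj_orth e x \<in> {y. y + s *\<^sub>R e \<in> ?D} \<and> 0 \<le> x \<bullet> e \<and> x \<bullet> e \<le> 1} = {}"
      using False e by (auto simp: inner_add_left ee)
    then have "cross_area e {y. y + s *\<^sub>R e \<in> ?D} = emeasure lborel ({} :: 'a set)"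
      unfolding cross_area_def by (rule arg_cong)
    then show ?thesis using False by simp
  qed
  have "?D \<in> sets borel" by measurable
  then have "emeasure lborel ?D = (\<integral>\<^sup>+s. indicator {a..b} s * cross_area e Y \<partial>lborel)"
    using emeasure_lborel_slices[of ?D e] e unfolding sl by blast
  also have "\<dots> = ennreal (b - a) * cross_area e Y"
    using ab by (simp add: nn_integral_multc)
  finally show ?thesis .
qed

text \<open>The cylinder of height \<open>c\<close> over \<open>Y\<close> is the dilation by
  \<open>c\<close> of the cylinder of height 1 over the rescaled set: a factor \<open>c ^ n\<close>
  in volume, of which one \<open>c\<close> is the height.\<close>

lemma cross_area_scale:
  fixes Y :: "'a::euclidean_space set"
  assumes [measurable]: "Y \<in> sets borel" and e: "norm e = 1" and c: "0 < c"
  shows "cross_area e Y = ennreal (c ^ (DIM('a) - 1)) * cross_area e {y. c *\<^sub>R y \<in> Y}"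
proof -
  let ?D = "{x. proj_orth e x \<in> Y \<and> 0 \<le> x \<bullet> e \<and> x \<bullet> e \<le> c}"
  have "ennreal c * cross_area e Y = emeasure lborel ?D"
    using emeasure_cylinder[of Y e 0 c] assms by simp
  also have "\<dots> = ennreal (c ^ DIM('a)) * emeasure lborel {x. c *\<^sub>R x \<in> ?D}"
    by (rule emeasure_lborel_scale_vimage) (use c in measurable)
  also have "{x. c *\<^sub>R x \<in> ?D} = {x. proj_orth e x \<in> {y. c *\<^sub>R y \<in> Y} \<and> 0 \<le> x \<bullet> e \<and> x \<bullet> e \<le> 1}"
    using c by (auto simp: linear_cmul[OF linear_proj_orth] zero_le_mult_iff)
  also have "c ^ DIM('a) = c * c ^ (DIM('a) - 1)"
    by (metis DIM_positive Suc_pred' power_Suc)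
  finally have "ennreal c * cross_area e Y
     = ennreal c * (ennreal (c ^ (DIM('a) - 1)) * cross_area e {y. c *\<^sub>R y \<in> Y})"
    using c by (simp add: ennreal_mult cross_area_def mult.assoc)
  then show ?thesis using c by (simp add: ennreal_mult_cancel_left)
qed

lemma cross_area_isometry:
  fixes T :: "'a::euclidean_space \<Rightarrow> 'a"
  assumes T: "linear T" "\<And>x. norm (T x) = norm x" and [measurable]: "Y \<in> sets borel"
  shows "cross_area e {x. T x \<in> Y} = cross_area (T e) Y"
proof -
  have inner: "T x \<bullet> T y = x \<bullet> y" for x y
    using T by (metis orthogonal_transformation orthogonal_transformation_def)
  have [measurable]: "T \<in> borel_measurable borel"
    by (rule borel_measurable_continuous_onI) (rule linear_continuous_on_compose[OF continuous_on_id T(1)])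
  have proj: "T (proj_orth e x) = proj_orth (T e) (T x)" for x
    by (simp add: proj_orth_def linear_diff[OF T(1)] linear_cmul[OF T(1)] inner)
  let ?A = "{x. proj_orth (T e) x \<in> Y \<and> 0 \<le> x \<bullet> T e \<and> x \<bullet> T e \<le> 1}"
  have "cross_area (T e) Y = emeasure (distr lborel borel T) ?A"
    by (simp add: cross_area_def distr_lborel_isometry[OF T])
  also have "\<dots> = emeasure lborel (T -` ?A)"
    by (subst emeasure_distr) (measurable; simp)+
  also have "T -` ?A = {x. proj_orth e x \<in> {x. T x \<in> Y} \<and> 0 \<le> x \<bullet> e \<and> x \<bullet> e \<le> 1}"
    by (auto simp: inner proj)
  finally show ?thesis by (simp add: cross_area_def)
qed

lemma isometry_exists:
  fixes e e' :: "'a::euclidean_space"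
  assumes "norm e = 1" "norm e' = 1"
  obtains T :: "'a \<Rightarrow> 'a" where "linear T" "\<And>x. norm (T x) = norm x" "T e = e'"
proof (cases "e = e'")
  case True then show ?thesis using that[of id] by (simp add: linear_id[unfolded id_def] id_def)
next
  case False
  define v where "v = e - e'"
  \<comment> \<open>The reflection in the hyperplane orthogonal to \<open>e - e'\<close>, which
    exchanges the two unit vectors.\<close>
  define T where "T x = x - (2 * (x \<bullet> v) / (v \<bullet> v)) *\<^sub>R v" for x
  have vv: "v \<bullet> v \<noteq> 0" using False by (simp add: v_def)
  have ee: "e \<bullet> e = 1" "e' \<bullet> e' = 1" using assms by (auto simp: dot_square_norm)
  have "linear T"
    by (rule linearI) (auto simp: T_def inner_add_left algebra_simps add_divide_distrib)
  moreover have "norm (T x) = norm x" for x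
  proof -
    have "T x \<bullet> T x = x \<bullet> x"
      using vv by (simp add: T_def inner_diff_left inner_diff_right inner_commute[of v x] field_simps)
    then show ?thesis by (simp add: norm_eq)
  qed
  moreover have "T e = e'"
  proof -
    have "2 * (e \<bullet> v) = v \<bullet> v"
      by (simp add: v_def inner_diff_left inner_diff_right ee inner_commute)
    then show ?thesis using vv by (simp add: T_def) (simp add: v_def)
  qed
  ultimately show ?thesis by (rule that)
qed

text \<open>A cylinder of height \<open>d\<close> over a set inside a ball of radius
  \<open>d\<close> fits into the ball of radius \<open>2 * d\<close>; dividing the volume by the
  height leaves \<open>d ^ (n - 1)\<close>.\<close>

lemma cross_area_le_pow:
  fixes C :: "'a::euclidean_space set"
  assumes [measurable]: "C \<in> sets borel" and C: "C \<subseteq> cball y d" and d: "0 < d" and e: "norm e = 1"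
  shows "cross_area e C \<le> ennreal (unit_ball_vol DIM('a) * 2 ^ DIM('a) * d ^ (DIM('a) - 1))"
proof -
  have n: "(2 * d) ^ DIM('a) = d * (2 ^ DIM('a) * d ^ (DIM('a) - 1))"
    by (metis DIM_positive Suc_pred' mult.left_commute power_Suc power_mult_distrib)
  have "ennreal d * cross_area e C = emeasure lborel {x. proj_orth e x \<in> C \<and> 0 \<le> x \<bullet> e \<and> x \<bullet> e \<le> d}"
    using emeasure_cylinder[of C e 0 d] d e by simp
  also have "\<dots> \<le> emeasure lborel (cball y (2 * d))"
  proof (rule emeasure_mono, clarsimp)
    fix x assume x: "proj_orth e x \<in> C" "0 \<le> x \<bullet> e" "x \<bullet> e \<le> d"
    have "dist (proj_orth e x) x \<le> d" using x e by (simp add: proj_orth_def dist_norm)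
    moreover have "dist y (proj_orth e x) \<le> d" using x C by auto
    ultimately show "dist y x \<le> 2 * d" using dist_triangle[of y x "proj_orth e x"] by linarith
  qed simp
  also have "\<dots> = ennreal (unit_ball_vol DIM('a) * (2 * d) ^ DIM('a))"
    using d by (simp add: emeasure_cball)
  also have "\<dots> = ennreal d * ennreal (unit_ball_vol DIM('a) * 2 ^ DIM('a) * d ^ (DIM('a) - 1))"
    unfolding n using d by (simp add: ennreal_mult'[symmetric] mult_ac)
  finally show ?thesis using d by (simp add: ennreal_mult_le_mult_iff)
qed

text \<open>The bound \<open>d ^ (n - 1)\<close> tends to 0 with \<open>d\<close> because
  \<open>n \<ge> 2\<close>. Nonempty sets of diameter 0, which the supremum in
  \<open>isodiam\<close> leaves out, are singletons.\<close>

lemma cross_area_singleton: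
  fixes y :: "'a::euclidean_space"
  assumes n: "2 \<le> DIM('a)" and e: "norm e = 1"
  shows "cross_area e {y} = 0"
proof -
  let ?K = "unit_ball_vol DIM('a) * 2 ^ DIM('a)"
  have "cross_area e {y} \<le> ennreal \<delta>" if "0 < \<delta>" for \<delta>
  proof -
    define d where "d = min 1 (\<delta> / ?K)"
    have K: "0 < ?K" by simp
    have d: "0 < d" "d \<le> 1" "?K * d \<le> \<delta>"
      using that K by (auto simp: d_def min_def field_simps)
    have "d ^ (DIM('a) - 1) \<le> d"
      using power_decreasing[of 1 "DIM('a) - 1" d] n d by simp
    then have "?K * d ^ (DIM('a) - 1) \<le> \<delta>"
      using mult_left_mono[of _ d ?K] d(3) K by (meson less_imp_le order_trans)
    moreover have "cross_area e {y} \<le> ennreal (?K * d ^ (DIM('a) - 1))"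
      by (rule cross_area_le_pow[of _ y d]) (use d e in auto)
    ultimately show ?thesis by (meson ennreal_leI order_trans)
  qed
  then show ?thesis
    using ennreal_le_epsilon[of 0 "cross_area e {y}"] by (simp add: bot_unique)
qed

lemma cross_area_disc_pos:
  fixes e :: "'a::euclidean_space"
  assumes e: "norm e = 1"
  shows "0 < cross_area e (cball 0 1 \<inter> {x. x \<bullet> e = 0})"
proof -
  have ee: "e \<bullet> e = 1" using e by (simp add: dot_square_norm)
  have [measurable]: "cball 0 1 \<inter> {x. x \<bullet> e = 0} \<in> sets borel" by measurable
  have "0 < emeasure lborel (ball ((1/2) *\<^sub>R e) (1/2))"
    using less_imp_neq[OF unit_ball_vol_pos[of "real DIM('a)"]]
    by (simp add: emeasure_ball zero_less_iff_neq_zero)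
  also have "\<dots> \<le> cross_area e (cball 0 1 \<inter> {x. x \<bullet> e = 0})"
    unfolding cross_area_def
  proof (rule emeasure_mono)
    show "ball ((1/2) *\<^sub>R e) (1/2)
      \<subseteq> {x. proj_orth e x \<in> cball 0 1 \<inter> {x. x \<bullet> e = 0} \<and> 0 \<le> x \<bullet> e \<and> x \<bullet> e \<le> 1}"
    proof
      fix x assume "x \<in> ball ((1/2) *\<^sub>R e) (1/2)"
      then have x: "norm (x - (1/2) *\<^sub>R e) < 1/2" by (simp add: dist_norm norm_minus_commute)
      have "proj_orth e (x - (1/2) *\<^sub>R e) = proj_orth e x"
        using proj_orth_add_scaleR[OF e, of x "-1/2"] by simp
      then have "norm (proj_orth e x) \<le> 1"
        using norm_proj_orth_le[OF e, of "x - (1/2) *\<^sub>R e"] x by simp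
      moreover have "\<bar>(x - (1/2) *\<^sub>R e) \<bullet> e\<bar> < 1/2"
        using Cauchy_Schwarz_ineq2[of "x - (1/2) *\<^sub>R e" e] x e by simp
      then have "0 \<le> x \<bullet> e" "x \<bullet> e \<le> 1" by (auto simp: inner_diff_left ee abs_if split: if_splits)
      ultimately show "x \<in> {x. proj_orth e x \<in> cball 0 1 \<inter> {x. x \<bullet> e = 0} \<and> 0 \<le> x \<bullet> e \<and> x \<bullet> e \<le> 1}"
        using e by simp
    qed
  qed measurable
  finally show ?thesis .
qed

section \<open>Shadows of sets of codimension one\<close>

definition codim1 :: "'a::euclidean_space itself \<Rightarrow> real" where
  "codim1 _ = real (DIM('a) - 1)"

lemma codim1_nonneg [simp]: "0 \<le> codim1 TYPE('a::euclidean_space)"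
  by (simp add: codim1_def)

text \<open>By the isodiametric inequality this constant is \<open>1\<close>, but the argument only uses that the same
  constant governs the Hausdorff measure in the source and in the target.\<close>

definition isodiam :: "'a::euclidean_space itself \<Rightarrow> real" where
  "isodiam _ = enn2real (SUP (e, C) \<in> {(e :: 'a, C). norm e = 1 \<and> compact C \<and> (\<forall>x\<in>C. x \<bullet> e = 0) \<and>
     0 < diameter C}. cross_area e C / hausdorff_cost (codim1 TYPE('a)) C)"

text \<open>\<open>enn2real\<close> would turn an infinite supremum into 0. Finiteness holds since a
  set lies in a ball around one of its points with its diameter as radius; positivity comes from the
  flat unit disc.\<close>

lemma isodiam_exists:
  assumes n: "2 \<le> DIM('a::euclidean_space)"
  defines "\<kappa> \<equiv> SUP (e, C) \<in> {(e :: 'a, C). norm e = 1 \<and> compact C \<and> (\<forall>x\<in>C. x \<bullet> e = 0) \<and>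
     0 < diameter C}. cross_area e C / hausdorff_cost (codim1 TYPE('a)) C"
  shows "0 < \<kappa>" "\<kappa> < top"
proof -
  let ?S = "{(e :: 'a, C). norm e = 1 \<and> compact C \<and> (\<forall>x\<in>C. x \<bullet> e = 0) \<and> 0 < diameter C}"
  let ?k = "codim1 TYPE('a)"
  have cost: "hausdorff_cost ?k C = ennreal (unit_ball_vol ?k * (diameter C / 2) ^ (DIM('a) - 1))"
    if "0 < diameter C" for C :: "'a set"
    using that powr_realpow[of "diameter C / 2" "DIM('a) - 1"]
    by (simp only: hausdorff_cost_def codim1_def)
  obtain e :: 'a where "e \<in> Basis" using nonempty_Basis by blast
  then have e: "norm e = 1" by simp
  let ?C = "cball 0 1 \<inter> {x. x \<bullet> e = 0}"
  have cC: "compact ?C"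
    by (intro compact_Int_closed compact_cball closed_Collect_eq continuous_intros)
  obtain y where y: "y \<noteq> 0" "orthogonal e y" using orthogonal_to_vector_exists[OF n] by blast
  then have "sgn y \<in> ?C" "0 \<in> ?C" by (auto simp: norm_sgn sgn_div_norm orthogonal_def inner_commute)
  then have "dist (sgn y) 0 \<le> diameter ?C"
    using compact_imp_bounded[OF cC] by (intro diameter_bounded_bound)
  then have dC: "0 < diameter ?C" using y by (simp add: norm_sgn)
  have "0 < cross_area e ?C / hausdorff_cost ?k ?C"
    using cross_area_disc_pos[OF e] by (simp add: cost[OF dC] ennreal_zero_less_divide)
  also have "\<dots> \<le> \<kappa>" unfolding \<kappa>_def
    by (rule SUP_upper2[of "(e, ?C)"]) (use e cC dC in auto)
  finally show "0 < \<kappa>" .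
  let ?u = "unit_ball_vol ?k" and ?v = "unit_ball_vol DIM('a) * 2 ^ DIM('a)"
  have "\<kappa> \<le> ennreal (?v * 2 ^ (DIM('a) - 1) / ?u)" unfolding \<kappa>_def
  proof (rule SUP_least, clarify)
    fix e :: 'a and C :: "'a set"
    assume a: "norm e = 1" "compact C" "0 < diameter C"
    then have "C \<noteq> {}" by auto
    then obtain y where "y \<in> C" by blast
    then have "C \<subseteq> cball y (diameter C)"
      using diameter_bounded_bound[OF compact_imp_bounded[OF a(2)]] by auto
    then have "cross_area e C \<le> ennreal (?v * diameter C ^ (DIM('a) - 1))"
      using a by (intro cross_area_le_pow) (auto intro: borel_closed compact_imp_closed)
    then have "cross_area e C / hausdorff_cost ?k C
      \<le> ennreal (?v * diameter C ^ (DIM('a) - 1)) / ennreal (?u * (diameter C / 2) ^ (DIM('a) - 1))"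
      unfolding cost[OF a(3)] by (rule divide_right_mono_ennreal)
    also have "\<dots> = ennreal (?v * diameter C ^ (DIM('a) - 1) / (?u * (diameter C / 2) ^ (DIM('a) - 1)))"
      using a(3) by (intro divide_ennreal) auto
    also have "?v * diameter C ^ (DIM('a) - 1) / (?u * (diameter C / 2) ^ (DIM('a) - 1))
       = ?v * 2 ^ (DIM('a) - 1) / ?u"
      using a(3) by (simp add: power_divide field_simps)
    finally show "cross_area e C / hausdorff_cost ?k C \<le> ennreal (?v * 2 ^ (DIM('a) - 1) / ?u)" .
  qed
  also have "\<dots> < top" by simp
  finally show "\<kappa> < top" .
qed

lemma ennreal_isodiam:
  assumes n: "2 \<le> DIM('a::euclidean_space)"
  shows "ennreal (isodiam TYPE('a)) = (SUP (e, C) \<in> {(e :: 'a, C). norm e = 1 \<and> compact C \<and>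
     (\<forall>x\<in>C. x \<bullet> e = 0) \<and> 0 < diameter C}. cross_area e C / hausdorff_cost (codim1 TYPE('a)) C)"
  unfolding isodiam_def by (rule ennreal_enn2real) (rule isodiam_exists(2)[OF n])

lemma isodiam_pos: "2 \<le> DIM('a::euclidean_space) \<Longrightarrow> 0 < isodiam TYPE('a)"
  unfolding isodiam_def enn2real_positive_iff by (intro conjI isodiam_exists)

lemma cross_area_le_isodiam:
  fixes C :: "'a::euclidean_space set"
  assumes n: "2 \<le> DIM('a)" and e: "norm e = 1" and C: "compact C" "\<And>x. x \<in> C \<Longrightarrow> x \<bullet> e = 0"
  shows "cross_area e C \<le> ennreal (isodiam TYPE('a)) * hausdorff_cost (codim1 TYPE('a)) C"
proof (cases "0 < diameter C")
  case True
  then have cost: "hausdorff_cost (codim1 TYPE('a)) C \<noteq> 0" "hausdorff_cost (codim1 TYPE('a)) C \<noteq> top"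
    using less_imp_neq[OF unit_ball_vol_pos[of "codim1 TYPE('a)"]] by (auto simp: hausdorff_cost_def)
  have "cross_area e C / hausdorff_cost (codim1 TYPE('a)) C \<le> ennreal (isodiam TYPE('a))"
    unfolding ennreal_isodiam[OF n] by (rule SUP_upper2[of "(e, C)"]) (use True e C in auto)
  then have "cross_area e C / hausdorff_cost (codim1 TYPE('a)) C * hausdorff_cost (codim1 TYPE('a)) C
      \<le> ennreal (isodiam TYPE('a)) * hausdorff_cost (codim1 TYPE('a)) C"
    by (rule mult_right_mono) simp
  then show ?thesis using cost
    by (simp add: ennreal_divide_times ennreal_times_divide mult_divide_eq_ennreal)
next
  case False
  have "cross_area e C = 0"
  proof (cases "C = {}")
    case True then show ?thesis by (simp add: cross_area_def)
  next
    case ne: False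
    then obtain y where y: "y \<in> C" by blast
    have "x = y" if "x \<in> C" for x
      using diameter_bounded_bound[OF compact_imp_bounded[OF C(1)] that y] False zero_le_dist[of x y]
      by (metis dist_eq_0_iff le_less_trans not_less_iff_gr_or_eq)
    then have "C = {y}" using y by blast
    then show ?thesis using cross_area_singleton[OF n e] by simp
  qed
  then show ?thesis by simp
qed

text \<open>Such a flat set is the pattern whose small copies are packed into the sphere.\<close>

lemma isodiam_near_optimal:
  assumes n: "2 \<le> DIM('a::euclidean_space)" and q: "0 \<le> q" "q < isodiam TYPE('a)"
  obtains e :: "'a::euclidean_space" and C where "norm e = 1" "compact C" "\<And>x. x \<in> C \<Longrightarrow> x \<bullet> e = 0" "0 < diameter C"
    "ennreal q * hausdorff_cost (codim1 TYPE('a)) C < cross_area e C"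
proof -
  have "ennreal q < ennreal (isodiam TYPE('a))" using q by (simp add: ennreal_less_iff)
  then obtain e :: 'a and C where C: "norm e = 1" "compact C" "\<And>x. x \<in> C \<Longrightarrow> x \<bullet> e = 0" "0 < diameter C"
    and lt: "ennreal q < cross_area e C / hausdorff_cost (codim1 TYPE('a)) C"
    unfolding ennreal_isodiam[OF n] less_SUP_iff by auto
  have cost: "hausdorff_cost (codim1 TYPE('a)) C \<noteq> 0" "hausdorff_cost (codim1 TYPE('a)) C \<noteq> top"
    using C(4) less_imp_neq[OF unit_ball_vol_pos[of "codim1 TYPE('a)"]] by (auto simp: hausdorff_cost_def)
  have "hausdorff_cost (codim1 TYPE('a)) C * ennreal q <
     hausdorff_cost (codim1 TYPE('a)) C * (cross_area e C / hausdorff_cost (codim1 TYPE('a)) C)"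
    using cost lt by (intro ennreal_mult_strict_left_mono) (auto simp: top.not_eq_extremum zero_less_iff_neq_zero)
  also have "\<dots> = cross_area e C"
    using cost by (simp add: ennreal_times_divide mult.commute mult_divide_eq_ennreal)
  finally show ?thesis using C by (intro that) (auto simp: mult.commute)
qed

text \<open>Swept backwards along \<open>e\<close>, so that membership of \<open>z\<close> is what a
  segment starting at \<open>z\<close> and hitting \<open>S\<close> provides.\<close>

definition sweep :: "'a::euclidean_space \<Rightarrow> real \<Rightarrow> 'a set \<Rightarrow> 'a set" where
  "sweep e t S = {z. \<exists>\<tau>\<in>{0..t}. z + \<tau> *\<^sub>R e \<in> S}"

lemma compact_sweep:
  assumes "compact S" shows "compact (sweep e t S)"
proof -
  have "sweep e t S = (\<lambda>(x, \<tau>). x - \<tau> *\<^sub>R e) ` (S \<times> {0..t})"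
  proof (intro set_eqI iffI)
    fix z assume "z \<in> sweep e t S"
    then obtain \<tau> where "\<tau> \<in> {0..t}" "z + \<tau> *\<^sub>R e \<in> S" by (auto simp: sweep_def)
    then show "z \<in> (\<lambda>(x, \<tau>). x - \<tau> *\<^sub>R e) ` (S \<times> {0..t})"
      by (intro image_eqI[of _ _ "(z + \<tau> *\<^sub>R e, \<tau>)"]) auto
  qed (force simp: sweep_def)
  then show ?thesis
    using assms by (auto intro!: compact_continuous_image compact_Times continuous_intros
        simp: case_prod_unfold)
qed

text \<open>The swept copy of a covering set lies in a cylinder of height
  \<open>t + 2 * \<delta>\<close> over the closure of its projection. The base has no larger
  diameter than the covering set, so \<open>isodiam\<close> bounds its cross area by the cost of
  that set.\<close>

lemma emeasure_sweep_pre: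
  fixes S :: "'a::euclidean_space set"
  assumes n: "2 \<le> DIM('a)" and e: "norm e = 1" and S: "compact S" and t: "0 \<le> t" and \<delta>: "0 < \<delta>"
    and c: "hausdorff_pre (codim1 TYPE('a)) \<delta> S < c"
  shows "emeasure lborel (sweep e t S) \<le> ennreal (t + 2 * \<delta>) * (ennreal (isodiam TYPE('a)) * c)"
proof -
  let ?k = "codim1 TYPE('a)"
  have ee: "e \<bullet> e = 1" using e by (simp add: dot_square_norm)
  obtain C where C: "S \<subseteq> (\<Union>i. C i)" "\<And>i. bounded (C i)" "\<And>i. diameter (C i) < \<delta>"
      "(\<Sum>i. hausdorff_cost ?k (C i)) < c"
    using hausdorff_pre_lessE[OF c] by blast
  define K where "K i = closure (proj_orth e ` C i)" for i
  define z where "z i = (SOME x. x \<in> C i)" for i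
  define Z where "Z i = {x. proj_orth e x \<in> K i \<and> z i \<bullet> e - \<delta> - t \<le> x \<bullet> e \<and> x \<bullet> e \<le> z i \<bullet> e + \<delta>}" for i
  have bP: "bounded (proj_orth e ` C i)" for i
    by (rule bounded_linear_image[OF C(2)]) (simp add: linear_proj_orth linear_conv_bounded_linear[symmetric])
  have K: "compact (K i)" for i unfolding K_def using bP by (simp add: compact_closure)
  have [measurable]: "K i \<in> sets borel" for i by (intro borel_closed compact_imp_closed K)
  have [measurable]: "Z i \<in> sets borel" for i unfolding Z_def by measurable
  have Ke: "x \<bullet> e = 0" if "x \<in> K i" for x i
  proof -
    have "K i \<subseteq> {x. x \<bullet> e = 0}" unfolding K_def
      by (rule closure_minimal) (auto simp: e intro!: closed_Collect_eq continuous_intros)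
    then show ?thesis using that by blast
  qed
  have dK: "diameter (K i) \<le> diameter (C i)" for i
  proof -
    have "dist x y \<le> diameter (C i)" if xy: "x \<in> proj_orth e ` C i" "y \<in> proj_orth e ` C i" for x y
    proof -
      obtain u v where uv: "u \<in> C i" "v \<in> C i" "x = proj_orth e u" "y = proj_orth e v" using xy by auto
      show ?thesis
        using dist_proj_orth_le[OF e, of u v] diameter_bounded_bound[OF C(2) uv(1,2)] uv by simp
    qed
    then have "diameter (proj_orth e ` C i) \<le> diameter (C i)"
      using diameter_ge_0[OF C(2)] by (intro diameter_le) (auto simp: dist_norm)
    then show ?thesis by (simp add: K_def diameter_closure bP)
  qed
  have "sweep e t S \<subseteq> (\<Union>i. Z i)"
  proof
    fix x assume "x \<in> sweep e t S"
    then obtain \<tau> where \<tau>: "\<tau> \<in> {0..t}" "x + \<tau> *\<^sub>R e \<in> S" by (auto simp: sweep_def)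
    then obtain i where i: "x + \<tau> *\<^sub>R e \<in> C i" using C(1) by blast
    then have zi: "z i \<in> C i" unfolding z_def by (rule someI)
    have "proj_orth e x \<in> K i"
      using i closure_subset[of "proj_orth e ` C i"] proj_orth_add_scaleR[OF e, of x \<tau>]
      by (metis K_def image_eqI subsetD)
    moreover have "\<bar>(x + \<tau> *\<^sub>R e - z i) \<bullet> e\<bar> \<le> \<delta>"
      using Cauchy_Schwarz_ineq2[of "x + \<tau> *\<^sub>R e - z i" e] e
        diameter_bounded_bound[OF C(2) i zi] C(3)[of i] by (simp add: dist_norm)
    then have "z i \<bullet> e - \<delta> - t \<le> x \<bullet> e" "x \<bullet> e \<le> z i \<bullet> e + \<delta>"
      using \<tau>(1) by (auto simp: inner_diff_left inner_add_left ee abs_le_iff)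
    ultimately show "x \<in> (\<Union>i. Z i)" by (auto simp: Z_def)
  qed
  then have "emeasure lborel (sweep e t S) \<le> emeasure lborel (\<Union>i. Z i)"
    by (rule emeasure_mono) measurable
  also have "\<dots> \<le> (\<Sum>i. emeasure lborel (Z i))"
    by (rule emeasure_subadditive_countably) auto
  also have "\<dots> \<le> (\<Sum>i. ennreal (t + 2 * \<delta>) * (ennreal (isodiam TYPE('a)) * hausdorff_cost ?k (C i)))"
  proof (intro suminf_le summableI)
    fix i
    have "emeasure lborel (Z i) = ennreal (t + 2 * \<delta>) * cross_area e (K i)"
      unfolding Z_def by (subst emeasure_cylinder) (use e t \<delta> in \<open>auto simp: algebra_simps\<close>)
    also have "cross_area e (K i) \<le> ennreal (isodiam TYPE('a)) * hausdorff_cost ?k (K i)"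
      by (rule cross_area_le_isodiam[OF n e K Ke])
    also have "hausdorff_cost ?k (K i) \<le> hausdorff_cost ?k (C i)"
      using hausdorff_cost_le[of ?k "K i" "diameter (C i)"] dK compact_imp_bounded[OF K]
      by (simp add: hausdorff_cost_def)
    finally show "emeasure lborel (Z i)
        \<le> ennreal (t + 2 * \<delta>) * (ennreal (isodiam TYPE('a)) * hausdorff_cost ?k (C i))"
      by (simp add: mult_left_mono)
  qed
  also have "\<dots> = ennreal (t + 2 * \<delta>) * (ennreal (isodiam TYPE('a)) * (\<Sum>i. hausdorff_cost ?k (C i)))"
    by simp
  also have "\<dots> \<le> ennreal (t + 2 * \<delta>) * (ennreal (isodiam TYPE('a)) * c)"
    using C(4) by (intro mult_left_mono) auto
  finally show ?thesis .
qed

lemma emeasure_sweep_le: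
  fixes S :: "'a::euclidean_space set"
  assumes n: "2 \<le> DIM('a)" and e: "norm e = 1" and S: "compact S" and t: "0 \<le> t"
    and fin: "hausdorff_outer (codim1 TYPE('a)) S < top"
  shows "emeasure lborel (sweep e t S)
    \<le> ennreal t * (ennreal (isodiam TYPE('a)) * hausdorff_outer (codim1 TYPE('a)) S)"
proof -
  let ?k = "codim1 TYPE('a)" and ?\<kappa> = "isodiam TYPE('a)"
  obtain h where h: "0 \<le> h" "hausdorff_outer ?k S = ennreal h" using fin by (cases rule: ennreal_cases) auto
  have \<kappa>: "0 \<le> ?\<kappa>" using isodiam_pos[OF n] by simp
  \<comment> \<open>One \<open>\<delta>\<close> serves as mesh size and as slack above the content,
    so a single limit removes both.\<close>
  let ?g = "\<lambda>\<delta>. (t + 2 * \<delta>) * (?\<kappa> * (h + \<delta>))"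
  have "emeasure lborel (sweep e t S) \<le> ennreal (?g \<delta>)" if \<delta>: "0 < \<delta>" for \<delta>
  proof -
    have "hausdorff_pre ?k \<delta> S \<le> ennreal h" using hausdorff_pre_le_outer[OF \<delta>, of ?k S] h by simp
    also have "\<dots> < ennreal (h + \<delta>)" using \<delta> h by (simp add: ennreal_less_iff)
    finally have "emeasure lborel (sweep e t S) \<le> ennreal (t + 2 * \<delta>) * (ennreal ?\<kappa> * ennreal (h + \<delta>))"
      by (rule emeasure_sweep_pre[OF n e S t \<delta>])
    also have "\<dots> = ennreal (?g \<delta>)"
      using h(1) t \<delta> \<kappa> by (simp del: ennreal_plus add: ennreal_mult'[symmetric])
    finally show ?thesis .
  qed
  then have ev: "\<forall>\<^sub>F \<delta> in at_right 0. emeasure lborel (sweep e t S) \<le> ennreal (?g \<delta>)"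
    by (auto simp: eventually_at_right_less intro: eventually_mono[OF eventually_at_right_less])
  have "((\<lambda>\<delta>. ennreal (?g \<delta>)) \<longlongrightarrow> ennreal (?g 0)) (at_right 0)"
    by (intro tendsto_ennrealI tendsto_intros)
  from tendsto_lowerbound[OF this ev] have "emeasure lborel (sweep e t S) \<le> ennreal (?g 0)" by simp
  then show ?thesis using h t \<kappa> by (simp add: ennreal_mult'[symmetric])
qed

section \<open>Surface area of the sphere\<close>

lemma nn_integral_FTC_power:
  assumes "0 \<le> a" "0 < n"
  shows "(\<integral>\<^sup>+s. ennreal (s ^ (n - 1)) * indicator {0<..<a} s \<partial>lborel) = ennreal (a ^ n / real n)"
proof -
  have "(\<integral>\<^sup>+s. ennreal (s ^ (n - 1)) * indicator {0<..<a} s \<partial>lborel)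
     = (\<integral>\<^sup>+s. ennreal (s ^ (n - 1)) * indicator {0..a} s \<partial>lborel)"
    using AE_lborel_singleton[of "0::real"] AE_lborel_singleton[of a]
    by (intro nn_integral_cong_AE) (auto simp: indicator_def)
  also have "\<dots> = ennreal (a ^ n / real n - 0 ^ n / real n)"
  proof (rule nn_integral_FTC_Icc)
    fix s :: real assume "s \<in> {0..a}"
    show "((\<lambda>s. s ^ n / real n) has_real_derivative s ^ (n - 1)) (at s)"
      by (auto intro!: derivative_eq_intros simp: assms(2) less_imp_neq[OF assms(2), symmetric])
  qed (use assms in auto)
  also have "a ^ n / real n - 0 ^ n / real n = a ^ n / real n" using assms by (simp add: zero_power)
  finally show ?thesis .
qed

text \<open>The cone measure: \<open>n\<close> times the volume of the part of the unit ball seen in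
  the given directions. It is surface area on the unit sphere, obtained without reference to
  Hausdorff measure; the origin, where \<open>sgn\<close> is 0, has volume 0.\<close>

definition sphere_area :: "'a::euclidean_space measure" where
  "sphere_area = distr (density lborel (\<lambda>x. of_nat DIM('a) * indicator (ball 0 1) x)) borel sgn"

lemma borel_measurable_sgn_euclidean [measurable]:
  "(sgn :: 'a::euclidean_space \<Rightarrow> 'a) \<in> borel_measurable borel"
  unfolding sgn_div_norm[abs_def] by measurable

lemma space_sphere_area [simp]: "space sphere_area = UNIV"
  and sets_sphere_area [simp, measurable_cong]: "sets sphere_area = sets borel"
  by (auto simp: sphere_area_def)

lemma emeasure_sphere_area:
  fixes B :: "'a::euclidean_space set"
  assumes [measurable]: "B \<in> sets borel"
  shows "emeasure sphere_area B = of_nat DIM('a) * emeasure lborel {x. sgn x \<in> B \<and> norm x < 1}"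
proof -
  have B: "sgn -` B \<in> sets (lborel :: 'a measure)"
    using measurable_sets_borel[OF borel_measurable_sgn_euclidean assms] by simp
  have u: "(\<lambda>x::'a. of_nat DIM('a) * indicator (ball 0 1) x :: ennreal) \<in> borel_measurable lborel"
    by (intro borel_measurable_times_ennreal borel_measurable_const borel_measurable_indicator) simp
  have "emeasure sphere_area B
     = (\<integral>\<^sup>+x. of_nat DIM('a) * indicator (ball 0 1) x * indicator (sgn -` B) x \<partial>lborel)"
    unfolding sphere_area_def using emeasure_density[OF u B] B
    by (subst emeasure_distr) simp_all
  also have "\<dots> = (\<integral>\<^sup>+x. of_nat DIM('a) * indicator {x. sgn x \<in> B \<and> norm x < 1} x \<partial>lborel)"
    by (intro nn_integral_cong) (auto simp: indicator_def)
  also have "\<dots> = of_nat DIM('a) * emeasure lborel {x. sgn x \<in> B \<and> norm x < 1}"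
    by (subst nn_integral_cmult) (measurable; simp)+
  finally show ?thesis .
qed

lemma finite_measure_sphere_area: "finite_measure sphere_area"
proof
  have "emeasure sphere_area (UNIV :: 'a set) \<le> of_nat DIM('a) * emeasure lborel (ball (0::'a) 1)"
    by (subst emeasure_sphere_area) (auto intro!: mult_left_mono emeasure_mono)
  also have "\<dots> < top"
    using emeasure_lborel_ball_finite[of "0::'a" 1] by (simp add: ennreal_mult_less_top of_nat_less_top)
  finally show "emeasure sphere_area (space (sphere_area :: 'a measure)) \<noteq> \<infinity>" by simp
qed

lemma emeasure_sphere_area_Int_sphere:
  fixes B :: "'a::euclidean_space set"
  assumes [measurable]: "B \<in> sets borel"
  shows "emeasure sphere_area (B \<inter> sphere 0 1) = emeasure sphere_area B"
proof -
  have "emeasure lborel {x. sgn x \<in> B \<inter> sphere 0 1 \<and> norm x < 1} = emeasure lborel {x. sgn x \<in> B \<and> norm x < 1}"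
  proof (rule emeasure_eq_AE)
    show "AE x in lborel. (x \<in> {x. sgn x \<in> B \<inter> sphere 0 1 \<and> norm x < 1}) = (x \<in> {x. sgn x \<in> B \<and> norm x < 1})"
      using AE_lborel_singleton[of "0::'a"] by eventually_elim (simp add: norm_sgn)
  qed auto
  then show ?thesis by (simp add: emeasure_sphere_area)
qed

lemma sets_cylinder:
  fixes X :: "'a::euclidean_space set"
  assumes [measurable]: "X \<in> sets borel"
  shows "{x. proj_orth e x \<in> X \<and> a \<le> x \<bullet> e \<and> x \<bullet> e \<le> b} \<in> sets lborel"
  by measurable

text \<open>The flat set \<open>e + Y\<close> in the tangent plane at \<open>e\<close> is projected
  radially to the sphere. The cone over it, cut at height \<open>s0 = 1 / (1 + R)\<close>, stays
  inside the unit ball because its points have norm below \<open>s0 * (1 + R)\<close>, and slicing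
  computes its volume as \<open>s0 ^ n / n\<close> times the cross area.\<close>

lemma sphere_area_lift_ge:
  fixes e :: "'a::euclidean_space"
  assumes e: "norm e = 1" and Y: "compact Y" "\<And>y. y \<in> Y \<Longrightarrow> y \<bullet> e = 0" "Y \<subseteq> cball 0 R" and R: "0 \<le> R"
  shows "ennreal ((1 / (1 + R)) ^ DIM('a)) * cross_area e Y \<le> emeasure sphere_area ((\<lambda>y. sgn (e + y)) ` Y)"
proof -
  let ?n = "DIM('a)" and ?L = "(\<lambda>y. sgn (e + y)) ` Y"
  define s0 where "s0 = 1 / (1 + R)"
  have s0: "0 < s0" using R by (simp add: s0_def)
  have ee: "e \<bullet> e = 1" using e by (simp add: dot_square_norm)
  have [measurable]: "Y \<in> sets borel" using Y(1) by (intro borel_closed compact_imp_closed)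
  have e0: "e + y \<noteq> 0" if "y \<in> Y" for y
  proof
    assume "e + y = 0"
    then have "(e + y) \<bullet> e = 0" by simp
    then show False using Y(2)[OF that] ee by (simp add: inner_add_left)
  qed
  have cL: "compact ?L"
    unfolding sgn_div_norm
    by (intro compact_continuous_image continuous_intros Y(1)) (use e0 in auto)
  then have [measurable]: "?L \<in> sets borel" by (intro borel_closed compact_imp_closed)
  define D where "D = {x. 0 < x \<bullet> e \<and> x \<bullet> e < s0 \<and> (1 / (x \<bullet> e)) *\<^sub>R proj_orth e x \<in> Y}"
  have [measurable]: "D \<in> sets borel" unfolding D_def by measurable
  have slice: "cross_area e {y. y + s *\<^sub>R e \<in> D} = ennreal (s ^ (?n - 1)) * indicator {0<..<s0} s * cross_area e Y" for s
  proof (cases "s \<in> {0<..<s0}")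
    case True
    have "{x. proj_orth e x \<in> {y. y + s *\<^sub>R e \<in> D} \<and> 0 \<le> x \<bullet> e \<and> x \<bullet> e \<le> 1}
       = {x. proj_orth e x \<in> {y. (1 / s) *\<^sub>R y \<in> Y} \<and> 0 \<le> x \<bullet> e \<and> x \<bullet> e \<le> 1}"
      using True e by (auto simp: inner_add_left ee D_def)
    then have "cross_area e {y. y + s *\<^sub>R e \<in> D} = cross_area e {y. (1 / s) *\<^sub>R y \<in> Y}"
      unfolding cross_area_def by (rule arg_cong)
    also have "\<dots> = ennreal (s ^ (?n - 1)) * (ennreal ((1 / s) ^ (?n - 1)) * cross_area e {y. (1 / s) *\<^sub>R y \<in> Y})"
      using True by (simp add: mult.assoc[symmetric] ennreal_mult'[symmetric] power_mult_distrib[symmetric])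
    also have "ennreal ((1 / s) ^ (?n - 1)) * cross_area e {y. (1 / s) *\<^sub>R y \<in> Y} = cross_area e Y"
      by (rule cross_area_scale[symmetric]) (use True e in auto)
    finally show ?thesis using True by simp
  next
    case False
    have "{x. proj_orth e x \<in> {y. y + s *\<^sub>R e \<in> D} \<and> 0 \<le> x \<bullet> e \<and> x \<bullet> e \<le> 1} = {}"
      using False e by (auto simp: inner_add_left ee D_def)
    then have "cross_area e {y. y + s *\<^sub>R e \<in> D} = emeasure lborel ({} :: 'a set)"
      unfolding cross_area_def by (rule arg_cong)
    then show ?thesis using False by simp
  qed
  have "emeasure lborel D = (\<integral>\<^sup>+s. ennreal (s ^ (?n - 1)) * indicator {0<..<s0} s * cross_area e Y \<partial>lborel)"
    using emeasure_lborel_slices[of D e] e unfolding slice by simp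
  also have "\<dots> = ennreal (s0 ^ ?n / real ?n) * cross_area e Y"
    by (subst nn_integral_multc, measurable, subst nn_integral_FTC_power) (use s0 in auto)
  finally have D: "emeasure lborel D = ennreal (s0 ^ ?n / real ?n) * cross_area e Y" .
  have "ennreal (s0 ^ ?n) * cross_area e Y = of_nat ?n * emeasure lborel D"
    unfolding D using s0
    by (simp add: mult.assoc[symmetric] ennreal_of_nat_eq_real_of_nat ennreal_mult'[symmetric])
  also have "\<dots> \<le> of_nat ?n * emeasure lborel {x. sgn x \<in> ?L \<and> norm x < 1}"
  proof (intro mult_left_mono emeasure_mono)
    show "D \<subseteq> {x. sgn x \<in> ?L \<and> norm x < 1}"
    proof
      fix x assume "x \<in> D"
      then have x: "0 < x \<bullet> e" "x \<bullet> e < s0" and y: "(1 / (x \<bullet> e)) *\<^sub>R proj_orth e x \<in> Y"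
        by (auto simp: D_def)
      let ?y = "(1 / (x \<bullet> e)) *\<^sub>R proj_orth e x"
      have xe: "x = (x \<bullet> e) *\<^sub>R (e + ?y)"
        using x by (simp add: algebra_simps proj_orth_def)
      have "sgn x = sgn (e + ?y)" by (subst xe) (use x in \<open>simp add: sgn_scaleR\<close>)
      moreover have "norm x < 1"
      proof -
        have "norm (e + ?y) \<le> 1 + R" using norm_triangle_ineq[of e ?y] y Y(3) e by auto
        moreover have "norm x = (x \<bullet> e) * norm (e + ?y)" by (subst xe) (use x in simp)
        ultimately have "norm x \<le> (x \<bullet> e) * (1 + R)" using x by simp
        also have "\<dots> < s0 * (1 + R)" using x R by (intro mult_strict_right_mono) auto
        finally show ?thesis using R by (simp add: s0_def)
      qed
      ultimately show "x \<in> {x. sgn x \<in> ?L \<and> norm x < 1}" using y by auto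
    qed
  qed auto
  also have "\<dots> = emeasure sphere_area ?L" by (rule emeasure_sphere_area[symmetric]) measurable
  finally show ?thesis by (simp add: s0_def)
qed

text \<open>The cone over a cap of radius \<open>R\<close> lies in a cylinder of height 2 over a
  disc of radius \<open>R\<close>. The constant is crude; what matters is the order
  \<open>R ^ (n - 1)\<close>, for the comparison of balls in the Vitali covering.\<close>

lemma sphere_area_cball_le:
  fixes \<theta> :: "'a::euclidean_space"
  assumes \<theta>: "norm \<theta> = 1" and R: "0 < R"
  shows "emeasure sphere_area (cball \<theta> R)
    \<le> ennreal (real DIM('a) * (2 * (unit_ball_vol DIM('a) * 2 ^ DIM('a) * R ^ (DIM('a) - 1))))"
proof -
  have "emeasure lborel {x. sgn x \<in> cball \<theta> R \<and> norm x < 1}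
     \<le> emeasure lborel {x. proj_orth \<theta> x \<in> cball 0 R \<and> -1 \<le> x \<bullet> \<theta> \<and> x \<bullet> \<theta> \<le> 1}"
  proof (rule emeasure_mono)
    show "{x. sgn x \<in> cball \<theta> R \<and> norm x < 1} \<subseteq> {x. proj_orth \<theta> x \<in> cball 0 R \<and> -1 \<le> x \<bullet> \<theta> \<and> x \<bullet> \<theta> \<le> 1}"
    proof safe
      fix x assume x: "sgn x \<in> cball \<theta> R" "norm x < 1"
      have "\<bar>x \<bullet> \<theta>\<bar> \<le> 1" using Cauchy_Schwarz_ineq2[of x \<theta>] x \<theta> by simp
      then show "-1 \<le> x \<bullet> \<theta>" "x \<bullet> \<theta> \<le> 1" by auto
      have "proj_orth \<theta> x = norm x *\<^sub>R proj_orth \<theta> (sgn x + (-1) *\<^sub>R \<theta>)"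
        unfolding proj_orth_add_scaleR[OF \<theta>] linear_cmul[OF linear_proj_orth, symmetric]
        by (cases "x = 0") (simp_all add: sgn_div_norm)
      then have "norm (proj_orth \<theta> x) = norm x * norm (proj_orth \<theta> (sgn x - \<theta>))" by simp
      also have "\<dots> \<le> 1 * norm (sgn x - \<theta>)"
        using x norm_proj_orth_le[OF \<theta>] by (intro mult_mono) auto
      finally show "proj_orth \<theta> x \<in> cball 0 R" using x(1) by (simp add: dist_norm norm_minus_commute)
    qed
  qed (rule sets_cylinder, simp)
  also have "\<dots> = ennreal 2 * cross_area \<theta> (cball 0 R)"
    by (subst emeasure_cylinder) (use \<theta> in auto)
  also have "\<dots> \<le> ennreal 2 * ennreal (unit_ball_vol DIM('a) * 2 ^ DIM('a) * R ^ (DIM('a) - 1))"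
    by (intro mult_left_mono cross_area_le_pow[of _ 0 R]) (use R \<theta> in auto)
  finally have "of_nat DIM('a) * emeasure lborel {x. sgn x \<in> cball \<theta> R \<and> norm x < 1}
    \<le> of_nat DIM('a) * (ennreal 2 * ennreal (unit_ball_vol DIM('a) * 2 ^ DIM('a) * R ^ (DIM('a) - 1)))"
    by (rule mult_left_mono) simp
  then show ?thesis
    using R by (simp add: emeasure_sphere_area ennreal_of_nat_eq_real_of_nat ennreal_mult'[symmetric] del: ennreal_numeral)
qed

text \<open>Radial projection of a flat piece to the sphere must not increase its diameter. With
  \<open>c\<close> the cosine of the angle,
  \<open>|u - v|^2 = (|u| - |v|)^2 + 2 |u| |v| (1 - c)\<close>, and here
  \<open>|u| |v| \<ge> 1\<close>.\<close>

lemma dist_sgn_le: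
  fixes u v :: "'a::real_inner"
  assumes "1 \<le> norm u" "1 \<le> norm v"
  shows "dist (sgn u) (sgn v) \<le> dist u v"
proof -
  define c where "c = sgn u \<bullet> sgn v"
  have nz: "norm u \<noteq> 0" "norm v \<noteq> 0" using assms by auto
  have nu: "norm (sgn u) = 1" "norm (sgn v) = 1" using nz by (auto simp: norm_sgn)
  have c1: "c \<le> 1" using norm_cauchy_schwarz[of "sgn u" "sgn v"] nu by (simp add: c_def)
  have uv: "u \<bullet> v = norm u * norm v * c" using nz by (simp add: c_def sgn_div_norm field_simps)
  have "1 * 1 \<le> norm u * norm v" using assms by (intro mult_mono) auto
  then have "2 * (1 - c) \<le> 2 * (norm u * norm v * (1 - c)) + (norm u - norm v)\<^sup>2"
    using mult_right_mono[of "1 * 1" "norm u * norm v" "1 - c"] c1 zero_le_power2[of "norm u - norm v"]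
    by linarith
  also have "\<dots> = (dist u v)\<^sup>2"
    using dot_norm_neg[of u v] unfolding uv dist_norm power2_diff by (simp add: algebra_simps)
  finally have "2 * (1 - c) \<le> (dist u v)\<^sup>2" .
  moreover have "(dist (sgn u) (sgn v))\<^sup>2 = 2 * (1 - c)"
    using dot_norm_neg[of "sgn u" "sgn v"] unfolding nu dist_norm c_def by simp
  ultimately have "(dist (sgn u) (sgn v))\<^sup>2 \<le> (dist u v)\<^sup>2" by simp
  then show ?thesis by (rule power2_le_imp_le) simp
qed

lemma cross_area_translate:
  fixes e :: "'a::euclidean_space"
  assumes [measurable]: "C \<in> sets borel" and e: "norm e = 1" and y: "y \<bullet> e = 0"
  shows "cross_area e {x. y + x \<in> C} = cross_area e C"
proof -
  let ?A = "{x. proj_orth e x \<in> C \<and> 0 \<le> x \<bullet> e \<and> x \<bullet> e \<le> 1}"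
  have "cross_area e C = emeasure (distr lborel borel ((+) y)) ?A"
    by (simp add: cross_area_def lborel_distr_plus)
  also have "\<dots> = emeasure lborel ((+) y -` ?A)"
    by (subst emeasure_distr) (measurable; simp)+
  also have "(+) y -` ?A = {x. proj_orth e x \<in> {x. y + x \<in> C} \<and> 0 \<le> x \<bullet> e \<and> x \<bullet> e \<le> 1}"
    using y by (auto simp: inner_add_left linear_add[OF linear_proj_orth] proj_orth_id)
  finally show ?thesis by (simp add: cross_area_def)
qed

text \<open>A nearly optimal flat set is rescaled to diameter \<open>R\<close>, placed in the
  tangent plane at \<open>\<theta>\<close> by an isometry and projected radially. This costs at most
  a factor \<open>(1 / (1 + R)) ^ n\<close> of area and does not increase the diameter. The last
  conclusion, area of order at least \<open>R ^ (n - 1)\<close>, serves the Vitali covering.\<close>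

lemma sphere_shapes:
  assumes n: "2 \<le> DIM('a::euclidean_space)" and q: "0 < q" "q < isodiam TYPE('a)"
  obtains R0 c :: real where "0 < R0" "0 < c"
    "\<And>(\<theta>::'a) R. norm \<theta> = 1 \<Longrightarrow> 0 < R \<Longrightarrow> R \<le> R0 \<Longrightarrow> \<exists>L. compact L \<and> L \<subseteq> sphere 0 1 \<inter> cball \<theta> R \<and>
       ennreal q * hausdorff_cost (codim1 TYPE('a)) L \<le> emeasure sphere_area L \<and>
       ennreal (c * R ^ (DIM('a) - 1)) \<le> emeasure sphere_area L"
proof -
  let ?n = "DIM('a)" and ?k = "codim1 TYPE('a)"
  \<comment> \<open>The gap between \<open>q\<close> and \<open>q'\<close> absorbs the factor
    \<open>(1 / (1 + R)) ^ n\<close> for small \<open>R\<close>.\<close>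
  obtain q' where q': "q < q'" "q' < isodiam TYPE('a)" using dense[OF q(2)] by blast
  obtain e :: 'a and C where e: "norm e = 1" and C: "compact C" "\<And>x. x \<in> C \<Longrightarrow> x \<bullet> e = 0" "0 < diameter C"
      and opt: "ennreal q' * hausdorff_cost ?k C < cross_area e C"
    using isodiam_near_optimal[OF n _ q'(2)] q q'(1) by (metis less_imp_le less_trans)
  define D where "D = diameter C"
  have D: "0 < D" using C by (simp add: D_def)
  have "C \<noteq> {}" using C(3) by auto
  then obtain y0 where y0: "y0 \<in> C" by blast
  have [measurable]: "C \<in> sets borel" using C(1) by (intro borel_closed compact_imp_closed)
  have "cross_area e C \<le> ennreal (isodiam TYPE('a)) * hausdorff_cost ?k C"
    by (rule cross_area_le_isodiam[OF n e C(1,2)])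
  also have "\<dots> < top" by (simp add: hausdorff_cost_def ennreal_mult_less_top)
  finally obtain a where a: "0 \<le> a" "cross_area e C = ennreal a" by (cases "cross_area e C") auto
  have a0: "0 < a" using opt a(1) unfolding a(2) by (metis ennreal_less_zero_iff gr_zeroI not_less_zero)
  have "((\<lambda>R. (1 / (1 + R)) ^ ?n * q') \<longlongrightarrow> (1 / (1 + 0)) ^ ?n * q') (at_right 0)"
    by (intro tendsto_intros) auto
  then have "\<forall>\<^sub>F R in at_right 0. q < (1 / (1 + R)) ^ ?n * q'"
    by (rule order_tendstoD) (use q' in simp)
  then obtain R0 where R0: "0 < R0" "\<And>R. 0 < R \<Longrightarrow> R < R0 \<Longrightarrow> q < (1 / (1 + R)) ^ ?n * q'"
    unfolding eventually_at_right_field by auto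
  \<comment> \<open>The limit gives the bound for \<open>R < R0\<close>, hence for all
    \<open>R \<le> R0 / 2\<close>. In \<open>c\<close> the projection factor is taken at its worst
    value there, and \<open>a / D ^ (n - 1)\<close> comes from the rescaling.\<close>
  let ?R0 = "R0 / 2"
  define c where "c = (1 / (1 + ?R0)) ^ ?n * a / D ^ (?n - 1)"
  show ?thesis
  proof (rule that)
    show "0 < ?R0" using R0 by simp
    show "0 < c" using a0 D R0 by (auto simp: c_def intro!: divide_pos_pos mult_pos_pos zero_less_power)
    fix \<theta> :: 'a and R assume \<theta>: "norm \<theta> = 1" and R: "0 < R" "R \<le> ?R0"
    obtain T :: "'a \<Rightarrow> 'a" where T: "linear T" "\<And>x. norm (T x) = norm x" "T e = \<theta>"
      using isometry_exists[OF e \<theta>] by blast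
    have T_inner: "T x \<bullet> T y = x \<bullet> y" for x y
      using T by (metis orthogonal_transformation orthogonal_transformation_def)
    have Tinj: "T x = T y \<longleftrightarrow> x = y" for x y
      using T(2)[of "x - y"] by (auto simp: linear_diff[OF T(1)])
    have Tcont: "continuous_on S T" for S by (rule linear_continuous_on_compose[OF continuous_on_id T(1)])
    define r where "r = R / D"
    have r: "0 < r" using R D by (simp add: r_def)
    define Z where "Z = (\<lambda>x. r *\<^sub>R (x - y0)) ` C"
    define Y where "Y = T ` Z"
    define L where "L = (\<lambda>y. sgn (\<theta> + y)) ` Y"
    have cZ: "compact Z" unfolding Z_def by (intro compact_continuous_image continuous_intros C(1))
    have cY: "compact Y" unfolding Y_def by (rule compact_continuous_image[OF Tcont cZ])
    have [measurable]: "Z \<in> sets borel" "Y \<in> sets borel"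
      using cZ cY by (auto intro: borel_closed compact_imp_closed)
    have Y\<theta>: "y \<bullet> \<theta> = 0" if "y \<in> Y" for y
      using that C(2) y0 by (auto simp: Y_def Z_def T_inner T(3)[symmetric] inner_diff_left)
    have Ydist: "dist y y' \<le> R" if yy: "y \<in> Y" "y' \<in> Y" for y y'
    proof -
      obtain u v where uv: "u \<in> C" "v \<in> C" "y = T (r *\<^sub>R (u - y0))" "y' = T (r *\<^sub>R (v - y0))"
        using yy by (auto simp: Y_def Z_def)
      have "dist y y' = norm (r *\<^sub>R (u - v))"
        unfolding uv dist_norm linear_diff[OF T(1), symmetric] T(2) by (simp add: algebra_simps)
      also have "\<dots> \<le> r * D"
        using diameter_bounded_bound[OF compact_imp_bounded[OF C(1)] uv(1,2)] r
        by (simp add: dist_norm D_def)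
      finally show ?thesis using D by (simp add: r_def)
    qed
    have Y0: "0 \<in> Y" using y0 linear_0[OF T(1)] by (force simp: Y_def Z_def)
    have YR: "Y \<subseteq> cball 0 R" using Ydist[OF Y0] by auto
    have norm1: "1 \<le> norm (\<theta> + y)" if "y \<in> Y" for y
    proof -
      have "(norm (\<theta> + y))\<^sup>2 = 1 + (norm y)\<^sup>2"
        using Y\<theta>[OF that] \<theta> norm_add_Pythagorean[of \<theta> y] by (simp add: orthogonal_def inner_commute)
      then have "1\<^sup>2 \<le> (norm (\<theta> + y))\<^sup>2" by simp
      then show ?thesis by (rule power2_le_imp_le) simp
    qed
    have nz: "\<theta> + y \<noteq> 0" if "y \<in> Y" for y using norm1[OF that] by auto
    have Ldist: "dist (sgn (\<theta> + y)) (sgn (\<theta> + y')) \<le> dist y y'" if "y \<in> Y" "y' \<in> Y" for y y'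
      using dist_sgn_le[OF norm1[OF that(1)] norm1[OF that(2)]] by simp
    have area: "emeasure sphere_area L \<ge> ennreal ((1 / (1 + R)) ^ ?n * (r ^ (?n - 1) * a))"
    proof -
      have "cross_area \<theta> Y = cross_area e {x. T x \<in> Y}"
        using cross_area_isometry[OF T(1,2), of Y e] T(3) by simp
      also have "{x. T x \<in> Y} = Z" by (auto simp: Y_def Tinj)
      also have "cross_area e Z = ennreal (r ^ (?n - 1)) * cross_area e {y. r *\<^sub>R y \<in> Z}"
        by (rule cross_area_scale) (use e r in auto)
      also have "{y. r *\<^sub>R y \<in> Z} = {x. y0 + x \<in> C}"
        using r by (force simp: Z_def)
      also have "cross_area e {x. y0 + x \<in> C} = ennreal a"
        using cross_area_translate[of C e y0] C(2)[OF y0] e a by simp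
      finally have "cross_area \<theta> Y = ennreal (r ^ (?n - 1) * a)"
        using r a by (simp add: ennreal_mult')
      then show ?thesis
        using sphere_area_lift_ge[OF \<theta> cY Y\<theta> YR] R a r by (simp add: L_def ennreal_mult')
    qed
    show "\<exists>L. compact L \<and> L \<subseteq> sphere 0 1 \<inter> cball \<theta> R \<and>
       ennreal q * hausdorff_cost ?k L \<le> emeasure sphere_area L \<and>
       ennreal (c * R ^ (?n - 1)) \<le> emeasure sphere_area L"
    proof (intro exI conjI)
      show "compact L" unfolding L_def sgn_div_norm
        by (intro compact_continuous_image continuous_intros cY) (use nz in auto)
      show "L \<subseteq> sphere 0 1 \<inter> cball \<theta> R"
      proof -
        have "sgn (\<theta> + y) \<in> sphere 0 1 \<inter> cball \<theta> R" if "y \<in> Y" for y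
        proof -
          have "sgn (\<theta> + 0) = \<theta>" using \<theta> by (simp add: sgn_div_norm)
          then have "dist \<theta> (sgn (\<theta> + y)) \<le> R" using Ldist[OF Y0 that] Ydist[OF Y0 that] by simp
          then show ?thesis using nz[OF that] by (simp add: norm_sgn)
        qed
        then show ?thesis by (auto simp: L_def)
      qed
      have Lbd: "bounded L" using \<open>compact L\<close> by (rule compact_imp_bounded)
      have "diameter L \<le> R"
      proof (rule diameter_le)
        fix x y assume "x \<in> L" "y \<in> L"
        then obtain u v where uv: "u \<in> Y" "v \<in> Y" "x = sgn (\<theta> + u)" "y = sgn (\<theta> + v)" by (auto simp: L_def)
        show "norm (x - y) \<le> R"
          using Ldist[OF uv(1,2)] Ydist[OF uv(1,2)] uv by (simp add: dist_norm)
      qed (use R in auto)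
      then have "hausdorff_cost ?k L \<le> ennreal (unit_ball_vol ?k * (R / 2) powr ?k)"
        by (rule hausdorff_cost_le[OF codim1_nonneg Lbd])
      also have "(R / 2) powr ?k = r ^ (?n - 1) * (D / 2) powr ?k"
      proof -
        have "R / 2 = r * (D / 2)" using D by (simp add: r_def)
        then show ?thesis using r D by (simp only: powr_mult powr_realpow[OF r] codim1_def)
      qed
      also have "ennreal (unit_ball_vol ?k * (r ^ (?n - 1) * (D / 2) powr ?k))
         = ennreal (r ^ (?n - 1)) * hausdorff_cost ?k C"
        using r by (simp add: hausdorff_cost_def D_def ennreal_mult'[symmetric] mult_ac)
      finally have costL: "hausdorff_cost ?k L \<le> ennreal (r ^ (?n - 1)) * hausdorff_cost ?k C" .
      have "ennreal q * hausdorff_cost ?k L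
          \<le> ennreal ((1 / (1 + R)) ^ ?n * q') * (ennreal (r ^ (?n - 1)) * hausdorff_cost ?k C)"
        using R0(2)[of R] R R0(1) by (intro mult_mono costL ennreal_leI) auto
      also have "\<dots> = ennreal ((1 / (1 + R)) ^ ?n * r ^ (?n - 1)) * (ennreal q' * hausdorff_cost ?k C)"
        using r R q q' by (simp add: ennreal_mult' mult_ac)
      also have "\<dots> \<le> ennreal ((1 / (1 + R)) ^ ?n * r ^ (?n - 1)) * ennreal a"
        using opt a by (intro mult_left_mono) auto
      also have "\<dots> = ennreal ((1 / (1 + R)) ^ ?n * (r ^ (?n - 1) * a))"
        using r R a by (simp add: ennreal_mult'[symmetric] mult_ac)
      finally show "ennreal q * hausdorff_cost ?k L \<le> emeasure sphere_area L" using area by (rule order_trans)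
      have "c * R ^ (?n - 1) \<le> (1 / (1 + R)) ^ ?n * (r ^ (?n - 1) * a)"
      proof -
        have "(1 / (1 + ?R0)) ^ ?n \<le> (1 / (1 + R)) ^ ?n"
          using R by (intro power_mono divide_left_mono) auto
        then have "(1 / (1 + ?R0)) ^ ?n * (r ^ (?n - 1) * a) \<le> (1 / (1 + R)) ^ ?n * (r ^ (?n - 1) * a)"
          using r a by (intro mult_right_mono) auto
        moreover have "c * R ^ (?n - 1) = (1 / (1 + ?R0)) ^ ?n * (r ^ (?n - 1) * a)"
          by (simp only: c_def r_def power_divide) (simp add: mult_ac)
        ultimately show ?thesis by simp
      qed
      then show "ennreal (c * R ^ (?n - 1)) \<le> emeasure sphere_area L"
        using area by (meson ennreal_leI order_trans)
    qed
  qed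
qed

text \<open>Vitali's covering lemma: the sets \<open>L i\<close> sit in disjoint balls, and the five
  times larger balls \<open>P i\<close> cover \<open>U\<close>. Area and cost of a ball are at most
  of order \<open>R ^ (n - 1)\<close> and the area of \<open>L i\<close> is at least of that order,
  whence one constant \<open>K\<close>.\<close>

lemma sphere_packing:
  assumes n: "2 \<le> DIM('a::euclidean_space)" and q: "0 < q" "q < isodiam TYPE('a)"
  obtains K :: real where "0 < K"
    "\<And>(U::'a set) \<delta>. openin (top_of_set (sphere 0 1)) U \<Longrightarrow> 0 < \<delta> \<Longrightarrow>
      \<exists>L P :: nat \<Rightarrow> 'a set. disjoint_family L \<and> (\<forall>i. compact (L i) \<and> L i \<subseteq> U \<and> diameter (L i) < \<delta> \<and>
        ennreal q * hausdorff_cost (codim1 TYPE('a)) (L i) \<le> emeasure sphere_area (L i)) \<and>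
        U \<subseteq> (\<Union>i. P i) \<and> (\<forall>i. compact (P i) \<and> diameter (P i) < \<delta> \<and>
        emeasure sphere_area (P i) \<le> ennreal K * emeasure sphere_area (L i) \<and>
        hausdorff_cost (codim1 TYPE('a)) (P i) \<le> ennreal K * emeasure sphere_area (L i))"
proof -
  let ?n = "DIM('a)" and ?k = "codim1 TYPE('a)"
  obtain R0 c where R0: "0 < R0" and c: "0 < c" and sh: "\<And>(\<theta>::'a) R. norm \<theta> = 1 \<Longrightarrow> 0 < R \<Longrightarrow> R \<le> R0 \<Longrightarrow>
      \<exists>L. compact L \<and> L \<subseteq> sphere 0 1 \<inter> cball \<theta> R \<and>
       ennreal q * hausdorff_cost ?k L \<le> emeasure sphere_area L \<and>
       ennreal (c * R ^ (?n - 1)) \<le> emeasure sphere_area L"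
    using sphere_shapes[OF n q] by metis
  define K1 where "K1 = real ?n * (2 * (unit_ball_vol ?n * 2 ^ ?n))"
  define K2 where "K2 = unit_ball_vol ?k"
  \<comment> \<open>\<open>K1\<close> and \<open>K2\<close> are the factors of
    \<open>R ^ (n - 1)\<close> in the bounds for area and cost of a ball of radius \<open>R\<close>;
    \<open>5 ^ (n - 1)\<close> comes from the enlargement and \<open>c\<close> from the area of the
    packed sets.\<close>
  define K where "K = (K1 + K2) * 5 ^ (?n - 1) / c"
  have K12: "0 < K1" "0 < K2" by (auto simp: K1_def K2_def)
  show ?thesis
  proof (rule that)
    show "0 < K" using K12 c by (simp add: K_def)
    fix U :: "'a set" and \<delta> :: real
    assume U: "openin (top_of_set (sphere 0 1)) U" and \<delta>: "0 < \<delta>"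
    obtain W where W: "open W" "U = sphere 0 1 \<inter> W" using U by (auto simp: openin_open)
    \<comment> \<open>\<open>10 * r\<close> is the diameter of the enlarged ball. The ball of radius
      \<open>r\<close> itself stays in \<open>W\<close>, so the set packed into it stays in
      \<open>U\<close>.\<close>
    have "\<exists>r>0. r \<le> R0 \<and> 10 * r < \<delta> \<and> cball x r \<subseteq> W" if "x \<in> U" for x
    proof -
      have "x \<in> W" using W(2) that by simp
      then obtain s where s: "0 < s" "cball x s \<subseteq> W" using open_contains_cball_eq[OF W(1)] by auto
      have "0 < min s (min R0 (\<delta> / 20))" "cball x (min s (min R0 (\<delta> / 20))) \<subseteq> W"
        using s R0 \<delta> by (auto simp: subset_eq)
      then show ?thesis by (intro exI[of _ "min s (min R0 (\<delta> / 20))"]) (use \<delta> in auto)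
    qed
    then obtain r where r: "\<And>x. x \<in> U \<Longrightarrow> 0 < r x \<and> r x \<le> R0 \<and> 10 * r x < \<delta> \<and> cball x (r x) \<subseteq> W"
      by metis
    have cov: "U \<subseteq> (\<Union>x\<in>U. cball x (r x))" using r by (force intro: less_imp_le)
    have rb: "\<And>x. x \<in> U \<Longrightarrow> 0 < r x \<and> r x \<le> R0" using r by blast
    obtain C where C: "countable C" "C \<subseteq> U"
        "pairwise (\<lambda>i j. disjnt (cball i (r i)) (cball j (r j))) C" "U \<subseteq> (\<Union>i\<in>C. cball i (5 * r i))"
      by (rule Vitali_covering_lemma_cballs[OF cov rb]) 
    have "\<exists>L. compact L \<and> L \<subseteq> sphere 0 1 \<inter> cball x (r x) \<and>
       ennreal q * hausdorff_cost ?k L \<le> emeasure sphere_area L \<and>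
       ennreal (c * r x ^ (?n - 1)) \<le> emeasure sphere_area L" if "x \<in> C" for x
    proof (rule sh)
      have "x \<in> U" using that C(2) by blast
      then show "norm x = 1" "0 < r x" "r x \<le> R0" using W(2) rb[of x] by auto
    qed
    then obtain LL where LL: "\<And>x. x \<in> C \<Longrightarrow> compact (LL x) \<and> LL x \<subseteq> sphere 0 1 \<inter> cball x (r x) \<and>
       ennreal q * hausdorff_cost ?k (LL x) \<le> emeasure sphere_area (LL x) \<and>
       ennreal (c * r x ^ (?n - 1)) \<le> emeasure sphere_area (LL x)"
      by metis
    define I where "I = to_nat_on C ` C"
    define g where "g = from_nat_into C"
    have gC: "g i \<in> C" if "i \<in> I" for i using that C(1) by (auto simp: I_def g_def)
    have ginj: "g i \<noteq> g j" if "i \<in> I" "j \<in> I" "i \<noteq> j" for i j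
      using that C(1) by (auto simp: I_def g_def)
    define L where "L i = (if i \<in> I then LL (g i) else {})" for i
    define P where "P i = (if i \<in> I then cball (g i) (5 * r (g i)) else {})" for i
    have "disjoint_family L"
      unfolding disjoint_family_on_def
    proof (intro ballI impI)
      fix i j :: nat assume "i \<noteq> j"
      show "L i \<inter> L j = {}"
      proof (cases "i \<in> I \<and> j \<in> I")
        case True
        then have "disjnt (cball (g i) (r (g i))) (cball (g j) (r (g j)))"
          using C(3) gC ginj \<open>i \<noteq> j\<close> by (auto simp: pairwise_def)
        then show ?thesis using LL[OF gC[of i]] LL[OF gC[of j]] True by (auto simp: L_def disjnt_def)
      qed (auto simp: L_def)
    qed
    moreover have "compact (L i) \<and> L i \<subseteq> U \<and> diameter (L i) < \<delta> \<and>
        ennreal q * hausdorff_cost ?k (L i) \<le> emeasure sphere_area (L i)" for i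
    proof (cases "i \<in> I")
      case True
      note l = LL[OF gC[OF True]] and rr = r[of "g i"]
      have gU: "g i \<in> U" using gC[OF True] C(2) by blast
      have "diameter (LL (g i)) \<le> diameter (cball (g i) (r (g i)))"
        using l by (intro diameter_subset) auto
      then have "diameter (LL (g i)) < \<delta>" using rr[OF gU] by auto
      moreover have "LL (g i) \<subseteq> U" using l rr[OF gU] W(2) by blast
      ultimately show ?thesis using True l by (simp add: L_def)
    qed (use \<delta> in \<open>simp add: L_def\<close>)
    moreover have "U \<subseteq> (\<Union>i. P i)"
    proof
      fix x assume "x \<in> U"
      then obtain z where z: "z \<in> C" "x \<in> cball z (5 * r z)" using C(4) by blast
      then have "x \<in> P (to_nat_on C z)" using C(1) by (simp add: P_def I_def g_def)
      then show "x \<in> (\<Union>i. P i)" by blast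
    qed
    moreover have "compact (P i) \<and> diameter (P i) < \<delta> \<and>
        emeasure sphere_area (P i) \<le> ennreal K * emeasure sphere_area (L i) \<and>
        hausdorff_cost ?k (P i) \<le> ennreal K * emeasure sphere_area (L i)" for i
    proof (cases "i \<in> I")
      case True
      let ?x = "g i" and ?r = "r (g i)"
      note l = LL[OF gC[OF True]]
      have gU: "?x \<in> U" using gC[OF True] C(2) by blast
      note rr = r[OF gU]
      have nx: "norm ?x = 1" using gU W(2) by auto
      have "ennreal (K * (c * ?r ^ (?n - 1))) \<le> ennreal K * emeasure sphere_area (L i)"
        using l True \<open>0 < K\<close> by (simp add: L_def ennreal_mult' mult_left_mono)
      moreover have "K * (c * ?r ^ (?n - 1)) = (K1 + K2) * (5 * ?r) ^ (?n - 1)"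
        using c by (simp only: K_def power_mult_distrib) simp
      ultimately have le: "ennreal ((K1 + K2) * (5 * ?r) ^ (?n - 1)) \<le> ennreal K * emeasure sphere_area (L i)"
        by metis
      have pA: "emeasure sphere_area (P i) \<le> ennreal ((K1 + K2) * (5 * ?r) ^ (?n - 1))"
      proof -
        have "emeasure sphere_area (P i) \<le> ennreal (K1 * (5 * ?r) ^ (?n - 1))"
          using sphere_area_cball_le[OF nx, of "5 * ?r"] rr True by (simp add: P_def K1_def mult.assoc)
        also have "\<dots> \<le> ennreal ((K1 + K2) * (5 * ?r) ^ (?n - 1))"
          using K12 rr by (intro ennreal_leI mult_right_mono) auto
        finally show ?thesis .
      qed
      have pC: "hausdorff_cost ?k (P i) \<le> ennreal ((K1 + K2) * (5 * ?r) ^ (?n - 1))"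
      proof -
        have "hausdorff_cost ?k (P i) = ennreal (K2 * (5 * ?r) powr ?k)"
          using True rr by (simp add: P_def hausdorff_cost_def K2_def)
        also have "(5 * ?r) powr ?k = (5 * ?r) ^ (?n - 1)"
          unfolding codim1_def using rr by (intro powr_realpow) auto
        also have "ennreal (K2 * (5 * ?r) ^ (?n - 1)) \<le> ennreal ((K1 + K2) * (5 * ?r) ^ (?n - 1))"
          using K12 rr by (intro ennreal_leI mult_right_mono) auto
        finally show ?thesis .
      qed
      have "compact (P i) \<and> diameter (P i) < \<delta>" using True rr by (simp add: P_def)
      then show ?thesis using order_trans[OF pA le] order_trans[OF pC le] by blast
    qed (use \<delta> in \<open>simp add: P_def\<close>)
    ultimately show "\<exists>L P :: nat \<Rightarrow> 'a set. disjoint_family L \<and> (\<forall>i. compact (L i) \<and> L i \<subseteq> U \<and> diameter (L i) < \<delta> \<and>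
        ennreal q * hausdorff_cost ?k (L i) \<le> emeasure sphere_area (L i)) \<and>
        U \<subseteq> (\<Union>i. P i) \<and> (\<forall>i. compact (P i) \<and> diameter (P i) < \<delta> \<and>
        emeasure sphere_area (P i) \<le> ennreal K * emeasure sphere_area (L i) \<and>
        hausdorff_cost ?k (P i) \<le> ennreal K * emeasure sphere_area (L i))"
      by (intro exI[of _ L] exI[of _ P]) auto
  qed
qed

lemma nn_integral_mono_measure':
  assumes sets: "sets M = sets N" and le: "\<And>A. A \<in> sets M \<Longrightarrow> emeasure M A \<le> emeasure N A"
  shows "(\<integral>\<^sup>+x. f x \<partial>M) \<le> (\<integral>\<^sup>+x. f x \<partial>N)"
proof -
  have space: "space M = space N" using sets by (rule sets_eq_imp_space_eq)
  have sf: "simple_function M g = simple_function N g" for g :: "'a \<Rightarrow> ennreal"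
    by (simp add: simple_function_def sets space)
  show ?thesis unfolding nn_integral_def
  proof (rule SUP_mono)
    fix g assume "g \<in> {g. simple_function M g \<and> g \<le> f}"
    then have g: "simple_function M g" "g \<le> f" by auto
    have "integral\<^sup>S M g \<le> integral\<^sup>S N g"
      unfolding simple_integral_def space[symmetric]
      by (intro sum_mono mult_left_mono le) (use g in \<open>auto simp: simple_function_def\<close>)
    then show "\<exists>h\<in>{g. simple_function N g \<and> g \<le> f}. integral\<^sup>S M g \<le> integral\<^sup>S N h"
      using g sf by auto
  qed
qed

text \<open>The packed sets \<open>L i\<close> make up at least the fraction \<open>1 / (2 K)\<close> of the surface area of \<open>U\<close> and cost at most
  \<open>1 / q\<close> per unit area, while \<open>M\<close> is used again on the open rest; iterating lowers \<open>M\<close> to \<open>1 / q\<close>.\<close>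

lemma hausdorff_pre_le_sphere_area_step:
  fixes q K M \<delta> :: real
  assumes q: "0 < q" and K: "0 < K" and M: "1 / q \<le> M" and \<delta>: "0 < \<delta>"
    and U: "openin (top_of_set (sphere (0::'a::euclidean_space) 1)) U"
    and bnd: "\<And>V::'a set. openin (top_of_set (sphere 0 1)) V \<Longrightarrow>
      hausdorff_pre s \<delta> V \<le> ennreal M * emeasure sphere_area V"
    and disj: "disjoint_family L"
    and L: "\<And>i. compact (L i)" "\<And>i. L i \<subseteq> U" "\<And>i. diameter (L i) < \<delta>"
      "\<And>i. ennreal q * hausdorff_cost s (L i) \<le> emeasure sphere_area (L i)"
    and P: "U \<subseteq> (\<Union>i. P i)" "\<And>i. compact (P i)"
      "\<And>i::nat. emeasure sphere_area (P i) \<le> ennreal K * emeasure sphere_area (L i)"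
  shows "hausdorff_pre s \<delta> U \<le> ennreal (M - (M - 1 / q) / (2 * K)) * emeasure sphere_area U"
proof -
  let ?A = "sphere_area :: 'a measure"
  interpret A: finite_measure ?A by (rule finite_measure_sphere_area)
  have Lb [measurable]: "L i \<in> sets borel" "P i \<in> sets borel" for i
    using L(1) P(2) by (auto intro: borel_closed compact_imp_closed)
  have Ub [measurable]: "V \<in> sets borel" if "openin (top_of_set (sphere (0::'a) 1)) V" for V
    using that by (auto simp: openin_open)
  note U' [measurable] = Ub[OF U]
  have M0: "0 < M" using M q by (meson divide_pos_pos less_le_trans zero_less_one)
  show ?thesis
  proof (cases "measure ?A U = 0")
    case True
    then have "emeasure ?A U = 0" by (simp add: A.emeasure_eq_measure)
    then show ?thesis using bnd[OF U] by simp
  next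
    case False
    then have aU: "0 < measure ?A U" by (simp add: zero_less_measure_iff)
    have "emeasure ?A U \<le> emeasure ?A (\<Union>i. P i)" by (rule emeasure_mono[OF P(1)]) simp
    also have "\<dots> \<le> (\<Sum>i. emeasure ?A (P i))" by (rule emeasure_subadditive_countably) auto
    also have "\<dots> \<le> (\<Sum>i. ennreal K * emeasure ?A (L i))" by (intro suminf_le P(3) summableI)
    also have "\<dots> = ennreal K * emeasure ?A (\<Union>i. L i)"
      using suminf_emeasure[of L ?A] disj by (simp add: image_subset_iff)
    finally have "measure ?A U \<le> K * measure ?A (\<Union>i. L i)"
      using K by (simp add: A.emeasure_eq_measure ennreal_mult'[symmetric])
    \<comment> \<open>The factor 2 makes the inequality strict, so that finitely many of the compact
      sets \<open>L i\<close> already reach this area and the rest of \<open>U\<close> is still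
      relatively open.\<close>
    then have half: "measure ?A U / (2 * K) < measure ?A (\<Union>i. L i)"
      using K aU by (simp add: field_simps)
    let ?W = "\<lambda>N. (\<Union>i<N. L i)"
    have "(\<lambda>N. measure ?A (?W N)) \<longlonglongrightarrow> measure ?A (\<Union>N. ?W N)"
      by (rule A.finite_Lim_measure_incseq) (auto simp: incseq_def intro: less_le_trans)
    also have "(\<Union>N. ?W N) = (\<Union>i. L i)" by auto
    finally have "\<forall>\<^sub>F N in sequentially. measure ?A U / (2 * K) < measure ?A (?W N)"
      using half by (rule order_tendstoD)
    then obtain N where N: "measure ?A U / (2 * K) < measure ?A (?W N)"
      by (auto simp: eventually_sequentially)
    have cW: "compact (?W N)" by (intro compact_UN L) auto
    have oV: "openin (top_of_set (sphere 0 1)) (U - ?W N)"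
    proof -
      obtain O' where "open O'" "U = sphere 0 1 \<inter> O'" using U by (auto simp: openin_open)
      then have "U - ?W N = sphere 0 1 \<inter> (O' - ?W N)" "open (O' - ?W N)"
        using cW by (auto intro: compact_imp_closed)
      then show ?thesis by (auto simp: openin_open)
    qed
    have WU: "?W N \<subseteq> U" using L(2) by auto
    have "ennreal q * hausdorff_pre s \<delta> (?W N) \<le> ennreal q * (\<Sum>i. hausdorff_cost s (if i < N then L i else {}))"
      using L(1,3) \<delta> by (intro mult_left_mono hausdorff_pre_le) (auto split: if_splits intro: compact_imp_bounded)
    also have "(\<Sum>i. hausdorff_cost s (if i < N then L i else {})) = (\<Sum>i<N. hausdorff_cost s (L i))"
      by (subst suminf_finite[of "{..<N}"]) auto
    also have "ennreal q * \<dots> \<le> (\<Sum>i<N. emeasure ?A (L i))"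
      unfolding sum_distrib_left by (intro sum_mono L)
    also have "\<dots> = emeasure ?A (?W N)"
      using disj by (subst sum_emeasure) (auto simp: disjoint_family_on_def)
    finally have "ennreal (1 / q) * (ennreal q * hausdorff_pre s \<delta> (?W N)) \<le> ennreal (1 / q) * emeasure ?A (?W N)"
      by (rule mult_left_mono) simp
    then have pW: "hausdorff_pre s \<delta> (?W N) \<le> ennreal (1 / q) * emeasure ?A (?W N)"
      using q by (simp add: mult.assoc[symmetric] ennreal_mult'[symmetric])
    have "hausdorff_pre s \<delta> U = hausdorff_pre s \<delta> (?W N \<union> (U - ?W N))"
      using WU by (simp add: Un_absorb1)
    also have "\<dots> \<le> hausdorff_pre s \<delta> (?W N) + hausdorff_pre s \<delta> (U - ?W N)"
      by (rule hausdorff_pre_Un_le[OF \<delta>])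
    also have "\<dots> \<le> ennreal (1 / q) * emeasure ?A (?W N) + ennreal M * emeasure ?A (U - ?W N)"
      by (intro add_mono pW bnd oV)
    also have "\<dots> = ennreal (1 / q * measure ?A (?W N) + M * (measure ?A U - measure ?A (?W N)))"
      using q M0 WU by (simp add: A.emeasure_eq_measure A.finite_measure_Diff ennreal_mult'[symmetric]
        ennreal_plus[symmetric] A.finite_measure_mono del: ennreal_plus)
    also have "\<dots> \<le> ennreal ((M - (M - 1 / q) / (2 * K)) * measure ?A U)"
    proof (rule ennreal_leI)
      have "(M - 1 / q) * (measure ?A U / (2 * K)) \<le> (M - 1 / q) * measure ?A (?W N)"
        using N M by (intro mult_left_mono) auto
      then show "1 / q * measure ?A (?W N) + M * (measure ?A U - measure ?A (?W N))
        \<le> (M - (M - 1 / q) / (2 * K)) * measure ?A U"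
        by (simp add: algebra_simps)
    qed
    finally show ?thesis by (simp add: A.emeasure_eq_measure ennreal_mult'')
  qed
qed

text \<open>The cover by the enlarged balls gives a first constant. The infimum \<open>m\<close> of
  all valid constants is itself valid, and as long as it exceeds \<open>1 / q\<close> the packing
  yields a strictly smaller one.\<close>

lemma hausdorff_pre_le_sphere_area:
  assumes n: "2 \<le> DIM('a::euclidean_space)" and q: "0 < q" "q < isodiam TYPE('a)" and \<delta>: "0 < \<delta>"
    and U: "openin (top_of_set (sphere (0::'a) 1)) U"
  shows "ennreal q * hausdorff_pre (codim1 TYPE('a)) \<delta> U \<le> emeasure sphere_area U"
proof -
  let ?k = "codim1 TYPE('a)" and ?A = "sphere_area :: 'a measure"
  let ?op = "openin (top_of_set (sphere (0::'a) 1))"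
  interpret A: finite_measure ?A by (rule finite_measure_sphere_area)
  have Ub [measurable]: "V \<in> sets borel" if "?op V" for V using that by (auto simp: openin_open)
  obtain K where K: "0 < K" and pack: "\<And>(U::'a set) \<delta>. ?op U \<Longrightarrow> 0 < \<delta> \<Longrightarrow>
      \<exists>L P :: nat \<Rightarrow> 'a set. disjoint_family L \<and> (\<forall>i. compact (L i) \<and> L i \<subseteq> U \<and> diameter (L i) < \<delta> \<and>
        ennreal q * hausdorff_cost ?k (L i) \<le> emeasure ?A (L i)) \<and>
        U \<subseteq> (\<Union>i. P i) \<and> (\<forall>i. compact (P i) \<and> diameter (P i) < \<delta> \<and>
        emeasure ?A (P i) \<le> ennreal K * emeasure ?A (L i) \<and>
        hausdorff_cost ?k (P i) \<le> ennreal K * emeasure ?A (L i))"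
    using sphere_packing[OF n q] by metis
  have crude: "hausdorff_pre ?k \<delta> V \<le> ennreal K * emeasure ?A V" if V: "?op V" for V
  proof -
    obtain L P :: "nat \<Rightarrow> 'a set" where LP: "disjoint_family L" "\<And>i. compact (L i)" "\<And>i. L i \<subseteq> V"
      "V \<subseteq> (\<Union>i. P i)" "\<And>i. compact (P i)" "\<And>i. diameter (P i) < \<delta>"
      "\<And>i. hausdorff_cost ?k (P i) \<le> ennreal K * emeasure ?A (L i)"
      using pack[OF V \<delta>] by metis
    have [measurable]: "L i \<in> sets borel" for i using LP(2) by (auto intro: borel_closed compact_imp_closed)
    have "hausdorff_pre ?k \<delta> V \<le> (\<Sum>i. hausdorff_cost ?k (P i))"
      by (rule hausdorff_pre_le) (use LP in \<open>auto intro: compact_imp_bounded\<close>)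
    also have "\<dots> \<le> (\<Sum>i. ennreal K * emeasure ?A (L i))" by (intro suminf_le LP summableI)
    also have "\<dots> = ennreal K * emeasure ?A (\<Union>i. L i)"
      using suminf_emeasure[of L ?A] LP(1) by (simp add: image_subset_iff)
    also have "\<dots> \<le> ennreal K * emeasure ?A V"
      using LP(3) Ub[OF V] by (intro mult_left_mono emeasure_mono) auto
    finally show ?thesis .
  qed
  define S where "S = {M. 1 / q \<le> M \<and> (\<forall>V. ?op V \<longrightarrow> hausdorff_pre ?k \<delta> V \<le> ennreal M * emeasure ?A V)}"
  have "max K (1 / q) \<in> S"
    using crude by (auto simp: S_def intro!: order_trans[OF crude] mult_right_mono ennreal_leI)
  then have Sne: "S \<noteq> {}" by blast
  have Sbd: "bdd_below S" by (rule bdd_belowI[of _ "1 / q"]) (simp add: S_def)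
  define m where "m = Inf S"
  have m1: "1 / q \<le> m" unfolding m_def by (rule cInf_greatest[OF Sne]) (simp add: S_def)
  have mS: "hausdorff_pre ?k \<delta> V \<le> ennreal m * emeasure ?A V" if V: "?op V" for V
  proof -
    have le: "hausdorff_pre ?k \<delta> V \<le> ennreal ((m + e) * measure ?A V)" if e: "0 < e" for e
    proof -
      have "Inf S < m + e" using e by (simp add: m_def)
      then obtain M where M: "M \<in> S" "M < m + e" using cInf_lessD[OF Sne] by blast
      have "hausdorff_pre ?k \<delta> V \<le> ennreal (M * measure ?A V)"
        using M(1) V by (simp add: S_def A.emeasure_eq_measure ennreal_mult'')
      also have "\<dots> \<le> ennreal ((m + e) * measure ?A V)"
        using M(2) by (intro ennreal_leI mult_right_mono) auto
      finally show ?thesis .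
    qed
    have "((\<lambda>e. ennreal ((m + e) * measure ?A V)) \<longlongrightarrow> ennreal ((m + 0) * measure ?A V)) (at_right 0)"
      by (intro tendsto_ennrealI tendsto_intros)
    then have "hausdorff_pre ?k \<delta> V \<le> ennreal ((m + 0) * measure ?A V)"
      by (rule tendsto_lowerbound) (auto intro!: eventually_mono[OF eventually_at_right_less] le)
    then show ?thesis by (simp add: A.emeasure_eq_measure ennreal_mult'')
  qed
  have "m \<le> 1 / q"
  proof (rule ccontr)
    assume "\<not> m \<le> 1 / q"
    then have gt: "1 / q < m" by simp
    \<comment> \<open>\<open>K' \<ge> 1\<close> keeps the improved constant at least
      \<open>1 / q\<close>.\<close>
    define K' where "K' = max K 1"
    have K': "0 < K'" "K \<le> K'" "1 \<le> K'" using K by (auto simp: K'_def)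
    have "m - (m - 1 / q) / (2 * K') \<in> S"
      unfolding S_def
    proof (intro CollectI conjI allI impI)
      have "(m - 1 / q) / (2 * K') \<le> (m - 1 / q) / 1" using gt K' by (intro divide_left_mono) auto
      then show "1 / q \<le> m - (m - 1 / q) / (2 * K')" by simp
      fix V assume V: "?op V"
      obtain L P :: "nat \<Rightarrow> 'a set" where LP: "disjoint_family L" "\<And>i. compact (L i)" "\<And>i. L i \<subseteq> V"
        "\<And>i. diameter (L i) < \<delta>" "\<And>i. ennreal q * hausdorff_cost ?k (L i) \<le> emeasure ?A (L i)"
        "V \<subseteq> (\<Union>i. P i)" "\<And>i. compact (P i)"
        "\<And>i. emeasure ?A (P i) \<le> ennreal K * emeasure ?A (L i)"
        using pack[OF V \<delta>] by metis
      have "emeasure ?A (P i) \<le> ennreal K' * emeasure ?A (L i)" for i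
        using LP(8)[of i] K'(2) by (meson ennreal_leI mult_right_mono order_trans zero_le)
      then show "hausdorff_pre ?k \<delta> V \<le> ennreal (m - (m - 1 / q) / (2 * K')) * emeasure ?A V"
        by (intro hausdorff_pre_le_sphere_area_step[OF q(1) K'(1) m1 \<delta> V mS LP(1-5) LP(6,7)])
    qed
    then have "m \<le> m - (m - 1 / q) / (2 * K')" unfolding m_def using Sbd by (rule cInf_lower)
    moreover have "0 < (m - 1 / q) / (2 * K')" using gt K' by (intro divide_pos_pos) auto
    ultimately show False by linarith
  qed
  then have "m = 1 / q" using m1 by simp
  then have "ennreal q * hausdorff_pre ?k \<delta> U \<le> ennreal q * (ennreal (1 / q) * emeasure ?A U)"
    using mS[OF U] by (intro mult_left_mono) auto
  also have "\<dots> = emeasure ?A U"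
    using q by (simp add: mult.assoc[symmetric] ennreal_mult'[symmetric])
  finally show ?thesis .
qed

text \<open>For relatively open sets \<open>q\<close> tends to \<open>isodiam\<close>; outer
  regularity of the finite area measure extends the inequality to Borel sets.\<close>

lemma hausdorff_le_sphere_area:
  fixes B :: "'a::euclidean_space set"
  assumes n: "2 \<le> DIM('a)" and B: "B \<in> sets borel" "B \<subseteq> sphere 0 1"
  shows "ennreal (isodiam TYPE('a)) * hausdorff_outer (codim1 TYPE('a)) B \<le> emeasure sphere_area B"
proof -
  let ?k = "codim1 TYPE('a)" and ?A = "sphere_area :: 'a measure"
  interpret A: finite_measure ?A by (rule finite_measure_sphere_area)
  have op: "ennreal (isodiam TYPE('a)) * hausdorff_outer ?k U \<le> emeasure ?A U"
    if U: "openin (top_of_set (sphere 0 1)) U" for U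
  proof -
    have 1: "ennreal q * hausdorff_outer ?k U \<le> emeasure ?A U" if q: "0 < q" "q < isodiam TYPE('a)" for q
      unfolding hausdorff_outer_SUP_seq SUP_mult_left_ennreal
      by (intro SUP_least hausdorff_pre_le_sphere_area[OF n q _ U]) simp
    have \<kappa>: "0 < isodiam TYPE('a)" by (rule isodiam_pos[OF n])
    \<comment> \<open>A single \<open>q\<close> already shows that the Hausdorff measure is finite,
      so the limit can be taken among real numbers.\<close>
    have "ennreal (isodiam TYPE('a) / 2) * hausdorff_outer ?k U < top"
      using 1[of "isodiam TYPE('a) / 2"] \<kappa> A.emeasure_finite[of U]
      by (simp add: top.not_eq_extremum[symmetric] top_unique) (auto simp: top_unique)
    then have "hausdorff_outer ?k U \<noteq> top" using \<kappa> by (auto simp: ennreal_mult_less_top)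
    then obtain h where h: "0 \<le> h" "hausdorff_outer ?k U = ennreal h"
      by (cases "hausdorff_outer ?k U") auto
    have "((\<lambda>q. ennreal (q * h)) \<longlongrightarrow> ennreal (isodiam TYPE('a) * h)) (at_left (isodiam TYPE('a)))"
      by (intro tendsto_ennrealI tendsto_intros)
    moreover have "\<forall>\<^sub>F q in at_left (isodiam TYPE('a)). ennreal (q * h) \<le> emeasure ?A U"
      using \<kappa> 1 h
      by (auto simp: eventually_at_left_field ennreal_mult' intro!: exI[of _ 0])
    ultimately have "ennreal (isodiam TYPE('a) * h) \<le> emeasure ?A U"
      by (rule tendsto_upperbound) simp
    then show ?thesis using h \<kappa> by (simp add: ennreal_mult')
  qed
  have "emeasure ?A B = (INF U \<in> {U. B \<subseteq> U \<and> open U}. emeasure ?A U)"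
    by (rule outer_regular) (use B finite_measure_sphere_area in \<open>auto simp: A.emeasure_eq_measure\<close>)
  also have "\<dots> \<ge> ennreal (isodiam TYPE('a)) * hausdorff_outer ?k B"
  proof (rule INF_greatest, clarify)
    fix U :: "'a set" assume U: "B \<subseteq> U" "open U"
    have "ennreal (isodiam TYPE('a)) * hausdorff_outer ?k B
        \<le> ennreal (isodiam TYPE('a)) * hausdorff_outer ?k (sphere 0 1 \<inter> U)"
      using U B by (intro mult_left_mono hausdorff_outer_mono) auto
    also have "\<dots> \<le> emeasure ?A (sphere 0 1 \<inter> U)"
      by (rule op) (use U in \<open>auto simp: openin_open\<close>)
    also have "\<dots> \<le> emeasure ?A U" by (rule emeasure_mono) (use U in auto)
    finally show "ennreal (isodiam TYPE('a)) * hausdorff_outer ?k B \<le> emeasure ?A U" .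
  qed
  finally show ?thesis .
qed

section \<open>Polar coordinates\<close>

lemma emeasure_cone_lessThan:
  fixes B :: "'a::euclidean_space set"
  assumes [measurable]: "B \<in> sets borel" and b: "0 \<le> b"
  shows "emeasure lborel {x. sgn x \<in> B \<and> norm x < b} = ennreal (b ^ DIM('a) / real DIM('a)) * emeasure sphere_area B"
proof (cases "b = 0")
  case True then show ?thesis by (simp add: zero_power)
next
  case False
  with b have b: "0 < b" by simp
  have "emeasure lborel {x. sgn x \<in> B \<and> norm x < b}
     = ennreal (b ^ DIM('a)) * emeasure lborel {x. b *\<^sub>R x \<in> {x. sgn x \<in> B \<and> norm x < b}}"
    by (rule emeasure_lborel_scale_vimage) (use b in measurable)
  also have "{x. b *\<^sub>R x \<in> {x. sgn x \<in> B \<and> norm x < b}} = {x. sgn x \<in> B \<and> norm x < 1}"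
    using b by (auto simp: sgn_scaleR)
  also have "ennreal (b ^ DIM('a)) = ennreal (b ^ DIM('a) / real DIM('a)) * of_nat DIM('a)"
    using b by (simp add: ennreal_of_nat_eq_real_of_nat ennreal_mult'[symmetric])
  finally show ?thesis by (simp add: emeasure_sphere_area mult.assoc)
qed

definition radial_measure :: "nat \<Rightarrow> real measure" where
  "radial_measure n = density lborel (\<lambda>r. ennreal (r ^ (n - 1)) * indicator {0<..} r)"

lemma sets_radial_measure [simp, measurable_cong]: "sets (radial_measure n) = sets borel"
  and space_radial_measure [simp]: "space (radial_measure n) = UNIV"
  by (auto simp: radial_measure_def)

lemma emeasure_radial_measure_lessThan:
  assumes "0 < n" shows "emeasure (radial_measure n) {..<b} = ennreal (max 0 b ^ n / real n)"
proof -
  have "emeasure (radial_measure n) {..<b}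
      = (\<integral>\<^sup>+r. ennreal (r ^ (n - 1)) * indicator {0<..} r * indicator {..<b} r \<partial>lborel)"
    unfolding radial_measure_def by (subst emeasure_density) auto
  also have "\<dots> = (\<integral>\<^sup>+r. ennreal (r ^ (n - 1)) * indicator {0<..<max 0 b} r \<partial>lborel)"
    by (intro nn_integral_cong) (auto simp: indicator_def)
  also have "\<dots> = ennreal (max 0 b ^ n / real n)"
    by (rule nn_integral_FTC_power) (use assms in auto)
  finally show ?thesis .
qed

lemma sigma_finite_radial_measure: "0 < n \<Longrightarrow> sigma_finite_measure (radial_measure n)"
  by standard (auto intro!: exI[of _ "range (\<lambda>k::nat. {..<real k})"] simp: emeasure_radial_measure_lessThan
      intro: reals_Archimedean2)

text \<open>For fixed \<open>B\<close> both sides are measures in \<open>I\<close>; they agree on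
  half-lines by the scaling of truncated cones.\<close>

lemma emeasure_cone_radial:
  fixes B :: "'a::euclidean_space set"
  assumes [measurable]: "B \<in> sets borel" "I \<in> sets borel"
  shows "emeasure lborel {x. sgn x \<in> B \<and> norm x \<in> I} = emeasure sphere_area B * emeasure (radial_measure DIM('a)) I"
proof -
  let ?n = "DIM('a)"
  interpret A: finite_measure "sphere_area :: 'a measure" by (rule finite_measure_sphere_area)
  define M where "M = distr (density lborel (indicator {x::'a. sgn x \<in> B})) borel norm"
  define N where "N = density (radial_measure ?n) (\<lambda>_. emeasure sphere_area B)"
  have M: "emeasure M J = emeasure lborel {x. sgn x \<in> B \<and> norm x \<in> J}" if [measurable]: "J \<in> sets borel" for J
  proof -
    have [measurable]: "norm -` J \<in> sets (borel :: 'a measure)"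
      by (rule measurable_sets_borel[OF _ that]) simp
    have "emeasure M J = (\<integral>\<^sup>+x. indicator {x::'a. sgn x \<in> B} x * indicator (norm -` J) x \<partial>lborel)"
      unfolding M_def by (subst emeasure_distr) (simp_all add: emeasure_density)
    also have "\<dots> = (\<integral>\<^sup>+x. indicator {x. sgn x \<in> B \<and> norm x \<in> J} x \<partial>lborel)"
      by (intro nn_integral_cong) (auto simp: indicator_def)
    also have "\<dots> = emeasure lborel {x. sgn x \<in> B \<and> norm x \<in> J}"
      by (rule nn_integral_indicator) measurable
    finally show ?thesis .
  qed
  have N: "emeasure N J = emeasure sphere_area B * emeasure (radial_measure ?n) J" if "J \<in> sets borel" for J
    unfolding N_def using that by (subst emeasure_density) (auto simp: nn_integral_cmult_indicator)
  have "M = N"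
  proof (rule measure_eqI_generator_eq[where \<Omega> = UNIV and E = "range lessThan" and A = "\<lambda>k::nat. {..<real k}"])
    show "Int_stable (range (lessThan :: real \<Rightarrow> _))"
    proof -
      have "{..<a} \<inter> {..<b} = {..<min a b}" for a b :: real by auto
      then show ?thesis by (auto simp: Int_stable_def)
    qed
    show "sets M = sigma_sets UNIV (range lessThan)" "sets N = sigma_sets UNIV (range lessThan)"
      by (simp_all add: M_def N_def borel_Iio)
    show "(\<Union>k::nat. {..<real k}) = UNIV" by (auto intro: reals_Archimedean2)
    fix X assume "X \<in> range (lessThan :: real \<Rightarrow> _)"
    then obtain b where X: "X = {..<b}" by auto
    have eq: "{x. sgn x \<in> B \<and> norm x < b} = {x. sgn x \<in> B \<and> norm x < max 0 b}"
      by (auto simp: max_def dest: le_less_trans[OF norm_ge_zero])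
    show "emeasure M X = emeasure N X"
      using emeasure_cone_lessThan[of B "max 0 b"] by (simp add: X M N eq emeasure_radial_measure_lessThan mult.commute)
  next
    fix k :: nat
    show "emeasure M {..<real k} \<noteq> \<infinity>"
      using emeasure_cone_lessThan[of B "real k"] by (simp add: M ennreal_mult_eq_top_iff)
  qed auto
  then show ?thesis using M[of I] N[of I] by simp
qed

lemma distr_lborel_polar:
  "sphere_area \<Otimes>\<^sub>M radial_measure DIM('a) = distr lborel (borel \<Otimes>\<^sub>M borel) (\<lambda>x::'a::euclidean_space. (sgn x, norm x))"
proof (rule pair_measure_eqI)
  interpret A: finite_measure "sphere_area :: 'a measure" by (rule finite_measure_sphere_area)
  show "sigma_finite_measure (sphere_area :: 'a measure)" ..
  show "sigma_finite_measure (radial_measure DIM('a))" by (rule sigma_finite_radial_measure) simp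
  show "sets (sphere_area \<Otimes>\<^sub>M radial_measure DIM('a)) = sets (distr lborel (borel \<Otimes>\<^sub>M borel) (\<lambda>x::'a. (sgn x, norm x)))"
    by (simp cong: sets_pair_measure_cong)
  fix B :: "'a set" and I assume "B \<in> sets sphere_area" "I \<in> sets (radial_measure DIM('a))"
  then have [measurable]: "B \<in> sets borel" "I \<in> sets borel" by auto
  have "emeasure (distr lborel (borel \<Otimes>\<^sub>M borel) (\<lambda>x::'a. (sgn x, norm x))) (B \<times> I)
     = emeasure lborel {x. sgn x \<in> B \<and> norm x \<in> I}"
    by (subst emeasure_distr) (auto simp: vimage_def intro!: arg_cong[where f="emeasure lborel"])
  then show "emeasure sphere_area B * emeasure (radial_measure DIM('a)) I
     = emeasure (distr lborel (borel \<Otimes>\<^sub>M borel) (\<lambda>x::'a. (sgn x, norm x))) (B \<times> I)"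
    by (simp add: emeasure_cone_radial)
qed

text \<open>The integral over the sphere of radius \<open>r\<close> in polar coordinates. Integrated
  over \<open>r\<close> it returns the volume integral with constant 1; its comparison with
  Hausdorff measure is where \<open>isodiam\<close> enters on the source side.\<close>

definition sphere_int :: "'a::euclidean_space \<Rightarrow> ('a \<Rightarrow> ennreal) \<Rightarrow> real \<Rightarrow> ennreal" where
  "sphere_int x0 \<psi> r = ennreal (r ^ (DIM('a) - 1)) * (\<integral>\<^sup>+\<theta>. \<psi> (x0 + r *\<^sub>R \<theta>) \<partial>sphere_area)"

lemma borel_measurable_sphere_int [measurable]:
  fixes \<psi> :: "'a::euclidean_space \<Rightarrow> ennreal"
  assumes [measurable]: "\<psi> \<in> borel_measurable borel"
  shows "sphere_int x0 \<psi> \<in> borel_measurable borel"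
proof -
  interpret A: finite_measure "sphere_area :: 'a measure" by (rule finite_measure_sphere_area)
  show ?thesis unfolding sphere_int_def[abs_def] by measurable
qed

lemma nn_integral_polar:
  fixes \<psi> :: "'a::euclidean_space \<Rightarrow> ennreal"
  assumes [measurable]: "\<psi> \<in> borel_measurable borel"
  shows "(\<integral>\<^sup>+x. \<psi> x \<partial>lborel) = (\<integral>\<^sup>+r. sphere_int x0 \<psi> r * indicator {0<..} r \<partial>lborel)"
proof -
  interpret A: finite_measure "sphere_area :: 'a measure" by (rule finite_measure_sphere_area)
  interpret R: sigma_finite_measure "radial_measure DIM('a)" by (rule sigma_finite_radial_measure) simp
  interpret P: pair_sigma_finite "sphere_area :: 'a measure" "radial_measure DIM('a)" ..
  have "(\<integral>\<^sup>+x. \<psi> x \<partial>lborel) = (\<integral>\<^sup>+x. \<psi> (x0 + x) \<partial>lborel)"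
    by (rule nn_integral_lborel_translate[symmetric]) measurable
  also have "\<dots> = (\<integral>\<^sup>+x. (\<lambda>(\<theta>, r). \<psi> (x0 + r *\<^sub>R \<theta>)) (sgn x, norm x) \<partial>lborel)"
  proof -
    have "norm x *\<^sub>R sgn x = x" for x :: 'a by (cases "x = 0") (auto simp: sgn_div_norm)
    then show ?thesis by simp
  qed
  also have "\<dots> = (\<integral>\<^sup>+z. (\<lambda>(\<theta>, r). \<psi> (x0 + r *\<^sub>R \<theta>)) z \<partial>(sphere_area \<Otimes>\<^sub>M radial_measure DIM('a)))"
    unfolding distr_lborel_polar by (subst nn_integral_distr) measurable
  also have "\<dots> = (\<integral>\<^sup>+r. (\<integral>\<^sup>+\<theta>. \<psi> (x0 + r *\<^sub>R \<theta>) \<partial>sphere_area) \<partial>radial_measure DIM('a))"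
    by (subst P.nn_integral_snd[symmetric]) auto
  also have "\<dots> = (\<integral>\<^sup>+r. sphere_int x0 \<psi> r * indicator {0<..} r \<partial>lborel)"
    unfolding radial_measure_def
    by (subst nn_integral_density) (auto simp: sphere_int_def mult_ac intro!: nn_integral_cong)
  finally show ?thesis .
qed

text \<open>The dilation \<open>\<theta> \<mapsto> x0 + r *\<^sub>R \<theta>\<close> is Lipschitz
  with constant \<open>r\<close>, which carries the estimate from the unit sphere to every
  sphere.\<close>

lemma hausdorff_sphere_le:
  fixes B :: "'a::euclidean_space set"
  assumes n: "2 \<le> DIM('a)" and [measurable]: "B \<in> sets borel" and r: "0 < r"
  shows "ennreal (isodiam TYPE('a)) * hausdorff_outer (codim1 TYPE('a)) (B \<inter> sphere x0 r)
    \<le> sphere_int x0 (indicator B) r"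
proof -
  let ?k = "codim1 TYPE('a)"
  let ?C = "{\<theta>. x0 + r *\<^sub>R \<theta> \<in> B} \<inter> sphere 0 1"
  have "B \<inter> sphere x0 r \<subseteq> (\<lambda>\<theta>. x0 + r *\<^sub>R \<theta>) ` ?C"
  proof
    fix x assume x: "x \<in> B \<inter> sphere x0 r"
    then have "x = x0 + r *\<^sub>R ((1 / r) *\<^sub>R (x - x0))" "norm ((1 / r) *\<^sub>R (x - x0)) = 1"
      using r by (auto simp: dist_norm norm_minus_commute)
    then show "x \<in> (\<lambda>\<theta>. x0 + r *\<^sub>R \<theta>) ` ?C"
      using x by (intro image_eqI[of _ _ "(1 / r) *\<^sub>R (x - x0)"]) auto
  qed
  then have "hausdorff_outer ?k (B \<inter> sphere x0 r) \<le> hausdorff_outer ?k ((\<lambda>\<theta>. x0 + r *\<^sub>R \<theta>) ` ?C)"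
    by (rule hausdorff_outer_mono)
  also have "\<dots> \<le> ennreal (r powr ?k) * hausdorff_outer ?k ?C"
    by (rule hausdorff_outer_lipschitz_image)
       (use r in \<open>auto simp: dist_norm scaleR_diff_right[symmetric]\<close>)
  also have "r powr ?k = r ^ (DIM('a) - 1)" unfolding codim1_def using r by (rule powr_realpow)
  finally have "ennreal (isodiam TYPE('a)) * hausdorff_outer ?k (B \<inter> sphere x0 r)
     \<le> ennreal (isodiam TYPE('a)) * (ennreal (r ^ (DIM('a) - 1)) * hausdorff_outer ?k ?C)"
    by (rule mult_left_mono) simp
  also have "\<dots> = ennreal (r ^ (DIM('a) - 1)) * (ennreal (isodiam TYPE('a)) * hausdorff_outer ?k ?C)"
    by (simp add: mult_ac)
  also have "\<dots> \<le> ennreal (r ^ (DIM('a) - 1)) * emeasure sphere_area ?C"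
    by (intro mult_left_mono hausdorff_le_sphere_area[OF n]) auto
  also have "emeasure sphere_area ?C = (\<integral>\<^sup>+\<theta>. indicator B (x0 + r *\<^sub>R \<theta>) \<partial>sphere_area)"
    by (subst emeasure_sphere_area_Int_sphere)
       (auto simp: nn_integral_indicator[symmetric] indicator_def simp del: nn_integral_indicator
         intro!: nn_integral_cong)
  finally show ?thesis by (simp add: sphere_int_def)
qed

text \<open>Admissibility bounds surface integrals from below, so this direction of the comparison
  is the one that transfers it to polar integrals.\<close>

lemma nn_integral_hausdorff_sphere_le:
  fixes \<psi> :: "'a::euclidean_space \<Rightarrow> ennreal"
  assumes n: "2 \<le> DIM('a)" and \<psi> [measurable]: "\<psi> \<in> borel_measurable borel" and r: "0 < r"
  shows "ennreal (isodiam TYPE('a)) * (\<integral>\<^sup>+x. \<psi> x * indicator (sphere x0 r) x \<partial>hausdorff_measure (codim1 TYPE('a)))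
    \<le> sphere_int x0 \<psi> r"
proof -
  let ?H = "hausdorff_measure (codim1 TYPE('a)) :: 'a measure" and ?\<kappa> = "ennreal (isodiam TYPE('a))"
  have meas [measurable]: "(\<lambda>\<theta>::'a. x0 + r *\<^sub>R \<theta>) \<in> borel_measurable borel" by measurable
  define M where "M = density ?H (\<lambda>x. ?\<kappa> * indicator (sphere x0 r) x)"
  define N where "N = density (distr sphere_area borel (\<lambda>\<theta>. x0 + r *\<^sub>R \<theta>)) (\<lambda>_. ennreal (r ^ (DIM('a) - 1)))"
  have "(\<integral>\<^sup>+x. \<psi> x \<partial>M) \<le> (\<integral>\<^sup>+x. \<psi> x \<partial>N)"
  proof (rule nn_integral_mono_measure')
    show "sets M = sets N" by (simp add: M_def N_def)
    fix B assume "B \<in> sets M"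
    then have B [measurable]: "B \<in> sets borel" by (simp add: M_def)
    have "emeasure M B = (\<integral>\<^sup>+x. ?\<kappa> * indicator (B \<inter> sphere x0 r) x \<partial>?H)"
      unfolding M_def by (subst emeasure_density) (auto intro!: nn_integral_cong simp: indicator_def)
    also have "\<dots> = ?\<kappa> * hausdorff_outer (codim1 TYPE('a)) (B \<inter> sphere x0 r)"
      by (subst nn_integral_cmult_indicator) (auto simp: emeasure_hausdorff_measure)
    also have "\<dots> \<le> sphere_int x0 (indicator B) r" by (rule hausdorff_sphere_le[OF n B r])
    also have "\<dots> = (\<integral>\<^sup>+x. indicator B x \<partial>N)"
      unfolding N_def
      by (subst nn_integral_density)
         (auto simp: nn_integral_cmult nn_integral_distr sphere_int_def simp del: nn_integral_indicator)
    also have "\<dots> = emeasure N B"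
      by (rule nn_integral_indicator) (simp add: N_def)
    finally show "emeasure M B \<le> emeasure N B" .
  qed
  also have "(\<integral>\<^sup>+x. \<psi> x \<partial>N) = sphere_int x0 \<psi> r"
    unfolding N_def by (subst nn_integral_density) (auto simp: nn_integral_cmult nn_integral_distr sphere_int_def)
  also have "(\<integral>\<^sup>+x. \<psi> x \<partial>M) = ?\<kappa> * (\<integral>\<^sup>+x. \<psi> x * indicator (sphere x0 r) x \<partial>?H)"
  proof -
    have u [measurable]: "indicator (sphere x0 r) \<in> borel_measurable ?H"
      by (rule borel_measurable_indicator) simp
    have \<psi>H [measurable]: "\<psi> \<in> borel_measurable ?H" using \<psi> by (simp cong: measurable_cong_sets)
    have "(\<integral>\<^sup>+x. \<psi> x \<partial>M) = (\<integral>\<^sup>+x. ?\<kappa> * indicator (sphere x0 r) x * \<psi> x \<partial>?H)"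
      unfolding M_def by (rule nn_integral_density) measurable
    also have "\<dots> = (\<integral>\<^sup>+x. ?\<kappa> * (\<psi> x * indicator (sphere x0 r) x) \<partial>?H)"
      by (simp add: mult_ac)
    also have "\<dots> = ?\<kappa> * (\<integral>\<^sup>+x. \<psi> x * indicator (sphere x0 r) x \<partial>?H)"
      by (rule nn_integral_cmult) measurable
    finally show ?thesis .
  qed
  finally show ?thesis .
qed

section \<open>The modulus of a family of spheres\<close>

lemma epowr_ennreal [simp]: "0 \<le> r \<Longrightarrow> epowr (ennreal r) a = ennreal (r powr a)"
  by (simp add: epowr_def)

lemma epowr_top [simp]: "epowr top a = top"
  by (simp add: epowr_def)

lemma epowr_zero [simp]: "epowr 0 a = 0"
  by (simp add: epowr_def)

lemma epowr_1_left [simp]: "epowr 1 a = 1"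
  using epowr_ennreal[of 1 a] by simp

lemma borel_measurable_epowr [measurable]: "(\<lambda>x. epowr x a) \<in> borel_measurable borel"
  unfolding epowr_def[abs_def] infinity_ennreal_def by measurable

lemma epowr_mono: "0 \<le> a \<Longrightarrow> x \<le> y \<Longrightarrow> epowr x a \<le> epowr y a"
  by (cases x; cases y) (auto intro!: ennreal_leI powr_mono2 simp: top_unique)

lemma epowr_epowr: "epowr (epowr x a) b = epowr x (a * b)"
  by (cases x) (auto simp: powr_powr)

lemma epowr_power: "0 < k \<Longrightarrow> epowr x a ^ k = epowr x (a * real k)"
proof (cases x)
  case (real r)
  assume k: "0 < k"
  have "(r powr a) ^ k = r powr (a * real k)"
    using powr_realpow[of "r powr a" k] k by (cases "r = 0") (auto simp: powr_powr zero_power)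
  then show ?thesis using real by (simp add: ennreal_power)
qed (simp add: power_eq_top_ennreal)

lemma epowr_one [simp]: "epowr x 1 = x"
  by (cases x) auto

lemma power_epowr: "0 < k \<Longrightarrow> x ^ k = epowr x (real k)"
  using epowr_power[of k x 1] by simp

lemma epowr_mult: "epowr (x * y) a = epowr x a * epowr y a"
proof (cases "x = top \<or> y = top")
  case False
  then show ?thesis
    by (cases x; cases y) (auto simp: ennreal_mult[symmetric] powr_mult)
next
  case True
  have pos: "0 < epowr z a" if "z \<noteq> 0" for z
    using that by (cases z) (auto simp: ennreal_zero_less_top)
  show ?thesis
    using True pos[of x] pos[of y]
    by (cases "x = 0"; cases "y = 0") (auto simp: ennreal_mult_top ennreal_top_mult)
qed

lemma epowr_divide: "0 < a \<Longrightarrow> 0 < c \<Longrightarrow> epowr (x / ennreal c) a = epowr x a / ennreal (c powr a)"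
proof -
  assume a: "0 < a" and c: "0 < c"
  have "x / ennreal c = x * ennreal (1 / c)"
    using c by (simp add: divide_ennreal_def inverse_ennreal inverse_eq_divide)
  moreover have "epowr x a / ennreal (c powr a) = epowr x a * ennreal ((1 / c) powr a)"
    using c by (simp add: divide_ennreal_def inverse_ennreal powr_divide inverse_eq_divide)
  ultimately show ?thesis using c by (simp add: epowr_mult)
qed

text \<open>Young's inequality for \<open>x / Q powr (1 / s)\<close> and
  \<open>Q powr (1 / s)\<close>; the second exponent becomes
  \<open>\<alpha> / s = 1 / (s - 1)\<close>. The extended cases agree with the conventions: a
  nonzero \<open>x\<close> over \<open>Q = 0\<close> gives infinity, and
  \<open>Q = \<infinity>\<close> makes the last summand infinite.\<close>

lemma Young_ennreal:
  fixes x Q :: ennreal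
  assumes s: "1 < s" and conj: "1 / s + 1 / \<alpha> = 1"
  shows "x \<le> ennreal (1 / s) * (epowr x s / Q) + ennreal (1 / \<alpha>) * epowr Q (1 / (s - 1))"
proof -
  have "1 / \<alpha> = 1 - 1 / s" "1 / s < 1" using s conj by auto
  then have a: "0 < 1 / \<alpha>" by simp
  then have \<alpha>0: "0 < \<alpha>" by simp
  have \<alpha>s: "\<alpha> = s / (s - 1)" using conj \<alpha>0 s by (simp add: field_simps)
  have \<alpha>1: "1 < \<alpha>" using s by (simp add: \<alpha>s)
  have s0: "0 < 1 / s" using s by simp
  consider "Q = top" | "x = 0" | "Q = 0" "x \<noteq> 0" | "Q \<noteq> top" "Q \<noteq> 0" "x = top"
    | "Q \<noteq> top" "Q \<noteq> 0" "x \<noteq> top" "x \<noteq> 0" by blast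
  then show ?thesis
  proof cases
    case 1 then show ?thesis using a by (simp add: ennreal_mult_top)
  next
    case 2 then show ?thesis by simp
  next
    case 3
    then have "epowr x s \<noteq> 0" by (cases x) auto
    then have "epowr x s / Q = top" using 3 by simp
    then show ?thesis using s0 by (simp add: ennreal_mult_top)
  next
    case 4
    then have "epowr x s / Q = top" by (simp add: ennreal_top_divide)
    then show ?thesis using s0 by (simp add: ennreal_mult_top)
  next
    case 5
    obtain u v where u: "x = ennreal u" "0 < u" and v: "Q = ennreal v" "0 < v"
      using 5 by (cases x; cases Q) (auto simp: less_le)
    have "u = (u / v powr (1 / s)) * v powr (1 / s)" using v by simp
    also have "\<dots> \<le> (u / v powr (1 / s)) powr s / s + (v powr (1 / s)) powr \<alpha> / \<alpha>"
      using s \<alpha>1 conj u v by (intro Youngs_inequality) auto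
    also have "(u / v powr (1 / s)) powr s = u powr s / v"
      using u v s by (simp add: powr_divide powr_powr)
    also have "(v powr (1 / s)) powr \<alpha> = v powr (1 / (s - 1))"
      using s by (simp add: powr_powr \<alpha>s)
    finally have le: "u \<le> u powr s / v / s + v powr (1 / (s - 1)) / \<alpha>" .
    have "ennreal (1 / s) * (epowr x s / Q) + ennreal (1 / \<alpha>) * epowr Q (1 / (s - 1))
       = ennreal (u powr s / v / s + v powr (1 / (s - 1)) / \<alpha>)"
      using u v s \<alpha>0 by (simp add: divide_ennreal ennreal_mult'[symmetric])
    then show ?thesis using le u(1) by (metis ennreal_leI)
  qed
qed

lemma AE_sphere_area: "AE \<theta> in (sphere_area :: 'a::euclidean_space measure). norm \<theta> = 1"
proof (rule AE_I)
  have "emeasure sphere_area ((UNIV - sphere (0::'a) 1) \<inter> sphere 0 1) = emeasure sphere_area (UNIV - sphere (0::'a) 1)"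
    by (rule emeasure_sphere_area_Int_sphere) simp
  then show "emeasure sphere_area (UNIV - sphere (0::'a) 1) = 0" by (simp add: Diff_Int_distrib2)
qed (auto simp: Compl_eq_Diff_UNIV[symmetric])

lemma nn_integral_radial:
  fixes \<psi> :: "'a::euclidean_space \<Rightarrow> ennreal"
  assumes [measurable]: "\<psi> \<in> borel_measurable borel" "h \<in> borel_measurable borel"
  shows "(\<integral>\<^sup>+x. \<psi> x * h (dist x x0) \<partial>lborel) = (\<integral>\<^sup>+r. sphere_int x0 \<psi> r * h r * indicator {0<..} r \<partial>lborel)"
proof -
  have "sphere_int x0 (\<lambda>x. \<psi> x * h (dist x x0)) r * indicator {0<..} r
      = sphere_int x0 \<psi> r * h r * indicator {0<..} r" for r
  proof (cases "0 < r")
    case True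
    have "(\<integral>\<^sup>+\<theta>. \<psi> (x0 + r *\<^sub>R \<theta>) * h (dist (x0 + r *\<^sub>R \<theta>) x0) \<partial>sphere_area)
       = (\<integral>\<^sup>+\<theta>. \<psi> (x0 + r *\<^sub>R \<theta>) * h r \<partial>sphere_area)"
      using AE_sphere_area True by (intro nn_integral_cong_AE) (auto elim!: eventually_mono simp: dist_norm)
    also have "\<dots> = (\<integral>\<^sup>+\<theta>. \<psi> (x0 + r *\<^sub>R \<theta>) \<partial>sphere_area) * h r"
      by (rule nn_integral_multc) measurable
    finally show ?thesis by (simp add: sphere_int_def mult_ac)
  qed simp
  then show ?thesis by (subst nn_integral_polar[of _ x0]) simp_all
qed

lemma nn_integral_ring:
  fixes \<psi> :: "'a::euclidean_space \<Rightarrow> ennreal"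
  assumes [measurable]: "\<psi> \<in> borel_measurable borel" and "0 \<le> a"
  shows "(\<integral>\<^sup>+x. \<psi> x * indicator {x. a < dist x x0 \<and> dist x x0 < b} x \<partial>lborel)
    = (\<integral>\<^sup>+r. sphere_int x0 \<psi> r * indicator {a<..<b} r \<partial>lborel)"
proof -
  have "(\<integral>\<^sup>+x. \<psi> x * indicator {x. a < dist x x0 \<and> dist x x0 < b} x \<partial>lborel)
     = (\<integral>\<^sup>+x. \<psi> x * indicator {a<..<b} (dist x x0) \<partial>lborel)"
    by (intro nn_integral_cong) (auto simp: indicator_def)
  also have "\<dots> = (\<integral>\<^sup>+r. sphere_int x0 \<psi> r * indicator {a<..<b} r * indicator {0<..} r \<partial>lborel)"
    by (rule nn_integral_radial) auto
  also have "\<dots> = (\<integral>\<^sup>+r. sphere_int x0 \<psi> r * indicator {a<..<b} r \<partial>lborel)"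
    using assms by (intro nn_integral_cong) (auto simp: indicator_def)
  finally show ?thesis .
qed

lemma surface_integral_sphere_le:
  fixes \<psi> :: "'a::euclidean_space \<Rightarrow> ennreal"
  assumes n: "2 \<le> DIM('a)" and \<psi>: "\<psi> \<in> borel_measurable borel" and r: "0 < r"
  shows "ennreal (isodiam TYPE('a)) * surface_integral \<psi> (indicator (sphere x0 r)) \<le> sphere_int x0 \<psi> r"
  using nn_integral_hausdorff_sphere_le[OF n \<psi> r, of x0]
  unfolding surface_integral_def codim1_def by simp

lemma ennreal_mult_bounded_imp_zero:
  fixes x c :: ennreal
  assumes c: "c < top" and le: "\<And>t. 0 < t \<Longrightarrow> ennreal t * x \<le> c"
  shows "x = 0"
proof -
  obtain c' where c': "0 \<le> c'" "c = ennreal c'" using c by (cases c) auto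
  have "x \<noteq> top" using le[of 1] c by (auto simp: top_unique)
  then obtain x' where x': "0 \<le> x'" "x = ennreal x'" by (cases x) auto
  have "t * x' \<le> c'" if "0 < t" for t
    using le[OF that] that x' c' by (simp add: ennreal_mult'[symmetric])
  from this[of "(c' + 1) / x'"] have "x' = 0"
    using c' x' by (cases "x' = 0") (auto simp: divide_pos_pos)
  then show ?thesis using x' by simp
qed

text \<open>Modulus zero provides densities \<open>\<rho> j\<close>, admissible for
  \<open>\<Gamma>\<close>, with energies below \<open>1 / (j + 1)\<close>. On \<open>Z\<close> all
  of them have sphere integral at least \<open>isodiam\<close>, so Young's inequality bounds
  \<open>t\<close> times \<open>isodiam\<close> times the length of \<open>Z\<close> by a term
  vanishing with \<open>j\<close> plus a constant. Let \<open>j\<close> tend to infinity first, then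
  \<open>t\<close>.\<close>

lemma exceptional_radii_null:
  fixes G :: "'a::euclidean_space set"
  assumes n: "2 \<le> DIM('a)" and p: "p > real (DIM('a) - 1)" and ab: "0 < a" "a < b" and G: "cball x0 b \<subseteq> G"
    and \<Gamma>: "surface_modulus p \<Gamma> = 0"
  obtains Z where "Z \<in> null_sets lborel" "\<And>r. a < r \<Longrightarrow> r < b \<Longrightarrow> indicator (sphere x0 r \<inter> G) \<in> \<Gamma> \<Longrightarrow> r \<in> Z"
proof -
  let ?k = "DIM('a) - 1" and ?\<kappa> = "isodiam TYPE('a)"
  define s where "s = p / real ?k"
  have k: "0 < ?k" using n by simp
  have s: "1 < s" using p k by (simp add: s_def)
  define \<alpha> where "\<alpha> = s / (s - 1)"
  have conj: "1 / s + 1 / \<alpha> = 1" using s by (simp add: \<alpha>_def field_simps)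
  have \<kappa>: "0 < ?\<kappa>" by (rule isodiam_pos[OF n])
  have "\<exists>\<rho>. \<rho> \<in> borel_measurable borel \<and> (\<forall>N\<in>\<Gamma>. surface_integral (\<lambda>y. \<rho> y ^ ?k) N \<ge> 1) \<and>
      (\<integral>\<^sup>+x. epowr (\<rho> x) p \<partial>lborel) < ennreal (1 / real (Suc j))" for j
  proof -
    have "surface_modulus p \<Gamma> < ennreal (1 / real (Suc j))" using \<Gamma> by simp
    then show ?thesis unfolding surface_modulus_def INF_less_iff by auto
  qed
  then obtain \<rho> where \<rho> [measurable]: "\<And>j. \<rho> j \<in> borel_measurable borel"
    and adm: "\<And>j N. N \<in> \<Gamma> \<Longrightarrow> surface_integral (\<lambda>y. \<rho> j y ^ ?k) N \<ge> 1"
    and small: "\<And>j. (\<integral>\<^sup>+x. epowr (\<rho> j x) p \<partial>lborel) < ennreal (1 / real (Suc j))" by metis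
  let ?R = "{x. a < dist x x0 \<and> dist x x0 < b}"
  define Z where "Z = {r\<in>{a<..<b}. \<forall>j. ennreal ?\<kappa> \<le> sphere_int x0 (\<lambda>y. \<rho> j y ^ ?k) r}"
  have [measurable]: "Z \<in> sets borel" unfolding Z_def by measurable
  have [measurable]: "?R \<in> sets borel" by measurable
  have Rfin: "emeasure lborel ?R < top"
  proof -
    have "emeasure lborel ?R \<le> emeasure lborel (cball x0 b)"
      by (rule emeasure_mono) (auto simp: dist_commute)
    then show ?thesis using emeasure_lborel_cball_finite[of x0 b] by (simp add: le_less_trans)
  qed
  have main: "ennreal t * (ennreal ?\<kappa> * emeasure lborel Z)
     \<le> ennreal (1 / s) * (ennreal (t powr s) * ennreal (1 / real (Suc j))) + ennreal (1 / \<alpha>) * emeasure lborel ?R"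
    if t: "0 < t" for t j
  proof -
    have "ennreal ?\<kappa> * emeasure lborel Z = (\<integral>\<^sup>+r. ennreal ?\<kappa> * indicator Z r \<partial>lborel)"
      by (subst nn_integral_cmult_indicator) auto
    also have "\<dots> \<le> (\<integral>\<^sup>+r. sphere_int x0 (\<lambda>y. \<rho> j y ^ ?k) r * indicator {a<..<b} r \<partial>lborel)"
      by (intro nn_integral_mono) (auto simp: Z_def indicator_def)
    also have "\<dots> = (\<integral>\<^sup>+x. \<rho> j x ^ ?k * indicator ?R x \<partial>lborel)"
      by (rule nn_integral_ring[symmetric]) (use ab in auto)
    finally have "ennreal t * (ennreal ?\<kappa> * emeasure lborel Z)
        \<le> ennreal t * (\<integral>\<^sup>+x. \<rho> j x ^ ?k * indicator ?R x \<partial>lborel)" by (rule mult_left_mono) simp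
    also have "\<dots> = (\<integral>\<^sup>+x. ennreal t * \<rho> j x ^ ?k * indicator ?R x \<partial>lborel)"
      by (subst nn_integral_cmult[symmetric]) (auto simp: mult.assoc)
    also have "\<dots> \<le> (\<integral>\<^sup>+x. ennreal (1 / s) * (ennreal (t powr s) * epowr (\<rho> j x) p) + ennreal (1 / \<alpha>) * indicator ?R x \<partial>lborel)"
    proof (rule nn_integral_mono)
      fix x
      have "ennreal t * \<rho> j x ^ ?k \<le> ennreal (1 / s) * (epowr (ennreal t * \<rho> j x ^ ?k) s / 1)
          + ennreal (1 / \<alpha>) * epowr 1 (1 / (s - 1))"
        by (rule Young_ennreal[OF s conj])
      also have "epowr (ennreal t * \<rho> j x ^ ?k) s = ennreal (t powr s) * epowr (\<rho> j x) p"
        using t k by (simp only: epowr_mult power_epowr epowr_epowr) (simp add: s_def)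
      finally show "ennreal t * \<rho> j x ^ ?k * indicator ?R x
         \<le> ennreal (1 / s) * (ennreal (t powr s) * epowr (\<rho> j x) p) + ennreal (1 / \<alpha>) * indicator ?R x"
        by (auto simp: indicator_def divide_ennreal_def)
    qed
    also have "\<dots> = ennreal (1 / s) * (ennreal (t powr s) * (\<integral>\<^sup>+x. epowr (\<rho> j x) p \<partial>lborel))
        + ennreal (1 / \<alpha>) * emeasure lborel ?R"
      by (simp add: nn_integral_add nn_integral_cmult nn_integral_cmult_indicator)
    also have "\<dots> \<le> ennreal (1 / s) * (ennreal (t powr s) * ennreal (1 / real (Suc j)))
        + ennreal (1 / \<alpha>) * emeasure lborel ?R"
      using small[of j] by (intro add_right_mono mult_left_mono) auto
    finally show ?thesis .
  qed
  have "ennreal ?\<kappa> * emeasure lborel Z = 0"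
  proof (rule ennreal_mult_bounded_imp_zero)
    show "ennreal (1 / \<alpha>) * emeasure lborel ?R < top" using Rfin by (simp add: ennreal_mult_less_top)
    fix t :: real assume t: "0 < t"
    have "(\<lambda>j. ennreal (1 / s * (t powr s * (1 / real (Suc j)))) + ennreal (1 / \<alpha>) * emeasure lborel ?R)
       \<longlonglongrightarrow> ennreal (1 / s * (t powr s * 0)) + ennreal (1 / \<alpha>) * emeasure lborel ?R"
      by (intro tendsto_add tendsto_ennrealI tendsto_mult tendsto_const lim_1_over_n[THEN LIMSEQ_Suc])
    moreover have "ennreal t * (ennreal ?\<kappa> * emeasure lborel Z)
        \<le> ennreal (1 / s * (t powr s * (1 / real (Suc j)))) + ennreal (1 / \<alpha>) * emeasure lborel ?R" for j
      using main[OF t, of j] s t by (simp add: ennreal_mult'[symmetric] del: of_nat_Suc)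
    ultimately have "ennreal t * (ennreal ?\<kappa> * emeasure lborel Z)
        \<le> ennreal (1 / s * (t powr s * 0)) + ennreal (1 / \<alpha>) * emeasure lborel ?R"
      by (intro LIMSEQ_le_const) auto
    then show "ennreal t * (ennreal ?\<kappa> * emeasure lborel Z) \<le> ennreal (1 / \<alpha>) * emeasure lborel ?R" by simp
  qed
  then have "Z \<in> null_sets lborel" using \<kappa> by (auto simp: null_sets_def)
  moreover have "r \<in> Z" if r: "a < r" "r < b" "indicator (sphere x0 r \<inter> G) \<in> \<Gamma>" for r
  proof -
    have "sphere x0 r \<inter> G = sphere x0 r" using r G by auto
    then have 1: "ennreal ?\<kappa> * 1 \<le> ennreal ?\<kappa> * surface_integral (\<lambda>y. \<rho> j y ^ ?k) (indicator (sphere x0 r))" for j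
      using adm[OF r(3)] by (intro mult_left_mono) auto
    have 2: "ennreal ?\<kappa> * surface_integral (\<lambda>y. \<rho> j y ^ ?k) (indicator (sphere x0 r)) \<le> sphere_int x0 (\<lambda>y. \<rho> j y ^ ?k) r" for j
      by (rule surface_integral_sphere_le[OF n]) (use r ab in \<open>auto intro: less_trans\<close>)
    have "ennreal ?\<kappa> \<le> sphere_int x0 (\<lambda>y. \<rho> j y ^ ?k) r" for j
      using order_trans[OF 1[of j] 2[of j]] by simp
    then show ?thesis using r by (simp add: Z_def)
  qed
  ultimately show ?thesis by (rule that)
qed

text \<open>Surface integrals see Lebesgue null sets. A majorant everywhere preserves admissibility,
  and equality almost everywhere preserves volume integrals; the value \<open>top\<close> on a Borel
  null set achieves both.\<close>

lemma lebesgue_ex_borel_majorant: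
  fixes f :: "'a::euclidean_space \<Rightarrow> ennreal"
  assumes "f \<in> borel_measurable lebesgue"
  obtains g where "g \<in> borel_measurable borel" "\<And>x. f x \<le> g x" "AE x in lebesgue. f x = g x"
proof -
  obtain g where g: "g \<in> borel_measurable lborel" "AE x in lborel. f x = g x"
    using completion_ex_borel_measurable[OF assms] by blast
  obtain N where N: "{x \<in> space lborel. f x \<noteq> g x} \<subseteq> N" "N \<in> null_sets lborel"
    using g(2) by (rule AE_E[elim_format]) (auto simp: null_sets_def)
  have [measurable]: "g \<in> borel_measurable borel" "N \<in> sets borel" using g(1) N(2) by auto
  define h where "h x = (if x \<in> N then top else g x)" for x
  have "h \<in> borel_measurable borel" unfolding h_def by measurable
  moreover have fg: "f x = g x" if "x \<notin> N" for x using N(1) that by auto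
  then have "f x \<le> h x" for x by (simp add: h_def)
  moreover have "AE x in lebesgue. f x = h x"
  proof -
    have "AE x in lborel. x \<notin> N" using N(2) by (rule AE_not_in)
    then have "AE x in lborel. f x = h x"
      by eventually_elim (simp add: h_def fg)
    then show ?thesis by (rule AE_completion)
  qed
  ultimately show ?thesis by (rule that)
qed

text \<open>Outside a null set of radii, admissibility gives a sphere integral of at least
  \<open>isodiam\<close>. Integration over the radii produces a volume integral of
  \<open>\<rho> ^ (n - 1)\<close>, to which Young's inequality with weight \<open>Q\<close>
  applies.\<close>

lemma ext_adm_lower_bound:
  fixes G :: "'a::euclidean_space set" and p :: real
  defines "s \<equiv> p / real (DIM('a) - 1)"
  assumes n: "2 \<le> DIM('a)" and p: "p > real (DIM('a) - 1)" and conj: "1 / s + 1 / \<alpha> = 1"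
    and ab: "0 < a" "a < b" and G: "cball x0 b \<subseteq> G" and oG: "open G"
    and Q: "Q \<in> borel_measurable (lebesgue_on G)"
    and \<rho>: "\<rho> \<in> ext_adm p (sphere_family G x0 a b)" and t: "0 < t"
  shows "ennreal t * (ennreal (isodiam TYPE('a)) * ennreal (b - a))
    \<le> ennreal (1 / s) * (ennreal (t powr s) * (\<integral>\<^sup>+x\<in>{x\<in>G. a < dist x x0 \<and> dist x x0 < b}. epowr (\<rho> x) p / Q x \<partial>lebesgue))
    + ennreal (1 / \<alpha>) * (\<integral>\<^sup>+x\<in>{x. a < dist x x0 \<and> dist x x0 < b}. epowr (Q x) (1 / (s - 1)) \<partial>lebesgue)"
proof -
  let ?k = "DIM('a) - 1" and ?\<kappa> = "isodiam TYPE('a)"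
  let ?R = "{x. a < dist x x0 \<and> dist x x0 < b}"
  have k: "0 < ?k" using n by simp
  have s: "1 < s" using p k by (simp add: s_def)
  have RG: "{x\<in>G. a < dist x x0 \<and> dist x x0 < b} = ?R" using G by (auto simp: dist_commute subset_eq)
  have Rb [measurable]: "?R \<in> sets borel" by measurable
  have RL [measurable]: "?R \<in> sets lebesgue" using Rb by simp
  \<comment> \<open>\<open>Q\<close> is measurable on \<open>G\<close> only; the cut-off agrees with
    it on the ring.\<close>
  define q where "q x = Q x * indicator G x" for x
  have qm [measurable]: "q \<in> borel_measurable lebesgue"
    using Q oG unfolding q_def by (subst (asm) borel_measurable_restrict_space_iff_ennreal) auto
  have qQ: "q x = Q x" if "x \<in> ?R" for x
  proof -
    have "x \<in> G" using that G by (auto simp: dist_commute subset_eq)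
    then show ?thesis by (simp add: q_def)
  qed
  have \<rho>m [measurable]: "\<rho> \<in> borel_measurable lebesgue" using \<rho> by (simp add: ext_adm_def)
  obtain \<Gamma>0 where \<Gamma>0: "surface_modulus p \<Gamma>0 = 0" and
      adm: "\<And>N. N \<in> sphere_family G x0 a b - \<Gamma>0 \<Longrightarrow> surface_integral (\<lambda>y. \<rho> y ^ ?k) N \<ge> 1"
    using \<rho> by (auto simp: ext_adm_def)
  obtain Z where Z: "Z \<in> null_sets lborel" "\<And>r. a < r \<Longrightarrow> r < b \<Longrightarrow> indicator (sphere x0 r \<inter> G) \<in> \<Gamma>0 \<Longrightarrow> r \<in> Z"
    using exceptional_radii_null[OF n p ab G \<Gamma>0] by blast
  obtain \<psi> where \<psi> [measurable]: "\<psi> \<in> borel_measurable borel" and ge: "\<And>x. \<rho> x ^ ?k \<le> \<psi> x"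
    and ae: "AE x in lebesgue. \<rho> x ^ ?k = \<psi> x"
    by (rule lebesgue_ex_borel_majorant[of "\<lambda>x. \<rho> x ^ ?k"]) measurable
  have int: "ennreal ?\<kappa> \<le> sphere_int x0 \<psi> r" if r: "a < r" "r < b" "r \<notin> Z" for r
  proof -
    have "sphere x0 r \<inter> G = sphere x0 r" using r G by auto
    moreover have "indicator (sphere x0 r \<inter> G) \<in> sphere_family G x0 a b"
      using r by (auto simp: sphere_family_def)
    moreover have "indicator (sphere x0 r \<inter> G) \<notin> \<Gamma>0" using r Z(2)[of r] by blast
    ultimately have "indicator (sphere x0 r) \<in> sphere_family G x0 a b - \<Gamma>0" by simp
    then have "1 \<le> surface_integral (\<lambda>y. \<rho> y ^ ?k) (indicator (sphere x0 r))" by (rule adm)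
    also have "\<dots> \<le> surface_integral \<psi> (indicator (sphere x0 r))"
      unfolding surface_integral_def by (intro nn_integral_mono mult_right_mono ge) simp
    finally have "ennreal ?\<kappa> * 1 \<le> ennreal ?\<kappa> * surface_integral \<psi> (indicator (sphere x0 r))"
      by (rule mult_left_mono) simp
    also have "\<dots> \<le> sphere_int x0 \<psi> r"
      by (rule surface_integral_sphere_le[OF n \<psi>]) (use r ab in simp)
    finally show ?thesis by simp
  qed
  have "ennreal ?\<kappa> * ennreal (b - a) = (\<integral>\<^sup>+r. ennreal ?\<kappa> * indicator {a<..<b} r \<partial>lborel)"
    using ab by (subst nn_integral_cmult_indicator) auto
  also have "\<dots> \<le> (\<integral>\<^sup>+r. sphere_int x0 \<psi> r * indicator {a<..<b} r \<partial>lborel)"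
    using AE_not_in[OF Z(1)] int
    by (intro nn_integral_mono_AE) (auto elim!: eventually_mono simp: indicator_def)
  also have "\<dots> = (\<integral>\<^sup>+x. \<psi> x * indicator ?R x \<partial>lborel)"
    by (rule nn_integral_ring[symmetric]) (use ab in auto)
  also have "\<dots> = (\<integral>\<^sup>+x. \<psi> x * indicator ?R x \<partial>lebesgue)"
    by (rule nn_integral_completion[symmetric])
  also have "\<dots> = (\<integral>\<^sup>+x. \<rho> x ^ ?k * indicator ?R x \<partial>lebesgue)"
    using ae by (intro nn_integral_cong_AE) (auto elim!: eventually_mono)
  finally have "ennreal t * (ennreal ?\<kappa> * ennreal (b - a))
     \<le> ennreal t * (\<integral>\<^sup>+x. \<rho> x ^ ?k * indicator ?R x \<partial>lebesgue)"
    by (rule mult_left_mono) simp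
  also have "\<dots> = (\<integral>\<^sup>+x. ennreal t * (\<rho> x ^ ?k * indicator ?R x) \<partial>lebesgue)"
    by (rule nn_integral_cmult[symmetric]) measurable
  also have "\<dots> \<le> (\<integral>\<^sup>+x. ennreal (1 / s) * (ennreal (t powr s) * (epowr (\<rho> x) p / q x * indicator ?R x))
     + ennreal (1 / \<alpha>) * (epowr (q x) (1 / (s - 1)) * indicator ?R x) \<partial>lebesgue)"
  proof (rule nn_integral_mono)
    fix x
    have "ennreal t * \<rho> x ^ ?k \<le> ennreal (1 / s) * (epowr (ennreal t * \<rho> x ^ ?k) s / q x)
        + ennreal (1 / \<alpha>) * epowr (q x) (1 / (s - 1))"
      by (rule Young_ennreal[OF s conj])
    also have "epowr (ennreal t * \<rho> x ^ ?k) s = ennreal (t powr s) * epowr (\<rho> x) p"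
      using t k by (simp only: epowr_mult power_epowr epowr_epowr) (simp add: s_def)
    finally show "ennreal t * (\<rho> x ^ ?k * indicator ?R x)
       \<le> ennreal (1 / s) * (ennreal (t powr s) * (epowr (\<rho> x) p / q x * indicator ?R x))
        + ennreal (1 / \<alpha>) * (epowr (q x) (1 / (s - 1)) * indicator ?R x)"
      by (auto simp: indicator_def ennreal_times_divide)
  qed
  also have "\<dots> = ennreal (1 / s) * (ennreal (t powr s) * (\<integral>\<^sup>+x. epowr (\<rho> x) p / q x * indicator ?R x \<partial>lebesgue))
     + ennreal (1 / \<alpha>) * (\<integral>\<^sup>+x. epowr (q x) (1 / (s - 1)) * indicator ?R x \<partial>lebesgue)"
    by (simp add: nn_integral_add nn_integral_cmult)
  also have "(\<integral>\<^sup>+x. epowr (\<rho> x) p / q x * indicator ?R x \<partial>lebesgue) = (\<integral>\<^sup>+x. epowr (\<rho> x) p / Q x * indicator ?R x \<partial>lebesgue)"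
    using qQ by (intro nn_integral_cong) (simp add: indicator_def)
  also have "(\<integral>\<^sup>+x. epowr (q x) (1 / (s - 1)) * indicator ?R x \<partial>lebesgue)
      = (\<integral>\<^sup>+x. epowr (Q x) (1 / (s - 1)) * indicator ?R x \<partial>lebesgue)"
    using qQ by (intro nn_integral_cong) (simp add: indicator_def)
  finally show ?thesis unfolding RG .
qed

lemma lower_Q_modulus_bound:
  fixes G :: "'a::euclidean_space set" and p :: real
  defines "s \<equiv> p / real (DIM('a) - 1)"
  assumes n: "2 \<le> DIM('a)" and p: "p > real (DIM('a) - 1)" and conj: "1 / s + 1 / \<alpha> = 1"
    and ab: "0 < a" "a < b" and G: "cball x0 b \<subseteq> G" and oG: "open G" "bounded G"
    and Q: "Q \<in> borel_measurable (lebesgue_on G)"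
    and low: "lower_Q_homeo p Q f G G' x0" and t: "0 < t"
  shows "ennreal t * (ennreal (isodiam TYPE('a)) * ennreal (b - a))
    \<le> ennreal (1 / s) * (ennreal (t powr s) * surface_modulus p (image_sphere_family f G x0 a b))
    + ennreal (1 / \<alpha>) * (\<integral>\<^sup>+x\<in>{x. a < dist x x0 \<and> dist x x0 < b}. epowr (Q x) (1 / (s - 1)) \<partial>lebesgue)"
proof -
  have k: "0 < DIM('a) - 1" using n by simp
  have s: "1 < s" using p k by (simp add: s_def)
  \<comment> \<open>The closed ball lies in the open set \<open>G\<close>, so \<open>G\<close>
    reaches strictly beyond radius \<open>b\<close>, as the definition of a lower Q-homeomorphism
    demands.\<close>
  obtain y where y: "y \<in> G" "b < dist y x0"
  proof -
    obtain e :: 'a where "e \<in> Basis" using nonempty_Basis by blast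
    then have e: "norm e = 1" by simp
    have "x0 + b *\<^sub>R e \<in> G" using G e ab by (auto simp: subset_eq dist_norm)
    then obtain d where d: "0 < d" "cball (x0 + b *\<^sub>R e) d \<subseteq> G" using open_contains_cball_eq[OF oG(1)] by blast
    have "x0 + (b + d) *\<^sub>R e \<in> cball (x0 + b *\<^sub>R e) d" using e d by (simp add: dist_norm algebra_simps)
    moreover have "dist (x0 + (b + d) *\<^sub>R e) x0 = b + d" using e d ab by (simp add: dist_norm)
    ultimately show ?thesis using d by (intro that[of "x0 + (b + d) *\<^sub>R e"]) auto
  qed
  have "bdd_above ((\<lambda>x. dist x x0) ` G)"
    using oG(2) unfolding bounded_any_center[of _ x0] by (auto simp: bdd_above_def dist_commute)
  then have "dist y x0 \<le> (SUP x\<in>G. dist x x0)" using y by (intro cSUP_upper)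
  then have b: "b < (SUP x\<in>G. dist x x0)" using y by simp
  let ?J = "INF \<rho> \<in> ext_adm p (sphere_family G x0 a b).
           \<integral>\<^sup>+ x \<in> {x\<in>G. a < dist x x0 \<and> dist x x0 < b}. epowr (\<rho> x) p / Q x \<partial>lebesgue"
  let ?I = "\<integral>\<^sup>+x\<in>{x. a < dist x x0 \<and> dist x x0 < b}. epowr (Q x) (1 / (s - 1)) \<partial>lebesgue"
  let ?l = "ennreal t * (ennreal (isodiam TYPE('a)) * ennreal (b - a))"
  have c: "0 < 1 / s * t powr s" using s t by simp
  have cs: "ennreal (1 / s * t powr s) * y = ennreal (1 / s) * (ennreal (t powr s) * y)" for y
    by (subst ennreal_mult) (use s in \<open>simp_all add: mult.assoc\<close>)
  have fin: "?l \<noteq> top" by (simp add: ennreal_mult_eq_top_iff)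
  \<comment> \<open>The \<open>Q\<close>-term does not depend on \<open>\<rho>\<close> and is moved
    to the left, so that the infimum over \<open>\<rho>\<close> can be taken in the remaining
    product. Finiteness of \<open>?l\<close> makes the truncated subtraction reversible.\<close>
  have "?l - ennreal (1 / \<alpha>) * ?I \<le> ennreal (1 / s * t powr s) * ?J"
  proof (rule le_ennreal_mult_INF[OF c])
    fix \<rho> assume "\<rho> \<in> ext_adm p (sphere_family G x0 a b)"
    note ext_adm_lower_bound[OF n p conj[unfolded s_def] ab G oG(1) Q this t, folded s_def]
    then show "?l - ennreal (1 / \<alpha>) * ?I \<le> ennreal (1 / s * t powr s) *
      (\<integral>\<^sup>+ x \<in> {x\<in>G. a < dist x x0 \<and> dist x x0 < b}. epowr (\<rho> x) p / Q x \<partial>lebesgue)"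
      using fin unfolding ennreal_minus_le_iff cs by (simp add: add.commute)
  qed
  also have "\<dots> \<le> ennreal (1 / s * t powr s) * surface_modulus p (image_sphere_family f G x0 a b)"
    using low ab b by (intro mult_left_mono) (auto simp: lower_Q_homeo_def)
  finally show ?thesis
    using fin unfolding ennreal_minus_le_iff cs by (simp add: add.commute)
qed

section \<open>Comparison of measures on the line\<close>

text \<open>Inner regularity of length and outer regularity of \<open>N\<close> reduce the claim to
  a compact \<open>K\<close> in an open \<open>V\<close> of nearly the same
  \<open>N\<close>-measure. A fine grid covers \<open>K\<close> by closed cells whose interiors are
  disjoint and lie in \<open>V\<close>, so lower bounds on intervals add up.\<close>

lemma emeasure_ge_of_intervals:
  fixes N :: "real measure"
  assumes N: "finite_measure N" and sets: "sets N = sets borel" and c: "0 \<le> c" and r: "r1 < r2"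
    and le: "\<And>a b. r1 \<le> a \<Longrightarrow> a < b \<Longrightarrow> b \<le> r2 \<Longrightarrow> ennreal (c * (b - a)) \<le> emeasure N {a<..<b}"
    and B: "B \<in> sets borel" "B \<subseteq> {r1<..<r2}"
  shows "ennreal c * emeasure lborel B \<le> emeasure N B"
proof -
  interpret N: finite_measure N by fact
  define M where "M = density lborel (indicator {r1<..<r2} :: real \<Rightarrow> ennreal)"
  have M: "emeasure M X = emeasure lborel (X \<inter> {r1<..<r2})" if "X \<in> sets borel" for X
    unfolding M_def using that
    by (subst emeasure_density) (auto simp: nn_integral_indicator[symmetric] indicator_inter_arith mult.commute simp del: nn_integral_indicator)
  have setsM: "sets M = sets borel" by (simp add: M_def)
  have "emeasure M UNIV \<noteq> \<infinity>" using r by (simp add: M)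
  then have "emeasure M B = (SUP K \<in> {K. K \<subseteq> B \<and> compact K}. emeasure M K)"
    by (intro inner_regular[OF setsM _ B(1)]) (auto intro!: finite_measureI simp: M_def)
  moreover have "ennreal c * emeasure M K \<le> emeasure N B" if K: "K \<subseteq> B" "compact K" for K
  proof (rule ennreal_le_epsilon)
    fix \<epsilon> :: real assume \<epsilon>: "0 < \<epsilon>"
    have Kb: "K \<in> sets borel" using K(2) by (intro borel_closed compact_imp_closed)
    have "emeasure N K = (INF U \<in> {U. K \<subseteq> U \<and> open U}. emeasure N U)"
      by (rule outer_regular[OF sets _ Kb]) (use N in auto)
    moreover have "emeasure N K < emeasure N K + ennreal \<epsilon>"
      using \<epsilon> by (simp add: ennreal_add_left_cancel_less[of _ 0, simplified] N.emeasure_eq_measure)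
    ultimately obtain V where V: "K \<subseteq> V" "open V" "emeasure N V < emeasure N K + ennreal \<epsilon>"
      by (auto simp: INF_less_iff)
    define W where "W = V \<inter> {r1<..<r2}"
    have W: "open W" "K \<subseteq> W" using V K B(2) by (auto simp: W_def)
    obtain \<delta> where \<delta>: "0 < \<delta>" "(\<Union>x\<in>K. ball x \<delta>) \<subseteq> W"
      using compact_subset_open_imp_ball_epsilon_subset[OF K(2) W] by blast
    \<comment> \<open>A cell of length \<open>\<delta> / 2\<close> that meets \<open>K\<close> stays
      within distance \<open>\<delta>\<close> of the common point.\<close>
    define h where "h = \<delta> / 2"
    have h: "0 < h" using \<delta> by (simp add: h_def)
    \<comment> \<open>The index \<open>j\<close> belongs to the cell from \<open>j * h\<close> to
      \<open>(j + 1) * h\<close> that is open on the left and closed on the right, hence the ceiling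
      minus one.\<close>
    define J where "J = (\<lambda>x. \<lceil>x / h\<rceil> - 1) ` K"
    let ?I = "\<lambda>j::int. {of_int j * h<..<(of_int j + 1) * h}"
    have key: "\<exists>x\<in>K. of_int j * h < x \<and> x \<le> (of_int j + 1) * h" if jJ: "j \<in> J" for j
    proof -
      obtain x where x: "x \<in> K" "j = \<lceil>x / h\<rceil> - 1" using jJ unfolding J_def by blast
      have "of_int j < x / h" "x / h \<le> of_int j + 1"
        unfolding x(2) using ceiling_correct[of "x / h"] by auto
      then show ?thesis using x(1) unfolding pos_less_divide_eq[OF h] pos_divide_le_eq[OF h] by blast
    qed
    have IW: "{of_int j * h..(of_int j + 1) * h} \<subseteq> W" if jJ: "j \<in> J" for j
    proof -
      obtain x where x: "x \<in> K" "of_int j * h < x" "x \<le> (of_int j + 1) * h" using key[OF jJ] by blast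
      have "{of_int j * h..(of_int j + 1) * h} \<subseteq> ball x \<delta>"
        using x h by (auto simp: dist_real_def h_def algebra_simps)
      then show ?thesis using \<delta>(2) x(1) by blast
    qed
    have finJ: "finite J"
    proof (rule finite_subset)
      show "J \<subseteq> {\<lceil>r1 / h\<rceil> - 1..\<lceil>r2 / h\<rceil> - 1}"
      proof
        fix j assume "j \<in> J"
        then obtain x where x: "x \<in> K" "j = \<lceil>x / h\<rceil> - 1" unfolding J_def by blast
        have "r1 < x" "x < r2" using x(1) K B(2) by auto
        then have "r1 / h \<le> x / h" "x / h \<le> r2 / h" using h by (auto intro!: divide_right_mono)
        then have "\<lceil>r1 / h\<rceil> \<le> \<lceil>x / h\<rceil>" "\<lceil>x / h\<rceil> \<le> \<lceil>r2 / h\<rceil>" by (auto intro: ceiling_mono)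
        then show "j \<in> {\<lceil>r1 / h\<rceil> - 1..\<lceil>r2 / h\<rceil> - 1}" using x(2) by simp
      qed
    qed simp
    have disj: "disjoint_family_on ?I J"
      unfolding disjoint_family_on_def
    proof (intro ballI impI)
      fix i j :: int assume "i \<noteq> j"
      then consider "i + 1 \<le> j" | "j + 1 \<le> i" by linarith
      then show "?I i \<inter> ?I j = {}"
      proof cases
        case 1
        then have "(of_int i + 1) * h \<le> of_int j * h" using h by (intro mult_right_mono) linarith+
        then show ?thesis by auto
      next
        case 2
        then have "(of_int j + 1) * h \<le> of_int i * h" using h by (intro mult_right_mono) linarith+
        then show ?thesis by auto
      qed
    qed
    have "ennreal c * emeasure M K \<le> ennreal c * emeasure lborel K"
      using Kb by (intro mult_left_mono) (auto simp: M intro!: emeasure_mono)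
    also have "\<dots> \<le> ennreal c * emeasure lborel (\<Union>j\<in>J. {of_int j * h..(of_int j + 1) * h})"
    proof (intro mult_left_mono emeasure_mono)
      show "K \<subseteq> (\<Union>j\<in>J. {of_int j * h..(of_int j + 1) * h})"
      proof
        fix x assume x: "x \<in> K"
        let ?j = "\<lceil>x / h\<rceil> - 1"
        have "of_int ?j < x / h" "x / h \<le> of_int ?j + 1"
          using ceiling_correct[of "x / h"] by auto
        then have "of_int ?j * h \<le> x" "x \<le> (of_int ?j + 1) * h"
          unfolding pos_less_divide_eq[OF h] pos_divide_le_eq[OF h] by auto
        then show "x \<in> (\<Union>j\<in>J. {of_int j * h..(of_int j + 1) * h})"
          using x unfolding J_def by (intro UN_I[of ?j]) auto
      qed
    qed (use finJ in auto)
    also have "\<dots> \<le> ennreal c * (\<Sum>j\<in>J. emeasure lborel {of_int j * h..(of_int j + 1) * h})"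
      by (intro mult_left_mono emeasure_subadditive_finite finJ) auto
    also have "\<dots> = (\<Sum>j\<in>J. ennreal (c * ((of_int j + 1) * h - of_int j * h)))"
      unfolding sum_distrib_left using h c by (intro sum.cong) (auto simp: ennreal_mult algebra_simps)
    also have "\<dots> \<le> (\<Sum>j\<in>J. emeasure N (?I j))"
    proof (intro sum_mono le)
      fix j assume j: "j \<in> J"
      have "of_int j * h \<in> W" "(of_int j + 1) * h \<in> W" using IW[OF j] h by (auto simp: subset_eq algebra_simps)
      then show "r1 \<le> of_int j * h" "(of_int j + 1) * h \<le> r2" by (auto simp: W_def)
      show "of_int j * h < (of_int j + 1) * h" using h by (simp add: algebra_simps)
    qed
    also have "\<dots> = emeasure N (\<Union>j\<in>J. ?I j)"
      by (rule sum_emeasure[OF _ disj finJ]) (auto simp: sets)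
    also have "\<dots> \<le> emeasure N V"
    proof (rule emeasure_mono)
      show "(\<Union>j\<in>J. ?I j) \<subseteq> V"
      proof
        fix x assume "x \<in> (\<Union>j\<in>J. ?I j)"
        then obtain j where "j \<in> J" "x \<in> ?I j" by blast
        then have "x \<in> W" using IW[of j] by auto
        then show "x \<in> V" by (simp add: W_def)
      qed
    qed (use V sets in auto)
    also have "\<dots> \<le> emeasure N K + ennreal \<epsilon>" using V by simp
    also have "\<dots> \<le> emeasure N B + ennreal \<epsilon>"
      using K B sets by (intro add_right_mono emeasure_mono) auto
    finally show "ennreal c * emeasure M K \<le> emeasure N B + ennreal \<epsilon>" .
  qed
  ultimately have "ennreal c * emeasure M B \<le> emeasure N B"
    by (auto simp: SUP_mult_left_ennreal intro!: SUP_least)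
  then show ?thesis using B by (simp add: M Int_absorb2)
qed

lemma nn_integral_le_combination:
  assumes sets [measurable_cong]: "sets N1 = sets M" "sets N2 = sets M"
    and le: "\<And>B. B \<in> sets M \<Longrightarrow> emeasure M B \<le> c1 * emeasure N1 B + c2 * emeasure N2 B"
    and f: "f \<in> borel_measurable M"
  shows "(\<integral>\<^sup>+x. f x \<partial>M) \<le> c1 * (\<integral>\<^sup>+x. f x \<partial>N1) + c2 * (\<integral>\<^sup>+x. f x \<partial>N2)"
  using f
proof induct
  case (cong f g)
  have "space N1 = space M" "space N2 = space M" using sets by (auto dest: sets_eq_imp_space_eq)
  then have "integral\<^sup>N M f = integral\<^sup>N M g" "integral\<^sup>N N1 f = integral\<^sup>N N1 g" "integral\<^sup>N N2 f = integral\<^sup>N N2 g"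
    using cong(3) by (auto intro!: nn_integral_cong)
  then show ?case using cong by simp
next
  case (set A)
  then show ?case using le[of A] sets by simp
next
  case (mult u c)
  have "u \<in> borel_measurable N1" "u \<in> borel_measurable N2" using mult sets by (auto cong: measurable_cong_sets)
  then have "(\<integral>\<^sup>+x. c * u x \<partial>M) \<le> c * (c1 * (\<integral>\<^sup>+x. u x \<partial>N1) + c2 * (\<integral>\<^sup>+x. u x \<partial>N2))"
    using mult by (simp add: nn_integral_cmult mult_left_mono)
  then show ?case using \<open>u \<in> borel_measurable N1\<close> \<open>u \<in> borel_measurable N2\<close>
    by (simp add: nn_integral_cmult algebra_simps)
next
  case (add u v)
  have "u \<in> borel_measurable N1" "u \<in> borel_measurable N2" "v \<in> borel_measurable N1" "v \<in> borel_measurable N2"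
    using add sets by (auto cong: measurable_cong_sets)
  then show ?case using add_mono[OF add(3) add(7)] add
    by (simp add: nn_integral_add algebra_simps)
next
  case (seq U)
  have m: "\<And>i. U i \<in> borel_measurable N1" "\<And>i. U i \<in> borel_measurable N2"
    using seq sets by (auto cong: measurable_cong_sets)
  have up: "U i x \<le> (SUP i. U i) x" for i x by (auto intro: SUP_upper le_funD)
  have "(\<integral>\<^sup>+x. (SUP i. U i) x \<partial>M) = (SUP i. \<integral>\<^sup>+x. U i x \<partial>M)"
    using seq by (simp add: nn_integral_monotone_convergence_SUP[symmetric] image_comp)
  also have "\<dots> \<le> c1 * (\<integral>\<^sup>+x. (SUP i. U i) x \<partial>N1) + c2 * (\<integral>\<^sup>+x. (SUP i. U i) x \<partial>N2)"
    by (intro SUP_least order_trans[OF seq(3)] add_mono mult_left_mono nn_integral_mono up) auto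
  finally show ?case .
qed

text \<open>The linearised inequality \<open>t dr \<le> (t\<^sup>s/s) dN1 + (1/\<alpha>) dN2\<close> may be used with \<open>t\<close> depending on the point.\<close>

lemma nn_integral_parametric_combination:
  fixes M N1 N2 :: "real measure"
  assumes sets: "sets M = sets borel" "sets N1 = sets borel" "sets N2 = sets borel"
    and s: "0 < s"
    and le: "\<And>t B. 0 < t \<Longrightarrow> B \<in> sets borel \<Longrightarrow>
      ennreal t * emeasure M B \<le> ennreal c1 * (ennreal (t powr s) * emeasure N1 B) + ennreal c2 * emeasure N2 B"
    and T: "T \<in> borel_measurable borel" and g: "g \<in> borel_measurable borel"
  shows "(\<integral>\<^sup>+x. g x * T x \<partial>M) \<le> ennreal c1 * (\<integral>\<^sup>+x. g x * epowr (T x) s \<partial>N1) + ennreal c2 * (\<integral>\<^sup>+x. g x \<partial>N2)"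
proof -
  note [measurable_cong] = sets
  note [measurable] = g T
  have space: "space M = UNIV" "space N1 = UNIV" "space N2 = UNIV"
    using sets by (auto dest: sets_eq_imp_space_eq)
  have const: "ennreal t * (\<integral>\<^sup>+x. g x * indicator B x \<partial>M)
     \<le> ennreal c1 * (ennreal (t powr s) * (\<integral>\<^sup>+x. g x * indicator B x \<partial>N1)) + ennreal c2 * (\<integral>\<^sup>+x. g x * indicator B x \<partial>N2)"
    if t: "0 < t" and [measurable]: "B \<in> sets borel" for t B
  proof -
    let ?M = "density M (\<lambda>_. ennreal t)"
    have "(\<integral>\<^sup>+x. g x * indicator B x \<partial>?M) \<le> ennreal c1 * ennreal (t powr s) * (\<integral>\<^sup>+x. g x * indicator B x \<partial>N1)
        + ennreal c2 * (\<integral>\<^sup>+x. g x * indicator B x \<partial>N2)"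
    proof (rule nn_integral_le_combination)
      fix B' assume "B' \<in> sets ?M"
      then have B': "B' \<in> sets borel" using sets by simp
      have "emeasure ?M B' = ennreal t * emeasure M B'"
        using B' sets by (subst emeasure_density) (auto simp: nn_integral_cmult_indicator)
      then show "emeasure ?M B' \<le> ennreal c1 * ennreal (t powr s) * emeasure N1 B' + ennreal c2 * emeasure N2 B'"
        using le[OF t B'] by (simp add: mult.assoc)
    qed (use sets in \<open>simp_all\<close>)
    moreover have "(\<integral>\<^sup>+x. g x * indicator B x \<partial>?M) = ennreal t * (\<integral>\<^sup>+x. g x * indicator B x \<partial>M)"
      by (subst nn_integral_density) (simp_all add: nn_integral_cmult)
    ultimately show ?thesis by (simp add: mult.assoc)
  qed
  \<comment> \<open>On each of the finitely many level sets of \<open>U\<close> the bound for a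
    constant factor applies; the value 0, for which no bound is assumed, contributes nothing on the
    left.\<close>
  have simple: "(\<integral>\<^sup>+x. g x * U x \<partial>M) \<le> ennreal c1 * (\<integral>\<^sup>+x. g x * epowr (U x) s \<partial>N1) + ennreal c2 * (\<integral>\<^sup>+x. g x \<partial>N2)"
    if U: "simple_function borel U" and fin: "\<And>x. U x < top" for U
  proof -
    let ?V = "U ` UNIV" and ?B = "\<lambda>t. U -` {t}"
    have finV: "finite ?V" using U by (simp add: simple_function_def)
    have [measurable]: "?B t \<in> sets borel" for t
    proof (cases "t \<in> ?V")
      case True then show ?thesis using U by (auto simp: simple_function_def)
    next
      case False
      then have "?B t = {}" by auto
      then show ?thesis by simp
    qed
    have rep: "k (U x) = (\<Sum>t\<in>?V. k t * indicator (?B t) x)" for k :: "ennreal \<Rightarrow> ennreal" and x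
    proof -
      have "(\<Sum>t\<in>?V. k t * indicator (?B t) x) = (\<Sum>t\<in>?V. if t = U x then k t else 0)"
        by (intro sum.cong) (auto simp: indicator_def)
      then show ?thesis using finV by (simp add: sum.delta)
    qed
    have int: "(\<integral>\<^sup>+x. g x * k (U x) \<partial>P) = (\<Sum>t\<in>?V. k t * (\<integral>\<^sup>+x. g x * indicator (?B t) x \<partial>P))"
      if [measurable_cong]: "sets P = sets borel" for P :: "real measure" and k
    proof -
      have "(\<integral>\<^sup>+x. g x * k (U x) \<partial>P) = (\<integral>\<^sup>+x. (\<Sum>t\<in>?V. k t * (g x * indicator (?B t) x)) \<partial>P)"
        unfolding rep[of k] by (simp add: sum_distrib_left mult_ac)
      also have "\<dots> = (\<Sum>t\<in>?V. k t * (\<integral>\<^sup>+x. g x * indicator (?B t) x \<partial>P))"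
        by (subst nn_integral_sum) (simp_all add: nn_integral_cmult)
      finally show ?thesis .
    qed
    have "(\<integral>\<^sup>+x. g x * U x \<partial>M) = (\<Sum>t\<in>?V. t * (\<integral>\<^sup>+x. g x * indicator (?B t) x \<partial>M))"
      using int[OF sets(1), of "\<lambda>t. t"] by simp
    also have "\<dots> \<le> (\<Sum>t\<in>?V. ennreal c1 * (epowr t s * (\<integral>\<^sup>+x. g x * indicator (?B t) x \<partial>N1))
        + ennreal c2 * (\<integral>\<^sup>+x. g x * indicator (?B t) x \<partial>N2))"
    proof (rule sum_mono)
      fix t assume "t \<in> ?V"
      then obtain x where "t = U x" by auto
      then obtain t' where t': "0 \<le> t'" "t = ennreal t'" using fin[of x] by (cases t) auto
      show "t * (\<integral>\<^sup>+x. g x * indicator (?B t) x \<partial>M) \<le> ennreal c1 * (epowr t s * (\<integral>\<^sup>+x. g x * indicator (?B t) x \<partial>N1))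
        + ennreal c2 * (\<integral>\<^sup>+x. g x * indicator (?B t) x \<partial>N2)"
        using const[of t' "?B t"] t' by (cases "t' = 0") auto
    qed
    also have "\<dots> = ennreal c1 * (\<integral>\<^sup>+x. g x * epowr (U x) s \<partial>N1) + ennreal c2 * (\<integral>\<^sup>+x. g x * (\<lambda>_. 1) (U x) \<partial>N2)"
      unfolding int[OF sets(2), of "\<lambda>t. epowr t s"] int[OF sets(3), of "\<lambda>_. 1"]
      by (simp add: sum.distrib sum_distrib_left)
    finally show ?thesis by simp
  qed
  obtain U where U: "\<And>i. simple_function borel (U i)" "incseq U" "\<And>i x. U i x < top" "\<And>x. (SUP i. U i x) = T x"
    using borel_measurable_implies_simple_function_sequence'[OF T] by metis
  note [measurable] = borel_measurable_simple_function[OF U(1)]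
  have "(\<integral>\<^sup>+x. g x * T x \<partial>M) = (\<integral>\<^sup>+x. (SUP i. g x * U i x) \<partial>M)"
    by (simp add: U(4)[symmetric] SUP_mult_left_ennreal)
  also have "\<dots> = (SUP i. \<integral>\<^sup>+x. g x * U i x \<partial>M)"
    using U(2) by (intro nn_integral_monotone_convergence_SUP) (auto simp: incseq_def le_fun_def intro!: mult_left_mono)
  also have "\<dots> \<le> ennreal c1 * (\<integral>\<^sup>+x. g x * epowr (T x) s \<partial>N1) + ennreal c2 * (\<integral>\<^sup>+x. g x \<partial>N2)"
  proof (rule SUP_least)
    fix i
    have "U i x \<le> T x" for x using U(4)[of x] by (metis SUP_upper UNIV_I)
    then show "(\<integral>\<^sup>+x. g x * U i x \<partial>M) \<le> ennreal c1 * (\<integral>\<^sup>+x. g x * epowr (T x) s \<partial>N1) + ennreal c2 * (\<integral>\<^sup>+x. g x \<partial>N2)"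
      using s by (intro order_trans[OF simple[OF U(1,3)]] add_right_mono mult_left_mono nn_integral_mono epowr_mono) auto
  qed
  finally show ?thesis .
qed

section \<open>The ring estimate for a lower Q-homeomorphism\<close>

lemma divide_ennreal_real: "0 < c \<Longrightarrow> x / ennreal c = x * ennreal (1 / c)"
  by (simp add: divide_ennreal_def inverse_ennreal inverse_eq_divide)

text \<open>The exponents of the theorem in terms of \<open>s\<close> are
  \<open>\<alpha> = s / (s - 1) = p / (p - n + 1)\<close> and
  \<open>1 / (s - 1) = (n - 1) / (p - n + 1)\<close>. One ring whose closed outer ball lies in
  \<open>G\<close> is fixed throughout.\<close>

locale lower_Q_ring =
  fixes G G' :: "'a::euclidean_space set" and f g :: "'a \<Rightarrow> 'a" and x0 :: 'a and p s \<alpha> r1 r2 :: real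
    and Q :: "'a \<Rightarrow> ennreal"
  assumes n: "2 \<le> DIM('a)" and p: "p > real (DIM('a) - 1)" and s_def: "s = p / real (DIM('a) - 1)"
    and conj: "1 / s + 1 / \<alpha> = 1"
    and r: "0 < r1" "r1 < r2" "cball x0 r2 \<subseteq> G" and G: "open G" "bounded G" "open G'"
    and hom: "homeomorphism G G' f g"
    and Q: "Q \<in> borel_measurable (lebesgue_on G)"
    and Qint: "(\<integral>\<^sup>+x\<in>cball x0 r2. epowr (Q x) (1 / (s - 1)) \<partial>lebesgue) < \<infinity>"
    and low: "lower_Q_homeo p Q f G G' x0"
begin

abbreviation "H \<equiv> hausdorff_measure (codim1 TYPE('a)) :: 'a measure"
abbreviation "Qt \<equiv> \<lambda>x. epowr (Q x) (1 / (s - 1))"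

text \<open>The radial coordinate carried over to the image. The value 0 outside \<open>G'\<close>
  lies below every radius in use, so it adds nothing to the level sets of positive value.\<close>

definition w :: "'a \<Rightarrow> real" where "w y = (if y \<in> G' then dist (g y) x0 else 0)"
definition S :: "real \<Rightarrow> 'a set" where "S \<rho> = f ` sphere x0 \<rho>"
definition D :: "real \<Rightarrow> 'a set" where "D \<rho> = f ` ball x0 \<rho>"

lemma k_pos: "0 < DIM('a) - 1" using n by simp

lemma s1: "1 < s" using p k_pos by (simp add: s_def)

lemma \<alpha>_eq: "\<alpha> = s / (s - 1)"
proof -
  have "1 / \<alpha> = 1 - 1 / s" using conj by simp
  then have *: "1 / \<alpha> = (s - 1) / s" using s1 by (simp add: field_simps)
  have "\<alpha> = 1 / (1 / \<alpha>)" by simp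
  also have "\<dots> = s / (s - 1)" unfolding * by simp
  finally show ?thesis .
qed

lemma \<alpha>1: "1 < \<alpha>" using s1 by (simp add: \<alpha>_eq)

lemma \<kappa>_pos: "0 < (isodiam TYPE('a))" by (rule isodiam_pos[OF n])

lemma fg: "x \<in> G \<Longrightarrow> f x \<in> G' \<and> g (f x) = x" and gf: "y \<in> G' \<Longrightarrow> g y \<in> G \<and> f (g y) = y"
  using hom by (auto simp: homeomorphism_def)

lemma cball_G: "\<rho> \<le> r2 \<Longrightarrow> cball x0 \<rho> \<subseteq> G"
  using r(3) by (meson order_trans subset_cball)

lemma f_cont: "continuous_on G f" and g_cont: "continuous_on G' g"
  using hom by (auto simp: homeomorphism_def)

lemma w_measurable [measurable]: "w \<in> borel_measurable borel"
  unfolding w_def[abs_def]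
  by (rule borel_measurable_continuous_on_if) (use G in \<open>auto intro!: continuous_intros g_cont\<close>)

lemma S_eq: "0 < \<rho> \<Longrightarrow> \<rho> \<le> r2 \<Longrightarrow> S \<rho> = {y. w y = \<rho>}"
proof (intro set_eqI iffI)
  fix y assume a: "0 < \<rho>" "\<rho> \<le> r2"
  show "y \<in> {y. w y = \<rho>}" if yS: "y \<in> S \<rho>"
  proof -
    obtain x where x: "x \<in> sphere x0 \<rho>" "y = f x" using yS by (auto simp: S_def)
    have "x \<in> G" using x cball_G[OF a(2)] by auto
    then show ?thesis using fg x by (simp add: w_def dist_commute)
  qed
  show "y \<in> S \<rho>" if "y \<in> {y. w y = \<rho>}"
  proof -
    have y: "y \<in> G'" "dist (g y) x0 = \<rho>" using that a by (auto simp: w_def split: if_splits)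
    then show ?thesis using gf[OF y(1)] unfolding S_def by (intro image_eqI[of _ _ "g y"]) (auto simp: dist_commute)
  qed
qed

lemma compact_S: "0 < \<rho> \<Longrightarrow> \<rho> \<le> r2 \<Longrightarrow> compact (S \<rho>)"
  unfolding S_def using cball_G[of \<rho>]
  by (intro compact_continuous_image continuous_on_subset[OF f_cont]) auto

lemma S_borel [measurable]: "0 < \<rho> \<Longrightarrow> \<rho> \<le> r2 \<Longrightarrow> S \<rho> \<in> sets borel"
  using compact_S by (auto intro: borel_closed compact_imp_closed)

text \<open>The energy of the density \<open>\<phi> / A(w)\<close>, distributed over the radii:
  energies over subrings become measures of intervals. \<open>Q_radial\<close> does the same for the
  integrable power of \<open>Q\<close>.\<close>

definition normalised :: "('a \<Rightarrow> ennreal) \<Rightarrow> (real \<Rightarrow> real) \<Rightarrow> real measure" where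
  "normalised \<phi> A = distr (density lborel (\<lambda>y. epowr (\<phi> y / ennreal (A (w y))) s * indicator {r1<..<r2} (w y))) borel w"

definition Q_radial :: "real measure" where
  "Q_radial = distr (density lebesgue (\<lambda>x. epowr (Q x * indicator G x) (1 / (s - 1)) * indicator {r1<..<r2} (dist x x0)))
     borel (\<lambda>x. dist x x0)"

lemma Q_measurable [measurable]: "(\<lambda>x. Q x * indicator G x) \<in> borel_measurable lebesgue"
  using Q G(1) by (subst (asm) borel_measurable_restrict_space_iff_ennreal) auto

lemma dist_measurable_lebesgue [measurable]: "(\<lambda>x::'a. dist x x0) \<in> borel_measurable lebesgue"
  by (rule measurable_completion) measurable

lemma in_ring_G: "dist x x0 < r2 \<Longrightarrow> x \<in> G"
  using r(3) by (auto simp: dist_commute subset_eq)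

lemma nn_integral_Q_radial:
  assumes [measurable]: "h \<in> borel_measurable borel"
  shows "(\<integral>\<^sup>+\<rho>. h \<rho> \<partial>Q_radial) = (\<integral>\<^sup>+x. Qt x * h (dist x x0) * indicator {x. r1 < dist x x0 \<and> dist x x0 < r2} x \<partial>lebesgue)"
proof -
  have [measurable]: "(\<lambda>x. h (dist x x0)) \<in> borel_measurable lebesgue" by measurable
  have "(\<integral>\<^sup>+\<rho>. h \<rho> \<partial>Q_radial) = (\<integral>\<^sup>+x. epowr (Q x * indicator G x) (1 / (s - 1)) * indicator {r1<..<r2} (dist x x0) * h (dist x x0) \<partial>lebesgue)"
    unfolding Q_radial_def
    by (subst nn_integral_distr, simp, simp, subst nn_integral_density) (measurable; simp)+
  also have "\<dots> = (\<integral>\<^sup>+x. Qt x * h (dist x x0) * indicator {x. r1 < dist x x0 \<and> dist x x0 < r2} x \<partial>lebesgue)"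
    by (intro nn_integral_cong) (auto simp: indicator_def in_ring_G mult_ac)
  finally show ?thesis .
qed

lemma emeasure_Q_radial:
  assumes "r1 \<le> a" "b \<le> r2"
  shows "emeasure Q_radial {a<..<b} = (\<integral>\<^sup>+x\<in>{x. a < dist x x0 \<and> dist x x0 < b}. Qt x \<partial>lebesgue)"
proof -
  have "emeasure Q_radial {a<..<b} = (\<integral>\<^sup>+\<rho>. indicator {a<..<b} \<rho> \<partial>Q_radial)"
    by (rule nn_integral_indicator[symmetric]) (simp add: Q_radial_def)
  also have "\<dots> = (\<integral>\<^sup>+x. Qt x * indicator {x. a < dist x x0 \<and> dist x x0 < b} x \<partial>lebesgue)"
    using assms by (subst nn_integral_Q_radial) (auto intro!: nn_integral_cong simp: indicator_def)
  finally show ?thesis .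
qed

lemma finite_Q_radial: "emeasure Q_radial UNIV < \<infinity>"
proof -
  have "emeasure Q_radial UNIV = (\<integral>\<^sup>+\<rho>. 1 \<partial>Q_radial)" by (simp add: Q_radial_def)
  also have "\<dots> = (\<integral>\<^sup>+x. Qt x * indicator {x. r1 < dist x x0 \<and> dist x x0 < r2} x \<partial>lebesgue)"
    by (subst nn_integral_Q_radial) auto
  also have "\<dots> \<le> (\<integral>\<^sup>+x\<in>cball x0 r2. Qt x \<partial>lebesgue)"
    by (intro nn_integral_mono) (auto simp: indicator_def dist_commute)
  finally show ?thesis using Qint by (rule le_less_trans)
qed

lemma nn_integral_normalised:
  assumes [measurable]: "h \<in> borel_measurable borel" "\<phi> \<in> borel_measurable borel" "A \<in> borel_measurable borel"
  shows "(\<integral>\<^sup>+\<rho>. h \<rho> \<partial>normalised \<phi> A)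
    = (\<integral>\<^sup>+y. epowr (\<phi> y / ennreal (A (w y))) s * indicator {r1<..<r2} (w y) * h (w y) \<partial>lborel)"
  unfolding normalised_def
  by (subst nn_integral_distr, simp, simp, subst nn_integral_density) (measurable; simp)+

text \<open>After division by \<open>A (w y)\<close> the surface integral of \<open>\<phi>\<close>
  over each \<open>S \<rho>\<close>, times \<open>isodiam\<close>, is at least 1. The root of order
  \<open>n - 1\<close> of this density, cut to radii between \<open>a\<close> and \<open>b\<close>,
  is therefore admissible, and its energy bounds the modulus in the lower inequality from
  above.\<close>

lemma interval_bound:
  assumes \<phi> [measurable]: "\<phi> \<in> borel_measurable borel" and A [measurable]: "A \<in> borel_measurable borel"
    and Apos: "\<And>\<rho>. 0 < A \<rho>"
    and le: "\<And>\<rho>. r1 < \<rho> \<Longrightarrow> \<rho> < r2 \<Longrightarrow> ennreal (A \<rho>) \<le> ennreal (isodiam TYPE('a)) * (\<integral>\<^sup>+y\<in>S \<rho>. \<phi> y \<partial>H)"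
    and ab: "r1 \<le> a" "a < b" "b \<le> r2" and t: "0 < t"
  shows "ennreal (t * (b - a)) \<le> ennreal (1 / s) * (ennreal (t powr s) * emeasure (normalised \<phi> A) {a<..<b})
     + ennreal (1 / \<alpha>) * emeasure Q_radial {a<..<b}"
proof -
  let ?k = "DIM('a) - 1"
  define \<Phi> where "\<Phi> y = ennreal (isodiam TYPE('a)) * (\<phi> y / ennreal (A (w y))) * indicator {a<..<b} (w y)" for y
  define \<rho> where "\<rho> y = epowr (\<Phi> y) (1 / real ?k)" for y
  have [measurable]: "\<Phi> \<in> borel_measurable borel" unfolding \<Phi>_def[abs_def] by measurable
  have [measurable]: "\<rho> \<in> borel_measurable borel" unfolding \<rho>_def[abs_def] by measurable
  have \<rho>k: "\<rho> y ^ ?k = \<Phi> y" for y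
    unfolding \<rho>_def using k_pos by (simp only: epowr_power) simp
  have \<rho>p: "epowr (\<rho> y) p = epowr (\<Phi> y) s" for y
    unfolding \<rho>_def epowr_epowr s_def by simp
  have "surface_modulus p (image_sphere_family f G x0 a b) \<le> (\<integral>\<^sup>+y. epowr (\<rho> y) p \<partial>lborel)"
    unfolding surface_modulus_def
  proof (rule INF_lower, intro CollectI conjI ballI)
    fix N assume "N \<in> image_sphere_family f G x0 a b"
    then obtain c where c: "a < c" "c < b" "N = indicator (f ` (sphere x0 c \<inter> G))"
      by (auto simp: image_sphere_family_def)
    have c': "r1 < c" "c < r2" "0 < c" "c \<le> r2" using c ab r by auto
    have "sphere x0 c \<inter> G = sphere x0 c" using cball_G[OF c'(4)] by auto
    then have N: "N = indicator (S c)" using c by (simp add: S_def)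
    have [measurable]: "S c \<in> sets H" using c' by simp
    have [measurable]: "\<phi> \<in> borel_measurable H" using \<phi> by (simp cong: measurable_cong_sets)
    have "\<rho> y ^ ?k * indicator (S c) y = ennreal ((isodiam TYPE('a)) / A c) * (\<phi> y * indicator (S c) y)" for y
    proof (cases "y \<in> S c")
      case True
      then have "w y = c" using S_eq[OF c'(3,4)] by auto
      then show ?thesis
        using c Apos[of c] \<kappa>_pos True
        unfolding \<rho>k \<Phi>_def
        by (simp add: divide_ennreal_real ennreal_mult'[symmetric] mult_ac)
    qed simp
    then have eq: "(\<lambda>y. \<rho> y ^ ?k * indicator (S c) y) = (\<lambda>y. ennreal ((isodiam TYPE('a)) / A c) * (\<phi> y * indicator (S c) y))"
      by (rule ext)
    have "surface_integral (\<lambda>y. \<rho> y ^ ?k) N = ennreal ((isodiam TYPE('a)) / A c) * (\<integral>\<^sup>+y\<in>S c. \<phi> y \<partial>H)"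
      unfolding surface_integral_def N codim1_def[of "TYPE('a)", symmetric] eq
      by (rule nn_integral_cmult) measurable
    also have "\<dots> = ennreal (1 / A c) * (ennreal (isodiam TYPE('a)) * (\<integral>\<^sup>+y\<in>S c. \<phi> y \<partial>H))"
      using Apos[of c] \<kappa>_pos by (simp add: mult.assoc[symmetric] ennreal_mult'[symmetric])
    also have "\<dots> \<ge> ennreal (1 / A c) * ennreal (A c)"
      by (intro mult_left_mono le c') simp
    also have "ennreal (1 / A c) * ennreal (A c) = 1"
      using Apos[of c] by (simp add: ennreal_mult'[symmetric])
    finally show "1 \<le> surface_integral (\<lambda>y. \<rho> y ^ ?k) N" .
  qed measurable
  also have "\<dots> = ennreal ((isodiam TYPE('a)) powr s) * emeasure (normalised \<phi> A) {a<..<b}"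
  proof -
    have "epowr (\<rho> y) p = ennreal ((isodiam TYPE('a)) powr s) *
        (epowr (\<phi> y / ennreal (A (w y))) s * indicator {r1<..<r2} (w y) * indicator {a<..<b} (w y))" for y
      unfolding \<rho>p \<Phi>_def using \<kappa>_pos ab by (auto simp: epowr_mult indicator_def mult.assoc)
    moreover have "emeasure (normalised \<phi> A) {a<..<b}
        = (\<integral>\<^sup>+y. epowr (\<phi> y / ennreal (A (w y))) s * indicator {r1<..<r2} (w y) * indicator {a<..<b} (w y) \<partial>lborel)"
      using nn_integral_normalised[of "indicator {a<..<b}" \<phi> A]
        nn_integral_indicator[of "{a<..<b}" "normalised \<phi> A"] by (simp add: normalised_def)
    moreover have "(\<integral>\<^sup>+y. ennreal ((isodiam TYPE('a)) powr s) *
        (epowr (\<phi> y / ennreal (A (w y))) s * indicator {r1<..<r2} (w y) * indicator {a<..<b} (w y)) \<partial>lborel)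
      = ennreal ((isodiam TYPE('a)) powr s) *
        (\<integral>\<^sup>+y. epowr (\<phi> y / ennreal (A (w y))) s * indicator {r1<..<r2} (w y) * indicator {a<..<b} (w y) \<partial>lborel)"
      by (rule nn_integral_cmult) measurable
    ultimately show ?thesis by simp
  qed
  finally have mod: "surface_modulus p (image_sphere_family f G x0 a b) \<le> ennreal ((isodiam TYPE('a)) powr s) * emeasure (normalised \<phi> A) {a<..<b}" .
  \<comment> \<open>Taking \<open>t / isodiam\<close> for \<open>t\<close> cancels the factor
    \<open>isodiam\<close> that comes from the source on the left and the factor
    \<open>isodiam powr s\<close> in the energy of \<open>\<Phi>\<close> on the right.\<close>
  have t': "0 < t / (isodiam TYPE('a))" using t \<kappa>_pos by simp
  have "ennreal (t / (isodiam TYPE('a))) * (ennreal (isodiam TYPE('a)) * ennreal (b - a))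
    \<le> ennreal (1 / s) * (ennreal ((t / (isodiam TYPE('a))) powr s) * surface_modulus p (image_sphere_family f G x0 a b))
    + ennreal (1 / \<alpha>) * (\<integral>\<^sup>+x\<in>{x. a < dist x x0 \<and> dist x x0 < b}. Qt x \<partial>lebesgue)"
    using lower_Q_modulus_bound[OF n p conj[unfolded s_def] _ ab(2) cball_G[OF ab(3)] G(1,2) Q low t'] ab r
    by (simp add: s_def)
  also have "\<dots> \<le> ennreal (1 / s) * (ennreal ((t / (isodiam TYPE('a))) powr s) * (ennreal ((isodiam TYPE('a)) powr s) * emeasure (normalised \<phi> A) {a<..<b}))
     + ennreal (1 / \<alpha>) * emeasure Q_radial {a<..<b}"
    unfolding emeasure_Q_radial[OF ab(1,3)] by (intro add_right_mono mult_left_mono mod) auto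
  also have "ennreal ((t / (isodiam TYPE('a))) powr s) * (ennreal ((isodiam TYPE('a)) powr s) * emeasure (normalised \<phi> A) {a<..<b})
     = ennreal (t powr s) * emeasure (normalised \<phi> A) {a<..<b}"
    using t \<kappa>_pos by (simp add: mult.assoc[symmetric] ennreal_mult'[symmetric] powr_mult[symmetric])
  also have "ennreal (t / (isodiam TYPE('a))) * (ennreal (isodiam TYPE('a)) * ennreal (b - a)) = ennreal (t * (b - a))"
    using t \<kappa>_pos ab by (simp add: mult.assoc[symmetric] ennreal_mult'[symmetric])
  finally show ?thesis .
qed

text \<open>The lower bound \<open>\<delta>\<close> on \<open>A\<close> makes the normalised energy
  a finite measure. The inequality on intervals therefore extends to Borel sets of radii and may be
  used with a factor depending on the radius.\<close>

lemma plan_bound_real: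
  assumes \<phi> [measurable]: "\<phi> \<in> borel_measurable borel" and A [measurable]: "A \<in> borel_measurable borel"
    and A\<delta>: "0 < \<delta>" "\<And>\<rho>. \<delta> \<le> A \<rho>"
    and le: "\<And>\<rho>. r1 < \<rho> \<Longrightarrow> \<rho> < r2 \<Longrightarrow> ennreal (A \<rho>) \<le> ennreal (isodiam TYPE('a)) * (\<integral>\<^sup>+y\<in>S \<rho>. \<phi> y \<partial>H)"
    and fin: "(\<integral>\<^sup>+y. epowr (\<phi> y) s \<partial>lborel) < \<infinity>"
    and \<eta> [measurable]: "\<eta> \<in> borel_measurable borel" and \<eta>0: "\<And>\<rho>. 0 \<le> \<eta> \<rho>" "\<And>\<rho>. \<rho> \<notin> {r1<..<r2} \<Longrightarrow> \<eta> \<rho> = 0"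
  shows "(\<integral>\<^sup>+\<rho>. ennreal (A \<rho>) * ennreal (\<eta> \<rho>) \<partial>lborel) \<le> ennreal (1 / s) * (\<integral>\<^sup>+y. epowr (\<phi> y) s \<partial>lborel)
    + ennreal (1 / \<alpha>) * (\<integral>\<^sup>+x. Qt x * ennreal (\<eta> (dist x x0) powr \<alpha>) * indicator {x. r1 < dist x x0 \<and> dist x x0 < r2} x \<partial>lebesgue)"
proof -
  let ?N = "normalised \<phi> A"
  have Apos: "0 < A \<rho>" for \<rho> using A\<delta> by (rule less_le_trans)
  have setsN: "sets ?N = sets borel" "sets Q_radial = sets borel" "space ?N = UNIV"
    by (auto simp: normalised_def Q_radial_def)
  have finN: "emeasure ?N UNIV < \<infinity>"
  proof -
    have "emeasure ?N UNIV = (\<integral>\<^sup>+\<rho>. 1 \<partial>?N)" using setsN by simp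
    also have "\<dots> = (\<integral>\<^sup>+y. epowr (\<phi> y / ennreal (A (w y))) s * indicator {r1<..<r2} (w y) \<partial>lborel)"
      by (subst nn_integral_normalised) auto
    also have "\<dots> \<le> (\<integral>\<^sup>+y. ennreal (1 / \<delta> powr s) * epowr (\<phi> y) s \<partial>lborel)"
    proof (rule nn_integral_mono)
      fix y
      have "epowr (\<phi> y / ennreal (A (w y))) s \<le> epowr (\<phi> y / ennreal \<delta>) s"
        using A\<delta> s1 Apos unfolding divide_ennreal_real[OF Apos] divide_ennreal_real[OF A\<delta>(1)]
        by (intro epowr_mono mult_left_mono ennreal_leI divide_left_mono) auto
      also have "\<dots> = ennreal (1 / \<delta> powr s) * epowr (\<phi> y) s"
        using A\<delta> s1 by (simp add: divide_ennreal_real epowr_mult powr_divide mult.commute)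
      finally show "epowr (\<phi> y / ennreal (A (w y))) s * indicator {r1<..<r2} (w y) \<le> ennreal (1 / \<delta> powr s) * epowr (\<phi> y) s"
        by (auto simp: indicator_def)
    qed
    also have "\<dots> = ennreal (1 / \<delta> powr s) * (\<integral>\<^sup>+y. epowr (\<phi> y) s \<partial>lborel)"
      by (rule nn_integral_cmult) measurable
    also have "\<dots> < \<infinity>" using fin by (simp add: ennreal_mult_less_top)
    finally show ?thesis .
  qed
  define M where "M = density lborel (indicator {r1<..<r2} :: real \<Rightarrow> ennreal)"
  have key: "ennreal t * emeasure M B \<le> ennreal (1 / s) * (ennreal (t powr s) * emeasure ?N B) + ennreal (1 / \<alpha>) * emeasure Q_radial B"
    if t: "0 < t" and B [measurable]: "B \<in> sets borel" for t B
  proof -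
    define c1 c2 where "c1 = ennreal (1 / s) * ennreal (t powr s)" and "c2 = ennreal (1 / \<alpha>)"
    \<comment> \<open>The right-hand side is assembled into one finite measure, the form in which
      the comparison on intervals applies.\<close>
    define N3 where "N3 = measure_of UNIV (sets borel) (\<lambda>B. c1 * emeasure ?N B + c2 * emeasure Q_radial B)"
    have N3: "emeasure N3 X = c1 * emeasure ?N X + c2 * emeasure Q_radial X" if "X \<in> sets borel" for X
      unfolding N3_def
    proof (rule emeasure_measure_of_sigma)
      show "sigma_algebra UNIV (sets (borel :: real measure))" using sets.sigma_algebra_axioms[of "borel :: real measure"] by simp
      show "countably_additive (sets borel) (\<lambda>B. c1 * emeasure ?N B + c2 * emeasure Q_radial B)"
      proof (rule countably_additiveI)
        fix X :: "nat \<Rightarrow> real set" assume X: "range X \<subseteq> sets borel" "disjoint_family X"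
        have "(\<Sum>i. emeasure ?N (X i)) = emeasure ?N (\<Union>i. X i)" "(\<Sum>i. emeasure Q_radial (X i)) = emeasure Q_radial (\<Union>i. X i)"
          using X setsN by (auto intro!: suminf_emeasure)
        then show "(\<Sum>i. c1 * emeasure ?N (X i) + c2 * emeasure Q_radial (X i)) = c1 * emeasure ?N (\<Union>i. X i) + c2 * emeasure Q_radial (\<Union>i. X i)"
          by (subst suminf_add[symmetric]) auto
      qed
    qed (use that in \<open>auto simp: positive_def\<close>)
    have sets3: "sets N3 = sets borel" unfolding N3_def
      by (subst sets_measure_of) (use sets.sigma_sets_eq[of "borel :: real measure"] in auto)
    have "finite_measure N3"
    proof (rule finite_measureI)
      have "space N3 = UNIV" using sets3 by (auto dest: sets_eq_imp_space_eq)
      then show "emeasure N3 (space N3) \<noteq> \<infinity>"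
        using N3[of UNIV] finN finite_Q_radial by (auto simp: c1_def c2_def ennreal_mult_eq_top_iff)
    qed
    then have "ennreal t * emeasure lborel (B \<inter> {r1<..<r2}) \<le> emeasure N3 (B \<inter> {r1<..<r2})"
    proof (rule emeasure_ge_of_intervals[OF _ sets3 less_imp_le[OF t] r(2)])
      fix a b assume "r1 \<le> a" "a < b" "b \<le> r2"
      from interval_bound[OF \<phi> A Apos le this t] show "ennreal (t * (b - a)) \<le> emeasure N3 {a<..<b}"
        by (simp add: N3 c1_def c2_def mult.assoc)
    qed auto
    also have "\<dots> \<le> emeasure N3 B" by (rule emeasure_mono) (use B sets3 in auto)
    also have "\<dots> = ennreal (1 / s) * (ennreal (t powr s) * emeasure ?N B) + ennreal (1 / \<alpha>) * emeasure Q_radial B"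
      by (simp add: N3 c1_def c2_def mult.assoc)
    also have "emeasure lborel (B \<inter> {r1<..<r2}) = emeasure M B"
      unfolding M_def by (subst emeasure_density)
        (auto simp: nn_integral_indicator[symmetric] indicator_inter_arith mult.commute simp del: nn_integral_indicator)
    finally show ?thesis .
  qed
  \<comment> \<open>The exponent \<open>1 - \<alpha>\<close> is negative, but where
    \<open>\<eta>\<close> is 0 both \<open>h\<close> and \<open>T\<close> are 0 by the convention
    \<open>0 powr x = 0\<close>, in agreement with the left side.\<close>
  define T where "T \<rho> = ennreal (A \<rho> * \<eta> \<rho> powr (1 - \<alpha>))" for \<rho>
  define h where "h \<rho> = ennreal (\<eta> \<rho> powr \<alpha>)" for \<rho>
  have [measurable]: "T \<in> borel_measurable borel" "h \<in> borel_measurable borel"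
    unfolding T_def[abs_def] h_def[abs_def] by measurable
  have "(\<integral>\<^sup>+\<rho>. ennreal (A \<rho>) * ennreal (\<eta> \<rho>) \<partial>lborel) = (\<integral>\<^sup>+\<rho>. h \<rho> * T \<rho> \<partial>M)"
  proof -
    have "ennreal (A \<rho>) * ennreal (\<eta> \<rho>) = indicator {r1<..<r2} \<rho> * (h \<rho> * T \<rho>)" for \<rho>
    proof (cases "\<eta> \<rho> = 0")
      case True then show ?thesis by (simp add: h_def)
    next
      case False
      then have e: "0 < \<eta> \<rho>" using \<eta>0(1)[of \<rho>] by simp
      have "\<rho> \<in> {r1<..<r2}" using False \<eta>0(2) by blast
      moreover have "\<eta> \<rho> powr \<alpha> * (A \<rho> * \<eta> \<rho> powr (1 - \<alpha>)) = A \<rho> * \<eta> \<rho>"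
        using e by (simp add: mult.left_commute[of _ "A \<rho>"] powr_add[symmetric])
      ultimately show ?thesis using e Apos[of \<rho>]
        by (simp add: h_def T_def ennreal_mult'[symmetric] less_imp_le)
    qed
    then show ?thesis unfolding M_def by (subst nn_integral_density) auto
  qed
  also have "\<dots> \<le> ennreal (1 / s) * (\<integral>\<^sup>+\<rho>. h \<rho> * epowr (T \<rho>) s \<partial>?N) + ennreal (1 / \<alpha>) * (\<integral>\<^sup>+\<rho>. h \<rho> \<partial>Q_radial)"
    by (rule nn_integral_parametric_combination) (use setsN s1 key in \<open>auto simp: M_def\<close>)
  also have "(\<integral>\<^sup>+\<rho>. h \<rho> * epowr (T \<rho>) s \<partial>?N) \<le> (\<integral>\<^sup>+y. epowr (\<phi> y) s \<partial>lborel)"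
  proof -
    have hT: "h \<rho> * epowr (T \<rho>) s \<le> ennreal (A \<rho> powr s)" for \<rho>
    proof (cases "\<eta> \<rho> = 0")
      case True then show ?thesis by (simp add: h_def)
    next
      case False
      then have e: "0 < \<eta> \<rho>" using \<eta>0(1)[of \<rho>] by simp
      have "\<alpha> + (1 - \<alpha>) * s = 0" using s1 by (simp add: \<alpha>_eq field_simps)
      then have "\<eta> \<rho> powr \<alpha> * (A \<rho> * \<eta> \<rho> powr (1 - \<alpha>)) powr s = A \<rho> powr s"
        using e Apos[of \<rho>] by (simp add: powr_mult powr_powr mult.left_commute[of _ "A \<rho> powr s"] powr_add[symmetric])
      then show ?thesis using Apos[of \<rho>] by (simp add: h_def T_def ennreal_mult'[symmetric] less_imp_le)
    qed
    have "(\<integral>\<^sup>+\<rho>. h \<rho> * epowr (T \<rho>) s \<partial>?N)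
      = (\<integral>\<^sup>+y. epowr (\<phi> y / ennreal (A (w y))) s * indicator {r1<..<r2} (w y) * (h (w y) * epowr (T (w y)) s) \<partial>lborel)"
      by (rule nn_integral_normalised) measurable
    also have "\<dots> \<le> (\<integral>\<^sup>+y. epowr (\<phi> y) s \<partial>lborel)"
    proof (rule nn_integral_mono)
      fix y
      let ?A = "A (w y)"
      have "epowr (\<phi> y / ennreal ?A) s * indicator {r1<..<r2} (w y) * (h (w y) * epowr (T (w y)) s)
        \<le> epowr (\<phi> y / ennreal ?A) s * 1 * ennreal (?A powr s)"
        by (intro mult_mono hT) (auto simp: indicator_def)
      also have "\<dots> = epowr (\<phi> y) s"
        using Apos[of "w y"] s1
        by (simp add: epowr_divide ennreal_divide_times ennreal_divide_self mult_divide_eq_ennreal)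
      finally show "epowr (\<phi> y / ennreal ?A) s * indicator {r1<..<r2} (w y) * (h (w y) * epowr (T (w y)) s) \<le> epowr (\<phi> y) s" .
    qed
    finally show ?thesis .
  qed
  also have "(\<integral>\<^sup>+\<rho>. h \<rho> \<partial>Q_radial)
    = (\<integral>\<^sup>+x. Qt x * ennreal (\<eta> (dist x x0) powr \<alpha>) * indicator {x. r1 < dist x x0 \<and> dist x x0 < r2} x \<partial>lebesgue)"
    by (subst nn_integral_Q_radial) (auto simp: h_def)
  finally show ?thesis by (simp add: add_right_mono mult_left_mono)
qed

end

text \<open>Each covering set is replaced by a small open neighbourhood. The cost grows as little as
  desired because \<open>powr s\<close> is continuous, at diameter 0 thanks to \<open>s > 0\<close>.
  This is the source of semicontinuity of contents in the radius.\<close>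

lemma hausdorff_pre_open_superset:
  assumes s: "0 < s" and lt: "hausdorff_pre s \<delta> (A :: 'a::metric_space set) < c"
  obtains U where "open U" "A \<subseteq> U" "hausdorff_pre s \<delta> U < c"
proof -
  obtain C where C: "A \<subseteq> (\<Union>i. C i)" "\<And>i::nat. bounded (C i)" "\<And>i. diameter (C i) < \<delta>"
      "(\<Sum>i. hausdorff_cost s (C i)) < c"
    using hausdorff_pre_lessE[OF lt] by blast
  obtain d where d: "(\<Sum>i. hausdorff_cost s (C i)) < d" "d < c" using dense[OF C(4)] by blast
  then obtain d' \<sigma> where ds: "0 \<le> \<sigma>" "0 \<le> d'" "d = ennreal d'" "(\<Sum>i. hausdorff_cost s (C i)) = ennreal \<sigma>"
    by (cases d; cases "\<Sum>i. hausdorff_cost s (C i)") (auto simp: top.extremum_strict)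
  define \<eta> where "\<eta> = d' - \<sigma>"
  have \<eta>: "0 < \<eta>" using d(1) ds by (simp add: \<eta>_def ennreal_less_iff)
  have "\<exists>O'. open O' \<and> C i \<subseteq> O' \<and> bounded O' \<and> diameter O' < \<delta> \<and>
     hausdorff_cost s O' \<le> hausdorff_cost s (C i) + ennreal (\<eta> * (1/2)^Suc i)" for i
  proof (cases "C i = {}")
    case True
    have "0 < \<delta>" using C(3)[of i] diameter_ge_0[OF C(2)[of i]] by linarith
    then show ?thesis using True by (intro exI[of _ "{}"]) auto
  next
    case False
    let ?v = "\<lambda>\<epsilon>. unit_ball_vol s * ((diameter (C i) + 2 * \<epsilon>) / 2) powr s"
    have dge: "0 \<le> diameter (C i)" by (rule diameter_ge_0[OF C(2)])
    have "((\<lambda>\<epsilon>. ?v \<epsilon>) \<longlongrightarrow> unit_ball_vol s * ((diameter (C i) + 2 * 0) / 2) powr s) (at_right 0)"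
    proof (intro tendsto_mult tendsto_const tendsto_powr2 tendsto_divide tendsto_add tendsto_ident_at)
      show "\<forall>\<^sub>F \<epsilon> in at_right 0. 0 \<le> (diameter (C i) + 2 * \<epsilon>) / 2"
        using eventually_at_right_less[of "0::real"] by eventually_elim (use dge in simp)
    qed (use s in auto)
    then have "\<forall>\<^sub>F \<epsilon> in at_right 0. ?v \<epsilon> < unit_ball_vol s * (diameter (C i) / 2) powr s + \<eta> * (1/2)^Suc i"
      by (rule order_tendstoD) (use \<eta> in simp)
    moreover have "\<forall>\<^sub>F \<epsilon> in at_right 0. \<epsilon> < (\<delta> - diameter (C i)) / 2"
      using C(3)[of i] by (intro order_tendstoD(2)[OF tendsto_ident_at]) auto
    moreover have "\<forall>\<^sub>F \<epsilon> in at_right 0. (0::real) < \<epsilon>" by (rule eventually_at_right_less)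
    ultimately have "\<forall>\<^sub>F \<epsilon> in at_right 0. ?v \<epsilon> < unit_ball_vol s * (diameter (C i) / 2) powr s + \<eta> * (1/2)^Suc i
       \<and> \<epsilon> < (\<delta> - diameter (C i)) / 2 \<and> 0 < \<epsilon>" by eventually_elim simp
    then obtain \<epsilon> where \<epsilon>: "?v \<epsilon> < unit_ball_vol s * (diameter (C i) / 2) powr s + \<eta> * (1/2)^Suc i"
        "\<epsilon> < (\<delta> - diameter (C i)) / 2" "0 < \<epsilon>"
      using eventually_happens'[OF trivial_limit_at_right_real] by blast
    define O' where "O' = (\<Union>x\<in>C i. ball x \<epsilon>)"
    have dd: "dist x y \<le> diameter (C i) + 2 * \<epsilon>" if xy: "x \<in> O'" "y \<in> O'" for x y
    proof -
      obtain u v where uv: "u \<in> C i" "v \<in> C i" "dist u x < \<epsilon>" "dist v y < \<epsilon>" using xy by (auto simp: O'_def)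
      have "dist x y \<le> dist u x + dist u v + dist v y"
        using dist_triangle[of x y u] dist_triangle[of u y v] by (simp add: dist_commute)
      then show ?thesis using uv diameter_bounded_bound[OF C(2) uv(1,2)] by simp
    qed
    have bO: "bounded O'" unfolding bounded_two_points using dd by blast
    have ne: "O' \<noteq> {}" using False \<epsilon>(3) by (force simp: O'_def)
    then have "(SUP (x,y)\<in>O' \<times> O'. dist x y) \<le> diameter (C i) + 2 * \<epsilon>"
      using dd by (intro cSUP_least) auto
    then have dO: "diameter O' \<le> diameter (C i) + 2 * \<epsilon>" using ne by (simp add: diameter_def[of O'])
    have "hausdorff_cost s O' \<le> ennreal (?v \<epsilon>)" by (rule hausdorff_cost_le[OF less_imp_le[OF s] bO dO])
    also have "\<dots> \<le> ennreal (unit_ball_vol s * (diameter (C i) / 2) powr s + \<eta> * (1/2)^Suc i)"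
      using \<epsilon>(1) by (intro ennreal_leI) simp
    also have "\<dots> = hausdorff_cost s (C i) + ennreal (\<eta> * (1/2)^Suc i)"
      unfolding hausdorff_cost_def using \<eta> s by (intro ennreal_plus) auto
    finally have "hausdorff_cost s O' \<le> hausdorff_cost s (C i) + ennreal (\<eta> * (1/2)^Suc i)" .
    moreover have "diameter O' < \<delta>" using dO \<epsilon>(2) by (simp add: field_simps)
    moreover have "open O'" "C i \<subseteq> O'" using \<epsilon>(3) by (auto simp: O'_def)
    ultimately show ?thesis using bO by blast
  qed
  then obtain O' where O': "\<And>i. open (O' i)" "\<And>i. C i \<subseteq> O' i" "\<And>i. bounded (O' i)" "\<And>i. diameter (O' i) < \<delta>"
     "\<And>i. hausdorff_cost s (O' i) \<le> hausdorff_cost s (C i) + ennreal (\<eta> * (1/2)^Suc i)" by metis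
  have "hausdorff_pre s \<delta> (\<Union>i. O' i) \<le> (\<Sum>i. hausdorff_cost s (O' i))"
    by (rule hausdorff_pre_le) (use O' in auto)
  also have "\<dots> \<le> (\<Sum>i. hausdorff_cost s (C i) + ennreal (\<eta> * (1/2)^Suc i))"
    by (intro suminf_le O' summableI)
  also have "\<dots> = (\<Sum>i. hausdorff_cost s (C i)) + (\<Sum>i. ennreal (\<eta> * (1/2)^Suc i))"
    by (rule suminf_add[symmetric]) auto
  also have "(\<Sum>i. ennreal (\<eta> * (1/2)^Suc i)) = ennreal \<eta>"
    using power_half_series \<eta> by (intro suminf_ennreal_eq) (auto dest: sums_mult[where c=\<eta>])
  also have "(\<Sum>i. hausdorff_cost s (C i)) + ennreal \<eta> = d"
    using ds \<eta> by (simp add: \<eta>_def ennreal_plus[symmetric] del: ennreal_plus)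
  finally have "hausdorff_pre s \<delta> (\<Union>i. O' i) < c" using d(2) by simp
  moreover have "A \<subseteq> (\<Union>i. O' i)" using C(1) O'(2) by blast
  moreover have "open (\<Union>i. O' i)" using O'(1) by blast
  ultimately show ?thesis by (intro that)
qed

section \<open>Image spheres: separation, area and measurability in the radius\<close>

context lower_Q_ring
begin

lemma compact_f_cball: "\<rho> \<le> r2 \<Longrightarrow> compact (f ` cball x0 \<rho>)"
  using cball_G by (intro compact_continuous_image continuous_on_subset[OF f_cont]) auto

lemma open_D: "\<rho> \<le> r2 \<Longrightarrow> open (D \<rho>)"
proof -
  assume "\<rho> \<le> r2"
  then have G1: "ball x0 \<rho> \<subseteq> G" using cball_G by (meson ball_subset_cball order_trans)
  have "D \<rho> = G' \<inter> g -` ball x0 \<rho>"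
  proof (intro set_eqI iffI)
    fix y assume "y \<in> D \<rho>"
    then show "y \<in> G' \<inter> g -` ball x0 \<rho>" using fg G1 by (auto simp: D_def)
  next
    fix y assume "y \<in> G' \<inter> g -` ball x0 \<rho>"
    then show "y \<in> D \<rho>" using gf unfolding D_def by (intro image_eqI[of _ _ "g y"]) auto
  qed
  then show ?thesis using continuous_open_preimage[OF g_cont G(3) open_ball] by simp
qed

lemma frontier_D: "\<rho> \<le> r2 \<Longrightarrow> frontier (D \<rho>) \<subseteq> S \<rho>"
proof -
  assume r: "\<rho> \<le> r2"
  have "closure (D \<rho>) \<subseteq> f ` cball x0 \<rho>"
    using compact_f_cball[OF r] by (intro closure_minimal) (auto simp: D_def compact_imp_closed)
  then have "frontier (D \<rho>) \<subseteq> f ` cball x0 \<rho> - D \<rho>"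
    using interior_open[OF open_D[OF r]] by (auto simp: frontier_def)
  also have "\<dots> \<subseteq> S \<rho>" by (force simp: D_def S_def)
  finally show ?thesis .
qed

text \<open>A segment with exactly one endpoint in \<open>D \<rho>\<close> is connected, hence meets
  the frontier, which lies in \<open>S \<rho>\<close>. In this way image spheres enter volume
  estimates.\<close>

lemma D_crossing:
  assumes r: "\<rho> \<le> r2" and t: "0 \<le> t" and ne: "z \<in> D \<rho> \<longleftrightarrow> z + t *\<^sub>R e \<notin> D \<rho>"
  shows "z \<in> sweep e t (S \<rho>)"
proof -
  let ?L = "(\<lambda>\<tau>. z + \<tau> *\<^sub>R e) ` {0..t}"
  have "connected ?L" by (intro connected_continuous_image continuous_intros) auto
  moreover have "z \<in> ?L" "z + t *\<^sub>R e \<in> ?L" using t by (force intro: image_eqI[of _ _ 0], force)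
  then have "?L \<inter> D \<rho> \<noteq> {}" "?L - D \<rho> \<noteq> {}" using ne by blast+
  ultimately have "?L \<inter> frontier (D \<rho>) \<noteq> {}" by (rule connected_Int_frontier)
  then show ?thesis using frontier_D[OF r] by (auto simp: sweep_def)
qed

text \<open>A ball around \<open>f x0\<close> inside \<open>D r1\<close>, translated by more than
  the diameter of the image of the closed ball, leaves every \<open>D \<rho>\<close>. So it lies in
  the sweep of \<open>S \<rho>\<close>, whose volume is controlled by the area. The uniform bound
  keeps normalising factors away from 0.\<close>

lemma S_area_lower:
  obtains c0 where "0 < c0" "\<And>\<rho>. r1 \<le> \<rho> \<Longrightarrow> \<rho> \<le> r2 \<Longrightarrow> ennreal c0 \<le> hausdorff_outer (codim1 TYPE('a)) (S \<rho>)"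
proof -
  obtain e :: 'a where "e \<in> Basis" using nonempty_Basis by blast
  then have e: "norm e = 1" by simp
  have bd: "bounded (f ` cball x0 r2)" using compact_f_cball[of r2] by (simp add: compact_imp_bounded)
  define t where "t = diameter (f ` cball x0 r2) + 1"
  have t: "0 < t" using diameter_ge_0[OF bd] by (simp add: t_def)
  have oD: "open (D r1)" by (rule open_D) (use r in simp)
  have "f x0 \<in> D r1" using r by (auto simp: D_def)
  then obtain b where b: "0 < b" "ball (f x0) b \<subseteq> D r1" using oD by (meson open_contains_ball)
  define m where "m = unit_ball_vol (real DIM('a)) * b ^ DIM('a)"
  have m: "0 < m" using b by (simp add: m_def)
  define c0 where "c0 = m / (t * isodiam TYPE('a))"
  show ?thesis
  proof (rule that)
    show "0 < c0" using m t \<kappa>_pos by (simp add: c0_def)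
    fix \<rho> assume \<rho>: "r1 \<le> \<rho>" "\<rho> \<le> r2"
    show "ennreal c0 \<le> hausdorff_outer (codim1 TYPE('a)) (S \<rho>)"
    proof (cases "hausdorff_outer (codim1 TYPE('a)) (S \<rho>)")
      case (real h)
      have "ball (f x0) b \<subseteq> sweep e t (S \<rho>)"
      proof
        fix z assume "z \<in> ball (f x0) b"
        then have z: "z \<in> D \<rho>" "z \<in> f ` cball x0 r2" using b \<rho> r by (auto simp: D_def)
        have "z + t *\<^sub>R e \<notin> f ` cball x0 r2"
          using diameter_bounded_bound[OF bd z(2), of "z + t *\<^sub>R e"] e t by (auto simp: dist_norm t_def)
        then have "z + t *\<^sub>R e \<notin> D \<rho>" using \<rho> by (auto simp: D_def)
        then show "z \<in> sweep e t (S \<rho>)" using z t \<rho> by (intro D_crossing) auto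
      qed
      then have "emeasure lborel (ball (f x0) b) \<le> emeasure lborel (sweep e t (S \<rho>))"
        using compact_sweep[OF compact_S, of \<rho> e t] \<rho> r
        by (intro emeasure_mono) (auto intro: borel_closed compact_imp_closed)
      also have "\<dots> \<le> ennreal t * (ennreal (isodiam TYPE('a)) * hausdorff_outer (codim1 TYPE('a)) (S \<rho>))"
        by (rule emeasure_sweep_le) (use n e compact_S \<rho> r t real in auto)
      also have "\<dots> = ennreal (t * (isodiam TYPE('a) * h))"
        using real t \<kappa>_pos by (simp add: ennreal_mult'[symmetric])
      finally have "m \<le> t * (isodiam TYPE('a) * h)"
        using b t \<kappa>_pos real by (simp add: emeasure_ball m_def ennreal_le_iff)
      then have "c0 \<le> h" using t \<kappa>_pos by (simp add: c0_def field_simps)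
      then show ?thesis using real by (simp add: ennreal_leI)
    qed simp
  qed
qed

text \<open>Truncating \<open>A\<close> at \<open>\<delta> + N\<close> leaves the lower bound
  \<open>\<delta>\<close> and the upper estimate intact; monotone convergence then admits infinite
  values.\<close>

lemma plan_bound:
  assumes \<phi> [measurable]: "\<phi> \<in> borel_measurable borel" and A [measurable]: "A \<in> borel_measurable borel"
    and \<delta>: "0 < \<delta>" "\<And>\<rho>. ennreal \<delta> \<le> A \<rho>"
    and le: "\<And>\<rho>. r1 < \<rho> \<Longrightarrow> \<rho> < r2 \<Longrightarrow> A \<rho> \<le> ennreal (isodiam TYPE('a)) * (\<integral>\<^sup>+y\<in>S \<rho>. \<phi> y \<partial>H)"
    and fin: "(\<integral>\<^sup>+y. epowr (\<phi> y) s \<partial>lborel) < \<infinity>"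
    and \<eta> [measurable]: "\<eta> \<in> borel_measurable borel" and \<eta>0: "\<And>\<rho>. 0 \<le> \<eta> \<rho>" "\<And>\<rho>. \<rho> \<notin> {r1<..<r2} \<Longrightarrow> \<eta> \<rho> = 0"
  shows "(\<integral>\<^sup>+\<rho>. A \<rho> * ennreal (\<eta> \<rho>) \<partial>lborel) \<le> ennreal (1 / s) * (\<integral>\<^sup>+y. epowr (\<phi> y) s \<partial>lborel)
    + ennreal (1 / \<alpha>) * (\<integral>\<^sup>+x. Qt x * ennreal (\<eta> (dist x x0) powr \<alpha>) * indicator {x. r1 < dist x x0 \<and> dist x x0 < r2} x \<partial>lebesgue)"
    (is "_ \<le> ?rhs")
proof -
  define B where "B N \<rho> = min (A \<rho>) (ennreal (\<delta> + real N))" for N \<rho>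
  have Bfin: "B N \<rho> < top" for N \<rho> by (auto simp: B_def min_def top.not_eq_extremum le_less_trans)
  have [measurable]: "B N \<in> borel_measurable borel" for N unfolding B_def[abs_def] by measurable
  have bound: "(\<integral>\<^sup>+\<rho>. B N \<rho> * ennreal (\<eta> \<rho>) \<partial>lborel) \<le> ?rhs" for N
  proof -
    have eq: "ennreal (enn2real (B N \<rho>)) = B N \<rho>" for \<rho> using Bfin by simp
    have "(\<integral>\<^sup>+\<rho>. ennreal (enn2real (B N \<rho>)) * ennreal (\<eta> \<rho>) \<partial>lborel) \<le> ?rhs"
    proof (rule plan_bound_real[OF \<phi> _ \<delta>(1) _ _ fin \<eta> \<eta>0])
      show "(\<lambda>\<rho>. enn2real (B N \<rho>)) \<in> borel_measurable borel" by measurable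
      fix \<rho>
      have "ennreal \<delta> \<le> B N \<rho>" using \<delta> by (auto simp: B_def intro: ennreal_leI)
      then have "ennreal \<delta> \<le> ennreal (enn2real (B N \<rho>))" by (simp add: eq)
      then show "\<delta> \<le> enn2real (B N \<rho>)" by (simp add: ennreal_le_iff)
      show "ennreal (enn2real (B N \<rho>)) \<le> ennreal (isodiam TYPE('a)) * (\<integral>\<^sup>+y\<in>S \<rho>. \<phi> y \<partial>H)" if "r1 < \<rho>" "\<rho> < r2"
        unfolding eq using le[OF that] by (auto simp: B_def intro: min.coboundedI1)
    qed auto
    then show ?thesis by (simp add: eq)
  qed
  have sup: "(SUP N. B N \<rho> * ennreal (\<eta> \<rho>)) = A \<rho> * ennreal (\<eta> \<rho>)" for \<rho>
  proof -
    have "(SUP N. B N \<rho>) = A \<rho>"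
    proof (rule antisym)
      show "(SUP N. B N \<rho>) \<le> A \<rho>" by (rule SUP_least) (simp add: B_def)
      show "A \<rho> \<le> (SUP N. B N \<rho>)"
      proof (cases "A \<rho>")
        case (real a)
        obtain N where "a \<le> real N" using real_arch_simple by blast
        then have "A \<rho> \<le> ennreal (\<delta> + real N)" unfolding real(2) using \<delta>(1) by (intro ennreal_leI) simp
        then have "A \<rho> = B N \<rho>" by (simp add: B_def min_absorb1)
        then show ?thesis by (metis SUP_upper UNIV_I)
      next
        case top
        have "ennreal (real N) \<le> (SUP N. B N \<rho>)" for N
          using \<delta> by (intro SUP_upper2[of N]) (auto simp: B_def top intro!: ennreal_leI)
        then have "(SUP N. ennreal (real N)) \<le> (SUP N. B N \<rho>)" by (rule SUP_least)
        then show ?thesis by (simp add: ennreal_SUP_of_nat_eq_top ennreal_of_nat_eq_real_of_nat[symmetric] top_unique top)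
      qed
    qed
    then show ?thesis by (simp add: SUP_mult_right_ennreal[symmetric])
  qed
  have "(SUP N. \<integral>\<^sup>+\<rho>. B N \<rho> * ennreal (\<eta> \<rho>) \<partial>lborel) \<le> ?rhs" by (rule SUP_least) (rule bound)
  also have "(SUP N. \<integral>\<^sup>+\<rho>. B N \<rho> * ennreal (\<eta> \<rho>) \<partial>lborel) = (\<integral>\<^sup>+\<rho>. (SUP N. B N \<rho> * ennreal (\<eta> \<rho>)) \<partial>lborel)"
  proof (rule nn_integral_monotone_convergence_SUP[symmetric])
    have "B m \<rho> \<le> B N \<rho>" if "m \<le> N" for m N \<rho>
      unfolding B_def using that by (intro min.mono ennreal_leI) auto
    then show "incseq (\<lambda>N \<rho>. B N \<rho> * ennreal (\<eta> \<rho>))"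
      by (auto simp: incseq_def le_fun_def intro!: mult_right_mono)
  qed measurable
  also have "\<dots> = (\<integral>\<^sup>+\<rho>. A \<rho> * ennreal (\<eta> \<rho>) \<partial>lborel)" by (simp only: sup)
  finally show ?thesis .
qed

text \<open>The excluded radii are the distances from \<open>x0\<close> to a compact set of points,
  hence a closed set.\<close>

lemma sphere_image_subset_open:
  assumes K: "closed K" and U: "open U"
  shows "open {\<rho> \<in> {r1<..<r2}. S \<rho> \<inter> K \<subseteq> U}"
proof -
  define B where "B = cball x0 r2 \<inter> f -` (K - U)"
  have "closedin (top_of_set (cball x0 r2)) B"
    unfolding B_def using K U cball_G[of r2]
    by (intro continuous_closedin_preimage continuous_on_subset[OF f_cont]) auto
  then have cB: "compact B" by (rule closedin_compact[OF compact_cball])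
  have "closed ((\<lambda>x. dist x0 x) ` B)"
    by (intro compact_imp_closed compact_continuous_image cB continuous_intros)
  moreover have "{\<rho> \<in> {r1<..<r2}. S \<rho> \<inter> K \<subseteq> U} = {r1<..<r2} - (\<lambda>x. dist x0 x) ` B"
  proof (intro set_eqI iffI)
    fix \<rho> assume a: "\<rho> \<in> {\<rho> \<in> {r1<..<r2}. S \<rho> \<inter> K \<subseteq> U}"
    have "\<rho> \<notin> (\<lambda>x. dist x0 x) ` B"
    proof
      assume "\<rho> \<in> (\<lambda>x. dist x0 x) ` B"
      then obtain x where x: "x \<in> B" "\<rho> = dist x0 x" by blast
      then have "f x \<in> S \<rho> \<inter> K" "f x \<notin> U" by (auto simp: B_def S_def)
      then show False using a by blast
    qed
    then show "\<rho> \<in> {r1<..<r2} - (\<lambda>x. dist x0 x) ` B" using a by blast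
  next
    fix \<rho> assume a: "\<rho> \<in> {r1<..<r2} - (\<lambda>x. dist x0 x) ` B"
    have "y \<in> U" if y: "y \<in> S \<rho> \<inter> K" for y
    proof (rule ccontr)
      assume "y \<notin> U"
      obtain x where x: "x \<in> sphere x0 \<rho>" "y = f x" using y by (auto simp: S_def)
      then have "x \<in> B" using y \<open>y \<notin> U\<close> a by (auto simp: B_def)
      then show False using a x by auto
    qed
    then show "\<rho> \<in> {\<rho> \<in> {r1<..<r2}. S \<rho> \<inter> K \<subseteq> U}" using a by auto
  qed
  ultimately show ?thesis by (simp add: open_Diff)
qed

lemma codim1_pos: "0 < codim1 TYPE('a)"
  using k_pos by (simp only: codim1_def of_nat_0_less_iff)

text \<open>Inside the ring each content of \<open>S \<rho> \<inter> K\<close> is upper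
  semicontinuous in \<open>\<rho>\<close>: an open superset of small content still contains the
  slices of nearby radii. The Hausdorff measure is a countable supremum of such functions.\<close>

lemma hausdorff_closed_slice_measurable:
  assumes K: "closed K"
  shows "(\<lambda>\<rho>. indicator {r1<..<r2} \<rho> * hausdorff_outer (codim1 TYPE('a)) (S \<rho> \<inter> K)) \<in> borel_measurable borel"
proof -
  let ?p = "\<lambda>m \<rho>. indicator {r1<..<r2} \<rho> * hausdorff_pre (codim1 TYPE('a)) (1 / real (Suc m)) (S \<rho> \<inter> K)"
  have pm: "?p m \<in> borel_measurable borel" for m
  proof (rule borel_measurableI_less)
    fix c :: ennreal
    have "open {\<rho> \<in> {r1<..<r2}. hausdorff_pre (codim1 TYPE('a)) (1 / real (Suc m)) (S \<rho> \<inter> K) < c}"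
      (is "open ?A")
      unfolding open_subopen[of ?A]
    proof
      fix \<rho> assume "\<rho> \<in> ?A"
      then have \<rho>: "\<rho> \<in> {r1<..<r2}" "hausdorff_pre (codim1 TYPE('a)) (1 / real (Suc m)) (S \<rho> \<inter> K) < c" by auto
      obtain U where U: "open U" "S \<rho> \<inter> K \<subseteq> U" "hausdorff_pre (codim1 TYPE('a)) (1 / real (Suc m)) U < c"
        using hausdorff_pre_open_superset[OF codim1_pos \<rho>(2)] by blast
      show "\<exists>T. open T \<and> \<rho> \<in> T \<and> T \<subseteq> ?A"
      proof (intro exI conjI)
        show "open {\<rho> \<in> {r1<..<r2}. S \<rho> \<inter> K \<subseteq> U}" by (rule sphere_image_subset_open[OF K U(1)])
        show "\<rho> \<in> {\<rho> \<in> {r1<..<r2}. S \<rho> \<inter> K \<subseteq> U}" using \<rho> U by simp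
        show "{\<rho> \<in> {r1<..<r2}. S \<rho> \<inter> K \<subseteq> U} \<subseteq> ?A"
          using U(3) by (auto intro: le_less_trans[OF hausdorff_pre_mono])
      qed
    qed
    then have "?A \<in> sets borel" by simp
    moreover have "{\<rho>. ?p m \<rho> < c} = ?A \<union> (if 0 < c then - {r1<..<r2} else {})"
      by (auto simp: indicator_def split: if_splits)
    ultimately have "{\<rho>. ?p m \<rho> < c} \<in> sets borel" by simp
    then show "{\<rho> \<in> space borel. ?p m \<rho> < c} \<in> sets borel" by simp
  qed
  have "indicator {r1<..<r2} \<rho> * hausdorff_outer (codim1 TYPE('a)) (S \<rho> \<inter> K) = (SUP m. ?p m \<rho>)" for \<rho>
    unfolding hausdorff_outer_SUP_seq by (rule SUP_mult_left_ennreal)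
  then show ?thesis using pm by (simp cong: measurable_cong)
qed

text \<open>Finite area is what the complement step of \<open>slice_measurable\<close> relies on,
  where measures of slices are subtracted.\<close>

definition good_radii :: "real set" where
  "good_radii = {\<rho> \<in> {r1<..<r2}. hausdorff_outer (codim1 TYPE('a)) (S \<rho>) < top}"

lemma good_radii_sub: "\<rho> \<in> good_radii \<Longrightarrow> r1 < \<rho> \<and> \<rho> < r2 \<and> 0 < \<rho> \<and> \<rho> \<le> r2"
  using r by (auto simp: good_radii_def)

lemma hausdorff_S_measurable:
  "(\<lambda>\<rho>. indicator {r1<..<r2} \<rho> * hausdorff_outer (codim1 TYPE('a)) (S \<rho>)) \<in> borel_measurable borel"
  using hausdorff_closed_slice_measurable[of UNIV] by simp

lemma good_radii_borel [measurable]: "good_radii \<in> sets borel"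
proof -
  let ?h = "\<lambda>\<rho>. indicator {r1<..<r2} \<rho> * hausdorff_outer (codim1 TYPE('a)) (S \<rho>)"
  have [measurable]: "?h \<in> borel_measurable borel" by (rule hausdorff_S_measurable)
  have "{\<rho> \<in> space borel. \<rho> \<in> {r1<..<r2} \<and> ?h \<rho> < top} \<in> sets borel" by measurable
  also have "{\<rho> \<in> space borel. \<rho> \<in> {r1<..<r2} \<and> ?h \<rho> < top} = good_radii"
    by (auto simp: good_radii_def)
  finally show ?thesis .
qed

lemma H_S: "\<rho> \<in> good_radii \<Longrightarrow> B \<in> sets borel \<Longrightarrow> emeasure H (S \<rho> \<inter> B) = hausdorff_outer (codim1 TYPE('a)) (S \<rho> \<inter> B)"
  using good_radii_sub by (intro emeasure_hausdorff_measure) auto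

text \<open>Dynkin's argument, starting from the closed sets, which generate the Borel sets and are
  stable under intersection.\<close>

lemma slice_measurable:
  assumes "B \<in> sets borel"
  shows "(\<lambda>\<rho>. indicator good_radii \<rho> * emeasure H (S \<rho> \<inter> B)) \<in> borel_measurable borel"
proof -
  let ?s = "\<lambda>B \<rho>. indicator good_radii \<rho> * emeasure H (S \<rho> \<inter> B)"
  have cl: "?s K \<in> borel_measurable borel" if K: "closed K" for K
  proof -
    have "?s K \<rho> = indicator good_radii \<rho> * (indicator {r1<..<r2} \<rho> * hausdorff_outer (codim1 TYPE('a)) (S \<rho> \<inter> K))" for \<rho>
      using H_S[of \<rho> K] good_radii_sub[of \<rho>] K by (auto simp: indicator_def borel_closed)
    then show ?thesis using hausdorff_closed_slice_measurable[OF K] by simp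
  qed
  have bs: "sigma_sets UNIV {C :: 'a set. closed C} = sets borel" by (simp add: borel_eq_closed)
  have B: "B \<in> sigma_sets UNIV {C :: 'a set. closed C}" using assms bs by blast
  have "Int_stable {C :: 'a set. closed C}" "{C :: 'a set. closed C} \<subseteq> Pow UNIV" by (auto simp: Int_stable_def)
  from this B show ?thesis
  proof (induction rule: sigma_sets_induct_disjoint)
    case (basic A) then show ?case using cl by simp
  next
    case empty then show ?case by simp
  next
    case (compl A)
    then have A: "A \<in> sets borel" using bs by blast
    have "?s (UNIV - A) \<rho> = ?s UNIV \<rho> - ?s A \<rho>" for \<rho>
    proof (cases "\<rho> \<in> good_radii")
      case True
      note g = good_radii_sub[OF True]
      have Sb: "S \<rho> \<in> sets borel" using g by simp
      have fin: "emeasure H (S \<rho> \<inter> A) \<noteq> \<infinity>"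
      proof -
        have "emeasure H (S \<rho> \<inter> A) \<le> emeasure H (S \<rho>)" by (rule emeasure_mono) (use Sb in auto)
        also have "\<dots> < top" using H_S[OF True, of UNIV] True by (simp add: good_radii_def)
        finally show ?thesis by simp
      qed
      have "S \<rho> \<inter> (UNIV - A) = S \<rho> - S \<rho> \<inter> A" by auto
      then have "emeasure H (S \<rho> \<inter> (UNIV - A)) = emeasure H (S \<rho>) - emeasure H (S \<rho> \<inter> A)"
        using emeasure_Diff[OF fin, of "S \<rho>"] Sb A by simp
      then show ?thesis using True by simp
    qed simp
    then show ?case using compl cl[of UNIV] by simp
  next
    case (union A)
    then have A: "A i \<in> sets borel" for i using bs by blast
    have eq: "?s (\<Union>i. A i) \<rho> = (\<Sum>i. ?s (A i) \<rho>)" for \<rho>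
    proof (cases "\<rho> \<in> good_radii")
      case True
      have Sb: "S \<rho> \<in> sets borel" using good_radii_sub[OF True] by simp
      have sm: "(\<Sum>i. emeasure H (S \<rho> \<inter> A i)) = emeasure H (\<Union>i. S \<rho> \<inter> A i)"
        using union(1) Sb A by (intro suminf_emeasure) (auto simp: disjoint_family_on_def)
      have "emeasure H (S \<rho> \<inter> (\<Union>i. A i)) = (\<Sum>i. emeasure H (S \<rho> \<inter> A i))"
          by (simp only: Int_UN_distrib sm)
        then show ?thesis using True by simp
    qed simp
    have [measurable]: "?s (A i) \<in> borel_measurable borel" for i by (rule union(3))
    show ?case unfolding eq by measurable
  qed
qed

text \<open>The measure \<open>\<mu>\<close> of the overview multiplied by \<open>isodiam\<close>,
  the same constant that bounds swept volumes, and restricted to spheres of finite area.\<close>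

definition plan :: "(real \<Rightarrow> real) \<Rightarrow> 'a measure" where
  "plan \<eta> = measure_of UNIV (sets borel) (\<lambda>B. \<integral>\<^sup>+\<rho>. ennreal (\<eta> \<rho>) *
     (ennreal (isodiam TYPE('a)) * (indicator good_radii \<rho> * emeasure H (S \<rho> \<inter> B))) \<partial>lborel)"

lemma sets_plan [simp, measurable_cong]: "sets (plan \<eta>) = sets borel"
  unfolding plan_def by (subst sets_measure_of) (use sets.sigma_sets_eq[of "borel :: 'a measure"] in auto)

lemma space_plan [simp]: "space (plan \<eta>) = UNIV"
  using sets_eq_imp_space_eq[OF sets_plan] by simp

lemma emeasure_plan:
  assumes [measurable]: "\<eta> \<in> borel_measurable borel" and B: "B \<in> sets borel"
  shows "emeasure (plan \<eta>) B = (\<integral>\<^sup>+\<rho>. ennreal (\<eta> \<rho>) *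
     (ennreal (isodiam TYPE('a)) * (indicator good_radii \<rho> * emeasure H (S \<rho> \<inter> B))) \<partial>lborel)"
  unfolding plan_def
proof (rule emeasure_measure_of_sigma[OF _ _ _ B])
  let ?F = "\<lambda>B. \<integral>\<^sup>+\<rho>. ennreal (\<eta> \<rho>) *
     (ennreal (isodiam TYPE('a)) * (indicator good_radii \<rho> * emeasure H (S \<rho> \<inter> B))) \<partial>lborel"
  show "sigma_algebra UNIV (sets (borel :: 'a measure))" using sets.sigma_algebra_axioms[of "borel :: 'a measure"] by simp
  show "countably_additive (sets borel) ?F"
  proof (rule countably_additiveI)
    fix A :: "nat \<Rightarrow> 'a set" assume A: "range A \<subseteq> sets borel" "disjoint_family A"
    have [measurable]: "(\<lambda>\<rho>. indicator good_radii \<rho> * emeasure H (S \<rho> \<inter> A i)) \<in> borel_measurable borel" for i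
      using A by (intro slice_measurable) auto
    have "(\<Sum>i. ?F (A i)) = (\<integral>\<^sup>+\<rho>. (\<Sum>i. ennreal (\<eta> \<rho>) *
     (ennreal (isodiam TYPE('a)) * (indicator good_radii \<rho> * emeasure H (S \<rho> \<inter> A i)))) \<partial>lborel)"
      by (rule nn_integral_suminf[symmetric]) measurable
    also have "\<dots> = ?F (\<Union>i. A i)"
    proof (rule nn_integral_cong)
      fix \<rho>
      show "(\<Sum>i. ennreal (\<eta> \<rho>) * (ennreal (isodiam TYPE('a)) * (indicator good_radii \<rho> * emeasure H (S \<rho> \<inter> A i))))
        = ennreal (\<eta> \<rho>) * (ennreal (isodiam TYPE('a)) * (indicator good_radii \<rho> * emeasure H (S \<rho> \<inter> (\<Union>i. A i))))"
      proof (cases "\<rho> \<in> good_radii")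
        case True
        have Sb: "S \<rho> \<in> sets borel" using good_radii_sub[OF True] by simp
        have sm: "(\<Sum>i. emeasure H (S \<rho> \<inter> A i)) = emeasure H (\<Union>i. S \<rho> \<inter> A i)"
          using A Sb by (intro suminf_emeasure) (auto simp: disjoint_family_on_def)
        have "emeasure H (S \<rho> \<inter> (\<Union>i. A i)) = (\<Sum>i. emeasure H (S \<rho> \<inter> A i))"
          by (simp only: Int_UN_distrib sm)
        then show ?thesis using True by simp
      qed simp
    qed
    finally show "(\<Sum>i. ?F (A i)) = ?F (\<Union>i. A i)" .
  qed
qed (auto simp: positive_def)

text \<open>Measurability of the inner integral and the formula are proved together, since the steps
  of the induction use the first to derive the second.\<close>

lemma nn_integral_plan:
  assumes \<eta> [measurable]: "\<eta> \<in> borel_measurable borel" and \<phi>: "\<phi> \<in> borel_measurable borel"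
  shows "(\<lambda>\<rho>. indicator good_radii \<rho> * (\<integral>\<^sup>+y\<in>S \<rho>. \<phi> y \<partial>H)) \<in> borel_measurable borel \<and>
    (\<integral>\<^sup>+y. \<phi> y \<partial>plan \<eta>) = (\<integral>\<^sup>+\<rho>. ennreal (\<eta> \<rho>) *
     (ennreal (isodiam TYPE('a)) * (indicator good_radii \<rho> * (\<integral>\<^sup>+y\<in>S \<rho>. \<phi> y \<partial>H))) \<partial>lborel)"
  (is "?m \<phi> \<in> _ \<and> ?l \<phi> = ?r \<phi>")
  using \<phi>
proof (induction rule: borel_measurable_induct)
  case (cong f g)
  then have "f = g" by auto
  then show ?case using cong by simp
next
  case (set A)
  have S: "?m (indicator A) = (\<lambda>\<rho>. indicator good_radii \<rho> * emeasure H (S \<rho> \<inter> A))"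
  proof
    fix \<rho>
    show "?m (indicator A) \<rho> = indicator good_radii \<rho> * emeasure H (S \<rho> \<inter> A)"
    proof (cases "\<rho> \<in> good_radii")
      case True
      have Sb: "S \<rho> \<in> sets borel" using good_radii_sub[OF True] by simp
      have "(\<integral>\<^sup>+y\<in>S \<rho>. indicator A y \<partial>H) = (\<integral>\<^sup>+y. indicator (S \<rho> \<inter> A) y \<partial>H)"
        by (intro nn_integral_cong) (auto simp: indicator_def)
      also have "\<dots> = emeasure H (S \<rho> \<inter> A)" by (rule nn_integral_indicator) (use Sb set in simp)
      finally show ?thesis by simp
    qed simp
  qed
  have "?r (indicator A) = emeasure (plan \<eta>) A"
    unfolding emeasure_plan[OF \<eta> set] by (intro nn_integral_cong) (simp only: fun_cong[OF S])
  moreover have "?l (indicator A) = emeasure (plan \<eta>) A"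
    by (rule nn_integral_indicator) (use set in simp)
  moreover have "?m (indicator A) \<in> borel_measurable borel" unfolding S by (rule slice_measurable[OF set])
  ultimately show ?case by metis
next
  case (mult u c)
  have S: "?m (\<lambda>x. c * u x) = (\<lambda>\<rho>. c * ?m u \<rho>)"
  proof
    fix \<rho> show "?m (\<lambda>x. c * u x) \<rho> = c * ?m u \<rho>"
    proof (cases "\<rho> \<in> good_radii")
      case True
      have [measurable]: "S \<rho> \<in> sets H" "u \<in> borel_measurable H" using good_radii_sub[OF True] mult by (auto cong: measurable_cong_sets)
      show ?thesis by (simp add: nn_integral_cmult mult.assoc mult.left_commute)
    qed simp
  qed
  have [measurable]: "?m u \<in> borel_measurable borel" "u \<in> borel_measurable (plan \<eta>)" using mult by (auto cong: measurable_cong_sets)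
  have "?r (\<lambda>x. c * u x) = (\<integral>\<^sup>+\<rho>. c * (ennreal (\<eta> \<rho>) * (ennreal (isodiam TYPE('a)) * ?m u \<rho>)) \<partial>lborel)"
    by (intro nn_integral_cong, unfold fun_cong[OF S]) (simp only: mult_ac)
  also have "\<dots> = c * ?r u" by (rule nn_integral_cmult) measurable
  finally show ?case using mult unfolding S by (simp add: nn_integral_cmult)
next
  case (add u v)
  have S: "?m (\<lambda>x. v x + u x) = (\<lambda>\<rho>. ?m v \<rho> + ?m u \<rho>)"
  proof
    fix \<rho> show "?m (\<lambda>x. v x + u x) \<rho> = ?m v \<rho> + ?m u \<rho>"
    proof (cases "\<rho> \<in> good_radii")
      case True
      have [measurable]: "S \<rho> \<in> sets H" "u \<in> borel_measurable H" "v \<in> borel_measurable H"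
        using good_radii_sub[OF True] add by (auto cong: measurable_cong_sets)
      show ?thesis by (simp add: nn_integral_add distrib_right distrib_left)
    qed simp
  qed
  have [measurable]: "?m u \<in> borel_measurable borel" "?m v \<in> borel_measurable borel"
    "u \<in> borel_measurable (plan \<eta>)" "v \<in> borel_measurable (plan \<eta>)" using add by (auto cong: measurable_cong_sets)
  have "?r (\<lambda>x. v x + u x) = (\<integral>\<^sup>+\<rho>. ennreal (\<eta> \<rho>) * (ennreal (isodiam TYPE('a)) * ?m v \<rho>)
      + ennreal (\<eta> \<rho>) * (ennreal (isodiam TYPE('a)) * ?m u \<rho>) \<partial>lborel)"
    by (intro nn_integral_cong, unfold fun_cong[OF S]) (simp only: distrib_left)
  also have "\<dots> = ?r v + ?r u" by (rule nn_integral_add) measurable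
  finally show ?case using add unfolding S by (simp add: nn_integral_add)
next
  case (seq U)
  have S: "?m (SUP i. U i) = (\<lambda>\<rho>. SUP i. ?m (U i) \<rho>)"
  proof
    fix \<rho> show "?m (SUP i. U i) \<rho> = (SUP i. ?m (U i) \<rho>)"
    proof (cases "\<rho> \<in> good_radii")
      case True
      have [measurable]: "S \<rho> \<in> sets H" "\<And>i. U i \<in> borel_measurable H" using good_radii_sub[OF True] seq by (auto cong: measurable_cong_sets)
      have "(\<integral>\<^sup>+y\<in>S \<rho>. (SUP i. U i) y \<partial>H) = (\<integral>\<^sup>+y. (SUP i. U i y * indicator (S \<rho>) y) \<partial>H)"
        by (simp add: SUP_mult_right_ennreal image_comp)
      also have "\<dots> = (SUP i. \<integral>\<^sup>+y. U i y * indicator (S \<rho>) y \<partial>H)"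
        using seq by (intro nn_integral_monotone_convergence_SUP) (auto simp: incseq_def le_fun_def intro!: mult_right_mono)
      finally show ?thesis using True by simp
    qed simp
  qed
  have [measurable]: "?m (U i) \<in> borel_measurable borel" "U i \<in> borel_measurable (plan \<eta>)" for i
    using seq by (auto cong: measurable_cong_sets)
  have inc: "incseq (\<lambda>i \<rho>. ennreal (\<eta> \<rho>) * (ennreal (isodiam TYPE('a)) * ?m (U i) \<rho>))"
    using seq by (auto simp: incseq_def le_fun_def intro!: mult_left_mono nn_integral_mono mult_right_mono)
  have "?r (SUP i. U i) = (\<integral>\<^sup>+\<rho>. (SUP i. ennreal (\<eta> \<rho>) * (ennreal (isodiam TYPE('a)) * ?m (U i) \<rho>)) \<partial>lborel)"
    by (intro nn_integral_cong, unfold fun_cong[OF S]) (simp only: SUP_mult_left_ennreal)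
  also have "\<dots> = (SUP i. ?r (U i))" by (rule nn_integral_monotone_convergence_SUP[OF inc]) measurable
  also have "\<dots> = (SUP i. ?l (U i))" using seq by simp
  also have "\<dots> = (\<integral>\<^sup>+y. (SUP i. U i y) \<partial>plan \<eta>)"
    by (rule nn_integral_monotone_convergence_SUP[symmetric]) (use seq in auto)
  also have "\<dots> = ?l (SUP i. U i)" by (simp add: image_comp)
  finally have "?l (SUP i. U i) = ?r (SUP i. U i)" by (rule sym)
  moreover have "?m (SUP i. U i) \<in> borel_measurable borel" unfolding S by measurable
  ultimately show ?case by blast
qed

end

section \<open>Sweeping along a segment\<close>

lemma nn_integral_layer_cake:
  fixes f :: "'a \<Rightarrow> real"
  assumes M: "sigma_finite_measure M" and f [measurable]: "f \<in> borel_measurable M" and f0: "\<And>x. 0 \<le> f x"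
  shows "(\<integral>\<^sup>+x. ennreal (f x) \<partial>M) = (\<integral>\<^sup>+t. indicator {0<..} t * emeasure M {x \<in> space M. t \<le> f x} \<partial>lborel)"
proof -
  interpret M: sigma_finite_measure M by fact
  interpret P: pair_sigma_finite M "lborel :: real measure" ..
  have "(\<integral>\<^sup>+x. ennreal (f x) \<partial>M) = (\<integral>\<^sup>+x. (\<integral>\<^sup>+t. indicator {0<..} t * (if t \<le> f x then 1 else 0) \<partial>lborel) \<partial>M)"
  proof (rule nn_integral_cong)
    fix x
    have "(\<integral>\<^sup>+t. indicator {0<..} t * (if t \<le> f x then 1 else 0) \<partial>lborel) = (\<integral>\<^sup>+t. indicator {0<..f x} t \<partial>lborel)"
      by (intro nn_integral_cong) (auto simp: indicator_def)
    then show "ennreal (f x) = (\<integral>\<^sup>+t. indicator {0<..} t * (if t \<le> f x then 1 else 0) \<partial>lborel)" using f0[of x] by simp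
  qed
  also have "\<dots> = (\<integral>\<^sup>+t. (\<integral>\<^sup>+x. indicator {0<..} t * (if t \<le> f x then 1 else 0) \<partial>M) \<partial>lborel)"
    by (rule P.Fubini'[symmetric]) measurable
  also have "\<dots> = (\<integral>\<^sup>+t. indicator {0<..} t * emeasure M {x \<in> space M. t \<le> f x} \<partial>lborel)"
  proof (rule nn_integral_cong)
    fix t :: real
    have "(\<integral>\<^sup>+x. indicator {0<..} t * (if t \<le> f x then 1 else 0) \<partial>M)
       = (\<integral>\<^sup>+x. indicator {0<..} t * indicator {x \<in> space M. t \<le> f x} x \<partial>M)"
      by (intro nn_integral_cong) (auto simp: indicator_def)
    also have "\<dots> = indicator {0<..} t * emeasure M {x \<in> space M. t \<le> f x}"
      by (rule nn_integral_cmult_indicator) measurable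
    finally show "(\<integral>\<^sup>+x. indicator {0<..} t * (if t \<le> f x then 1 else 0) \<partial>M) = indicator {0<..} t * emeasure M {x \<in> space M. t \<le> f x}" .
  qed
  finally show ?thesis .
qed

text \<open>Layer by layer: if \<open>\<psi> z \<ge> l\<close> and \<open>z\<close> lies in the
  sweep, then the point of \<open>S\<close> reached from \<open>z\<close> satisfies
  \<open>\<psi> + C * t \<ge> l\<close>. So each superlevel set within the sweep is swept from a
  compact piece of \<open>S\<close>, and the volume bound is integrated over
  \<open>l\<close>.\<close>

lemma nn_integral_sweep_le:
  fixes S :: "'a::euclidean_space set" and \<psi> :: "'a \<Rightarrow> real"
  assumes n: "2 \<le> DIM('a)" and e: "norm e = 1" and S: "compact S" and t: "0 \<le> t"
    and fin: "hausdorff_outer (codim1 TYPE('a)) S < top"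
    and \<psi>: "\<And>x. 0 \<le> \<psi> x" "\<And>x y. \<bar>\<psi> x - \<psi> y\<bar> \<le> C * dist x y" and C: "0 \<le> C"
  shows "(\<integral>\<^sup>+z\<in>sweep e t S. ennreal (\<psi> z) \<partial>lborel)
    \<le> ennreal t * (ennreal (isodiam TYPE('a)) * (\<integral>\<^sup>+x\<in>S. ennreal (\<psi> x + C * t) \<partial>hausdorff_measure (codim1 TYPE('a))))"
proof -
  let ?H = "hausdorff_measure (codim1 TYPE('a)) :: 'a measure" and ?\<kappa> = "ennreal (isodiam TYPE('a))"
  have cont: "continuous_on UNIV \<psi>"
    using \<psi>(2) C by (intro lipschitz_on_continuous_on[of C]) (auto simp: lipschitz_on_def dist_real_def)
  then have [measurable]: "\<psi> \<in> borel_measurable borel" by (rule borel_measurable_continuous_onI)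
  have Sb [measurable]: "S \<in> sets borel" using S by (intro borel_closed compact_imp_closed)
  have cs: "compact (sweep e t S)" using S by (rule compact_sweep)
  then have sb [measurable]: "sweep e t S \<in> sets borel" by (intro borel_closed compact_imp_closed)
  define L where "L = density lborel (indicator (sweep e t S) :: 'a \<Rightarrow> ennreal)"
  define N where "N = density ?H (indicator S :: 'a \<Rightarrow> ennreal)"
  have SH: "(indicator S :: 'a \<Rightarrow> ennreal) \<in> borel_measurable ?H" by (rule borel_measurable_indicator) simp
  have L: "emeasure L B = emeasure lborel (sweep e t S \<inter> B)" if "B \<in> sets borel" for B
    unfolding L_def using that by (subst emeasure_density)
      (auto simp: nn_integral_indicator[symmetric] indicator_inter_arith simp del: nn_integral_indicator)
  have N: "emeasure N B = hausdorff_outer (codim1 TYPE('a)) (S \<inter> B)" if B: "B \<in> sets borel" for B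
  proof -
    have "emeasure N B = (\<integral>\<^sup>+x. indicator S x * indicator B x \<partial>?H)"
      unfolding N_def using B by (intro emeasure_density SH) simp
    also have "\<dots> = (\<integral>\<^sup>+x. indicator (S \<inter> B) x \<partial>?H)" by (simp add: indicator_inter_arith)
    also have "\<dots> = emeasure ?H (S \<inter> B)" by (rule nn_integral_indicator) (use B in simp)
    finally show ?thesis using B by (simp add: emeasure_hausdorff_measure)
  qed
  have setsLN [measurable_cong]: "sets L = sets borel" "sets N = sets borel" by (auto simp: L_def N_def)
  have sp: "space L = UNIV" "space N = UNIV" by (auto simp: L_def N_def)
  have sL: "sigma_finite_measure L"
  proof -
    have "emeasure L (space L) = emeasure lborel (sweep e t S)" using L[of UNIV] sp by simp
    also have "\<dots> < \<infinity>" using cs by (rule emeasure_compact_finite)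
    finally interpret finite_measure L by (intro finite_measureI) simp
    show ?thesis ..
  qed
  have sN: "sigma_finite_measure N"
  proof -
    have "emeasure N (space N) \<noteq> \<infinity>" using N[of UNIV] sp fin by simp
    then interpret finite_measure N by (rule finite_measureI)
    show ?thesis ..
  qed
  have "(\<integral>\<^sup>+z\<in>sweep e t S. ennreal (\<psi> z) \<partial>lborel) = (\<integral>\<^sup>+z. ennreal (\<psi> z) \<partial>L)"
    unfolding L_def by (subst nn_integral_density) (auto simp: mult.commute)
  also have "\<dots> = (\<integral>\<^sup>+l. indicator {0<..} l * emeasure L {x. l \<le> \<psi> x} \<partial>lborel)"
    using nn_integral_layer_cake[OF sL, of \<psi>] \<psi>(1) sp by simp
  also have "\<dots> \<le> (\<integral>\<^sup>+l. ennreal t * ?\<kappa> * (indicator {0<..} l * emeasure N {x. l \<le> \<psi> x + C * t}) \<partial>lborel)"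
  proof (rule nn_integral_mono)
    fix l :: real
    let ?B = "{x. l \<le> \<psi> x + C * t}"
    have clB: "closed ?B" by (intro closed_Collect_le continuous_intros cont)
    have "emeasure L {x. l \<le> \<psi> x} = emeasure lborel (sweep e t S \<inter> {x. l \<le> \<psi> x})" by (rule L) measurable
    also have "\<dots> \<le> emeasure lborel (sweep e t (S \<inter> ?B))"
    proof (rule emeasure_mono)
      show "sweep e t S \<inter> {x. l \<le> \<psi> x} \<subseteq> sweep e t (S \<inter> ?B)"
      proof
        fix z assume "z \<in> sweep e t S \<inter> {x. l \<le> \<psi> x}"
        then obtain \<tau> where \<tau>: "\<tau> \<in> {0..t}" "z + \<tau> *\<^sub>R e \<in> S" "l \<le> \<psi> z" by (auto simp: sweep_def)
        have "\<psi> z - \<psi> (z + \<tau> *\<^sub>R e) \<le> C * dist z (z + \<tau> *\<^sub>R e)" using \<psi>(2)[of z "z + \<tau> *\<^sub>R e"] by linarith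
        also have "\<dots> \<le> C * t" using \<tau>(1) e C by (intro mult_left_mono) (auto simp: dist_norm)
        finally show "z \<in> sweep e t (S \<inter> ?B)" using \<tau> by (auto simp: sweep_def)
      qed
      show "sweep e t (S \<inter> ?B) \<in> sets lborel"
        using compact_sweep[OF compact_Int_closed[OF S clB]] by (auto intro: borel_closed compact_imp_closed)
    qed
    also have "\<dots> \<le> ennreal t * (?\<kappa> * hausdorff_outer (codim1 TYPE('a)) (S \<inter> ?B))"
    proof (rule emeasure_sweep_le[OF n e compact_Int_closed[OF S clB] t])
      show "hausdorff_outer (codim1 TYPE('a)) (S \<inter> ?B) < top"
        using hausdorff_outer_mono[of "S \<inter> ?B" S "codim1 TYPE('a)"] fin by (auto intro: le_less_trans)
    qed
    also have "hausdorff_outer (codim1 TYPE('a)) (S \<inter> ?B) = emeasure N ?B"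
      by (rule N[symmetric]) (use clB in simp)
    finally show "indicator {0<..} l * emeasure L {x. l \<le> \<psi> x} \<le> ennreal t * ?\<kappa> * (indicator {0<..} l * emeasure N ?B)"
      by (auto simp: indicator_def mult.assoc)
  qed
  also have "\<dots> = ennreal t * ?\<kappa> * (\<integral>\<^sup>+l. indicator {0<..} l * emeasure N {x. l \<le> \<psi> x + C * t} \<partial>lborel)"
  proof (rule nn_integral_cmult)
    interpret N: sigma_finite_measure N by (rule sN)
    have "(\<lambda>l. emeasure N (Pair l -` {p \<in> space (borel \<Otimes>\<^sub>M N). fst p \<le> \<psi> (snd p) + C * t})) \<in> borel_measurable borel"
      by (rule N.measurable_emeasure_Pair) measurable
    moreover have "Pair l -` {p \<in> space (borel \<Otimes>\<^sub>M N). fst p \<le> \<psi> (snd p) + C * t} = {x. l \<le> \<psi> x + C * t}" for l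
      by (auto simp: space_pair_measure sp)
    ultimately have [measurable]: "(\<lambda>l. emeasure N {x. l \<le> \<psi> x + C * t}) \<in> borel_measurable borel" by simp
    show "(\<lambda>l. indicator {0<..} l * emeasure N {x. l \<le> \<psi> x + C * t}) \<in> borel_measurable lborel" by measurable
  qed
  also have "(\<integral>\<^sup>+l. indicator {0<..} l * emeasure N {x. l \<le> \<psi> x + C * t} \<partial>lborel) = (\<integral>\<^sup>+x. ennreal (\<psi> x + C * t) \<partial>N)"
    using nn_integral_layer_cake[OF sN, of "\<lambda>x. \<psi> x + C * t"] \<psi>(1) C t sp by simp
  also have "\<dots> = (\<integral>\<^sup>+x. indicator S x * ennreal (\<psi> x + C * t) \<partial>?H)"
    unfolding N_def
  proof (rule nn_integral_density[OF SH])
    show "(\<lambda>x. ennreal (\<psi> x + C * t)) \<in> borel_measurable ?H" by measurable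
  qed
  finally show ?thesis by (simp add: mult.assoc mult.commute[of "indicator S _"])
qed

text \<open>Either \<open>y \<le> \<theta> * x\<close> or \<open>x < y / \<theta>\<close>, and one
  summand suffices in each case. The factor of \<open>x powr s\<close> tends to 1 with
  \<open>\<theta>\<close>, which a fixed constant such as \<open>2 powr s\<close> would not
  provide.\<close>

lemma add_powr_le:
  fixes x y s \<theta> :: real
  assumes "0 \<le> x" "0 \<le> y" "0 < \<theta>" "0 < s"
  shows "(x + y) powr s \<le> (1 + \<theta>) powr s * x powr s + (1 + 1 / \<theta>) powr s * y powr s"
proof (cases "y \<le> \<theta> * x")
  case True
  then have "(x + y) powr s \<le> ((1 + \<theta>) * x) powr s"
    using assms by (intro powr_mono2) (auto simp: algebra_simps)
  also have "\<dots> = (1 + \<theta>) powr s * x powr s" using assms by (simp add: powr_mult)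
  finally show ?thesis by (simp add: add_increasing2)
next
  case False
  then have "x \<le> 1 / \<theta> * y" using assms by (simp add: field_simps)
  then have "(x + y) powr s \<le> ((1 + 1 / \<theta>) * y) powr s"
    using assms by (intro powr_mono2) (auto simp: distrib_right)
  also have "\<dots> = (1 + 1 / \<theta>) powr s * y powr s" using assms by (simp add: powr_mult)
  finally show ?thesis by (simp add: add_increasing)
qed

lemma epowr_add_le:
  assumes "0 < \<theta>" "0 < s" "0 \<le> y"
  shows "epowr (x + ennreal y) s \<le> ennreal ((1 + \<theta>) powr s) * epowr x s + ennreal ((1 + 1 / \<theta>) powr s * y powr s)"
proof (cases x)
  case (real r)
  have "epowr (x + ennreal y) s = ennreal ((r + y) powr s)"
    using real assms by (simp add: ennreal_plus[symmetric] del: ennreal_plus)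
  also have "\<dots> \<le> ennreal ((1 + \<theta>) powr s * r powr s + (1 + 1 / \<theta>) powr s * y powr s)"
    using real assms by (intro ennreal_leI add_powr_le) auto
  finally show ?thesis using real assms by (simp add: ennreal_mult)
next
  case top
  then show ?thesis using assms by (simp add: ennreal_mult_top)
qed

section \<open>The s-energy estimate for the measure carried by the image spheres\<close>

context lower_Q_ring
begin

definition energy :: "(real \<Rightarrow> real) \<Rightarrow> ennreal" where
  "energy \<eta> = (\<integral>\<^sup>+x. Qt x * ennreal (\<eta> (dist x x0) powr \<alpha>) * indicator {x. r1 < dist x x0 \<and> dist x x0 < r2} x \<partial>lebesgue)"

definition K0 :: "'a set" where "K0 = f ` cball x0 r2"

lemma K0: "compact K0" "K0 \<in> sets borel" "emeasure lborel K0 < \<infinity>"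
proof -
  show c: "compact K0" unfolding K0_def by (rule compact_f_cball) simp
  then show "K0 \<in> sets borel" by (intro borel_closed compact_imp_closed)
  show "emeasure lborel K0 < \<infinity>" using c by (rule emeasure_compact_finite)
qed

lemma S_K0: "\<rho> \<le> r2 \<Longrightarrow> S \<rho> \<subseteq> K0"
  by (auto simp: S_def K0_def)

text \<open>Testing with the indicator of the compact image \<open>K0\<close> bounds the integral of
  area times \<open>\<eta>\<close> by the volume of \<open>K0\<close> and the energy, both finite.
  So the area is finite for almost every radius with \<open>\<eta> > 0\<close>.\<close>

lemma AE_good_radii:
  assumes \<eta> [measurable]: "\<eta> \<in> borel_measurable borel" and \<eta>0: "\<And>\<rho>. 0 \<le> \<eta> \<rho>" "\<And>\<rho>. \<rho> \<notin> {r1<..<r2} \<Longrightarrow> \<eta> \<rho> = 0"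
    and fin: "energy \<eta> < \<infinity>"
  shows "AE \<rho> in lborel. \<eta> \<rho> = 0 \<or> \<rho> \<in> good_radii"
proof -
  let ?\<kappa> = "isodiam TYPE('a)" and ?k = "codim1 TYPE('a)"
  obtain c0 where c0: "0 < c0" "\<And>\<rho>. r1 \<le> \<rho> \<Longrightarrow> \<rho> \<le> r2 \<Longrightarrow> ennreal c0 \<le> hausdorff_outer ?k (S \<rho>)"
    using S_area_lower by blast
  \<comment> \<open>The value \<open>c0\<close> outside the ring only maintains the lower bound
    demanded by \<open>plan_bound\<close>.\<close>
  define A where "A \<rho> = ennreal ?\<kappa> * (if \<rho> \<in> {r1<..<r2} then hausdorff_outer ?k (S \<rho>) else ennreal c0)" for \<rho>
  have Aeq: "A = (\<lambda>\<rho>. ennreal ?\<kappa> * (indicator {r1<..<r2} \<rho> * hausdorff_outer ?k (S \<rho>) + indicator (- {r1<..<r2}) \<rho> * ennreal c0))"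
    by (auto simp: A_def indicator_def)
  have [measurable]: "(\<lambda>\<rho>. indicator {r1<..<r2} \<rho> * hausdorff_outer ?k (S \<rho>)) \<in> borel_measurable borel"
    by (rule hausdorff_S_measurable)
  have [measurable]: "A \<in> borel_measurable borel" unfolding Aeq by measurable
  have "(\<integral>\<^sup>+\<rho>. A \<rho> * ennreal (\<eta> \<rho>) \<partial>lborel) \<le> ennreal (1 / s) * (\<integral>\<^sup>+y. epowr (indicator K0 y) s \<partial>lborel) + ennreal (1 / \<alpha>) * energy \<eta>"
    unfolding energy_def
  proof (rule plan_bound[where \<delta> = "?\<kappa> * c0"])
    show "indicator K0 \<in> borel_measurable borel" using K0 by measurable
    show "0 < ?\<kappa> * c0" using c0 \<kappa>_pos by simp
    show "ennreal (?\<kappa> * c0) \<le> A \<rho>" for \<rho>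
      using c0(2)[of \<rho>] \<kappa>_pos c0(1) by (auto simp: A_def ennreal_mult' intro!: mult_left_mono)
    show "A \<rho> \<le> ennreal ?\<kappa> * (\<integral>\<^sup>+y\<in>S \<rho>. indicator K0 y \<partial>H)" if \<rho>: "r1 < \<rho>" "\<rho> < r2" for \<rho>
    proof -
      have Sb: "S \<rho> \<in> sets borel" using \<rho> r by simp
      have "(\<integral>\<^sup>+y\<in>S \<rho>. indicator K0 y \<partial>H) = (\<integral>\<^sup>+y. indicator (S \<rho>) y \<partial>H)"
        using S_K0[of \<rho>] \<rho> by (intro nn_integral_cong) (auto simp: indicator_def)
      also have "\<dots> = hausdorff_outer ?k (S \<rho>)"
        using Sb by (subst nn_integral_indicator) (auto simp: emeasure_hausdorff_measure)
      finally show ?thesis using \<rho> by (simp add: A_def)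
    qed
    have "(\<integral>\<^sup>+y. epowr (indicator K0 y) s \<partial>lborel) = (\<integral>\<^sup>+y. indicator K0 y \<partial>lborel)"
      by (intro nn_integral_cong) (auto simp: indicator_def)
    then show "(\<integral>\<^sup>+y. epowr (indicator K0 y) s \<partial>lborel) < \<infinity>" using K0 by simp
  qed (use \<eta>0 in auto)
  also have "(\<integral>\<^sup>+y. epowr (indicator K0 y) s \<partial>lborel) = (\<integral>\<^sup>+y. indicator K0 y \<partial>lborel)"
    by (intro nn_integral_cong) (auto simp: indicator_def)
  also have "\<dots> = emeasure lborel K0" using K0 by simp
  also have "ennreal (1 / s) * emeasure lborel K0 + ennreal (1 / \<alpha>) * energy \<eta> < \<infinity>"
    using K0(3) fin by (simp add: ennreal_mult_less_top)
  finally have "AE \<rho> in lborel. A \<rho> * ennreal (\<eta> \<rho>) \<noteq> \<infinity>"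
    by (intro nn_integral_noteq_infinite) auto
  then show ?thesis
  proof eventually_elim
    case (elim \<rho>)
    show ?case
    proof (rule ccontr)
      assume a: "\<not> (\<eta> \<rho> = 0 \<or> \<rho> \<in> good_radii)"
      then have \<rho>: "\<rho> \<in> {r1<..<r2}" using \<eta>0(2) by blast
      then have "hausdorff_outer ?k (S \<rho>) = top" using a by (simp add: good_radii_def less_top[symmetric])
      then have "A \<rho> = top" using \<rho> \<kappa>_pos by (simp add: A_def ennreal_mult_top)
      moreover have "0 < \<eta> \<rho>" using a \<eta>0(1)[of \<rho>] by simp
      ultimately show False using elim by (simp add: ennreal_top_mult)
    qed
  qed
qed

text \<open>The natural choice of \<open>A\<close>, the integral of \<open>\<phi>\<close> over
  \<open>S \<rho>\<close>, may fail to be bounded below. A small constant on \<open>K0\<close> is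
  added to \<open>\<phi>\<close>, which turns the area bound into a lower bound for
  \<open>A\<close>, and is removed in the limit.\<close>

lemma plan_le:
  assumes \<eta> [measurable]: "\<eta> \<in> borel_measurable borel" and \<eta>0: "\<And>\<rho>. 0 \<le> \<eta> \<rho>" "\<And>\<rho>. \<rho> \<notin> good_radii \<Longrightarrow> \<eta> \<rho> = 0"
    and \<phi> [measurable]: "\<phi> \<in> borel_measurable borel" and fin: "(\<integral>\<^sup>+y. epowr (\<phi> y) s \<partial>lborel) < \<infinity>"
  shows "(\<integral>\<^sup>+y. \<phi> y \<partial>plan \<eta>) \<le> ennreal (1 / s) * (\<integral>\<^sup>+y. epowr (\<phi> y) s \<partial>lborel) + ennreal (1 / \<alpha>) * energy \<eta>"
proof -
  let ?\<kappa> = "isodiam TYPE('a)" and ?k = "codim1 TYPE('a)"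
  let ?I = "\<integral>\<^sup>+y. epowr (\<phi> y) s \<partial>lborel"
  have [measurable]: "K0 \<in> sets borel" by (rule K0)
  obtain c0 where c0: "0 < c0" "\<And>\<rho>. r1 \<le> \<rho> \<Longrightarrow> \<rho> \<le> r2 \<Longrightarrow> ennreal c0 \<le> hausdorff_outer ?k (S \<rho>)"
    using S_area_lower by blast
  have good: "\<rho> \<in> {r1<..<r2}" if "\<rho> \<in> good_radii" for \<rho> using good_radii_sub[OF that] by simp
  have step: "(\<integral>\<^sup>+y. \<phi> y \<partial>plan \<eta>) \<le> ennreal (1 / s) * (ennreal ((1 + \<theta>) powr s) * ?I
      + ennreal ((1 + 1 / \<theta>) powr s * (\<theta>\<^sup>2) powr s) * emeasure lborel K0) + ennreal (1 / \<alpha>) * energy \<eta>"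
    if \<theta>: "0 < \<theta>" for \<theta>
  proof -
    \<comment> \<open>The square makes the extra term vanish: \<open>(1 + 1 / \<theta>) *
      \<theta>\<^sup>2 = \<theta>\<^sup>2 + \<theta>\<close> tends to 0, although the factor
      \<open>1 + 1 / \<theta>\<close> from the splitting blows up.\<close>
    define \<phi>' where "\<phi>' y = \<phi> y + ennreal (\<theta>\<^sup>2) * indicator K0 y" for y
    have [measurable]: "\<phi>' \<in> borel_measurable borel" unfolding \<phi>'_def[abs_def] by measurable
    have m: "(\<lambda>\<rho>. indicator good_radii \<rho> * (\<integral>\<^sup>+y\<in>S \<rho>. \<phi>' y \<partial>H)) \<in> borel_measurable borel"
      and rep: "(\<integral>\<^sup>+y. \<phi>' y \<partial>plan \<eta>) = (\<integral>\<^sup>+\<rho>. ennreal (\<eta> \<rho>) *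
         (ennreal ?\<kappa> * (indicator good_radii \<rho> * (\<integral>\<^sup>+y\<in>S \<rho>. \<phi>' y \<partial>H))) \<partial>lborel)"
      using nn_integral_plan[OF \<eta>, of \<phi>'] by auto
    note [measurable] = m
    define A where "A \<rho> = ennreal ?\<kappa> * (indicator good_radii \<rho> * (\<integral>\<^sup>+y\<in>S \<rho>. \<phi>' y \<partial>H)
        + indicator (- good_radii) \<rho> * ennreal (\<theta>\<^sup>2 * c0))" for \<rho>
    have [measurable]: "A \<in> borel_measurable borel" unfolding A_def[abs_def] by measurable
    have low: "ennreal (\<theta>\<^sup>2 * c0) \<le> (\<integral>\<^sup>+y\<in>S \<rho>. \<phi>' y \<partial>H)" if \<rho>: "\<rho> \<in> {r1<..<r2}" for \<rho>
    proof -
      have Sb: "S \<rho> \<in> sets borel" using \<rho> r by simp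
      have "ennreal (\<theta>\<^sup>2 * c0) \<le> ennreal (\<theta>\<^sup>2) * hausdorff_outer ?k (S \<rho>)"
        using c0(2)[of \<rho>] \<rho> c0(1) by (simp add: ennreal_mult mult_left_mono)
      also have "\<dots> = (\<integral>\<^sup>+y. ennreal (\<theta>\<^sup>2) * indicator (S \<rho>) y \<partial>H)"
        using Sb by (subst nn_integral_cmult_indicator) (auto simp: emeasure_hausdorff_measure)
      also have "\<dots> \<le> (\<integral>\<^sup>+y\<in>S \<rho>. \<phi>' y \<partial>H)"
        using S_K0[of \<rho>] \<rho> by (intro nn_integral_mono) (auto simp: indicator_def \<phi>'_def)
      finally show ?thesis .
    qed
    have le: "(\<integral>\<^sup>+y. epowr (\<phi>' y) s \<partial>lborel) \<le> ennreal ((1 + \<theta>) powr s) * ?I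
        + ennreal ((1 + 1 / \<theta>) powr s * (\<theta>\<^sup>2) powr s) * emeasure lborel K0"
    proof -
      have "(\<integral>\<^sup>+y. epowr (\<phi>' y) s \<partial>lborel) \<le> (\<integral>\<^sup>+y. ennreal ((1 + \<theta>) powr s) * epowr (\<phi> y) s
        + ennreal ((1 + 1 / \<theta>) powr s * (\<theta>\<^sup>2) powr s) * indicator K0 y \<partial>lborel)"
      proof (rule nn_integral_mono)
        fix y
        show "epowr (\<phi>' y) s \<le> ennreal ((1 + \<theta>) powr s) * epowr (\<phi> y) s
           + ennreal ((1 + 1 / \<theta>) powr s * (\<theta>\<^sup>2) powr s) * indicator K0 y"
        proof (cases "y \<in> K0")
          case True
          then show ?thesis using epowr_add_le[OF \<theta>, of s "\<theta>\<^sup>2" "\<phi> y"] s1 by (simp add: \<phi>'_def)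
        next
          case False
          have "1 * epowr (\<phi> y) s \<le> ennreal ((1 + \<theta>) powr s) * epowr (\<phi> y) s"
            using \<theta> s1 by (intro mult_right_mono) (auto simp: ge_one_powr_ge_zero ennreal_leI[of 1, simplified])
          then show ?thesis using False by (simp add: \<phi>'_def)
        qed
      qed
      also have "\<dots> = ennreal ((1 + \<theta>) powr s) * ?I
        + ennreal ((1 + 1 / \<theta>) powr s * (\<theta>\<^sup>2) powr s) * emeasure lborel K0"
        by (simp add: nn_integral_add nn_integral_cmult nn_integral_cmult_indicator)
      finally show ?thesis .
    qed
    have "(\<integral>\<^sup>+y. \<phi> y \<partial>plan \<eta>) \<le> (\<integral>\<^sup>+y. \<phi>' y \<partial>plan \<eta>)"
      by (intro nn_integral_mono) (simp add: \<phi>'_def)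
    also have "\<dots> = (\<integral>\<^sup>+\<rho>. A \<rho> * ennreal (\<eta> \<rho>) \<partial>lborel)"
      unfolding rep
    proof (rule nn_integral_cong)
      fix \<rho>
      show "ennreal (\<eta> \<rho>) * (ennreal ?\<kappa> * (indicator good_radii \<rho> * (\<integral>\<^sup>+y\<in>S \<rho>. \<phi>' y \<partial>H))) = A \<rho> * ennreal (\<eta> \<rho>)"
        using \<eta>0(2)[of \<rho>] by (cases "\<rho> \<in> good_radii") (simp_all add: A_def mult.commute)
    qed
    also have "\<dots> \<le> ennreal (1 / s) * (\<integral>\<^sup>+y. epowr (\<phi>' y) s \<partial>lborel) + ennreal (1 / \<alpha>) * energy \<eta>"
      unfolding energy_def
    proof (rule plan_bound[where \<delta> = "?\<kappa> * (\<theta>\<^sup>2 * c0)"])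
      show "0 < ?\<kappa> * (\<theta>\<^sup>2 * c0)" using c0 \<kappa>_pos \<theta> by simp
      show "ennreal (?\<kappa> * (\<theta>\<^sup>2 * c0)) \<le> A \<rho>" for \<rho>
        using low[of \<rho>] good[of \<rho>] \<kappa>_pos
        by (cases "\<rho> \<in> good_radii") (auto simp: A_def ennreal_mult' intro!: mult_left_mono)
      show "A \<rho> \<le> ennreal ?\<kappa> * (\<integral>\<^sup>+y\<in>S \<rho>. \<phi>' y \<partial>H)" if "r1 < \<rho>" "\<rho> < r2" for \<rho>
        using low[of \<rho>] that by (cases "\<rho> \<in> good_radii") (auto simp: A_def intro!: mult_left_mono)
      show "(\<integral>\<^sup>+y. epowr (\<phi>' y) s \<partial>lborel) < \<infinity>"
        using le by (rule le_less_trans) (use fin K0 in \<open>simp add: ennreal_mult_less_top\<close>)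
      show "0 \<le> \<eta> \<rho>" for \<rho> by (rule \<eta>0)
      show "\<eta> \<rho> = 0" if "\<rho> \<notin> {r1<..<r2}" for \<rho> using that good \<eta>0(2) by blast
    qed measurable
    also have "\<dots> \<le> ennreal (1 / s) * (ennreal ((1 + \<theta>) powr s) * ?I
      + ennreal ((1 + 1 / \<theta>) powr s * (\<theta>\<^sup>2) powr s) * emeasure lborel K0) + ennreal (1 / \<alpha>) * energy \<eta>"
      by (intro add_right_mono mult_left_mono le) simp
    finally show ?thesis .
  qed
  obtain I m where Im: "?I = ennreal I" "0 \<le> I" "emeasure lborel K0 = ennreal m" "0 \<le> m"
    using fin K0(3) by (cases ?I; cases "emeasure lborel K0") auto
  let ?b = "\<lambda>\<theta>. 1 / s * ((1 + \<theta>) powr s * I + (\<theta>\<^sup>2 + \<theta>) powr s * m)"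
  have "(\<integral>\<^sup>+y. \<phi> y \<partial>plan \<eta>) \<le> ennreal (?b \<theta>) + ennreal (1 / \<alpha>) * energy \<eta>" if \<theta>: "0 < \<theta>" for \<theta>
  proof -
    have "(1 + 1 / \<theta>) powr s * (\<theta>\<^sup>2) powr s = ((1 + 1 / \<theta>) * \<theta>\<^sup>2) powr s"
      using \<theta> by (simp add: powr_mult)
    also have "(1 + 1 / \<theta>) * \<theta>\<^sup>2 = \<theta>\<^sup>2 + \<theta>" using \<theta> by (simp add: field_simps power2_eq_square)
    finally have e: "(1 + 1 / \<theta>) powr s * (\<theta>\<^sup>2) powr s = (\<theta>\<^sup>2 + \<theta>) powr s" .
    have "ennreal (1 / s) * (ennreal ((1 + \<theta>) powr s) * ?I + ennreal ((\<theta>\<^sup>2 + \<theta>) powr s) * emeasure lborel K0) = ennreal (?b \<theta>)"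
      using s1 Im by (simp add: ennreal_mult'[symmetric] ennreal_plus[symmetric] del: ennreal_plus)
    then show ?thesis using step[OF \<theta>] unfolding e by simp
  qed
  then have ev: "\<forall>\<^sub>F \<theta> in at_right 0. (\<integral>\<^sup>+y. \<phi> y \<partial>plan \<eta>) \<le> ennreal (?b \<theta>) + ennreal (1 / \<alpha>) * energy \<eta>"
    by (auto intro: eventually_mono[OF eventually_at_right_less])
  have "((\<lambda>\<theta>. ?b \<theta>) \<longlongrightarrow> 1 / s * ((1 + 0) powr s * I + (0\<^sup>2 + 0) powr s * m)) (at_right 0)"
  proof (intro tendsto_mult tendsto_add tendsto_const tendsto_powr2 tendsto_power tendsto_ident_at)
    show "\<forall>\<^sub>F x in at_right 0. 0 \<le> 1 + (x::real)"
      using eventually_at_right_less[of "0::real"] by eventually_elim simp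
    show "\<forall>\<^sub>F x in at_right 0. 0 \<le> x\<^sup>2 + (x::real)"
      using eventually_at_right_less[of "0::real"] by eventually_elim simp
  qed (use s1 in auto)
  then have "((\<lambda>\<theta>. ennreal (?b \<theta>) + ennreal (1 / \<alpha>) * energy \<eta>) \<longlongrightarrow>
     ennreal (1 / s * ((1 + 0) powr s * I + (0\<^sup>2 + 0) powr s * m)) + ennreal (1 / \<alpha>) * energy \<eta>) (at_right 0)"
    by (intro tendsto_add tendsto_ennrealI tendsto_const)
  from tendsto_lowerbound[OF this ev] have "(\<integral>\<^sup>+y. \<phi> y \<partial>plan \<eta>) \<le> ennreal (1 / s * I) + ennreal (1 / \<alpha>) * energy \<eta>"
    by simp
  then show ?thesis using Im s1 by (simp add: ennreal_mult'[symmetric])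
qed

end

section \<open>The mollified potential\<close>

lemma mollifier_exists:
  assumes \<delta>: "0 < (\<delta>::real)"
  obtains \<theta> :: "'a::euclidean_space \<Rightarrow> real" and C where "\<And>z. 0 \<le> \<theta> z" "0 \<le> C"
    "\<And>x y. \<bar>\<theta> x - \<theta> y\<bar> \<le> C * dist x y" "\<And>z. \<delta> \<le> norm z \<Longrightarrow> \<theta> z = 0" "\<And>z. \<theta> z \<le> C * \<delta>"
    "(\<integral>\<^sup>+z. ennreal (\<theta> z) \<partial>lborel) = 1" "\<And>z. \<theta> (- z) = \<theta> z"
proof -
  \<comment> \<open>A cone, to be normalised by its integral \<open>J\<close>: the Lipschitz
    constant \<open>1 / J\<close> also gives the height bound \<open>\<delta> / J\<close>, so one
    constant \<open>C\<close> serves both conclusions.\<close>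
  let ?h = "\<lambda>z::'a. max 0 (\<delta> - norm z)"
  have [measurable]: "?h \<in> borel_measurable borel" by measurable
  let ?I = "\<integral>\<^sup>+z. ennreal (?h z) \<partial>lborel"
  have "?I \<le> (\<integral>\<^sup>+z. ennreal \<delta> * indicator (cball (0::'a) \<delta>) z \<partial>lborel)"
    using \<delta> by (intro nn_integral_mono) (auto simp: indicator_def max_def intro!: ennreal_leI)
  also have "\<dots> = ennreal \<delta> * emeasure lborel (cball (0::'a) \<delta>)"
    by (rule nn_integral_cmult_indicator) simp
  also have "\<dots> < top" using emeasure_lborel_cball_finite[of "0::'a" \<delta>] by (simp add: ennreal_mult_less_top)
  finally have fin: "?I < top" .
  have "0 < ennreal (\<delta> / 2) * emeasure lborel (ball (0::'a) (\<delta> / 2))"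
    using \<delta> less_imp_neq[OF unit_ball_vol_pos[of "real DIM('a)"]]
    by (simp add: emeasure_ball ennreal_zero_less_mult_iff zero_less_iff_neq_zero)
  also have "\<dots> = (\<integral>\<^sup>+z. ennreal (\<delta> / 2) * indicator (ball (0::'a) (\<delta> / 2)) z \<partial>lborel)"
    by (rule nn_integral_cmult_indicator[symmetric]) simp
  also have "\<dots> \<le> ?I"
    using \<delta> by (intro nn_integral_mono) (auto simp: indicator_def max_def intro!: ennreal_leI)
  finally have pos: "0 < ?I" .
  obtain J where J: "?I = ennreal J" "0 < J" using fin pos by (cases ?I) auto
  let ?\<theta> = "\<lambda>z. ?h z / J"
  show ?thesis
  proof (rule that[of ?\<theta> "1 / J"])
    fix x y :: 'a
    have "\<bar>?h x - ?h y\<bar> \<le> norm (x - y)"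
      using norm_triangle_ineq3[of x y] by (auto simp: max_def abs_if split: if_splits)
    then show "\<bar>?\<theta> x - ?\<theta> y\<bar> \<le> 1 / J * dist x y"
      using J(2) by (simp add: diff_divide_distrib[symmetric] dist_norm divide_right_mono)
  next
    have "(\<integral>\<^sup>+z. ennreal (?\<theta> z) \<partial>lborel) = (\<integral>\<^sup>+z. ennreal (1 / J) * ennreal (?h z) \<partial>lborel)"
      using J(2) by (intro nn_integral_cong) (simp add: ennreal_mult'[symmetric])
    also have "\<dots> = ennreal (1 / J) * ?I" by (rule nn_integral_cmult) measurable
    finally show "(\<integral>\<^sup>+z. ennreal (?\<theta> z) \<partial>lborel) = 1" using J by (simp add: ennreal_mult'[symmetric])
  qed (use J \<delta> in \<open>auto simp: divide_right_mono max_def\<close>)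
qed

context lower_Q_ring
begin

lemma emeasure_plan_off_K0:
  assumes \<eta>: "\<eta> \<in> borel_measurable borel"
  shows "emeasure (plan \<eta>) (- K0) = 0"
proof -
  have "S \<rho> \<inter> - K0 = {}" if "\<rho> \<in> good_radii" for \<rho> using good_radii_sub[OF that] S_K0[of \<rho>] by blast
  then have zero: "indicator good_radii \<rho> * emeasure H (S \<rho> \<inter> - K0) = 0" for \<rho>
    by (cases "\<rho> \<in> good_radii") auto
  have "- K0 \<in> sets borel" using K0(2) by simp
  from emeasure_plan[OF \<eta> this] show ?thesis unfolding zero by simp
qed

text \<open>The plan has no mass off \<open>K0\<close>, so the estimate for the indicator of
  \<open>K0\<close> bounds its total mass.\<close>

lemma finite_plan:
  assumes \<eta>: "\<eta> \<in> borel_measurable borel" and \<eta>0: "\<And>\<rho>. 0 \<le> \<eta> \<rho>" "\<And>\<rho>. \<rho> \<notin> good_radii \<Longrightarrow> \<eta> \<rho> = 0"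
    and fin: "energy \<eta> < \<infinity>"
  shows "finite_measure (plan \<eta>)"
proof (rule finite_measureI)
  have KI: "(\<integral>\<^sup>+y. epowr (indicator K0 y) s \<partial>lborel) = emeasure lborel K0"
  proof -
    have "(\<integral>\<^sup>+y. epowr (indicator K0 y) s \<partial>lborel) = (\<integral>\<^sup>+y. indicator K0 y \<partial>lborel)"
      by (intro nn_integral_cong) (auto simp: indicator_def)
    then show ?thesis using K0 by simp
  qed
  have "emeasure (plan \<eta>) UNIV \<le> emeasure (plan \<eta>) K0 + emeasure (plan \<eta>) (- K0)"
    using emeasure_subadditive[of K0 "plan \<eta>" "- K0"] K0(2) by (simp add: Compl_partition)
  also have "\<dots> = (\<integral>\<^sup>+y. indicator K0 y \<partial>plan \<eta>)"
    using K0(2) emeasure_plan_off_K0[OF \<eta>] by simp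
  also have "\<dots> \<le> ennreal (1 / s) * (\<integral>\<^sup>+y. epowr (indicator K0 y) s \<partial>lborel) + ennreal (1 / \<alpha>) * energy \<eta>"
    by (rule plan_le[OF \<eta> \<eta>0]) (use K0 KI in auto)
  also have "\<dots> < \<infinity>" unfolding KI using K0(3) fin by (simp add: ennreal_mult_less_top)
  finally show "emeasure (plan \<eta>) (space (plan \<eta>)) \<noteq> \<infinity>" by simp
qed

lemma D_eq: "0 < \<rho> \<Longrightarrow> \<rho> \<le> r2 \<Longrightarrow> D \<rho> = {y \<in> G'. w y < \<rho>}"
proof (intro set_eqI iffI)
  fix y assume a: "0 < \<rho>" "\<rho> \<le> r2"
  show "y \<in> {y \<in> G'. w y < \<rho>}" if yD: "y \<in> D \<rho>"
  proof -
    obtain x where x: "x \<in> ball x0 \<rho>" "y = f x" using yD by (auto simp: D_def)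
    have "x \<in> G" using x cball_G[OF a(2)] by auto
    then show ?thesis using fg x by (simp add: w_def dist_commute)
  qed
  show "y \<in> D \<rho>" if yw: "y \<in> {y \<in> G'. w y < \<rho>}"
  proof -
    have y: "y \<in> G'" "dist (g y) x0 < \<rho>" using yw by (auto simp: w_def)
    then show ?thesis using gf[OF y(1)] unfolding D_def by (intro image_eqI[of _ _ "g y"]) (auto simp: dist_commute)
  qed
qed

text \<open>The sets \<open>D \<rho>\<close> are described through \<open>w\<close>, so that the
  integrand is jointly measurable in \<open>z\<close> and \<open>\<rho>\<close>.\<close>

definition potential :: "(real \<Rightarrow> real) \<Rightarrow> 'a \<Rightarrow> ennreal" where
  "potential \<eta> z = (\<integral>\<^sup>+\<rho>. ennreal (\<eta> \<rho>) * (if z \<in> G' \<and> w z < \<rho> then 1 else 0) \<partial>lborel)"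

text \<open>The \<open>\<eta>\<close>-mass of the spheres hit by the segment of length
  \<open>h\<close> from \<open>z\<close> in direction \<open>e\<close>. The condition is put into
  one subset of the product space, whose Borel measurability gives the joint measurability for
  Tonelli's theorem.\<close>

definition crossing :: "(real \<Rightarrow> real) \<Rightarrow> 'a \<Rightarrow> real \<Rightarrow> 'a \<Rightarrow> ennreal" where
  "crossing \<eta> e h z = (\<integral>\<^sup>+\<rho>. ennreal (\<eta> \<rho>) * indicator {p. r1 \<le> snd p \<and> snd p \<le> r2 \<and> fst p \<in> sweep e h (S (snd p))} (z, \<rho>) \<partial>lborel)"

lemma G'_borel [measurable]: "G' \<in> sets borel"
  using G(3) by simp

lemma potential_measurable [measurable]:
  assumes [measurable]: "\<eta> \<in> borel_measurable borel"
  shows "potential \<eta> \<in> borel_measurable borel"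
  unfolding potential_def[abs_def] by measurable

text \<open>The set is the continuous image of a compact ring times \<open>{0..h}\<close>, hence
  compact.\<close>

lemma sweep_set_borel: "{p. r1 \<le> snd p \<and> snd p \<le> r2 \<and> fst p \<in> sweep e h (S (snd p))} \<in> sets (borel :: ('a \<times> real) measure)"
proof -
  let ?K = "(cball x0 r2 - ball x0 r1) \<times> {0..h}"
  have eq: "{p. r1 \<le> snd p \<and> snd p \<le> r2 \<and> fst p \<in> sweep e h (S (snd p))} = (\<lambda>(x, \<tau>). (f x - \<tau> *\<^sub>R e, dist x0 x)) ` ?K"
  proof (intro set_eqI iffI)
    fix p assume "p \<in> {p. r1 \<le> snd p \<and> snd p \<le> r2 \<and> fst p \<in> sweep e h (S (snd p))}"
    then obtain \<tau> x where a: "\<tau> \<in> {0..h}" "r1 \<le> snd p" "snd p \<le> r2" "dist x0 x = snd p" "fst p + \<tau> *\<^sub>R e = f x"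
      by (auto simp: sweep_def S_def)
    have "fst p = f x - \<tau> *\<^sub>R e" unfolding a(5)[symmetric] by simp
    then show "p \<in> (\<lambda>(x, \<tau>). (f x - \<tau> *\<^sub>R e, dist x0 x)) ` ?K"
      using a by (intro image_eqI[of _ _ "(x, \<tau>)"]) (auto simp: prod_eq_iff)
  next
    fix p assume "p \<in> (\<lambda>(x, \<tau>). (f x - \<tau> *\<^sub>R e, dist x0 x)) ` ?K"
    then obtain x \<tau> where "x \<in> cball x0 r2 - ball x0 r1" "\<tau> \<in> {0..h}" "p = (f x - \<tau> *\<^sub>R e, dist x0 x)" by auto
    then show "p \<in> {p. r1 \<le> snd p \<and> snd p \<le> r2 \<and> fst p \<in> sweep e h (S (snd p))}"
      by (auto simp: sweep_def S_def intro!: bexI[of _ \<tau>])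
  qed
  have "compact ?K" by (intro compact_Times compact_diff compact_cball open_ball compact_Icc)
  moreover have "continuous_on ?K (\<lambda>(x, \<tau>). (f x - \<tau> *\<^sub>R e, dist x0 x))"
    unfolding case_prod_unfold
    by (intro continuous_intros continuous_on_compose2[OF f_cont]) (use r(3) in auto)
  ultimately have "compact ((\<lambda>(x, \<tau>). (f x - \<tau> *\<^sub>R e, dist x0 x)) ` ?K)" by (rule compact_continuous_image[rotated])
  then show ?thesis unfolding eq by (intro borel_closed compact_imp_closed)
qed

lemma crossing_pair_measurable [measurable]:
  "(\<lambda>p. indicator {p. r1 \<le> snd p \<and> snd p \<le> r2 \<and> fst p \<in> sweep e h (S (snd p))} p :: ennreal) \<in> borel_measurable (borel \<Otimes>\<^sub>M borel)"
  unfolding borel_prod by (rule borel_measurable_indicator[OF sweep_set_borel])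

lemma crossing_measurable [measurable]:
  assumes [measurable]: "\<eta> \<in> borel_measurable borel"
  shows "crossing \<eta> e h \<in> borel_measurable borel"
  unfolding crossing_def[abs_def] by measurable

text \<open>Only radii for which exactly one of the two points lies in \<open>D \<rho>\<close>
  contribute to the difference, and those spheres are hit by the segment. Two inequalities replace
  an absolute value, as the potentials are extended nonnegative.\<close>

lemma potential_diff:
  assumes [measurable]: "\<eta> \<in> borel_measurable borel" and \<eta>0: "\<And>\<rho>. \<rho> \<notin> good_radii \<Longrightarrow> \<eta> \<rho> = 0" and h: "0 \<le> h"
  shows "potential \<eta> (z + h *\<^sub>R e) \<le> potential \<eta> z + crossing \<eta> e h z"
    and "potential \<eta> z \<le> potential \<eta> (z + h *\<^sub>R e) + crossing \<eta> e h z"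
proof -
  let ?P = "{p. r1 \<le> snd p \<and> snd p \<le> r2 \<and> fst p \<in> sweep e h (S (snd p))}"
  have m [measurable]: "(\<lambda>\<rho>. indicator ?P (z, \<rho>) :: ennreal) \<in> borel_measurable borel" by measurable
  have pt: "ennreal (\<eta> \<rho>) * (if u \<in> G' \<and> w u < \<rho> then 1 else 0)
      \<le> ennreal (\<eta> \<rho>) * (if v \<in> G' \<and> w v < \<rho> then 1 else 0) + ennreal (\<eta> \<rho>) * indicator ?P (z, \<rho>)"
    if uv: "(u = z \<and> v = z + h *\<^sub>R e) \<or> (u = z + h *\<^sub>R e \<and> v = z)" for u v \<rho>
  proof (cases "\<rho> \<in> good_radii \<and> u \<in> G' \<and> w u < \<rho> \<and> \<not> (v \<in> G' \<and> w v < \<rho>)")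
    case True
    note g = good_radii_sub[OF conjunct1[OF True]]
    have "z \<in> D \<rho> \<longleftrightarrow> z + h *\<^sub>R e \<notin> D \<rho>" using uv True g by (auto simp: D_eq)
    then have "z \<in> sweep e h (S \<rho>)" using g h by (intro D_crossing) auto
    then show ?thesis using g by simp
  next
    case False
    then show ?thesis using \<eta>0[of \<rho>] by auto
  qed
  show "potential \<eta> (z + h *\<^sub>R e) \<le> potential \<eta> z + crossing \<eta> e h z"
    unfolding potential_def crossing_def
    by (subst nn_integral_add[symmetric], measurable, measurable, intro nn_integral_mono pt) simp
  show "potential \<eta> z \<le> potential \<eta> (z + h *\<^sub>R e) + crossing \<eta> e h z"
    unfolding potential_def crossing_def
    by (subst nn_integral_add[symmetric], measurable, measurable, intro nn_integral_mono pt) simp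
qed

text \<open>Tonelli's theorem and the sweeping estimate on each sphere, with the weight
  \<open>\<theta> (y - z)\<close>. To first order in \<open>h\<close> the bound is \<open>h\<close>
  times the mollified plan; the variation of \<open>\<theta>\<close> over distance \<open>h\<close>
  costs a term of second order.\<close>

lemma crossing_mollified_le:
  assumes \<eta> [measurable]: "\<eta> \<in> borel_measurable borel" and \<eta>0: "\<And>\<rho>. \<rho> \<notin> good_radii \<Longrightarrow> \<eta> \<rho> = 0"
    and h: "0 \<le> h" and e: "norm e = 1"
    and \<theta>: "\<And>z. 0 \<le> \<theta> z" "\<And>x y. \<bar>\<theta> x - \<theta> y\<bar> \<le> C * dist x y" and C: "0 \<le> C"
  shows "(\<integral>\<^sup>+z. crossing \<eta> e h z * ennreal (\<theta> (y - z)) \<partial>lborel)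
    \<le> ennreal h * ((\<integral>\<^sup>+z. ennreal (\<theta> (y - z)) \<partial>plan \<eta>) + ennreal (C * h) * emeasure (plan \<eta>) UNIV)"
proof -
  let ?P = "{p. r1 \<le> snd p \<and> snd p \<le> r2 \<and> fst p \<in> sweep e h (S (snd p))}"
  have "continuous_on UNIV \<theta>"
    using \<theta>(2) C by (intro lipschitz_on_continuous_on[of C]) (auto simp: lipschitz_on_def dist_real_def)
  then have [measurable]: "\<theta> \<in> borel_measurable borel" by (rule borel_measurable_continuous_onI)
  have "(\<integral>\<^sup>+z. crossing \<eta> e h z * ennreal (\<theta> (y - z)) \<partial>lborel)
     = (\<integral>\<^sup>+z. (\<integral>\<^sup>+\<rho>. ennreal (\<eta> \<rho>) * indicator ?P (z, \<rho>) * ennreal (\<theta> (y - z)) \<partial>lborel) \<partial>lborel)"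
    unfolding crossing_def by (intro nn_integral_cong nn_integral_multc[symmetric]) measurable
  also have "\<dots> = (\<integral>\<^sup>+\<rho>. (\<integral>\<^sup>+z. ennreal (\<eta> \<rho>) * indicator ?P (z, \<rho>) * ennreal (\<theta> (y - z)) \<partial>lborel) \<partial>lborel)"
    by (rule lborel_pair.Fubini'[symmetric]) measurable
  also have "\<dots> \<le> (\<integral>\<^sup>+\<rho>. ennreal h * (ennreal (\<eta> \<rho>) * (ennreal (isodiam TYPE('a)) *
      (indicator good_radii \<rho> * (\<integral>\<^sup>+x\<in>S \<rho>. ennreal (\<theta> (y - x) + C * h) \<partial>H)))) \<partial>lborel)"
  proof (rule nn_integral_mono)
    fix \<rho>
    show "(\<integral>\<^sup>+z. ennreal (\<eta> \<rho>) * indicator ?P (z, \<rho>) * ennreal (\<theta> (y - z)) \<partial>lborel)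
      \<le> ennreal h * (ennreal (\<eta> \<rho>) * (ennreal (isodiam TYPE('a)) *
      (indicator good_radii \<rho> * (\<integral>\<^sup>+x\<in>S \<rho>. ennreal (\<theta> (y - x) + C * h) \<partial>H))))"
    proof (cases "\<rho> \<in> good_radii")
      case True
      note g = good_radii_sub[OF True]
      have [measurable]: "sweep e h (S \<rho>) \<in> sets borel"
        using compact_sweep[OF compact_S, of \<rho> e h] g by (auto intro: borel_closed compact_imp_closed)
      have "(\<integral>\<^sup>+z. ennreal (\<eta> \<rho>) * indicator ?P (z, \<rho>) * ennreal (\<theta> (y - z)) \<partial>lborel)
         = (\<integral>\<^sup>+z. ennreal (\<eta> \<rho>) * (ennreal (\<theta> (y - z)) * indicator (sweep e h (S \<rho>)) z) \<partial>lborel)"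
        using g by (intro nn_integral_cong) (auto simp: indicator_def)
      also have "\<dots> = ennreal (\<eta> \<rho>) * (\<integral>\<^sup>+z\<in>sweep e h (S \<rho>). ennreal (\<theta> (y - z)) \<partial>lborel)"
        by (rule nn_integral_cmult) measurable
      also have "\<dots> \<le> ennreal (\<eta> \<rho>) * (ennreal h * (ennreal (isodiam TYPE('a)) * (\<integral>\<^sup>+x\<in>S \<rho>. ennreal (\<theta> (y - x) + C * h) \<partial>H)))"
      proof (intro mult_left_mono nn_integral_sweep_le n e h C \<theta>(1))
        show "compact (S \<rho>)" using g by (intro compact_S) auto
        show "hausdorff_outer (codim1 TYPE('a)) (S \<rho>) < top" using True by (simp add: good_radii_def)
        show "\<bar>\<theta> (y - x) - \<theta> (y - x')\<bar> \<le> C * dist x x'" for x x'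
          using \<theta>(2)[of "y - x" "y - x'"] by (simp add: dist_norm norm_minus_commute)
      qed simp
      finally show ?thesis using True by (simp add: mult_ac)
    next
      case False
      then show ?thesis using \<eta>0[OF False] by simp
    qed
  qed
  also have "\<dots> = ennreal h * (\<integral>\<^sup>+x. ennreal (\<theta> (y - x) + C * h) \<partial>plan \<eta>)"
  proof -
    have "(\<lambda>\<rho>. indicator good_radii \<rho> * (\<integral>\<^sup>+x\<in>S \<rho>. ennreal (\<theta> (y - x) + C * h) \<partial>H)) \<in> borel_measurable borel"
      and eq: "(\<integral>\<^sup>+x. ennreal (\<theta> (y - x) + C * h) \<partial>plan \<eta>) = (\<integral>\<^sup>+\<rho>. ennreal (\<eta> \<rho>) *
     (ennreal (isodiam TYPE('a)) * (indicator good_radii \<rho> * (\<integral>\<^sup>+x\<in>S \<rho>. ennreal (\<theta> (y - x) + C * h) \<partial>H))) \<partial>lborel)"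
      using nn_integral_plan[OF \<eta>, of "\<lambda>x. ennreal (\<theta> (y - x) + C * h)"] by auto
    note [measurable] = this(1)
    show ?thesis unfolding eq by (rule nn_integral_cmult) measurable
  qed
  also have "(\<integral>\<^sup>+x. ennreal (\<theta> (y - x) + C * h) \<partial>plan \<eta>)
     = (\<integral>\<^sup>+x. ennreal (\<theta> (y - x)) + ennreal (C * h) \<partial>plan \<eta>)"
    using \<theta>(1) C h by (intro nn_integral_cong ennreal_plus) auto
  also have "\<dots> = (\<integral>\<^sup>+x. ennreal (\<theta> (y - x)) \<partial>plan \<eta>) + ennreal (C * h) * emeasure (plan \<eta>) UNIV"
    by (subst nn_integral_add) auto
  finally show ?thesis .
qed

text \<open>Duality: with \<open>F\<close> the mollified plan, test the estimate of the plan with the mollification of \<open>F\<^sup>\<alpha>\<^sup>-\<^sup>1\<close>,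
  whose \<open>s\<close>-energy is at most that of \<open>F\<^sup>\<alpha>\<^sup>-\<^sup>1\<close>, i.e. the \<open>\<alpha>\<close>-energy of \<open>F\<close>.\<close>

lemma mollified_plan_energy:
  assumes \<eta> [measurable]: "\<eta> \<in> borel_measurable borel" and \<eta>0: "\<And>\<rho>. 0 \<le> \<eta> \<rho>" "\<And>\<rho>. \<rho> \<notin> good_radii \<Longrightarrow> \<eta> \<rho> = 0"
    and fin: "energy \<eta> < \<infinity>"
    and \<theta> [measurable]: "\<theta> \<in> borel_measurable borel" and \<theta>0: "\<And>z. 0 \<le> \<theta> z" "\<And>z. \<delta> \<le> norm z \<Longrightarrow> \<theta> z = 0"
    "\<And>z. \<theta> z \<le> B" "(\<integral>\<^sup>+z. ennreal (\<theta> z) \<partial>lborel) = 1"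
  shows "(\<integral>\<^sup>+y. epowr (\<integral>\<^sup>+z. ennreal (\<theta> (y - z)) \<partial>plan \<eta>) \<alpha> \<partial>lborel) \<le> energy \<eta>"
proof -
  interpret P: finite_measure "plan \<eta>" by (rule finite_plan[OF \<eta> \<eta>0 fin])
  interpret PP: pair_sigma_finite "lborel :: 'a measure" "plan \<eta>" ..
  define F where "F y = (\<integral>\<^sup>+z. ennreal (\<theta> (y - z)) \<partial>plan \<eta>)" for y
  have [measurable]: "F \<in> borel_measurable borel" unfolding F_def[abs_def] by measurable
  define X where "X = (\<integral>\<^sup>+y. epowr (F y) \<alpha> \<partial>lborel)"
  have \<alpha>0: "0 < \<alpha>" "0 < \<alpha> - 1" using \<alpha>1 by auto
  \<comment> \<open>Finiteness of \<open>X\<close> allows \<open>X / s\<close> to be absorbed at the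
    end, and it is the hypothesis of \<open>plan_le\<close> for the test function. It holds because
    \<open>F\<close> is bounded and vanishes off a ball.\<close>
  have Xfin: "X < \<infinity>"
  proof -
    obtain b where b: "K0 \<subseteq> cball 0 b"
      using compact_imp_bounded[OF K0(1)] unfolding bounded_iff by (auto simp: subset_eq)
    have AEK: "AE z in plan \<eta>. z \<in> K0"
      by (rule AE_I[of _ _ "- K0"]) (use emeasure_plan_off_K0[OF \<eta>] K0(2) in auto)
    have Fz: "F y = 0" if y: "y \<notin> cball 0 (b + \<delta>)" for y
    proof -
      have "AE z in plan \<eta>. ennreal (\<theta> (y - z)) = 0"
        using AEK
      proof eventually_elim
        case (elim z)
        have "norm z \<le> b" using elim b by auto
        moreover have "norm y \<le> norm (y - z) + norm z" using norm_triangle_ineq[of "y - z" z] by simp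
        ultimately have "\<delta> \<le> norm (y - z)" using y by simp
        then show ?case using \<theta>0(2) by simp
      qed
      then show ?thesis unfolding F_def by (subst nn_integral_0_iff_AE) auto
    qed
    have FB: "F y \<le> ennreal B * emeasure (plan \<eta>) UNIV" for y
    proof -
      have "F y \<le> (\<integral>\<^sup>+z. ennreal B \<partial>plan \<eta>)"
        unfolding F_def by (intro nn_integral_mono ennreal_leI \<theta>0)
      then show ?thesis by simp
    qed
    have "X \<le> (\<integral>\<^sup>+y. epowr (ennreal B * emeasure (plan \<eta>) UNIV) \<alpha> * indicator (cball (0::'a) (b + \<delta>)) y \<partial>lborel)"
      unfolding X_def
    proof (rule nn_integral_mono)
      fix y
      show "epowr (F y) \<alpha> \<le> epowr (ennreal B * emeasure (plan \<eta>) UNIV) \<alpha> * indicator (cball 0 (b + \<delta>)) y"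
        using Fz[of y] epowr_mono[OF _ FB[of y], of \<alpha>] \<alpha>0 by (cases "y \<in> cball 0 (b + \<delta>)") auto
    qed
    also have "\<dots> = epowr (ennreal B * emeasure (plan \<eta>) UNIV) \<alpha> * emeasure lborel (cball (0::'a) (b + \<delta>))"
      by (rule nn_integral_cmult_indicator) simp
    also have "\<dots> < \<infinity>"
    proof -
      have "ennreal B * emeasure (plan \<eta>) UNIV < top"
        by (simp add: P.emeasure_eq_measure ennreal_mult_less_top)
      then have "epowr (ennreal B * emeasure (plan \<eta>) UNIV) \<alpha> < top"
        by (cases "ennreal B * emeasure (plan \<eta>) UNIV") auto
      then show ?thesis using emeasure_lborel_cball_finite[of "0::'a" "b + \<delta>"] by (simp add: ennreal_mult_less_top)
    qed
    finally show ?thesis .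
  qed
  define E where "E y = epowr (F y) (\<alpha> - 1)" for y
  have [measurable]: "E \<in> borel_measurable borel" unfolding E_def[abs_def] by measurable
  have FE: "F y * E y = epowr (F y) \<alpha>" for y
  proof (cases "F y")
    case (real x)
    have "x * x powr (\<alpha> - 1) = x powr \<alpha>" using real \<alpha>0 by (cases "x = 0") (auto simp: powr_mult_base)
    then show ?thesis using real by (simp add: E_def ennreal_mult'[symmetric])
  next
    case top then show ?thesis by (simp add: E_def ennreal_top_mult)
  qed
  have Es: "epowr (E y) s = epowr (F y) \<alpha>" for y
  proof -
    have "(\<alpha> - 1) * s = \<alpha>" using s1 by (simp add: \<alpha>_eq field_simps)
    then show ?thesis by (simp add: E_def epowr_epowr)
  qed
  have "X = (\<integral>\<^sup>+y. F y * E y \<partial>lborel)" by (simp add: X_def FE)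
  also have "\<dots> = (\<integral>\<^sup>+y. (\<integral>\<^sup>+z. ennreal (\<theta> (y - z)) * E y \<partial>plan \<eta>) \<partial>lborel)"
    unfolding F_def by (intro nn_integral_cong nn_integral_multc[symmetric]) measurable
  also have "\<dots> = (\<integral>\<^sup>+z. (\<integral>\<^sup>+y. ennreal (\<theta> (y - z)) * E y \<partial>lborel) \<partial>plan \<eta>)"
    by (rule PP.Fubini'[symmetric]) measurable
  also have "\<dots> = (\<integral>\<^sup>+z. (\<integral>\<^sup>+x. ennreal (\<theta> x) * E (z + x) \<partial>lborel) \<partial>plan \<eta>)"
  proof (rule nn_integral_cong)
    fix z
    show "(\<integral>\<^sup>+y. ennreal (\<theta> (y - z)) * E y \<partial>lborel) = (\<integral>\<^sup>+x. ennreal (\<theta> x) * E (z + x) \<partial>lborel)"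
      using nn_integral_lborel_translate[of "\<lambda>y. ennreal (\<theta> (y - z)) * E y" z] by simp
  qed
  also have "\<dots> = (\<integral>\<^sup>+x. (\<integral>\<^sup>+z. ennreal (\<theta> x) * E (z + x) \<partial>plan \<eta>) \<partial>lborel)"
    by (rule PP.Fubini') measurable
  also have "\<dots> \<le> (\<integral>\<^sup>+x. ennreal (\<theta> x) * (ennreal (1 / s) * X + ennreal (1 / \<alpha>) * energy \<eta>) \<partial>lborel)"
  proof (rule nn_integral_mono)
    fix x
    \<comment> \<open>Every translate of \<open>E\<close> has the same s-energy, so the
      mollification is tested one translate at a time, and \<open>\<theta>\<close>, of mass 1,
      averages the bounds.\<close>
    have tr: "(\<integral>\<^sup>+z. epowr (E (z + x)) s \<partial>lborel) = X"
      using nn_integral_lborel_translate[of "\<lambda>z. epowr (F z) \<alpha>" x] by (simp add: Es X_def add.commute)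
    have "(\<integral>\<^sup>+z. ennreal (\<theta> x) * E (z + x) \<partial>plan \<eta>) = ennreal (\<theta> x) * (\<integral>\<^sup>+z. E (z + x) \<partial>plan \<eta>)"
      by (rule nn_integral_cmult) measurable
    also have "\<dots> \<le> ennreal (\<theta> x) * (ennreal (1 / s) * X + ennreal (1 / \<alpha>) * energy \<eta>)"
    proof (rule mult_left_mono)
      have "(\<integral>\<^sup>+z. E (z + x) \<partial>plan \<eta>) \<le> ennreal (1 / s) * (\<integral>\<^sup>+z. epowr (E (z + x)) s \<partial>lborel) + ennreal (1 / \<alpha>) * energy \<eta>"
        by (rule plan_le[OF \<eta> \<eta>0]) (use tr Xfin in \<open>measurable; simp\<close>)+
      then show "(\<integral>\<^sup>+z. E (z + x) \<partial>plan \<eta>) \<le> ennreal (1 / s) * X + ennreal (1 / \<alpha>) * energy \<eta>"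
        unfolding tr .
    qed simp
    finally show "(\<integral>\<^sup>+z. ennreal (\<theta> x) * E (z + x) \<partial>plan \<eta>)
      \<le> ennreal (\<theta> x) * (ennreal (1 / s) * X + ennreal (1 / \<alpha>) * energy \<eta>)" .
  qed
  also have "\<dots> = ennreal (1 / s) * X + ennreal (1 / \<alpha>) * energy \<eta>"
    by (subst nn_integral_multc) (auto simp: \<theta>0(4))
  finally have main: "X \<le> ennreal (1 / s) * X + ennreal (1 / \<alpha>) * energy \<eta>" .
  obtain x en where xe: "X = ennreal x" "0 \<le> x" "energy \<eta> = ennreal en" "0 \<le> en"
    using Xfin fin by (cases X; cases "energy \<eta>") auto
  have "x \<le> 1 / s * x + 1 / \<alpha> * en"
    using main s1 \<alpha>0 xe by (simp add: ennreal_mult'[symmetric] ennreal_plus[symmetric] del: ennreal_plus)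
  moreover have "1 / s = 1 - 1 / \<alpha>" using conj by simp
  ultimately have "1 / \<alpha> * x \<le> 1 / \<alpha> * en" by (simp add: algebra_simps)
  then have "x \<le> en" using \<alpha>0(1) by (simp add: divide_le_cancel)
  then show ?thesis using xe by (simp add: X_def F_def ennreal_leI)
qed

end

section \<open>Line integrals along rectifiable curves\<close>

definition polygon_length :: "(real \<Rightarrow> 'a::metric_space) \<Rightarrow> real list \<Rightarrow> real" where
  "polygon_length \<gamma> ts = (\<Sum>i < length ts - 1. dist (\<gamma> (ts ! i)) (\<gamma> (ts ! Suc i)))"

lemma curve_length_eq: "curve_length \<gamma> a b = (SUP ts \<in> {ts. sorted ts \<and> set ts \<subseteq> {a..b}}. ennreal (polygon_length \<gamma> ts))"
  by (simp add: curve_length_def polygon_length_def)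

lemma polygon_length_nonneg: "0 \<le> polygon_length \<gamma> ts"
  by (simp add: polygon_length_def sum_nonneg)

lemma polygon_length_Nil [simp]: "polygon_length \<gamma> [] = 0"
  and polygon_length_single [simp]: "polygon_length \<gamma> [x] = 0"
  by (simp_all add: polygon_length_def)

lemma polygon_length_Cons_Cons [simp]:
  "polygon_length \<gamma> (x # y # ts) = dist (\<gamma> x) (\<gamma> y) + polygon_length \<gamma> (y # ts)"
  by (simp add: polygon_length_def sum.lessThan_Suc_shift del: sum.lessThan_Suc)

lemma polygon_length_append_ge: "polygon_length \<gamma> xs + polygon_length \<gamma> ys \<le> polygon_length \<gamma> (xs @ ys)"
proof (induction xs)
  case (Cons x xs)
  then show ?case
  proof (cases xs)
    case Nil then show ?thesis by (cases ys) auto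
  next
    case (Cons y zs) then show ?thesis using Cons.IH by simp
  qed
qed simp

text \<open>Clipping from above and from below at \<open>t\<close> inserts \<open>t\<close> as a
  node. Only the edge across \<open>t\<close> changes, and there the triangle inequality
  applies.\<close>

lemma polygon_length_split_le:
  "polygon_length \<gamma> ts \<le> polygon_length \<gamma> (map (min t) ts) + polygon_length \<gamma> (map (max t) ts)" if "sorted ts"
  using that
proof (induction ts)
  case (Cons x ts)
  show ?case
  proof (cases ts)
    case (Cons y zs)
    have xy: "x \<le> y" using Cons.prems local.Cons by simp
    have "dist (\<gamma> x) (\<gamma> y) \<le> dist (\<gamma> (min t x)) (\<gamma> (min t y)) + dist (\<gamma> (max t x)) (\<gamma> (max t y))"
    proof (cases "x \<le> t \<and> t \<le> y")
      case True
      then show ?thesis using dist_triangle[of "\<gamma> x" "\<gamma> y" "\<gamma> t"] by (simp add: min_def max_def)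
    next
      case False
      then have "y < t \<or> t < x" using xy by auto
      then show ?thesis using xy by (auto simp: min_def max_def)
    qed
    then show ?thesis using Cons.IH Cons.prems local.Cons by simp
  qed simp
qed simp

lemma curve_length_add:
  assumes "a \<le> t" "t \<le> b"
  shows "curve_length \<gamma> a b = curve_length \<gamma> a t + curve_length \<gamma> t b"
proof (rule antisym)
  show "curve_length \<gamma> a b \<le> curve_length \<gamma> a t + curve_length \<gamma> t b"
    unfolding curve_length_eq[of \<gamma> a b]
  proof (rule SUP_least, clarify)
    fix ts assume ts: "sorted ts" "set ts \<subseteq> {a..b}"
    have "ennreal (polygon_length \<gamma> ts) \<le> ennreal (polygon_length \<gamma> (map (min t) ts)) + ennreal (polygon_length \<gamma> (map (max t) ts))"
      using polygon_length_split_le[OF ts(1), of \<gamma> t]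
      by (subst ennreal_plus[symmetric]) (auto intro: ennreal_leI polygon_length_nonneg)
    also have "\<dots> \<le> curve_length \<gamma> a t + curve_length \<gamma> t b"
      unfolding curve_length_eq
    proof (intro add_mono SUP_upper CollectI conjI)
      show "sorted (map (min t) ts)" "sorted (map (max t) ts)"
        using ts(1) by (auto simp: sorted_map intro: sorted_wrt_mono_rel[rotated])
      show "set (map (min t) ts) \<subseteq> {a..t}" "set (map (max t) ts) \<subseteq> {t..b}" using ts(2) assms by auto
    qed
    finally show "ennreal (polygon_length \<gamma> ts) \<le> curve_length \<gamma> a t + curve_length \<gamma> t b" .
  qed
  have ne: "{ts. sorted ts \<and> set ts \<subseteq> {u..v}} \<noteq> {}" for u v :: real by (auto intro: exI[of _ "[]"])
  have "curve_length \<gamma> a t + curve_length \<gamma> t b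
    = (SUP xs \<in> {ts. sorted ts \<and> set ts \<subseteq> {a..t}}. SUP ys \<in> {ts. sorted ts \<and> set ts \<subseteq> {t..b}}.
         ennreal (polygon_length \<gamma> xs) + ennreal (polygon_length \<gamma> ys))"
    unfolding curve_length_eq by (simp add: ennreal_SUP_add_left[OF ne, symmetric] ennreal_SUP_add_right[OF ne, symmetric])
  also have "\<dots> \<le> curve_length \<gamma> a b"
  proof (intro SUP_least, clarify)
    fix xs ys assume x: "sorted xs" "set xs \<subseteq> {a..t}" and y: "sorted ys" "set ys \<subseteq> {t..b}"
    have "ennreal (polygon_length \<gamma> xs) + ennreal (polygon_length \<gamma> ys) \<le> ennreal (polygon_length \<gamma> (xs @ ys))"
      using polygon_length_append_ge[of \<gamma> xs ys]
      by (subst ennreal_plus[symmetric]) (auto intro: ennreal_leI polygon_length_nonneg)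
    also have "\<dots> \<le> curve_length \<gamma> a b"
      unfolding curve_length_eq by (rule SUP_upper) (use x y assms in \<open>fastforce simp: sorted_append\<close>)
    finally show "ennreal (polygon_length \<gamma> xs) + ennreal (polygon_length \<gamma> ys) \<le> curve_length \<gamma> a b" .
  qed
  finally show "curve_length \<gamma> a t + curve_length \<gamma> t b \<le> curve_length \<gamma> a b" .
qed

lemma curve_length_ge_dist: "a \<le> b \<Longrightarrow> ennreal (dist (\<gamma> a) (\<gamma> b)) \<le> curve_length \<gamma> a b"
  unfolding curve_length_eq by (rule SUP_upper2[of "[a, b]"]) auto

context
  fixes \<gamma> :: "real \<Rightarrow> 'a::metric_space" and a b :: real
  assumes ab: "a < b" and cont: "continuous_on {a..b} \<gamma>" and fin: "curve_length \<gamma> a b < \<infinity>"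
begin

text \<open>The distribution function whose \<open>interval_measure\<close> defines
  \<open>line_integral\<close>. Once it is known to be monotone and right continuous, half-open
  intervals receive the length of the corresponding arc.\<close>

definition arc_length :: "real \<Rightarrow> real" where
  "arc_length t = enn2real (curve_length \<gamma> a (max a (min t b)))"

lemma curve_length_subinterval_finite: "a \<le> u \<Longrightarrow> u \<le> v \<Longrightarrow> v \<le> b \<Longrightarrow> curve_length \<gamma> u v < top"
proof -
  assume uv: "a \<le> u" "u \<le> v" "v \<le> b"
  have "curve_length \<gamma> u v \<le> curve_length \<gamma> a u + (curve_length \<gamma> u v + curve_length \<gamma> v b)"
    by (simp add: add_increasing add_increasing2)
  also have "\<dots> = curve_length \<gamma> a b"
    using curve_length_add[of u v b \<gamma>] curve_length_add[of a u b \<gamma>] uv by simp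
  finally show ?thesis using fin by (simp add: le_less_trans)
qed

lemma arc_length_diff:
  assumes "a \<le> u" "u \<le> v" "v \<le> b"
  shows "ennreal (arc_length v - arc_length u) = curve_length \<gamma> u v" and "arc_length u \<le> arc_length v"
proof -
  have lu: "arc_length u = enn2real (curve_length \<gamma> a u)" "arc_length v = enn2real (curve_length \<gamma> a v)"
    using assms by (simp_all add: arc_length_def max_def min_def)
  have add: "curve_length \<gamma> a v = curve_length \<gamma> a u + curve_length \<gamma> u v"
    by (rule curve_length_add) (use assms in auto)
  obtain x y where xy: "curve_length \<gamma> a u = ennreal x" "0 \<le> x" "curve_length \<gamma> u v = ennreal y" "0 \<le> y"
    using curve_length_subinterval_finite[of a u] curve_length_subinterval_finite[of u v] assms
    by (cases "curve_length \<gamma> a u"; cases "curve_length \<gamma> u v") auto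
  have "arc_length v - arc_length u = y"
    unfolding lu add using xy by (simp add: ennreal_plus[symmetric] del: ennreal_plus)
  then show "ennreal (arc_length v - arc_length u) = curve_length \<gamma> u v" "arc_length u \<le> arc_length v"
    using xy by auto
qed

lemma arc_length_mono: "u \<le> v \<Longrightarrow> arc_length u \<le> arc_length v"
proof -
  assume "u \<le> v"
  have clip: "arc_length t = arc_length (max a (min t b))" for t
    using ab by (simp add: arc_length_def min_def max_def)
  show ?thesis
    unfolding clip[of u] clip[of v]
    by (rule arc_length_diff(2)) (use \<open>u \<le> v\<close> ab in \<open>auto simp: max_def min_def\<close>)
qed

text \<open>The length of the part after \<open>t\<close> is a supremum of continuous functions of \<open>t\<close>.\<close>

lemma arc_length_right_continuous: "continuous (at_right t) arc_length"
proof (cases "t < a \<or> b \<le> t")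
  case True
  then have "\<forall>\<^sub>F u in at_right t. arc_length t = arc_length u"
  proof
    assume "t < a"
    then have "\<forall>\<^sub>F u in at_right t. u < a" by (intro order_tendstoD(2)[OF tendsto_ident_at])
    then show ?thesis by eventually_elim (use \<open>t < a\<close> ab in \<open>simp add: arc_length_def\<close>)
  next
    assume "b \<le> t"
    have "\<forall>\<^sub>F u in at_right t. t < u" by (rule eventually_at_right_less)
    then show ?thesis by eventually_elim (use \<open>b \<le> t\<close> ab in \<open>simp add: arc_length_def\<close>)
  qed
  then have "(arc_length \<longlongrightarrow> arc_length t) (at_right t)"
    by (intro tendsto_eventually) (auto elim: eventually_mono)
  then show ?thesis by (simp add: continuous_within)
next
  case False
  then have t: "a \<le> t" "t < b" by auto
  have "(arc_length \<longlongrightarrow> arc_length t) (at_right t)"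
  proof (rule order_tendstoI)
    fix l assume l: "l < arc_length t"
    have "\<forall>\<^sub>F u in at_right t. t < u" by (rule eventually_at_right_less)
    then show "\<forall>\<^sub>F u in at_right t. l < arc_length u"
      by eventually_elim (rule less_le_trans[OF l arc_length_mono], simp)
  next
    fix l assume l: "arc_length t < l"
    define \<epsilon> where "\<epsilon> = l - arc_length t"
    have \<epsilon>: "0 < \<epsilon>" using l by (simp add: \<epsilon>_def)
    obtain L where L: "curve_length \<gamma> t b = ennreal L" "0 \<le> L"
      using curve_length_subinterval_finite[of t b] t by (cases "curve_length \<gamma> t b") auto
    have Ldiff: "arc_length b - arc_length t = L"
      using arc_length_diff[of t b] t L by (simp add: ennreal_inj)
    \<comment> \<open>The alternative \<open>L = 0\<close> is separate because
      \<open>ennreal\<close> maps the negative number \<open>- \<epsilon> / 2\<close> to 0, so the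
      inequality is not strict there.\<close>
    have "ennreal (L - \<epsilon> / 2) < curve_length \<gamma> t b \<or> L = 0"
      using \<epsilon> L by (auto simp: ennreal_less_iff ennreal_lessI)
    then obtain ts where ts: "sorted ts" "set ts \<subseteq> {t..b}" "L - \<epsilon> / 2 < polygon_length \<gamma> ts"
    proof
      assume "ennreal (L - \<epsilon> / 2) < curve_length \<gamma> t b"
      then obtain ts where "sorted ts" "set ts \<subseteq> {t..b}" "ennreal (L - \<epsilon> / 2) < ennreal (polygon_length \<gamma> ts)"
        unfolding curve_length_eq less_SUP_iff by auto
      moreover from this have "L - \<epsilon> / 2 < polygon_length \<gamma> ts"
        by (metis ennreal_leI not_le)
      ultimately show ?thesis using that by blast
    next
      assume "L = 0"
      then show ?thesis using \<epsilon> by (intro that[of "[]"]) auto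
    qed
    have idx: "ts ! i \<in> {t..b}" if "i < length ts" for i using ts(2) that nth_mem by blast
    \<comment> \<open>Raising all nodes to at least \<open>u\<close> produces an admissible
      partition of \<open>{u..b}\<close>, whose length converges as \<open>u\<close> decreases to
      \<open>t\<close>.\<close>
    have lim: "((\<lambda>u. polygon_length \<gamma> (map (max u) ts)) \<longlongrightarrow> polygon_length \<gamma> (map (max t) ts)) (at_right t)"
    proof -
      have c: "((\<lambda>u. \<gamma> (max u x)) \<longlongrightarrow> \<gamma> (max t x)) (at_right t)" if x: "x \<in> {t..b}" for x
      proof (rule continuous_on_tendsto_compose[OF cont])
        show "((\<lambda>u. max u x) \<longlongrightarrow> max t x) (at_right t)" by (intro tendsto_max tendsto_ident_at tendsto_const)
        show "max t x \<in> {a..b}" using x t by auto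
        have "\<forall>\<^sub>F u in at_right t. u < b" using t by (intro order_tendstoD(2)[OF tendsto_ident_at])
        moreover have "\<forall>\<^sub>F u in at_right t. t < u" by (rule eventually_at_right_less)
        ultimately show "\<forall>\<^sub>F u in at_right t. max u x \<in> {a..b}" by eventually_elim (use x t in auto)
      qed
      show ?thesis unfolding polygon_length_def length_map
      proof (intro tendsto_sum)
        fix i assume "i \<in> {..<length ts - 1}"
        then have i: "i < length ts" "Suc i < length ts" by auto
        show "((\<lambda>u. dist (\<gamma> (map (max u) ts ! i)) (\<gamma> (map (max u) ts ! Suc i))) \<longlongrightarrow>
           dist (\<gamma> (map (max t) ts ! i)) (\<gamma> (map (max t) ts ! Suc i))) (at_right t)"
          using tendsto_dist[OF c[OF idx[OF i(1)]] c[OF idx[OF i(2)]]] i by simp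
      qed
    qed
    have "map (max t) ts = ts" by (rule map_idI) (use ts(2) in auto)
    then have "\<forall>\<^sub>F u in at_right t. L - \<epsilon> / 2 < polygon_length \<gamma> (map (max u) ts)"
      using lim ts(3) by (intro order_tendstoD(1)[of _ "polygon_length \<gamma> ts"]) auto
    moreover have "\<forall>\<^sub>F u in at_right t. u < b" using t by (intro order_tendstoD(2)[OF tendsto_ident_at])
    moreover have "\<forall>\<^sub>F u in at_right t. t < u" by (rule eventually_at_right_less)
    ultimately show "\<forall>\<^sub>F u in at_right t. arc_length u < l"
    proof eventually_elim
      case (elim u)
      have "ennreal (polygon_length \<gamma> (map (max u) ts)) \<le> curve_length \<gamma> u b"
        unfolding curve_length_eq
      proof (rule SUP_upper, intro CollectI conjI)
        show "sorted (map (max u) ts)" using ts(1) by (auto simp: sorted_map intro: sorted_wrt_mono_rel[rotated])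
        show "set (map (max u) ts) \<subseteq> {u..b}" using ts(2) elim by auto
      qed
      also have "\<dots> = ennreal (arc_length b - arc_length u)"
        using elim t by (intro arc_length_diff(1)[symmetric]) auto
      finally have "polygon_length \<gamma> (map (max u) ts) \<le> arc_length b - arc_length u"
        using arc_length_mono[of u b] elim by (simp add: ennreal_le_iff)
      then have "L - \<epsilon> / 2 < arc_length b - arc_length u" using elim by linarith
      then show ?case using Ldiff \<epsilon> by (simp add: \<epsilon>_def field_simps)
    qed
  qed
  then show ?thesis by (simp add: continuous_within)
qed

text \<open>The last hypothesis says that \<open>F\<close> is an upper gradient of \<open>u\<close>
  up to a second order error. On a fine partition the increments of \<open>u\<close> are bounded by
  Riemann sums of \<open>F\<close> plus a small error, and step functions built from almost the same
  sums lie below \<open>F\<close> along the curve.\<close>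

lemma line_integral_ge:
  fixes F u :: "'a \<Rightarrow> real"
  assumes F: "\<And>y. 0 \<le> F y" and L: "0 \<le> L" and lip: "\<And>x y. F x \<le> F y + L * dist x y"
    and u: "\<And>x y. \<bar>u y - u x\<bar> \<le> dist x y * (F x + L * dist x y)"
  shows "ennreal \<bar>u (\<gamma> b) - u (\<gamma> a)\<bar> \<le> line_integral (\<lambda>y. ennreal (F y)) \<gamma> a b"
proof (rule ennreal_le_epsilon)
  fix e :: real assume e: "0 < e"
  define len where "len = arc_length b - arc_length a"
  have len0: "0 \<le> len" using arc_length_mono[of a b] ab by (simp add: len_def)
  \<comment> \<open>Upper and lower sums differ by at most \<open>2 * L * \<epsilon> * len\<close>,
    which must not exceed \<open>e\<close>; the summand 1 avoids division by zero.\<close>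
  define \<epsilon> where "\<epsilon> = e / (2 * L * len + 1)"
  have \<epsilon>: "0 < \<epsilon>" using e L len0 by (auto simp: \<epsilon>_def intro!: divide_pos_pos add_nonneg_pos mult_nonneg_nonneg)
  have "uniformly_continuous_on {a..b} \<gamma>" using cont by (intro compact_uniformly_continuous) auto
  then obtain d where d: "0 < d" "\<And>x y. x \<in> {a..b} \<Longrightarrow> y \<in> {a..b} \<Longrightarrow> dist x y < d \<Longrightarrow> dist (\<gamma> x) (\<gamma> y) < \<epsilon>"
    using \<epsilon> unfolding uniformly_continuous_on_def by (metis dist_commute)
  obtain N where N: "(b - a) / d < real N" using reals_Archimedean2 by blast
  have N0: "0 < N" using N ab d(1) by (metis divide_pos_pos diff_gt_0_iff_gt less_trans of_nat_0_less_iff)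
  define t where "t i = a + real i * ((b - a) / real N)" for i
  have step: "t (Suc i) = t i + (b - a) / real N" for i
    unfolding t_def of_nat_Suc by (simp add: add_divide_distrib distrib_right)
  have stepd: "(b - a) / real N < d" using N N0 d(1) by (simp add: field_simps)
  have step0: "0 < (b - a) / real N" using ab N0 by simp
  have t0: "t 0 = a" and tN: "t N = b" using N0 by (auto simp: t_def)
  have tmono: "t i \<le> t j" if "i \<le> j" for i j
    unfolding t_def using that less_imp_le[OF step0] by (intro add_left_mono mult_right_mono) simp_all
  have tin: "t i \<in> {a..b}" if "i \<le> N" for i using tmono[of 0 i] tmono[of i N] that t0 tN by auto
  let ?\<mu> = "interval_measure arc_length"
  have sm: "sets ?\<mu> = sets borel" "space ?\<mu> = UNIV" by simp_all
  define m where "m i = arc_length (t (Suc i)) - arc_length (t i)" for i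
  have m0: "0 \<le> m i" for i using arc_length_mono[OF tmono[of i "Suc i"]] by (simp add: m_def)
  have em: "emeasure ?\<mu> {t i<..t (Suc i)} = ennreal (m i)" for i
    unfolding m_def using tmono[of i "Suc i"] arc_length_mono arc_length_right_continuous
    by (intro emeasure_interval_measure_Ioc) auto
  have summ: "(\<Sum>i<N. m i) = len"
    unfolding m_def len_def using sum_lessThan_telescope[of "\<lambda>i. arc_length (t i)" N] by (simp only: t0 tN)
  have dm: "dist (\<gamma> (t i)) (\<gamma> (t (Suc i))) \<le> m i" if "i < N" for i
  proof -
    have "ennreal (dist (\<gamma> (t i)) (\<gamma> (t (Suc i)))) \<le> curve_length \<gamma> (t i) (t (Suc i))"
      by (rule curve_length_ge_dist[OF tmono]) simp
    also have "\<dots> = ennreal (m i)"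
      unfolding m_def using tin[of i] tin[of "Suc i"] that tmono[of i "Suc i"] by (intro arc_length_diff(1)[symmetric]) auto
    finally show ?thesis using m0 by (simp add: ennreal_le_iff)
  qed
  have "\<bar>u (\<gamma> b) - u (\<gamma> a)\<bar> = \<bar>\<Sum>i<N. u (\<gamma> (t (Suc i))) - u (\<gamma> (t i))\<bar>"
    by (simp add: sum_lessThan_telescope[of "\<lambda>i. u (\<gamma> (t i))"] t0 tN)
  also have "\<dots> \<le> (\<Sum>i<N. \<bar>u (\<gamma> (t (Suc i))) - u (\<gamma> (t i))\<bar>)" by (rule sum_abs)
  also have "\<dots> \<le> (\<Sum>i<N. m i * (F (\<gamma> (t i)) + L * \<epsilon>))"
  proof (rule sum_mono)
    fix i assume "i \<in> {..<N}"
    then have i: "i < N" by simp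
    have "dist (\<gamma> (t i)) (\<gamma> (t (Suc i))) < \<epsilon>"
      using tin[of i] tin[of "Suc i"] i stepd step0 by (intro d(2)) (auto simp: step dist_real_def)
    then have "dist (\<gamma> (t i)) (\<gamma> (t (Suc i))) * (F (\<gamma> (t i)) + L * dist (\<gamma> (t i)) (\<gamma> (t (Suc i)))) \<le> m i * (F (\<gamma> (t i)) + L * \<epsilon>)"
      using dm[OF i] F L m0 by (intro mult_mono add_mono mult_left_mono) (auto intro!: add_nonneg_nonneg mult_nonneg_nonneg)
    then show "\<bar>u (\<gamma> (t (Suc i))) - u (\<gamma> (t i))\<bar> \<le> m i * (F (\<gamma> (t i)) + L * \<epsilon>)"
      using u[of "\<gamma> (t (Suc i))" "\<gamma> (t i)"] by (meson order_trans)
  qed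
  finally have up: "\<bar>u (\<gamma> b) - u (\<gamma> a)\<bar> \<le> (\<Sum>i<N. m i * (F (\<gamma> (t i)) + L * \<epsilon>))" .
  have "(\<Sum>i<N. ennreal (m i * max 0 (F (\<gamma> (t i)) - L * \<epsilon>))) \<le> line_integral (\<lambda>y. ennreal (F y)) \<gamma> a b"
  proof -
    \<comment> \<open>Half-open cells are disjoint and receive exactly the arc length of each step
      from the interval measure. The point \<open>a\<close> is left out, which is harmless for a
      lower bound.\<close>
    let ?f = "\<lambda>x. \<Sum>i<N. ennreal (max 0 (F (\<gamma> (t i)) - L * \<epsilon>)) * indicator {t i<..t (Suc i)} x"
    have "(\<Sum>i<N. ennreal (m i * max 0 (F (\<gamma> (t i)) - L * \<epsilon>))) = (\<Sum>i<N. ennreal (max 0 (F (\<gamma> (t i)) - L * \<epsilon>)) * emeasure ?\<mu> {t i<..t (Suc i)})"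
      using m0 by (intro sum.cong) (auto simp: em ennreal_mult'[symmetric] mult.commute)
    also have "\<dots> = (\<integral>\<^sup>+x. ?f x \<partial>?\<mu>)"
      by (subst nn_integral_sum) (auto simp: nn_integral_cmult_indicator)
    also have "\<dots> \<le> (\<integral>\<^sup>+x. ennreal (F (\<gamma> x)) * indicator {a..b} x \<partial>?\<mu>)"
    proof (rule nn_integral_mono)
      fix x
      show "?f x \<le> ennreal (F (\<gamma> x)) * indicator {a..b} x"
      proof (cases "\<exists>j<N. x \<in> {t j<..t (Suc j)}")
        case False
        then have "?f x = 0" by (intro sum.neutral) (auto simp: indicator_def)
        then show ?thesis by simp
      next
        case True
        then obtain j where j: "j < N" "x \<in> {t j<..t (Suc j)}" by blast
        have other: "x \<notin> {t i<..t (Suc i)}" if ij: "i \<noteq> j" for i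
        proof
          assume x: "x \<in> {t i<..t (Suc i)}"
          consider "Suc i \<le> j" | "Suc j \<le> i" using ij by linarith
          then show False
          proof cases
            case 1 then show False using tmono[OF 1] x j(2) by auto
          next
            case 2 then show False using tmono[OF 2] x j(2) by auto
          qed
        qed
        have "?f x = (\<Sum>i<N. if i = j then ennreal (max 0 (F (\<gamma> (t j)) - L * \<epsilon>)) else 0)"
          using other j(2) by (intro sum.cong) (auto simp: indicator_def)
        also have "\<dots> = ennreal (max 0 (F (\<gamma> (t j)) - L * \<epsilon>))" using j(1) by (simp add: sum.delta)
        also have "\<dots> \<le> ennreal (F (\<gamma> x))"
        proof (rule ennreal_leI)
          have xin: "x \<in> {a..b}" using tin[of j] tin[of "Suc j"] j by auto
          have "dist (\<gamma> (t j)) (\<gamma> x) < \<epsilon>"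
            using tin[of j] j xin stepd by (intro d(2)) (auto simp: step dist_real_def)
          then have "F (\<gamma> (t j)) \<le> F (\<gamma> x) + L * \<epsilon>"
            using lip[of "\<gamma> (t j)" "\<gamma> x"] L mult_left_mono[of "dist (\<gamma> (t j)) (\<gamma> x)" \<epsilon> L] by linarith
          then show "max 0 (F (\<gamma> (t j)) - L * \<epsilon>) \<le> F (\<gamma> x)" using F[of "\<gamma> x"] by simp
        qed
        finally show ?thesis using tin[of j] tin[of "Suc j"] j by (auto simp: indicator_def)
      qed
    qed
    also have "\<dots> = line_integral (\<lambda>y. ennreal (F y)) \<gamma> a b"
      unfolding line_integral_def arc_length_def[abs_def] ..
    finally show ?thesis .
  qed
  moreover have "(\<Sum>i<N. m i * (F (\<gamma> (t i)) + L * \<epsilon>)) \<le> (\<Sum>i<N. m i * max 0 (F (\<gamma> (t i)) - L * \<epsilon>)) + e"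
  proof -
    have "(\<Sum>i<N. m i * (F (\<gamma> (t i)) + L * \<epsilon>)) \<le> (\<Sum>i<N. m i * max 0 (F (\<gamma> (t i)) - L * \<epsilon>) + m i * (2 * L * \<epsilon>))"
    proof (rule sum_mono)
      fix i
      have "F (\<gamma> (t i)) + L * \<epsilon> \<le> max 0 (F (\<gamma> (t i)) - L * \<epsilon>) + 2 * L * \<epsilon>" by simp
      then show "m i * (F (\<gamma> (t i)) + L * \<epsilon>) \<le> m i * max 0 (F (\<gamma> (t i)) - L * \<epsilon>) + m i * (2 * L * \<epsilon>)"
        using m0[of i] unfolding distrib_left[symmetric] by (rule mult_left_mono)
    qed
    also have "\<dots> = (\<Sum>i<N. m i * max 0 (F (\<gamma> (t i)) - L * \<epsilon>)) + len * (2 * L * \<epsilon>)"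
      by (simp add: sum.distrib sum_distrib_right[symmetric] summ)
    also have "len * (2 * L * \<epsilon>) \<le> e"
    proof -
      define q where "q = 2 * L * len"
      have q: "0 \<le> q" using L len0 by (simp add: q_def)
      have "len * (2 * L * \<epsilon>) = q * (e / (q + 1))" by (simp add: \<epsilon>_def q_def)
      also have "\<dots> \<le> e" using q e by (simp add: field_simps)
      finally show ?thesis .
    qed
    finally show ?thesis by simp
  qed
  ultimately show "ennreal \<bar>u (\<gamma> b) - u (\<gamma> a)\<bar> \<le> line_integral (\<lambda>y. ennreal (F y)) \<gamma> a b + ennreal e"
  proof -
    assume A: "(\<Sum>i<N. ennreal (m i * max 0 (F (\<gamma> (t i)) - L * \<epsilon>))) \<le> line_integral (\<lambda>y. ennreal (F y)) \<gamma> a b"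
      and B: "(\<Sum>i<N. m i * (F (\<gamma> (t i)) + L * \<epsilon>)) \<le> (\<Sum>i<N. m i * max 0 (F (\<gamma> (t i)) - L * \<epsilon>)) + e"
    have nn: "0 \<le> (\<Sum>i<N. m i * max 0 (F (\<gamma> (t i)) - L * \<epsilon>))" using m0 by (intro sum_nonneg mult_nonneg_nonneg) auto
    have "ennreal \<bar>u (\<gamma> b) - u (\<gamma> a)\<bar> \<le> ennreal ((\<Sum>i<N. m i * max 0 (F (\<gamma> (t i)) - L * \<epsilon>)) + e)"
      using up B by (intro ennreal_leI) linarith
    also have "\<dots> = (\<Sum>i<N. ennreal (m i * max 0 (F (\<gamma> (t i)) - L * \<epsilon>))) + ennreal e"
      using nn e m0 by (simp add: sum_ennreal)
    finally show ?thesis using A by (meson add_right_mono order_trans)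
  qed
qed

end

section \<open>The mollified plan as an upper gradient of the mollified potential\<close>

context lower_Q_ring
begin

text \<open>A translation of the integration variable moves the shift from the mollifier to the
  potential, whose increments are bounded by crossings.\<close>

lemma mollified_potential_step:
  assumes \<eta> [measurable]: "\<eta> \<in> borel_measurable borel" and \<eta>0: "\<And>\<rho>. \<rho> \<notin> good_radii \<Longrightarrow> \<eta> \<rho> = 0"
    and h: "0 \<le> h" and e: "norm e = 1"
    and \<theta>: "\<And>z. 0 \<le> \<theta> z" "\<And>x y. \<bar>\<theta> x - \<theta> y\<bar> \<le> C * dist x y" and C: "0 \<le> C"
  defines "v \<equiv> \<lambda>y. \<integral>\<^sup>+z. potential \<eta> z * ennreal (\<theta> (y - z)) \<partial>lborel"
    and "X \<equiv> \<lambda>y. ennreal h * ((\<integral>\<^sup>+z. ennreal (\<theta> (y - z)) \<partial>plan \<eta>) + ennreal (C * h) * emeasure (plan \<eta>) UNIV)"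
  shows "v (y + h *\<^sub>R e) \<le> v y + X y" "v y \<le> v (y + h *\<^sub>R e) + X y"
proof -
  have "continuous_on UNIV \<theta>"
    using \<theta>(2) C by (intro lipschitz_on_continuous_on[of C]) (auto simp: lipschitz_on_def dist_real_def)
  then have [measurable]: "\<theta> \<in> borel_measurable borel" by (rule borel_measurable_continuous_onI)
  have shift: "v (y + h *\<^sub>R e) = (\<integral>\<^sup>+z. potential \<eta> (z + h *\<^sub>R e) * ennreal (\<theta> (y - z)) \<partial>lborel)"
    unfolding v_def
    using nn_integral_lborel_translate[of "\<lambda>z. potential \<eta> z * ennreal (\<theta> (y + h *\<^sub>R e - z))" "h *\<^sub>R e"]
    by (simp add: add.commute)
  have cr: "(\<integral>\<^sup>+z. crossing \<eta> e h z * ennreal (\<theta> (y - z)) \<partial>lborel) \<le> X y"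
    unfolding X_def by (rule crossing_mollified_le[OF \<eta> \<eta>0 h e \<theta> C])
  have "v (y + h *\<^sub>R e) \<le> (\<integral>\<^sup>+z. potential \<eta> z * ennreal (\<theta> (y - z)) + crossing \<eta> e h z * ennreal (\<theta> (y - z)) \<partial>lborel)"
    unfolding shift distrib_right[symmetric]
    by (intro nn_integral_mono mult_right_mono potential_diff(1)[OF \<eta> \<eta>0 h]) simp_all
  also have "\<dots> = v y + (\<integral>\<^sup>+z. crossing \<eta> e h z * ennreal (\<theta> (y - z)) \<partial>lborel)"
    unfolding v_def by (rule nn_integral_add) measurable
  also have "\<dots> \<le> v y + X y" by (intro add_left_mono cr)
  finally show "v (y + h *\<^sub>R e) \<le> v y + X y" .
  have "v y \<le> (\<integral>\<^sup>+z. potential \<eta> (z + h *\<^sub>R e) * ennreal (\<theta> (y - z)) + crossing \<eta> e h z * ennreal (\<theta> (y - z)) \<partial>lborel)"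
    unfolding v_def distrib_right[symmetric]
    by (intro nn_integral_mono mult_right_mono potential_diff(2)[OF \<eta> \<eta>0 h]) simp_all
  also have "\<dots> = v (y + h *\<^sub>R e) + (\<integral>\<^sup>+z. crossing \<eta> e h z * ennreal (\<theta> (y - z)) \<partial>lborel)"
    unfolding shift by (rule nn_integral_add) measurable
  also have "\<dots> \<le> v (y + h *\<^sub>R e) + X y" by (intro add_left_mono cr)
  finally show "v y \<le> v (y + h *\<^sub>R e) + X y" .
qed

text \<open>For \<open>\<eta>\<close> supported in \<open>{a'..b'}\<close> the potential is constant
  within this distance of each boundary image, so mollifying at scale \<open>\<delta>\<close>
  preserves its boundary values. Both radii come from a compact set inside an open one.\<close>

lemma separation_radius:
  assumes "r1 < a'" "a' \<le> b'" "b' < r2"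
  obtains \<delta> where "0 < \<delta>" "\<And>y. y \<in> S r1 \<Longrightarrow> ball y \<delta> \<subseteq> D a'" "\<And>y. y \<in> S r2 \<Longrightarrow> ball y \<delta> \<inter> D b' = {}"
proof -
  have "S r1 \<subseteq> D a'" using assms by (auto simp: S_def D_def)
  moreover have "open (D a')" by (rule open_D) (use assms in simp)
  moreover have "compact (S r1)" by (rule compact_S) (use r in auto)
  ultimately obtain d1 where d1: "0 < d1" "(\<Union>x\<in>S r1. ball x d1) \<subseteq> D a'"
    using compact_subset_open_imp_ball_epsilon_subset by blast
  have b'0: "0 < b'" using assms r by simp
  have "S r2 \<subseteq> - (f ` cball x0 b')"
  proof
    fix y assume "y \<in> S r2"
    then obtain x where x: "x \<in> sphere x0 r2" "y = f x" by (auto simp: S_def)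
    have "y \<notin> f ` cball x0 b'"
    proof
      assume "y \<in> f ` cball x0 b'"
      then obtain x' where x': "x' \<in> cball x0 b'" "f x = f x'" using x by auto
      have "x \<in> G" "x' \<in> G" using x x' cball_G[of r2] cball_G[of b'] assms by auto
      then have "x = x'" using fg[of x] fg[of x'] x'(2) by metis
      then show False using x x' assms by auto
    qed
    then show "y \<in> - (f ` cball x0 b')" by simp
  qed
  moreover have "open (- (f ` cball x0 b'))"
    using compact_f_cball[of b'] assms by (simp add: compact_imp_closed open_Compl)
  moreover have "compact (S r2)" by (rule compact_S) (use r in auto)
  ultimately obtain d2 where d2: "0 < d2" "(\<Union>x\<in>S r2. ball x d2) \<subseteq> - (f ` cball x0 b')"
    using compact_subset_open_imp_ball_epsilon_subset by blast
  have DC: "D b' \<subseteq> f ` cball x0 b'" by (auto simp: D_def)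
  show ?thesis
  proof (rule that[of "min d1 d2"])
    show "ball y (min d1 d2) \<subseteq> D a'" if "y \<in> S r1" for y
      using d1(2) that by fastforce
    show "ball y (min d1 d2) \<inter> D b' = {}" if "y \<in> S r2" for y
      using d2(2) that DC by fastforce
  qed (use d1 d2 in auto)
qed

text \<open>The mollified potential \<open>u\<close> equals \<open>c\<close> on \<open>S r1\<close>
  and 0 on \<open>S r2\<close>, so its upper gradient \<open>F\<close>, divided by \<open>c\<close>,
  is admissible, and duality bounds the energy of \<open>F\<close>. A support of
  \<open>\<eta>\<close> strictly inside the ring leaves room for the mollification.\<close>

lemma curve_modulus_le_energy:
  assumes \<eta> [measurable]: "\<eta> \<in> borel_measurable borel" and \<eta>0: "\<And>\<rho>. 0 \<le> \<eta> \<rho>" "\<And>\<rho>. \<rho> \<notin> good_radii \<Longrightarrow> \<eta> \<rho> = 0"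
    and supp: "r1 < a'" "a' \<le> b'" "b' < r2" "\<And>\<rho>. \<rho> \<notin> {a'..b'} \<Longrightarrow> \<eta> \<rho> = 0"
    and c: "(\<integral>\<^sup>+\<rho>. ennreal (\<eta> \<rho>) \<partial>lborel) = ennreal c" "0 < c"
    and fin: "energy \<eta> < \<infinity>"
  shows "ennreal (c powr \<alpha>) * curve_modulus \<alpha> (curve_family (S r1) (S r2) (f ` G)) \<le> energy \<eta>"
proof -
  interpret P: finite_measure "plan \<eta>" by (rule finite_plan[OF \<eta> \<eta>0 fin])
  obtain \<delta> where \<delta>: "0 < \<delta>" "\<And>y. y \<in> S r1 \<Longrightarrow> ball y \<delta> \<subseteq> D a'" "\<And>y. y \<in> S r2 \<Longrightarrow> ball y \<delta> \<inter> D b' = {}"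
    using separation_radius[OF supp(1-3)] by blast
  obtain \<theta> :: "'a \<Rightarrow> real" and C where \<theta>: "\<And>z. 0 \<le> \<theta> z" "0 \<le> C"
    "\<And>x y. \<bar>\<theta> x - \<theta> y\<bar> \<le> C * dist x y" "\<And>z. \<delta> \<le> norm z \<Longrightarrow> \<theta> z = 0" "\<And>z. \<theta> z \<le> C * \<delta>"
    "(\<integral>\<^sup>+z. ennreal (\<theta> z) \<partial>lborel) = 1" "\<And>z. \<theta> (- z) = \<theta> z"
    using mollifier_exists[OF \<delta>(1)] by metis
  have "continuous_on UNIV \<theta>"
    using \<theta>(2,3) by (intro lipschitz_on_continuous_on[of C]) (auto simp: lipschitz_on_def dist_real_def)
  then have [measurable]: "\<theta> \<in> borel_measurable borel" by (rule borel_measurable_continuous_onI)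
  define m where "m = measure (plan \<eta>) UNIV"
  have m: "0 \<le> m" "emeasure (plan \<eta>) UNIV = ennreal m" by (auto simp: m_def P.emeasure_eq_measure)
  define FF where "FF y = (\<integral>\<^sup>+z. ennreal (\<theta> (y - z)) \<partial>plan \<eta>)" for y
  define v where "v y = (\<integral>\<^sup>+z. potential \<eta> z * ennreal (\<theta> (y - z)) \<partial>lborel)" for y
  have \<theta>y: "(\<integral>\<^sup>+z. ennreal (\<theta> (y - z)) \<partial>lborel) = 1" for y
  proof -
    have "\<theta> (y - z) = \<theta> (- y + z)" for z using \<theta>(7)[of "y - z"] by (simp add: algebra_simps)
    then show ?thesis using nn_integral_lborel_translate[of "\<lambda>z. ennreal (\<theta> z)" "- y"] \<theta>(6) by simp
  qed
  have FFfin: "FF y < top" for y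
  proof -
    have "FF y \<le> (\<integral>\<^sup>+z. ennreal (C * \<delta>) \<partial>plan \<eta>)" unfolding FF_def by (intro nn_integral_mono ennreal_leI \<theta>)
    also have "\<dots> < top" using m by (simp add: ennreal_mult_less_top)
    finally show ?thesis .
  qed
  have pot_le: "potential \<eta> z \<le> ennreal c" for z
    unfolding potential_def c(1)[symmetric] by (intro nn_integral_mono) simp
  have vfin: "v y < top" for y
  proof -
    have "v y \<le> (\<integral>\<^sup>+z. ennreal c * ennreal (\<theta> (y - z)) \<partial>lborel)"
      unfolding v_def by (intro nn_integral_mono mult_right_mono pot_le) simp
    also have "\<dots> = ennreal c * 1" by (subst nn_integral_cmult) (auto simp: \<theta>y)
    finally show ?thesis by (simp add: le_less_trans)
  qed
  define F where "F y = enn2real (FF y)" for y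
  define u where "u y = enn2real (v y)" for y
  have F: "FF y = ennreal (F y)" "0 \<le> F y" for y using FFfin[of y] by (auto simp: F_def)
  have u: "v y = ennreal (u y)" "0 \<le> u y" for y using vfin[of y] by (auto simp: u_def)
  \<comment> \<open>With \<open>m\<close> the mass of the plan, this is both a Lipschitz constant of
    \<open>F\<close> and the coefficient of the second order error in the increments of
    \<open>u\<close>.\<close>
  define L where "L = C * m"
  have L: "0 \<le> L" using \<theta>(2) m by (simp add: L_def)
  have lip: "F x \<le> F y + L * dist x y" for x y
  proof -
    have "FF x \<le> (\<integral>\<^sup>+z. ennreal (\<theta> (y - z)) + ennreal (C * dist x y) \<partial>plan \<eta>)"
      unfolding FF_def
    proof (rule nn_integral_mono)
      fix z
      have "\<theta> (x - z) \<le> \<theta> (y - z) + C * dist x y" using \<theta>(3)[of "x - z" "y - z"] by (simp add: dist_norm abs_le_iff)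
      then show "ennreal (\<theta> (x - z)) \<le> ennreal (\<theta> (y - z)) + ennreal (C * dist x y)"
        using \<theta>(1)[of "y - z"] \<theta>(2) by (simp add: ennreal_plus[symmetric] ennreal_leI del: ennreal_plus)
    qed
    also have "\<dots> = FF y + ennreal (C * dist x y) * ennreal m"
      unfolding FF_def by (subst nn_integral_add) (auto simp: m)
    also have "\<dots> = ennreal (F y + L * dist x y)"
      using F \<theta>(2) m by (simp add: L_def ennreal_mult'[symmetric] mult_ac)
    finally show ?thesis unfolding F(1) using F(2)[of y] L by (simp add: ennreal_le_iff del: ennreal_plus)
  qed
  have ulip: "\<bar>u y - u x\<bar> \<le> dist x y * (F x + L * dist x y)" for x y
  proof (cases "x = y")
    case False
    define h where "h = dist x y"
    define e where "e = (1 / h) *\<^sub>R (y - x)"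
    have h: "0 < h" using False by (simp add: h_def)
    have e: "norm e = 1" using h by (simp add: e_def h_def dist_norm norm_minus_commute)
    have y: "y = x + h *\<^sub>R e" using h by (simp add: e_def)
    have "ennreal h * (FF x + ennreal (C * h) * emeasure (plan \<eta>) UNIV) = ennreal (h * (F x + L * h))"
    proof -
      have "ennreal (C * h) * emeasure (plan \<eta>) UNIV = ennreal (L * h)"
        unfolding m(2) L_def using \<theta>(2) h m(1) by (subst ennreal_mult'[symmetric]) (auto simp: mult_ac)
      then show ?thesis
        unfolding F(1) using h F(2)[of x] L
        by (simp only:) (simp add: ennreal_plus[symmetric] ennreal_mult'[symmetric] del: ennreal_plus)
    qed
    then have "ennreal (u y) \<le> ennreal (u x) + ennreal (h * (F x + L * h))" "ennreal (u x) \<le> ennreal (u y) + ennreal (h * (F x + L * h))"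
      using mollified_potential_step[OF \<eta> \<eta>0(2) less_imp_le[OF h] e \<theta>(1,3,2), of x, folded v_def FF_def] u y by auto
    then have "u y \<le> u x + h * (F x + L * h)" "u x \<le> u y + h * (F x + L * h)"
      using u(2) h F(2)[of x] L by (simp_all add: ennreal_plus[symmetric] ennreal_le_iff del: ennreal_plus)
    then show ?thesis by (simp add: h_def abs_le_iff)
  qed simp
  have u1: "u y = c" if y: "y \<in> S r1" for y
  proof -
    have "v y = (\<integral>\<^sup>+z. ennreal c * ennreal (\<theta> (y - z)) \<partial>lborel)"
      unfolding v_def
    proof (rule nn_integral_cong)
      fix z
      show "potential \<eta> z * ennreal (\<theta> (y - z)) = ennreal c * ennreal (\<theta> (y - z))"
      proof (cases "dist y z < \<delta>")
        case True
        then have "z \<in> D a'" using \<delta>(2)[OF y] by auto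
        then have z: "z \<in> G'" "w z < a'" using D_eq[of a'] supp r by auto
        have "potential \<eta> z = (\<integral>\<^sup>+\<rho>. ennreal (\<eta> \<rho>) \<partial>lborel)"
          unfolding potential_def using z supp(4) by (intro nn_integral_cong) force
        then show ?thesis using c by simp
      next
        case False
        then show ?thesis using \<theta>(4)[of "y - z"] by (simp add: dist_norm)
      qed
    qed
    also have "\<dots> = ennreal c * 1" by (subst nn_integral_cmult) (auto simp: \<theta>y)
    finally show ?thesis using c(2) by (simp add: u_def)
  qed
  have u2: "u y = 0" if y: "y \<in> S r2" for y
  proof -
    have "v y = (\<integral>\<^sup>+z. 0 \<partial>(lborel :: 'a measure))"
      unfolding v_def
    proof (rule nn_integral_cong)
      fix z
      show "potential \<eta> z * ennreal (\<theta> (y - z)) = 0"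
      proof (cases "dist y z < \<delta>")
        case True
        then have "z \<notin> D b'" using \<delta>(3)[OF y] by auto
        then have z: "z \<notin> G' \<or> b' \<le> w z" using D_eq[of b'] supp r by auto
        have "potential \<eta> z = (\<integral>\<^sup>+\<rho>. 0 \<partial>(lborel :: real measure))"
          unfolding potential_def using z supp(4) by (intro nn_integral_cong) force
        then show ?thesis by simp
      next
        case False
        then show ?thesis using \<theta>(4)[of "y - z"] by (simp add: dist_norm)
      qed
    qed
    then show ?thesis by (simp add: u_def)
  qed
  have FFm [measurable]: "FF \<in> borel_measurable borel" unfolding FF_def[abs_def] by measurable
  then have [measurable]: "F \<in> borel_measurable borel" unfolding F_def[abs_def] by measurable
  have "curve_modulus \<alpha> (curve_family (S r1) (S r2) (f ` G)) \<le> (\<integral>\<^sup>+y. epowr (ennreal (F y / c)) \<alpha> \<partial>lborel)"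
    unfolding curve_modulus_def
  proof (rule INF_lower, intro CollectI conjI)
    show "(\<lambda>y. ennreal (F y / c)) \<in> borel_measurable borel" by measurable
    show "\<forall>(\<gamma>, a, b)\<in>curve_family (S r1) (S r2) (f ` G). curve_length \<gamma> a b < \<infinity> \<longrightarrow> 1 \<le> line_integral (\<lambda>y. ennreal (F y / c)) \<gamma> a b"
    proof (clarsimp simp: curve_family_def)
      fix \<gamma> :: "real \<Rightarrow> 'a" and a b :: real
      assume ab: "a < b" and cont: "continuous_on {a..b} \<gamma>" and ends: "\<gamma> a \<in> S r1" "\<gamma> b \<in> S r2"
        and len: "curve_length \<gamma> a b < top"
      have "ennreal \<bar>u (\<gamma> b) / c - u (\<gamma> a) / c\<bar> \<le> line_integral (\<lambda>y. ennreal (F y / c)) \<gamma> a b"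
      proof (rule line_integral_ge[OF ab cont, where L = "L / c"])
        show "F x / c \<le> F y / c + L / c * dist x y" for x y
          using lip[of x y] c(2) by (simp add: field_simps)
        show "\<bar>u y / c - u x / c\<bar> \<le> dist x y * (F x / c + L / c * dist x y)" for x y
        proof -
          have "\<bar>u y / c - u x / c\<bar> = \<bar>u y - u x\<bar> / c" using c(2) by (simp add: diff_divide_distrib[symmetric])
          also have "\<dots> \<le> dist x y * (F x + L * dist x y) / c" using ulip[of y x] c(2) by (intro divide_right_mono) auto
          finally show ?thesis using c(2) by (simp add: field_simps)
        qed
      qed (use len L c F in auto)
      then show "1 \<le> line_integral (\<lambda>y. ennreal (F y / c)) \<gamma> a b"
        using u1[OF ends(1)] u2[OF ends(2)] c(2) by simp
    qed
  qed
  also have "\<dots> = (\<integral>\<^sup>+y. ennreal (1 / c powr \<alpha>) * epowr (FF y) \<alpha> \<partial>lborel)"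
    using F c(2) by (intro nn_integral_cong) (simp add: powr_divide ennreal_mult'[symmetric])
  also have "\<dots> = ennreal (1 / c powr \<alpha>) * (\<integral>\<^sup>+y. epowr (FF y) \<alpha> \<partial>lborel)"
    by (rule nn_integral_cmult) measurable
  also have "\<dots> \<le> ennreal (1 / c powr \<alpha>) * energy \<eta>"
    unfolding FF_def
    by (intro mult_left_mono mollified_plan_energy[OF \<eta> \<eta>0 fin _ \<theta>(1,4,5,6)]) auto
  finally have "ennreal (c powr \<alpha>) * curve_modulus \<alpha> (curve_family (S r1) (S r2) (f ` G))
     \<le> ennreal (c powr \<alpha>) * (ennreal (1 / c powr \<alpha>) * energy \<eta>)" by (rule mult_left_mono) simp
  also have "\<dots> = energy \<eta>" using c(2) by (simp add: mult.assoc[symmetric] ennreal_mult'[symmetric])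
  finally show ?thesis .
qed

end

section \<open>The modulus of curves joining two spheres\<close>

text \<open>Polar coordinates; this allows \<open>\<eta>\<close> to be changed on a null set of
  radii.\<close>

lemma null_sets_dist:
  fixes x0 :: "'a::euclidean_space"
  assumes N: "N \<in> null_sets lborel"
  shows "{x. dist x x0 \<in> N} \<in> null_sets lborel"
proof -
  have [measurable]: "N \<in> sets borel" using N by auto
  have "emeasure lborel {x. dist x x0 \<in> N} = (\<integral>\<^sup>+x. indicator {x. dist x x0 \<in> N} x \<partial>lborel)"
    by (rule nn_integral_indicator[symmetric]) measurable
  also have "\<dots> = (\<integral>\<^sup>+x. 1 * indicator N (dist x x0) \<partial>lborel)"
    by (intro nn_integral_cong) (simp add: indicator_def)
  also have "\<dots> = (\<integral>\<^sup>+r. sphere_int x0 (\<lambda>x. 1) r * indicator N r * indicator {0<..} r \<partial>lborel)"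
    by (rule nn_integral_radial) measurable
  also have "\<dots> = (\<integral>\<^sup>+r. 0 \<partial>(lborel :: real measure))"
    using AE_not_in[OF N] by (intro nn_integral_cong_AE) (auto elim!: eventually_mono)
  finally show ?thesis by (auto intro!: null_setsI)
qed

context lower_Q_ring
begin

text \<open>Since \<open>\<eta>\<close> may be infinite or live near the end radii, it is truncated
  in height and in support, and then restricted to good radii, which by \<open>AE_good_radii\<close>
  leaves the integral unchanged. The truncated integrals may stay below 1, so homogeneity gives the
  bound with a factor \<open>t powr \<alpha>\<close> for every \<open>t < 1\<close>, and
  \<open>t\<close> tends to 1.\<close>

lemma ring_modulus_le_borel:
  assumes \<eta> [measurable]: "\<eta> \<in> borel_measurable borel"
    and one: "1 \<le> (\<integral>\<^sup>+r. \<eta> r * indicator {r1<..<r2} r \<partial>lborel)"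
  shows "curve_modulus \<alpha> (curve_family (S r1) (S r2) (f ` G))
    \<le> (\<integral>\<^sup>+x. Qt x * epowr (\<eta> (dist x x0)) \<alpha> * indicator {x. r1 < dist x x0 \<and> dist x x0 < r2} x \<partial>lebesgue)"
    (is "?M \<le> ?R")
proof (cases "?R = \<infinity>")
  case False
  then have R: "?R < \<infinity>" by (simp add: less_top)
  \<comment> \<open>For small \<open>m\<close> the interval from \<open>a m\<close> to
    \<open>b m\<close> may be empty; then \<open>h m\<close> vanishes identically.\<close>
  define a where "a m = r1 + 1 / real (Suc m)" for m
  define b where "b m = r2 - 1 / real (Suc m)" for m
  define h where "h m r = enn2real (min (\<eta> r) (of_nat m)) * indicator {a m..b m} r" for m r
  define k where "k m r = h m r * indicator good_radii r" for m r
  have [measurable]: "h m \<in> borel_measurable borel" "k m \<in> borel_measurable borel" for m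
    unfolding k_def[abs_def] h_def[abs_def] by measurable
  have ab: "r1 < a m" "b m < r2" for m by (auto simp: a_def b_def)
  have h0: "0 \<le> h m r" "0 \<le> k m r" "k m r \<le> h m r" for m r by (auto simp: h_def k_def indicator_def)
  have hsupp: "r \<notin> {a m..b m} \<Longrightarrow> h m r = 0" for m r by (simp add: h_def)
  have fin: "min (\<eta> r) (of_nat m) < top" for m r by (simp add: min_less_iff_disj ennreal_of_nat_eq_real_of_nat)
  have h: "ennreal (h m r) = min (\<eta> r) (of_nat m) * indicator {a m..b m} r" for m r
    using fin[of r m] by (simp add: h_def indicator_def)
  have h_le: "ennreal (h m r) \<le> \<eta> r" "ennreal (h m r) \<le> of_nat m * indicator {r1<..<r2} r" for m r
    unfolding h using ab[of m] by (auto simp: indicator_def)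
  have en: "energy \<zeta> \<le> ?R" if "\<And>r. 0 \<le> \<zeta> r" "\<And>r. \<zeta> r \<le> h m r" for \<zeta> m
    unfolding energy_def
  proof (intro nn_integral_mono mult_right_mono mult_left_mono)
    fix x
    have "ennreal (\<zeta> (dist x x0)) \<le> \<eta> (dist x x0)"
      by (rule order_trans[OF ennreal_leI[OF that(2)] h_le(1)])
    then have "epowr (ennreal (\<zeta> (dist x x0))) \<alpha> \<le> epowr (\<eta> (dist x x0)) \<alpha>"
      using \<alpha>1 by (intro epowr_mono) auto
    then show "ennreal (\<zeta> (dist x x0) powr \<alpha>) \<le> epowr (\<eta> (dist x x0)) \<alpha>" using that(1) by simp
  qed auto
  have int_k: "(\<integral>\<^sup>+r. ennreal (k m r) \<partial>lborel) = (\<integral>\<^sup>+r. ennreal (h m r) \<partial>lborel)" for m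
  proof -
    have "AE r in lborel. h m r = 0 \<or> r \<in> good_radii"
    proof (rule AE_good_radii)
      show "energy (h m) < \<infinity>" using en[of "h m" m] h0 R by (meson le_less_trans order_refl)
      show "h m r = 0" if "r \<notin> {r1<..<r2}" for r using that ab[of m] by (intro hsupp) auto
    qed (use h0 in auto)
    then show ?thesis by (intro nn_integral_cong_AE) (auto elim!: eventually_mono simp: k_def)
  qed
  have int_fin: "(\<integral>\<^sup>+r. ennreal (h m r) \<partial>lborel) < top" for m
  proof -
    have "(\<integral>\<^sup>+r. ennreal (h m r) \<partial>lborel) \<le> (\<integral>\<^sup>+r. of_nat m * indicator {r1<..<r2} r \<partial>lborel)"
      by (intro nn_integral_mono h_le)
    also have "\<dots> = of_nat m * emeasure lborel {r1<..<r2}" by (rule nn_integral_cmult_indicator) simp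
    also have "\<dots> < top" using r by (simp add: ennreal_mult_less_top ennreal_of_nat_eq_real_of_nat)
    finally show ?thesis .
  qed
  have lim: "(SUP m. \<integral>\<^sup>+r. ennreal (h m r) \<partial>lborel) = (\<integral>\<^sup>+r. \<eta> r * indicator {r1<..<r2} r \<partial>lborel)"
  proof -
    have inc: "incseq (\<lambda>m r. ennreal (h m r))"
    proof (intro incseq_SucI le_funI)
      fix m r
      have "a (Suc m) \<le> a m" "b m \<le> b (Suc m)" by (auto simp: a_def b_def frac_le)
      then show "ennreal (h m r) \<le> ennreal (h (Suc m) r)"
        unfolding h by (intro mult_mono min.mono) (auto simp: indicator_def)
    qed
    have "(SUP m. ennreal (h m r)) = \<eta> r * indicator {r1<..<r2} r" for r
    proof (rule antisym)
      show "(SUP m. ennreal (h m r)) \<le> \<eta> r * indicator {r1<..<r2} r"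
        using h_le(1) h_le(2)[of _ r] by (intro SUP_least) (cases "r \<in> {r1<..<r2}"; simp)
      show "\<eta> r * indicator {r1<..<r2} r \<le> (SUP m. ennreal (h m r))"
      proof (cases "r \<in> {r1<..<r2}")
        case True
        obtain m0 where m0: "1 / real (Suc m0) < min (r - r1) (r2 - r)"
          using True nat_approx_posE[of "min (r - r1) (r2 - r)"] by auto
        have "\<eta> r = (SUP m. min (\<eta> r) (of_nat m))"
          unfolding inf_min[symmetric] by (simp add: inf_SUP[symmetric] ennreal_SUP_of_nat_eq_top)
        also have "\<dots> \<le> (SUP m. ennreal (h m r))"
        proof (rule SUP_mono)
          fix m
          have "1 / real (Suc (max m m0)) \<le> 1 / real (Suc m0)" by (intro divide_left_mono) auto
          then have "r \<in> {a (max m m0)..b (max m m0)}" using m0 by (auto simp: a_def b_def)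
          then have "min (\<eta> r) (of_nat m) \<le> ennreal (h (max m m0) r)"
            unfolding h by (simp add: min_le_iff_disj)
          then show "\<exists>m'\<in>UNIV. min (\<eta> r) (of_nat m) \<le> ennreal (h m' r)" by blast
        qed
        finally show ?thesis using True by simp
      qed simp
    qed
    then show ?thesis using inc by (subst nn_integral_monotone_convergence_SUP[symmetric]) auto
  qed
  have bound: "ennreal (t powr \<alpha>) * ?M \<le> ?R" if t: "0 < t" "t < 1" for t
  proof -
    have "ennreal t < 1" using t by (simp add: ennreal_less_iff[of t 1, simplified])
    then have "ennreal t < (SUP m. \<integral>\<^sup>+r. ennreal (h m r) \<partial>lborel)" using one unfolding lim by (rule less_le_trans)
    then obtain m where m: "ennreal t < (\<integral>\<^sup>+r. ennreal (h m r) \<partial>lborel)" by (auto simp: less_SUP_iff)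
    define c where "c = enn2real (\<integral>\<^sup>+r. ennreal (h m r) \<partial>lborel)"
    have c: "(\<integral>\<^sup>+r. ennreal (k m r) \<partial>lborel) = ennreal c" using int_fin[of m] by (simp add: c_def int_k)
    have tc: "t < c" using m t unfolding int_k[symmetric] c by (simp add: ennreal_less_iff)
    have "a m \<le> b m"
    proof (rule ccontr)
      assume "\<not> a m \<le> b m"
      then have "h m r = 0" for r using hsupp[of r m] by auto
      then show False using m by simp
    qed
    have "ennreal (t powr \<alpha>) * ?M \<le> ennreal (c powr \<alpha>) * ?M"
      using tc t \<alpha>1 by (intro mult_right_mono ennreal_leI powr_mono2) auto
    also have "\<dots> \<le> energy (k m)"
    proof (rule curve_modulus_le_energy[where a' = "a m" and b' = "b m"])
      show "energy (k m) < \<infinity>" using en[of "k m" m] h0 R by (meson le_less_trans)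
    qed (use h0 ab \<open>a m \<le> b m\<close> hsupp c tc t in \<open>auto simp: k_def\<close>)
    also have "\<dots> \<le> ?R" by (rule en[of _ m]) (use h0 in auto)
    finally show ?thesis .
  qed
  have "?M < top"
  proof (rule ccontr)
    assume "\<not> ?M < top"
    then have "?M = top" by (simp only: less_top[symmetric] not_not)
    then show False using bound[of "1/2"] R by (simp add: ennreal_mult_top top_unique)
  qed
  then obtain M where M: "?M = ennreal M" "0 \<le> M" by (cases ?M) auto
  obtain R' where R': "?R = ennreal R'" "0 \<le> R'" using R by (cases ?R) auto
  have "((\<lambda>t. t powr \<alpha> * M) \<longlongrightarrow> 1 powr \<alpha> * M) (at_left 1)"
    by (intro tendsto_intros) auto
  moreover have "\<forall>\<^sub>F t in at_left 1. t powr \<alpha> * M \<le> R'"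
  proof -
    have "\<forall>\<^sub>F t in at_left 1. t \<in> {0<..<(1::real)}" by (rule eventually_at_left_real) simp
    then show ?thesis
    proof eventually_elim
      case (elim t)
      then show ?case
        using bound[of t] M(2) R'(2) unfolding M(1) R'(1) by (simp add: ennreal_mult'[symmetric] ennreal_le_iff)
    qed
  qed
  ultimately have "1 powr \<alpha> * M \<le> R'" by (rule tendsto_upperbound) (simp add: trivial_limit_at_left_real)
  then show ?thesis unfolding M(1) R'(1) by (simp add: ennreal_leI)
qed simp

text \<open>A Borel function agreeing with \<open>\<eta>\<close> almost everywhere on the ring
  leaves both integrals unchanged, the one over the ring in space by
  \<open>null_sets_dist\<close>.\<close>

lemma ring_modulus_le:
  assumes \<eta>: "\<eta> \<in> borel_measurable (lebesgue_on {r1<..<r2})"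
    and one: "1 \<le> (\<integral>\<^sup>+r\<in>{r1<..<r2}. \<eta> r \<partial>lebesgue)"
  shows "curve_modulus \<alpha> (curve_family (S r1) (S r2) (f ` G))
    \<le> (\<integral>\<^sup>+x\<in>{x. r1 < dist x x0 \<and> dist x x0 < r2}. Qt x * epowr (\<eta> (dist x x0)) \<alpha> \<partial>lebesgue)"
proof -
  define h where "h r = \<eta> r * indicator {r1<..<r2} r" for r
  have "h \<in> borel_measurable lebesgue"
    using \<eta> unfolding h_def[abs_def] by (subst (asm) borel_measurable_restrict_space_iff_ennreal) auto
  then obtain g' where g' [measurable]: "g' \<in> borel_measurable borel" and ae: "AE r in lborel. h r = g' r"
    using completion_ex_borel_measurable[of h lborel] by auto
  have "(\<integral>\<^sup>+r. h r \<partial>lebesgue) = (\<integral>\<^sup>+r. g' r * indicator {r1<..<r2} r \<partial>lebesgue)"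
    using AE_completion[OF ae] by (intro nn_integral_cong_AE) (auto elim!: eventually_mono simp: h_def indicator_def)
  also have "\<dots> = (\<integral>\<^sup>+r. g' r * indicator {r1<..<r2} r \<partial>lborel)" by (rule nn_integral_completion)
  finally have "1 \<le> (\<integral>\<^sup>+r. g' r * indicator {r1<..<r2} r \<partial>lborel)" using one by (simp add: h_def)
  then have "curve_modulus \<alpha> (curve_family (S r1) (S r2) (f ` G))
    \<le> (\<integral>\<^sup>+x. Qt x * epowr (g' (dist x x0)) \<alpha> * indicator {x. r1 < dist x x0 \<and> dist x x0 < r2} x \<partial>lebesgue)"
    by (rule ring_modulus_le_borel[OF g'])
  also have "\<dots> = (\<integral>\<^sup>+x\<in>{x. r1 < dist x x0 \<and> dist x x0 < r2}. Qt x * epowr (\<eta> (dist x x0)) \<alpha> \<partial>lebesgue)"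
  proof (rule nn_integral_cong_AE)
    obtain N where N: "\<And>r. r \<in> space lborel - N \<Longrightarrow> h r = g' r" "N \<in> null_sets lborel"
      using ae by (rule AE_E3) blast
    have "AE x in lebesgue. x \<notin> {x. dist x x0 \<in> N}"
      by (intro AE_completion AE_not_in null_sets_dist N)
    then show "AE x in lebesgue. Qt x * epowr (g' (dist x x0)) \<alpha> * indicator {x. r1 < dist x x0 \<and> dist x x0 < r2} x
      = Qt x * epowr (\<eta> (dist x x0)) \<alpha> * indicator {x. r1 < dist x x0 \<and> dist x x0 < r2} x"
    proof eventually_elim
      case (elim x)
      then have "h (dist x x0) = g' (dist x x0)" using N(1) by auto
      then show ?case by (cases "r1 < dist x x0 \<and> dist x x0 < r2") (auto simp: h_def)
    qed
  qed
  finally show ?thesis .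
qed

end

text \<open>A ball is connected, so if it left \<open>G\<close> it would meet the frontier at
  distance at most \<open>\<rho>\<close>.\<close>

lemma cball_subset_of_infdist_frontier:
  fixes G :: "'a::euclidean_space set"
  assumes "x0 \<in> G" "0 \<le> \<rho>" "\<rho> < infdist x0 (frontier G)"
  shows "cball x0 \<rho> \<subseteq> G"
proof (rule ccontr)
  assume "\<not> cball x0 \<rho> \<subseteq> G"
  moreover have "x0 \<in> cball x0 \<rho> \<inter> G" using assms by simp
  ultimately have "cball x0 \<rho> \<inter> frontier G \<noteq> {}"
    by (intro connected_Int_frontier) (auto simp only: connected_cball Diff_eq_empty_iff)
  then obtain y where y: "y \<in> frontier G" "dist x0 y \<le> \<rho>" by auto
  then show False using infdist_le[OF y(1), of x0] assms by simp
qed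

theorem theorem4p1:
  fixes G G' :: "'a::euclidean_space set" and x0 :: 'a and p :: real
    and Q :: "'a \<Rightarrow> ennreal" and f :: "'a \<Rightarrow> 'a"
  assumes "DIM('a) \<ge> 2"
    and "open G" and "connected G" and "bounded G"
    and "open G'" and "connected G'" and "bounded G'"
    and "x0 \<in> G"
    and "p > real DIM('a) - 1"
    and "Q \<in> borel_measurable (lebesgue_on G)"
    and "\<And>K. compact K \<Longrightarrow> K \<subseteq> G \<Longrightarrow>
           (\<integral>\<^sup>+ x \<in> K. epowr (Q x) ((real DIM('a) - 1) / (p - real DIM('a) + 1)) \<partial>lebesgue) < \<infinity>"
    and "lower_Q_homeo p Q f G G' x0"
  shows "ring_Q_homeo (p / (p - real DIM('a) + 1))
           (\<lambda>x. epowr (Q x) ((real DIM('a) - 1) / (p - real DIM('a) + 1))) f G x0"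
proof -
  obtain g where g: "homeomorphism G G' f g" using assms(12) by (auto simp: lower_Q_homeo_def)
  then have "f ` G = G'" by (simp add: homeomorphism_def)
  define k where "k = real (DIM('a) - 1)"
  have k: "k = real DIM('a) - 1" "0 < k" "k < p" using assms(1,9) by (auto simp: k_def of_nat_diff)
  \<comment> \<open>With \<open>k = n - 1\<close> and \<open>s = p / k\<close> the two exponents are
    \<open>s / (s - 1)\<close> and \<open>1 / (s - 1)\<close>.\<close>
  have exps: "p / (p - real DIM('a) + 1) = p / (p - k)" "(real DIM('a) - 1) / (p - real DIM('a) + 1) = 1 / (p / k - 1)"
  proof -
    have d: "p - real DIM('a) + 1 = p - k" "real DIM('a) - 1 = k" using k(1) by simp_all
    show "p / (p - real DIM('a) + 1) = p / (p - k)" "(real DIM('a) - 1) / (p - real DIM('a) + 1) = 1 / (p / k - 1)"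
      unfolding d using k(2,3) by (auto simp: field_simps)
  qed
  show ?thesis
    unfolding ring_Q_homeo_def exps
  proof (intro conjI allI impI)
    show "\<exists>g. homeomorphism G (f ` G) f g" using g \<open>f ` G = G'\<close> by blast
    fix r1 r2 :: real and \<eta> :: "real \<Rightarrow> ennreal"
    assume "0 < r1 \<and> r1 < r2 \<and> r2 < infdist x0 (frontier G) \<and> \<eta> \<in> borel_measurable (lebesgue_on {r1<..<r2})
      \<and> (\<integral>\<^sup>+ r \<in> {r1<..<r2}. \<eta> r \<partial>lebesgue) \<ge> 1"
    then have r: "0 < r1" "r1 < r2" "r2 < infdist x0 (frontier G)"
      and \<eta>: "\<eta> \<in> borel_measurable (lebesgue_on {r1<..<r2})" "1 \<le> (\<integral>\<^sup>+ r \<in> {r1<..<r2}. \<eta> r \<partial>lebesgue)"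
      by auto
    have sub: "cball x0 r2 \<subseteq> G" by (rule cball_subset_of_infdist_frontier) (use assms r in auto)
    interpret lower_Q_ring G G' f g x0 p "p / k" "p / (p - k)" r1 r2 Q
    proof
      show "(\<integral>\<^sup>+x\<in>cball x0 r2. epowr (Q x) (1 / (p / k - 1)) \<partial>lebesgue) < \<infinity>"
        using assms(11)[OF compact_cball sub] by (simp only: exps)
      show "1 / (p / k) + 1 / (p / (p - k)) = 1" using k by (simp add: field_simps)
      show "p > real (DIM('a) - 1)" "p / k = p / real (DIM('a) - 1)" using k by (simp_all only: k_def[symmetric])
    qed (use assms r sub g in auto)
    show "curve_modulus (p / (p - k)) (curve_family (f ` sphere x0 r1) (f ` sphere x0 r2) (f ` G))
      \<le> (\<integral>\<^sup>+ x \<in> {x. r1 < dist x x0 \<and> dist x x0 < r2}. epowr (Q x) (1 / (p / k - 1)) * epowr (\<eta> (dist x x0)) (p / (p - k)) \<partial>lebesgue)"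
      using ring_modulus_le[OF \<eta>] by (simp only: S_def)
  qed
qed

end
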